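(* Let $\Omega\subset\mathbb{R}^d$ be nonempty, open and bounded, satisfying an interior cone condition, and let $1\le p,q\le\infty$ and $s\in\mathbb{N}$ be such that $s>d/p$, or $p=1$ and $s=d$. For every $n\in\mathbb{N}$ with $n\ge2$, let $P_n$ be a set of $n$ independent random points, each uniformly distributed on $\Omega$. Then $$\Delta^{\rm unif}\big(P_n,W_p^s(\Omega),L_q(\Omega)\big)\;\asymp\;\begin{cases}(n/\log n)^{-s/d+1/p-1/q} & \text{if } q\ge p,\\ n^{-s/d} & \text{if } q<p,\end{cases}$$ where $a\asymp b$ means that each side is bounded from above by a constant multiple of the other for all such $n$, with constants independent of $n$.
   Context: Notation: $1/\infty:=0$. $\Omega$ satisfies an interior cone condition if there are $r>0$ and $\theta\in(0,\pi]$ such that for every $x\in\Omega$ there is a direction $\xi(x)\in\mathbb{S}^{d-1}$ with $K(x):=\{x+\lambda y:\ y\in\mathbb{S}^{d-1},\ \langle y,\xi(x)\rangle\ge\cos\theta,\ \lambda\in[0,r]\}\subset\Omega$. Sobolev space: $W_p^s(\Omega)$ is the space of functions $f:\Omega\to\mathbb{R}$ with (weak) derivatives $D^\alpha f\in L_p(\Omega)$ for all $\alpha\in\mathbb{N}_0^d$, $|\alpha|\le s$, with norm $\|f\|_{W_p^s(\Omega)}:=\big(\sum_{|\alpha|\le s}\|D^\alpha f\|_{L_p(\Omega)}^p\big)^{1/p}$ (usual modification for $p=\infty$). Under the assumption on $s,p$ it embeds continuously into the space $C_b(\Omega)$ of bounded continuous functions; elements are identified with their continuous representatives, so function values are defined.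 Uniform error: for a random operator $A:W_p^s(\Omega)\to L_q(\Omega)$, $$\Delta^{\rm unif}(A,W_p^s(\Omega),L_q(\Omega)):=\mathbb{E}\sup_{\|f\|_{W_p^s(\Omega)}\le1}\|f-A(f)\|_{L_q(\Omega)},$$ where $\mathbb{E}$ is understood as an upper integral in case of non-measurability. For a random finite point set $P\subset\Omega$, $$\Delta^{\rm unif}(P,W_p^s(\Omega),L_q(\Omega)):=\inf_A\Delta^{\rm unif}(A,W_p^s(\Omega),L_q(\Omega)),$$ where the infimum is over all random operators of the form $A(f)=\varphi(f|_P)$ with a random mapping $\varphi:\mathbb{R}^P\to L_q(\Omega)$; here $f|_P=(f(x))_{x\in P}$, and the mapping $\varphi$ may depend on the realization of $P$ and on additional randomness, but depends on $f$ only through $f|_P$. *)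

theory Defs
  imports "HOL-Probability.Probability"
begin

definition ennreal_powr :: "ennreal \<Rightarrow> real \<Rightarrow> ennreal" where
  "ennreal_powr x a = (if x = \<infinity> then \<infinity> else ennreal (enn2real x powr a))"

text \<open>
  Only used for \<open>1 \<le> p \<le> \<infinity>\<close>; the exponent \<^term>\<open>a\<close> of \<^const>\<open>ennreal_powr\<close> is then positive.
  For \<open>p = \<infinity>\<close>, \<^const>\<open>esssup\<close> returns \<open>\<infinity>\<close> on functions that are not measurable.
\<close>

definition Lp_norm :: "ennreal \<Rightarrow> 'a measure \<Rightarrow> ('a \<Rightarrow> real) \<Rightarrow> ennreal" where
  "Lp_norm p M f =
    (if p = \<infinity> then esssup M (\<lambda>x. ennreal \<bar>f x\<bar>)
     else ennreal_powr (\<integral>\<^sup>+ x. ennreal (\<bar>f x\<bar> powr enn2real p) \<partial>M) (1 / enn2real p))"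

definition Lp_space :: "ennreal \<Rightarrow> 'a measure \<Rightarrow> ('a \<Rightarrow> real) set" where
  "Lp_space p M = {f \<in> borel_measurable M. Lp_norm p M f < \<infinity>}"

definition partial_deriv :: "'d::finite \<Rightarrow> (real ^ 'd \<Rightarrow> real) \<Rightarrow> real ^ 'd \<Rightarrow> real" where
  "partial_deriv i f x = frechet_derivative f (at x) (axis i 1)"

text \<open>
  A function is \<open>C\<^sup>\<infinity>\<close> iff every iterated partial derivative, in any order, is (totally)
  differentiable everywhere: differentiability of one level gives continuity of the level below.
\<close>

definition smooth :: "(real ^ 'd::finite \<Rightarrow> real) \<Rightarrow> bool" where
  "smooth f \<longleftrightarrow> (\<forall>is. foldr partial_deriv is f differentiable_on UNIV)"

definition test_function :: "(real ^ 'd::finite) set \<Rightarrow> (real ^ 'd \<Rightarrow> real) \<Rightarrow> bool" where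
  "test_function \<Omega> \<phi> \<longleftrightarrow>
     smooth \<phi> \<and> compact (closure {x. \<phi> x \<noteq> 0}) \<and> closure {x. \<phi> x \<noteq> 0} \<subseteq> \<Omega>"

text \<open>
  Multi-indices are functions \<open>'d \<Rightarrow> nat\<close>. The index type carries no order, so the classical
  derivative \<open>D\<^sup>\<alpha>\<close> differentiates in an arbitrary order, with coordinate \<open>i\<close> occurring \<open>\<alpha> i\<close>
  times; it is only applied to smooth functions, for which the order is irrelevant.
\<close>

definition multi_deriv :: "('d::finite \<Rightarrow> nat) \<Rightarrow> (real ^ 'd \<Rightarrow> real) \<Rightarrow> real ^ 'd \<Rightarrow> real" where
  "multi_deriv \<alpha> f = foldr partial_deriv (SOME is. \<forall>i. count_list is i = \<alpha> i) f"

definition locally_integrable_on :: "(real ^ 'd::finite \<Rightarrow> real) \<Rightarrow> (real ^ 'd) set \<Rightarrow> bool" where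
  "locally_integrable_on f \<Omega> \<longleftrightarrow> (\<forall>K. compact K \<and> K \<subseteq> \<Omega> \<longrightarrow> f absolutely_integrable_on K)"

definition has_weak_deriv ::
  "(real ^ 'd::finite) set \<Rightarrow> ('d \<Rightarrow> nat) \<Rightarrow> (real ^ 'd \<Rightarrow> real) \<Rightarrow> (real ^ 'd \<Rightarrow> real) \<Rightarrow> bool" where
  "has_weak_deriv \<Omega> \<alpha> f g \<longleftrightarrow>
     locally_integrable_on f \<Omega> \<and> locally_integrable_on g \<Omega> \<and>
     (\<forall>\<phi>. test_function \<Omega> \<phi> \<longrightarrow>
        (LINT x|lebesgue_on \<Omega>. f x * multi_deriv \<alpha> \<phi> x) =
        (-1) ^ (\<Sum>i\<in>UNIV. \<alpha> i) * (LINT x|lebesgue_on \<Omega>. g x * \<phi> x))"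

text \<open>Weak derivatives are unique up to null sets; \<open>weak_deriv\<close> picks a representative.\<close>

definition weak_deriv ::
  "(real ^ 'd::finite) set \<Rightarrow> ('d \<Rightarrow> nat) \<Rightarrow> (real ^ 'd \<Rightarrow> real) \<Rightarrow> real ^ 'd \<Rightarrow> real" where
  "weak_deriv \<Omega> \<alpha> f = (SOME g. has_weak_deriv \<Omega> \<alpha> f g)"

definition multi_indices :: "nat \<Rightarrow> ('d::finite \<Rightarrow> nat) set" where
  "multi_indices s = {\<alpha>. (\<Sum>i\<in>UNIV. \<alpha> i) \<le> s}"

definition sobolev_norm ::
  "ennreal \<Rightarrow> nat \<Rightarrow> (real ^ 'd::finite) set \<Rightarrow> (real ^ 'd \<Rightarrow> real) \<Rightarrow> ennreal" where
  "sobolev_norm p s \<Omega> f =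
    (if p = \<infinity> then (SUP \<alpha>\<in>multi_indices s. Lp_norm p (lebesgue_on \<Omega>) (weak_deriv \<Omega> \<alpha> f))
     else ennreal_powr
       (\<Sum>\<alpha>\<in>multi_indices s. ennreal_powr (Lp_norm p (lebesgue_on \<Omega>) (weak_deriv \<Omega> \<alpha> f)) (enn2real p))
       (1 / enn2real p))"

text \<open>
  Functions on \<open>\<Omega>\<close> are total functions whose values outside \<open>\<Omega>\<close> are ignored. The space consists
  of the continuous representatives, so that point evaluation is meaningful.
\<close>

definition sobolev_space ::
  "ennreal \<Rightarrow> nat \<Rightarrow> (real ^ 'd::finite) set \<Rightarrow> (real ^ 'd \<Rightarrow> real) set" where
  "sobolev_space p s \<Omega> =
    {f. continuous_on \<Omega> f \<and>
        (\<forall>\<alpha>\<in>multi_indices s. \<exists>g\<in>Lp_space p (lebesgue_on \<Omega>). has_weak_deriv \<Omega> \<alpha> f g)}"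

definition sobolev_ball ::
  "ennreal \<Rightarrow> nat \<Rightarrow> (real ^ 'd::finite) set \<Rightarrow> (real ^ 'd \<Rightarrow> real) set" where
  "sobolev_ball p s \<Omega> = {f \<in> sobolev_space p s \<Omega>. sobolev_norm p s \<Omega> f \<le> 1}"

definition finite_cone :: "real \<Rightarrow> real \<Rightarrow> real ^ 'd::finite \<Rightarrow> real ^ 'd \<Rightarrow> (real ^ 'd) set" where
  "finite_cone r \<theta> x \<xi> = {x + l *\<^sub>R y | l y. norm y = 1 \<and> y \<bullet> \<xi> \<ge> cos \<theta> \<and> l \<in> {0..r}}"

definition interior_cone_condition :: "(real ^ 'd::finite) set \<Rightarrow> bool" where
  "interior_cone_condition \<Omega> \<longleftrightarrow>
     (\<exists>r>0. \<exists>\<theta>\<in>{0<..pi}. \<forall>x\<in>\<Omega>. \<exists>\<xi>. norm \<xi> = 1 \<and> finite_cone r \<theta> x \<xi> \<subseteq> \<Omega>)"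

text \<open>
  The library's \<^const>\<open>nn_integral\<close> is a lower integral on functions that are not measurable;
  the expectation below has to be an upper one.
\<close>

definition upper_nn_integral :: "'a measure \<Rightarrow> ('a \<Rightarrow> ennreal) \<Rightarrow> ennreal" where
  "upper_nn_integral M F =
     (INF G\<in>{G \<in> borel_measurable M. \<forall>\<omega>\<in>space M. F \<omega> \<le> G \<omega>}. \<integral>\<^sup>+ \<omega>. G \<omega> \<partial>M)"

text \<open>
  A random operator on the probability space \<open>M\<close> is a function \<open>A\<close>, where \<open>A \<omega>\<close> maps
  \<open>W\<^sub>p\<^sup>s(\<Omega>)\<close> to \<open>L\<^sub>q(\<Omega>)\<close>.
\<close>

definition unif_error ::
  "'w measure \<Rightarrow> ('w \<Rightarrow> (real ^ 'd \<Rightarrow> real) \<Rightarrow> real ^ 'd \<Rightarrow> real) \<Rightarrow>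
   ennreal \<Rightarrow> nat \<Rightarrow> ennreal \<Rightarrow> (real ^ 'd::finite) set \<Rightarrow> ennreal" where
  "unif_error M A p s q \<Omega> =
     upper_nn_integral M
       (\<lambda>\<omega>. SUP f\<in>sobolev_ball p s \<Omega>. Lp_norm q (lebesgue_on \<Omega>) (\<lambda>x. f x - A \<omega> f x))"

text \<open>
  \<open>P\<close> is a random point set on \<open>M\<close>. The mapping \<open>\<phi>\<close> may use the outcome in \<open>M\<close> (hence the
  realization of \<open>P\<close>) and additional randomness from an arbitrary probability measure \<open>R\<close>;
  it sees \<open>f\<close> only through \<open>restrict f (P \<omega>)\<close>. The data space \<open>\<real>\<^bsup>P \<omega>\<^esup>\<close> is \<open>P \<omega> \<rightarrow>\<^sub>E UNIV\<close>.
\<close>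

definition random_mappings ::
  "'w measure \<Rightarrow> real measure \<Rightarrow> ('w \<Rightarrow> (real ^ 'd) set) \<Rightarrow> ennreal \<Rightarrow> (real ^ 'd::finite) set \<Rightarrow>
   ('w \<times> real \<Rightarrow> (real ^ 'd \<Rightarrow> real) \<Rightarrow> real ^ 'd \<Rightarrow> real) set" where
  "random_mappings M R P q \<Omega> =
     {\<phi>. \<forall>(\<omega>, u)\<in>space (M \<Otimes>\<^sub>M R). \<forall>y\<in>P \<omega> \<rightarrow>\<^sub>E UNIV. \<phi> (\<omega>, u) y \<in> Lp_space q (lebesgue_on \<Omega>)}"

definition unif_error_points ::
  "'w measure \<Rightarrow> ('w \<Rightarrow> (real ^ 'd) set) \<Rightarrow>
   ennreal \<Rightarrow> nat \<Rightarrow> ennreal \<Rightarrow> (real ^ 'd::finite) set \<Rightarrow> ennreal" where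
  "unif_error_points M P p s q \<Omega> =
     (INF R\<in>{R. prob_space R}. INF \<phi>\<in>random_mappings M R P q \<Omega>.
        unif_error (M \<Otimes>\<^sub>M R) (\<lambda>(\<omega>, u) f. \<phi> (\<omega>, u) (restrict f (P \<omega>))) p s q \<Omega>)"

definition iid_uniform :: "'w measure \<Rightarrow> (real ^ 'd::finite) set \<Rightarrow> nat \<Rightarrow> (nat \<Rightarrow> 'w \<Rightarrow> real ^ 'd) \<Rightarrow> bool" where
  "iid_uniform M \<Omega> n X \<longleftrightarrow>
     prob_space M \<and> prob_space.indep_vars M (\<lambda>_. borel) X {..<n} \<and>
     (\<forall>i<n. X i \<in> space M \<rightarrow> \<Omega> \<and> distr M borel (X i) = uniform_measure lborel \<Omega>)"

definition rate :: "nat \<Rightarrow> ennreal \<Rightarrow> nat \<Rightarrow> ennreal \<Rightarrow> nat \<Rightarrow> real" where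
  "rate d p s q n =
    (if p \<le> q
     then (real n / ln (real n)) powr (- real s / real d + enn2real (1 / p) - enn2real (1 / q))
     else real n powr (- real s / real d))"

end

theory Submission
 imports Defs
begin

text \<open>
 Upper bound. Mollified Taylor polynomials at scale \<open>t\<close> inside a cone have bounded degree
 in each variable and are normed by every small perturbation of a grid. Hence, if \<open>f\<close> vanishes somewhere
 in each of finitely many small balls attached to \<open>x\<close> inside the cone, then
 \<open>|f x|\<^sup>p \<le> C t\<^bsup>sp - d\<^esup> \<integral>|D\<^sup>s f|\<^sup>p\<close>, the integral being over a ball of radius \<open>R t\<close> about \<open>x\<close>. This applies
 to the difference of \<open>f\<close> and any interpolant from the unit ball. For \<open>q \<ge> p\<close> one uses a global scale,
 the random covering radius, whose moments are of order \<open>(ln n / n)\<^bsup>1/d\<^esup>\<close>; for \<open>q < p\<close> a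
 local dyadic scale, since the set of points requiring the scale \<open>2\<^sup>m n\<^bsup>-1/d\<^esup>\<close> has
 exponentially small expected measure.

 Lower bound. A normalised sum \<open>f\<close> of bumps on grid cubes without nodes is indistinguishable from \<open>-f\<close>.
 With \<open>2 n\<close> cubes, half of them are always empty. With about \<open>4 n / ln n\<close> cubes, the second
 moment method leaves one of them empty with probability at least \<open>1/2\<close>.
\<close>

subsection \<open>Smooth bump functions\<close>

text \<open>A weakly differentiable \<open>f\<close> has no Taylor polynomial at a single point.
  Mollifying at an auxiliary scale \<open>\<epsilon>\<close>, which is unrelated to \<open>t\<close>
  and chosen as small as \<open>f\<close> demands, provides one about every base point
  \<open>z\<close>. Its remainder, however, is controlled by the integral of the derivatives of
  order \<open>s\<close> only after averaging over \<open>z\<close> in a ball \<open>B\<close> that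
  keeps away from \<open>x\<close> and from the nodes. The norming inequality holds for each
  polynomial, so it can be applied for every \<open>z\<close> first and averaged afterwards.
  Constants independent of \<open>x\<close> come from compactness: finitely many directions serve
  all cones. Hoelder's and Jensen's inequalities appear in the form of bounds that are linear in the
  quantity to be integrated and contain a free threshold, which is chosen at the end:
  \<open>G \<le> \<mu> + \<mu> powr (1 - p) * G powr p\<close> and
  \<open>X powr a \<le> \<mu> powr a + \<mu> powr (a - 1) * X\<close>. For p = \<infinity> the local
  estimate runs with a finite exponent \<open>P\<close> that exceeds the dimension and, if q is
  finite, also q.\<close>

definition dseq :: "(nat \<Rightarrow> real \<Rightarrow> real) \<Rightarrow> bool" where
 "dseq b \<longleftrightarrow> (\<forall>k x. (b k has_real_derivative b (Suc k) x) (at x))"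

lemma dseqD: "dseq b \<Longrightarrow> (b k has_real_derivative b (Suc k) x) (at x)" by (simp add: dseq_def)

lemma dseq_affine:
 assumes "dseq b"
 shows "dseq (\<lambda>k x. \<alpha> ^ k * b k (\<alpha> * x + \<beta>))" unfolding dseq_def
proof (intro allI)
 fix k x
 have "((\<lambda>x. b k (\<alpha> * x + \<beta>)) has_real_derivative b (Suc k) (\<alpha> * x + \<beta>) * \<alpha>) (at x)"
  by (rule DERIV_chain2[OF dseqD[OF assms]]) (auto intro!: derivative_eq_intros)
 then have "((\<lambda>x. \<alpha> ^ k * b k (\<alpha> * x + \<beta>)) has_real_derivative \<alpha> ^ k * (b (Suc k) (\<alpha> * x + \<beta>) * \<alpha>)) (at x)" by (rule DERIV_cmult)
 then show "((\<lambda>x. \<alpha> ^ k * b k (\<alpha> * x + \<beta>)) has_real_derivative \<alpha> ^ Suc k * b (Suc k) (\<alpha> * x + \<beta>)) (at x)" by (simp add: mult_ac)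
qed

text \<open>A \<open>dseq\<close> carries all derivatives of a smooth function as data, so a product
  has to supply all of its own. The list holds the index pairs of the terms of the k-th derivative
  of a product, with repetitions in place of binomial coefficients.\<close>

definition leibniz_step :: "(nat \<times> nat) list \<Rightarrow> (nat \<times> nat) list" where
 "leibniz_step L = map (\<lambda>(i, j). (Suc i, j)) L @ map (\<lambda>(i, j). (i, Suc j)) L"

definition dseq_mult :: "(nat \<Rightarrow> real \<Rightarrow> real) \<Rightarrow> (nat \<Rightarrow> real \<Rightarrow> real) \<Rightarrow> nat \<Rightarrow> real \<Rightarrow> real" where
 "dseq_mult a b k x = (\<Sum>(i, j)\<leftarrow>(leibniz_step ^^ k) [(0, 0)]. a i x * b j x)"

lemma dseq_dseq_mult:
 assumes a: "dseq a" and b: "dseq b"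
 shows "dseq (dseq_mult a b)"
proof -
 have *: "((\<lambda>x. \<Sum>(i, j)\<leftarrow>L. a i x * b j x) has_real_derivative
    (\<Sum>(i, j)\<leftarrow>leibniz_step L. a i x * b j x)) (at x)" for L x
 proof (induction L)
  case Nil
  then show ?case by (simp add: leibniz_step_def)
 next
  case (Cons ij L)
  obtain i j where ij: "ij = (i, j)" by (cases ij)
  have "((\<lambda>x. a i x * b j x + (\<Sum>(i, j)\<leftarrow>L. a i x * b j x)) has_real_derivative
    (a (Suc i) x * b j x + b (Suc j) x * a i x) + (\<Sum>(i, j)\<leftarrow>leibniz_step L. a i x * b j x)) (at x)"
   by (intro DERIV_add DERIV_mult dseqD a b Cons)
  then show ?case by (simp add: ij leibniz_step_def algebra_simps)
 qed
 show ?thesis unfolding dseq_def dseq_mult_def using * by simp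
qed

lemma dseq_mult_0: "dseq_mult a b 0 x = a 0 x * b 0 x" by (simp add: dseq_mult_def)

lemma dseq_mult_eq_0: "(\<forall>k. a k x = 0) \<or> (\<forall>k. b k x = 0) \<Longrightarrow> dseq_mult a b k x = 0"
 unfolding dseq_mult_def case_prod_beta by (auto simp: sum_list_0)

text \<open>The function exp(-1/x), extended by 0, does not have derivatives of its own shape. With
  a polynomial factor in 1/x the family is closed under differentiation.\<close>

definition flat_exp :: "real poly \<Rightarrow> real \<Rightarrow> real" where
 "flat_exp P x = (if x > 0 then poly P (1 / x) * exp (- (1 / x)) else 0)"

text \<open>The power \<open>u ^ k\<close> is there for the induction on \<open>P\<close>: removing
  the constant coefficient of \<open>P\<close> raises \<open>k\<close> by one.\<close>

lemma poly_mult_exp_tendsto_0: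
 "((\<lambda>u. u ^ k * poly P u * exp (- u)) \<longlongrightarrow> (0::real)) at_top"
proof (induction P arbitrary: k)
 case 0
 then show ?case by simp
next
 case (pCons a P)
 have 1: "((\<lambda>u. u ^ k * exp (- u)) \<longlongrightarrow> (0::real)) at_top" using tendsto_power_div_exp_0[of k] by (simp add: exp_minus field_simps)
 have "((\<lambda>u. a * (u ^ k * exp (- u)) + u ^ Suc k * poly P u * exp (- u)) \<longlongrightarrow> a * 0 + 0) at_top" by (intro tendsto_intros 1 pCons)
 then show ?case by (simp add: algebra_simps)
qed

lemma flat_exp_deriv:
 "(flat_exp P has_real_derivative flat_exp ([:0, 0, 1:] * (P - pderiv P)) x) (at x)"
proof -
 consider "x > 0" | "x < 0" | "x = 0" by linarith
 then show ?thesis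
 proof cases
  case 1
  have "((\<lambda>x. poly P (1 / x) * exp (- (1 / x))) has_real_derivative
    flat_exp ([:0, 0, 1:] * (P - pderiv P)) x) (at x)"
  proof -
   have i: "((\<lambda>x. 1 / x) has_real_derivative (- (1 / x\<^sup>2))) (at x)"
    using 1 by (auto intro!: derivative_eq_intros simp: power2_eq_square)
   have p: "((\<lambda>x. poly P (1 / x)) has_real_derivative poly (pderiv P) (1 / x) * (- (1 / x\<^sup>2))) (at x)"
    by (rule DERIV_chain2[OF poly_DERIV i])
   have e: "((\<lambda>x. exp (- (1 / x))) has_real_derivative exp (- (1 / x)) * (- (- (1 / x\<^sup>2)))) (at x)"
    by (rule DERIV_chain2[OF DERIV_exp DERIV_minus[OF i]])
   show ?thesis using DERIV_mult[OF p e] 1 by (simp add: flat_exp_def power2_eq_square algebra_simps)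
  qed
  then show ?thesis
  proof (rule has_field_derivative_transform_within_open[where S = "{0<..}"])
  qed (use 1 in \<open>auto simp: flat_exp_def\<close>)
 next
  case 2
  have "((\<lambda>x. 0) has_real_derivative flat_exp ([:0, 0, 1:] * (P - pderiv P)) x) (at x)" using 2 by (simp add: flat_exp_def)
  then show ?thesis
  proof (rule has_field_derivative_transform_within_open[where S = "{..<0}"])
  qed (use 2 in \<open>auto simp: flat_exp_def\<close>)
 next
  case 3
  have r: "((\<lambda>y. flat_exp P y / y) \<longlongrightarrow> 0) (at_right 0)"
  proof -
   \<comment> \<open>With u = 1/y the difference quotient at 0 from the right is u P(u)
     exp(-u).\<close>
   have "((\<lambda>y. (inverse y) ^ 1 * poly P (inverse y) * exp (- (inverse y))) \<longlongrightarrow> 0) (at_right 0)"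
    by (rule filterlim_compose[OF poly_mult_exp_tendsto_0 filterlim_inverse_at_top_right])
   moreover have "\<forall>\<^sub>F y in at_right 0. (inverse y) ^ 1 * poly P (inverse y) * exp (- (inverse y)) = flat_exp P y / y"
    using eventually_at_right_less by eventually_elim (auto simp: flat_exp_def field_simps)
   ultimately show ?thesis by (rule Lim_transform_eventually)
  qed
  have l: "((\<lambda>y. flat_exp P y / y) \<longlongrightarrow> 0) (at_left 0)"
  proof -
   have "\<forall>\<^sub>F y in at_left 0. flat_exp P y / y = (0::real)" unfolding eventually_at_filter by (auto simp: flat_exp_def)
   then show ?thesis by (rule tendsto_eventually)
  qed
  have "((\<lambda>y. flat_exp P y / y) \<longlongrightarrow> 0) (at 0)" using l r filterlim_at_split by blast
  then show ?thesis unfolding 3 has_field_derivative_iff by (simp add: flat_exp_def)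
 qed
qed

definition flat_seq :: "nat \<Rightarrow> real \<Rightarrow> real" where
 "flat_seq k = flat_exp (((\<lambda>P. [:0, 0, 1:] * (P - pderiv P)) ^^ k) 1)"

lemma dseq_flat_seq: "dseq flat_seq" unfolding dseq_def flat_seq_def using flat_exp_deriv by simp

lemma flat_seq_neg: "x \<le> 0 \<Longrightarrow> flat_seq k x = 0" by (simp add: flat_seq_def flat_exp_def)

lemma flat_seq_0: "flat_seq 0 x = (if x > 0 then exp (- (1 / x)) else 0)" by (simp add: flat_seq_def flat_exp_def)

text \<open>One factor is flat to the left of \<open>a\<close>, the other to the right of
  \<open>b\<close>. The steepness \<open>c\<close> stretches the arguments; as it grows, the values
  on the open interval tend to 1, so that bumps approximate indicators.\<close>

definition bump :: "real \<Rightarrow> real \<Rightarrow> real \<Rightarrow> nat \<Rightarrow> real \<Rightarrow> real" where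
 "bump c a b = dseq_mult (\<lambda>k x. c ^ k * flat_seq k (c * x + (- c * a)))
   (\<lambda>k x. (- c) ^ k * flat_seq k ((- c) * x + c * b))"

lemma dseq_bump: "dseq (bump c a b)" unfolding bump_def by (intro dseq_dseq_mult dseq_affine dseq_flat_seq)

lemma bump_eq_0:
 assumes "c > 0" "x \<le> a \<or> b \<le> x"
 shows "bump c a b k x = 0" using assms(2)
proof
 assume "x \<le> a"
 then have "c * x + - c * a \<le> 0" using assms(1) by (simp add: mult_left_mono)
 then show ?thesis unfolding bump_def using flat_seq_neg by (intro dseq_mult_eq_0) simp
next
 assume "b \<le> x"
 then have "- c * x + c * b \<le> 0" using assms(1) by (simp add: mult_left_mono)
 then show ?thesis unfolding bump_def using flat_seq_neg by (intro dseq_mult_eq_0) simp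
qed

lemma bump_0: "bump c a b 0 x = flat_seq 0 (c * (x - a)) * flat_seq 0 (c * (b - x))"
 by (simp add: bump_def dseq_mult_0 algebra_simps)

lemma bump_0_bounds: "0 \<le> bump c a b 0 x" "bump c a b 0 x \<le> 1"
proof -
 have "0 \<le> flat_seq 0 y \<and> flat_seq 0 y \<le> 1" for y by (simp add: flat_seq_0)
 then show "0 \<le> bump c a b 0 x" "bump c a b 0 x \<le> 1" unfolding bump_0 by (auto intro: mult_le_one)
qed

lemma bump_0_pos: "c > 0 \<Longrightarrow> a < x \<Longrightarrow> x < b \<Longrightarrow> 0 < bump c a b 0 x" by (auto simp: bump_0 flat_seq_0)

lemma bump_tendsto:
 "((\<lambda>n. bump (real (Suc n)) a b 0 x) \<longlonglongrightarrow> indicator {a<..<b} x)"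
proof -
 have *: "(\<lambda>n. flat_seq 0 (real (Suc n) * y)) \<longlonglongrightarrow> indicator {0<..} y" for y
 proof (cases "y > 0")
  case True
  have "(\<lambda>n. exp (- ((1 / y) * (1 / real (Suc n))))) \<longlonglongrightarrow> exp (- ((1 / y) * 0))"
   by (intro tendsto_intros LIMSEQ_Suc[OF lim_1_over_n])
  moreover have "flat_seq 0 (real (Suc n) * y) = exp (- ((1 / y) * (1 / real (Suc n))))" for n
   using True by (simp add: flat_seq_0 mult_pos_pos)
  ultimately show ?thesis using True by simp
 next
  case False
  then show ?thesis by (auto simp: flat_seq_0 zero_less_mult_iff)
 qed
 have "(\<lambda>n. bump (real (Suc n)) a b 0 x) \<longlonglongrightarrow> indicator {0<..} (x - a) * indicator {0<..} (b - x)"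
  unfolding bump_0 by (intro tendsto_mult *)
 also have "indicator {0<..} (x - a) * indicator {0<..} (b - x) = (indicator {a<..<b} x :: real)" by (auto simp: indicator_def)
 finally show ?thesis .
qed

text \<open>The multi-index \<open>m\<close> selects the derivative order in each coordinate:
  \<open>prodf b m\<close> is the m-th mixed derivative of the tensor product
  \<open>prodf b (\<lambda>_. 0)\<close>. Differentiating is an index shift, which makes the order
  of differentiation irrelevant.\<close>

definition prodf :: "('d::finite \<Rightarrow> nat \<Rightarrow> real \<Rightarrow> real) \<Rightarrow> ('d \<Rightarrow> nat) \<Rightarrow> real ^ 'd \<Rightarrow> real" where
 "prodf b m x = (\<Prod>i\<in>UNIV. b i (m i) (x $ i))"

lemma prodf_upd:
 "prodf b (m(i := k)) x = b i k (x $ i) * (\<Prod>j\<in>UNIV - {i}. b j (m j) (x $ j))"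
 unfolding prodf_def by (subst prod.remove[of _ i]) auto

lemma prodf_has_derivative:
 fixes b :: "'d::finite \<Rightarrow> nat \<Rightarrow> real \<Rightarrow> real"
 assumes "\<forall>i. dseq (b i)"
 shows "(prodf b m has_derivative (\<lambda>v. \<Sum>i\<in>UNIV. v $ i * prodf b (m(i := Suc (m i))) x)) (at x)"
proof -
 have 1: "((\<lambda>x. b i (m i) (x $ i)) has_derivative (\<lambda>v. b i (Suc (m i)) (x $ i) * v $ i)) (at x)" for i
 proof -
  have "(b i (m i) has_derivative (*) (b i (Suc (m i)) (x $ i))) (at (x $ i))"
   using dseqD[OF assms[rule_format]] unfolding has_field_derivative_def by simp
  moreover have "((\<lambda>x. x $ i) has_derivative (\<lambda>v. v $ i)) (at x)"
   by (intro bounded_linear_imp_has_derivative bounded_linear_vec_nth)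
  ultimately show ?thesis using has_derivative_compose[of "\<lambda>x. x $ i" "\<lambda>v. v $ i" x UNIV "b i (m i)"] by simp
 qed
 have "((\<lambda>x. \<Prod>i\<in>UNIV. b i (m i) (x $ i)) has_derivative
   (\<lambda>v. \<Sum>i\<in>UNIV. (b i (Suc (m i)) (x $ i) * v $ i) * (\<Prod>j\<in>UNIV - {i}. b j (m j) (x $ j)))) (at x)"
  by (rule has_derivative_prod) (rule 1)
 then show ?thesis unfolding prodf_upd by (simp add: prodf_def[abs_def] mult_ac)
qed

lemma prodf_differentiable:
 "\<forall>i. dseq (b i) \<Longrightarrow> prodf b m differentiable_on A"
 by (meson differentiable_at_imp_differentiable_on differentiable_def prodf_has_derivative)

lemma prodf_continuous:
 "\<forall>i. dseq (b i) \<Longrightarrow> continuous_on A (prodf b m)" by (meson differentiable_imp_continuous_on prodf_differentiable)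

lemma partial_deriv_eq:
 "(f has_derivative f') (at x) \<Longrightarrow> partial_deriv i f x = f' (axis i 1)" unfolding partial_deriv_def by (metis frechet_derivative_at)

lemma partial_deriv_prodf:
 assumes "\<forall>i. dseq (b i)"
 shows "partial_deriv i (prodf b m) = prodf b (m(i := Suc (m i)))"
proof
 fix x
 have "(\<Sum>j\<in>UNIV. axis i 1 $ j * prodf b (m(j := Suc (m j))) x) =
   (\<Sum>j\<in>UNIV. if j = i then prodf b (m(j := Suc (m j))) x else 0)" by (rule sum.cong) (auto simp: axis_def)
 then show "partial_deriv i (prodf b m) x = prodf b (m(i := Suc (m i))) x"
  by (simp add: partial_deriv_eq[OF prodf_has_derivative[OF assms]])
qed

lemma foldr_partial_deriv_prodf:
 assumes "\<forall>i. dseq (b i)"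
 shows "foldr partial_deriv is (prodf b m) = prodf b (\<lambda>i. m i + count_list is i)"
proof (induction "is")
 case (Cons i "is")
 then show ?case by (auto simp: partial_deriv_prodf[OF assms] intro!: arg_cong[of _ _ "prodf b"])
qed simp

text \<open>This is what makes the \<open>SOME\<close> in \<open>multi_deriv\<close>
  meaningful.\<close>

lemma ex_count_list:
 fixes \<alpha> :: "'d::finite \<Rightarrow> nat"
 shows "\<exists>is. \<forall>i. count_list is i = \<alpha> i"
proof -
 obtain "is" where "mset is = Abs_multiset \<alpha>" using ex_mset by blast
 then have "count_list is i = \<alpha> i" for i by (simp add: count_mset[symmetric] Abs_multiset_inverse)
 then show ?thesis by blast
qed

lemma multi_deriv_list:
 obtains "is" where "\<And>i. count_list is i = \<alpha> i" "\<And>f. multi_deriv \<alpha> f = foldr partial_deriv is f"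
 unfolding multi_deriv_def using someI_ex[OF ex_count_list[of \<alpha>]] by blast

lemma multi_deriv_prodf:
 assumes "\<forall>i. dseq (b i)"
 shows "multi_deriv \<alpha> (prodf b (\<lambda>_. 0)) = prodf b \<alpha>"
proof -
 obtain "is" where "\<And>i. count_list is i = \<alpha> i" "\<And>f. multi_deriv \<alpha> f = foldr partial_deriv is f" using multi_deriv_list by blast
 then show ?thesis by (simp add: foldr_partial_deriv_prodf[OF assms])
qed

lemma smooth_prodf:
 assumes "\<forall>i. dseq (b i)"
 shows "smooth (prodf b m)" unfolding smooth_def using prodf_differentiable[OF assms]
 by (simp add: foldr_partial_deriv_prodf[OF assms])

lemma prodf_eq_0:
 assumes "\<And>i t. t \<le> l $ i \<or> u $ i \<le> t \<Longrightarrow> b i (m i) t = 0" "x \<notin> box l u"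
 shows "prodf b m x = 0"
proof -
 obtain i where "x $ i \<le> l $ i \<or> u $ i \<le> x $ i" using assms(2) by (auto simp: mem_box_cart not_less)
 then show ?thesis unfolding prodf_def using assms(1)[of "x $ i" i] by (intro prod_zero) auto
qed

lemma test_function_prodf:
 assumes "\<forall>i. dseq (b i)" "\<And>i t. t \<le> l $ i \<or> u $ i \<le> t \<Longrightarrow> b i 0 t = 0" "cbox l u \<subseteq> \<Omega>"
 shows "test_function \<Omega> (prodf b (\<lambda>_. 0))"
proof -
 have "{x. prodf b (\<lambda>_. 0) x \<noteq> 0} \<subseteq> box l u" using prodf_eq_0[where m = "\<lambda>_. 0"] assms(2) by blast
 then have "closure {x. prodf b (\<lambda>_. 0) x \<noteq> 0} \<subseteq> cbox l u" by (meson box_subset_cbox closed_cbox closure_minimal order_trans)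
 then have "compact (closure {x. prodf b (\<lambda>_. 0) x \<noteq> 0})" "closure {x. prodf b (\<lambda>_. 0) x \<noteq> 0} \<subseteq> \<Omega>"
  using assms(3) by (meson bounded_cbox bounded_subset closed_closure compact_eq_bounded_closed order_trans)+
 then show ?thesis unfolding test_function_def using smooth_prodf[OF assms(1)] by blast
qed

subsection \<open>Test functions and integration by parts\<close>

lemma integral_lebesgue_on:
 fixes f :: "'a::euclidean_space \<Rightarrow> real"
 assumes "\<Omega> \<in> sets borel"
 shows "(LINT x|lebesgue_on \<Omega>. f x) = (LINT x|lebesgue. indicator \<Omega> x * f x)" using assms by (subst integral_restrict_space) auto

text \<open>Bumps of growing steepness on the box are test functions, are bounded by 1 and converge
  to the indicator of its interior. Dominated convergence passes the hypothesis to that indicator,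
  and the frontier of the box is a null set.\<close>

lemma integral_cbox_eq_0_of_test_functions:
 fixes g :: "real ^ 'd::finite \<Rightarrow> real"
 assumes \<Omega>: "open \<Omega>" and g: "locally_integrable_on g \<Omega>"
  and 0: "\<And>\<phi>. test_function \<Omega> \<phi> \<Longrightarrow> (LINT x|lebesgue_on \<Omega>. g x * \<phi> x) = 0"
  and lu: "cbox l u \<subseteq> \<Omega>"
 shows "integral (cbox l u) g = 0"
proof -
 define \<phi> where "\<phi> n = prodf (\<lambda>i. bump (real (Suc n)) (l $ i) (u $ i)) (\<lambda>_. 0)" for n
 have gi: "g absolutely_integrable_on cbox l u" using g lu compact_cbox unfolding locally_integrable_on_def by blast
 then have gi': "integrable lebesgue (\<lambda>x. indicator (cbox l u) x * g x)" by (simp add: set_integrable_def)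
 have zero: "\<phi> n x = 0" if "x \<notin> box l u" for n x unfolding \<phi>_def by (rule prodf_eq_0[OF _ that]) (rule bump_eq_0, auto)
 have le: "\<bar>\<phi> n x\<bar> \<le> 1" for n x unfolding \<phi>_def prodf_def abs_prod
  by (intro prod_le_1) (use bump_0_bounds in \<open>auto simp: abs_le_iff\<close>)
 have cont: "continuous_on UNIV (\<phi> n)" for n unfolding \<phi>_def by (intro prodf_continuous allI dseq_bump)
 have lim: "(\<lambda>n. \<phi> n x) \<longlonglongrightarrow> indicator (box l u) x" for x
 proof -
  have "(\<lambda>n. \<phi> n x) \<longlonglongrightarrow> (\<Prod>i\<in>UNIV. indicator {l $ i<..<u $ i} (x $ i))"
   unfolding \<phi>_def prodf_def by (intro tendsto_prod bump_tendsto)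
  also have "(\<Prod>i\<in>UNIV. indicator {l $ i<..<u $ i} (x $ i)) = (indicator (box l u) x :: real)"
   by (auto simp: indicator_def mem_box_cart)
  finally show ?thesis .
 qed
 have "(\<lambda>n. LINT x|lebesgue. indicator (cbox l u) x * g x * \<phi> n x) \<longlonglongrightarrow>
   (LINT x|lebesgue. indicator (cbox l u) x * g x * indicator (box l u) x)"
 proof (rule integral_dominated_convergence[where w = "\<lambda>x. \<bar>indicator (cbox l u) x * g x\<bar>"])
  show "AE x in lebesgue. (\<lambda>n. indicator (cbox l u) x * g x * \<phi> n x) \<longlonglongrightarrow>
    indicator (cbox l u) x * g x * indicator (box l u) x" by (intro AE_I2 tendsto_mult tendsto_const lim)
  show "(\<lambda>x. indicator (cbox l u) x * g x * \<phi> n x) \<in> borel_measurable lebesgue" for n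
   using borel_measurable_continuous_onI[OF cont[of n]] by (intro borel_measurable_times[OF borel_measurable_integrable[OF gi']])
     (simp add: measurable_completion)
  show "AE x in lebesgue. norm (indicator (cbox l u) x * g x * \<phi> n x) \<le> \<bar>indicator (cbox l u) x * g x\<bar>" for n
   using le by (intro AE_I2) (simp add: abs_mult mult_left_le)
  show "(\<lambda>x. indicator (cbox l u) x * g x * indicator (box l u) x) \<in> borel_measurable lebesgue"
   by (rule borel_measurable_times[OF borel_measurable_integrable[OF gi']]) (rule borel_measurable_indicator, simp)
  show "integrable lebesgue (\<lambda>x. \<bar>indicator (cbox l u) x * g x\<bar>)" using gi' by (rule integrable_abs)
 qed
 moreover have "(LINT x|lebesgue. indicator (cbox l u) x * g x * \<phi> n x) = 0" for n
 proof -
  have "test_function \<Omega> (\<phi> n)" unfolding \<phi>_def by (rule test_function_prodf[OF _ _ lu]) (auto intro: dseq_bump bump_eq_0)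
  then have "(LINT x|lebesgue_on \<Omega>. g x * \<phi> n x) = 0" by (rule 0)
  then have "(LINT x|lebesgue. indicator \<Omega> x * (g x * \<phi> n x)) = 0" using \<Omega> by (simp add: integral_lebesgue_on)
  also have "(\<lambda>x. indicator \<Omega> x * (g x * \<phi> n x)) = (\<lambda>x. indicator (cbox l u) x * g x * \<phi> n x)"
   using zero[of _ n] lu box_subset_cbox[of l u] by (fastforce simp: indicator_def fun_eq_iff)
  finally show ?thesis .
 qed
 ultimately have "(LINT x|lebesgue. indicator (cbox l u) x * g x * indicator (box l u) x) = 0" by (simp add: LIMSEQ_const_iff)
 also have "(LINT x|lebesgue. indicator (cbox l u) x * g x * indicator (box l u) x) =
   (LINT x|lebesgue. indicator (cbox l u) x * g x)"
 proof (rule integral_cong_AE)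
  have "AE x in lebesgue. x \<notin> cbox l u - box l u"
   using negligible_frontier_interval[of l u] negligible_iff_null_sets AE_not_in by blast
  then show "AE x in lebesgue. indicator (cbox l u) x * g x * indicator (box l u) x = indicator (cbox l u) x * g x"
   by eventually_elim (auto simp: indicator_def)
  show "(\<lambda>x. indicator (cbox l u) x * g x * indicator (box l u) x) \<in> borel_measurable lebesgue"
   by (rule borel_measurable_times[OF borel_measurable_integrable[OF gi']]) (rule borel_measurable_indicator, simp)
 qed (rule borel_measurable_integrable[OF gi'])
 finally show ?thesis using set_lebesgue_integral_eq_integral(2)[OF gi] by (simp add: set_lebesgue_integral_def)
qed

text \<open>The fundamental lemma of the calculus of variations. If all integrals over boxes vanish,
  so do the averages over small cubes at a point, and these recover the function almost
  everywhere.\<close>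

lemma AE_eq_0_of_test_functions:
 fixes g :: "real ^ 'd::finite \<Rightarrow> real"
 assumes \<Omega>: "open \<Omega>" and g: "locally_integrable_on g \<Omega>"
  and 0: "\<And>\<phi>. test_function \<Omega> \<phi> \<Longrightarrow> (LINT x|lebesgue_on \<Omega>. g x * \<phi> x) = 0"
 shows "AE x in lebesgue. x \<in> \<Omega> \<longrightarrow> g x = 0"
proof -
 have box: "negligible {x \<in> cbox l u. g x \<noteq> 0}" if lu: "cbox l u \<subseteq> \<Omega>" for l u
 proof -
  \<comment> \<open>Extension by 0 from one box. Boxes meet in boxes, so the integral of
    \<open>h\<close> over every box vanishes, also over those that leave
    \<open>\<Omega>\<close>.\<close>
  define h where "h x = (if x \<in> cbox l u then g x else 0)" for x
  have i0: "integral (cbox a b) h = 0" for a b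
  proof -
   obtain a' b' where ab: "cbox a b \<inter> cbox l u = cbox a' b'" using Int_interval[of a b l u] by blast
   have "integral (cbox a b) h = integral (cbox a b \<inter> cbox l u) g"
    unfolding h_def by (subst integral_restrict_Int) (simp add: Int_commute)
   also have "\<dots> = 0" unfolding ab using ab lu by (intro integral_cbox_eq_0_of_test_functions[OF \<Omega> g 0]) auto
   finally show ?thesis .
  qed
  have "g absolutely_integrable_on cbox l u" using g lu compact_cbox unfolding locally_integrable_on_def by blast
  then have "h integrable_on UNIV" unfolding h_def using absolutely_integrable_on_def integrable_restrict_UNIV by blast
  then have "h integrable_on cbox a b" for a b by (meson integrable_on_subcbox subset_UNIV)
  then obtain N where N: "negligible N"
   "\<And>x e. \<lbrakk>x \<notin> N; 0 < e\<rbrakk> \<Longrightarrow> \<exists>d>0. \<forall>k. 0 < k \<and> k < d \<longrightarrow>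
     norm (integral (cbox x (x + k *\<^sub>R One)) h /\<^sub>R k ^ DIM(real ^ 'd) - h x) < e" using integrable_ccontinuous_explicit by blast
  \<comment> \<open>The averages over cubes with corner \<open>x\<close> are 0 and would otherwise
    have to come closer than \<open>\<bar>h x\<bar>\<close> to \<open>h x\<close>.\<close>
  have "h x = 0" if xN: "x \<notin> N" for x
  proof (rule ccontr)
   assume "h x \<noteq> 0"
   then obtain d where "d > 0" "\<And>k. 0 < k \<and> k < d \<Longrightarrow>
     norm (integral (cbox x (x + k *\<^sub>R One)) h /\<^sub>R k ^ DIM(real ^ 'd) - h x) < \<bar>h x\<bar>" using N(2)[OF xN, of "\<bar>h x\<bar>"] by auto
   from this(2)[of "d / 2"] this(1) show False by (simp add: i0)
  qed
  then have "{x \<in> cbox l u. g x \<noteq> 0} \<subseteq> N" unfolding h_def by fastforce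
  then show ?thesis using N(1) negligible_subset by blast
 qed
 obtain \<D> where D: "countable \<D>" "\<D> \<subseteq> Pow \<Omega>" "\<And>X. X \<in> \<D> \<Longrightarrow> \<exists>a b. X = cbox a b" "\<Union>\<D> = \<Omega>"
  using open_countable_Union_open_cbox[OF \<Omega>] by metis
 have "{x \<in> \<Omega>. g x \<noteq> 0} = (\<Union>X\<in>\<D>. {x \<in> X. g x \<noteq> 0})" using D(4) by blast
 moreover have "negligible {x \<in> X. g x \<noteq> 0}" if "X \<in> \<D>" for X using D(2) D(3)[OF that] that box by blast
 then have "negligible (\<Union>X\<in>\<D>. {x \<in> X. g x \<noteq> 0})" using D(1) by (intro negligible_countable_Union) auto
 ultimately have "{x \<in> \<Omega>. g x \<noteq> 0} \<in> null_sets lebesgue" by (simp add: negligible_iff_null_sets)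
 then have "AE x in lebesgue. x \<notin> {x \<in> \<Omega>. g x \<noteq> 0}" by (rule AE_not_in)
 then show ?thesis by eventually_elim auto
qed

section \<open>Integration by parts against test functions\<close>

lemma has_derivative_along_axis:
 assumes "(f has_derivative f') (at (x + t *\<^sub>R v))"
 shows "((\<lambda>t. f (x + t *\<^sub>R v)) has_real_derivative f' v) (at t)"
proof -
 have "((\<lambda>t. x + t *\<^sub>R v) has_derivative (\<lambda>h. h *\<^sub>R v)) (at t)" by (auto intro!: derivative_eq_intros)
 from has_derivative_compose[OF this assms]
 have "((\<lambda>t. f (x + t *\<^sub>R v)) has_derivative (\<lambda>h. f' (h *\<^sub>R v))) (at t)" .
 moreover have "f' (h *\<^sub>R v) = h * f' v" for h using linear_scale[OF has_derivative_linear[OF assms]] by simp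
 moreover have "(*) (f' v) = (\<lambda>h. h * f' v)" by (simp add: fun_eq_iff mult.commute)
 ultimately show ?thesis unfolding has_field_derivative_def by simp
qed

lemma has_derivative_at_differentiable:
 "f differentiable_on UNIV \<Longrightarrow> (f has_derivative frechet_derivative f (at x)) (at x)"
 by (metis UNIV_I differentiable_on_def frechet_derivative_works)

lemma partial_deriv_eq_0:
 assumes "closed S" "\<And>x. x \<notin> S \<Longrightarrow> f x = 0" "x \<notin> S"
 shows "partial_deriv i f x = 0"
proof -
 have "((\<lambda>_. 0) has_derivative (\<lambda>_. 0)) (at x)" by simp
 then have "(f has_derivative (\<lambda>_. 0)) (at x)"
  by (rule has_derivative_transform_within_open[of _ _ _ _ "- S"]) (use assms in auto)
 then show ?thesis by (simp add: partial_deriv_eq)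
qed

lemma integrable_continuous_compact_support:
 fixes f :: "'a::euclidean_space \<Rightarrow> real"
 assumes "continuous_on UNIV f" "compact S" "\<And>x. x \<notin> S \<Longrightarrow> f x = 0"
 shows "integrable lborel f"
proof -
 have "integrable lborel (\<lambda>x. indicator S x *\<^sub>R f x)"
  by (rule borel_integrable_compact[OF assms(2)]) (meson assms(1) continuous_on_subset subset_UNIV)
 also have "(\<lambda>x. indicator S x *\<^sub>R f x) = f" using assms(3) by (force simp: indicator_def)
 finally show ?thesis .
qed

text \<open>By translation invariance every difference quotient of \<open>g\<close> along the axis
  has integral 0, and the quotients converge dominatedly to the partial derivative.\<close>

lemma integral_partial_deriv_eq_0:
 fixes g :: "real ^ 'd::finite \<Rightarrow> real"
 assumes diff: "g differentiable_on UNIV" and cont: "continuous_on UNIV (partial_deriv i g)"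
  and S: "compact S" "\<And>x. x \<notin> S \<Longrightarrow> g x = 0"
 shows "(LINT x|lborel. partial_deriv i g x) = 0"
proof -
 let ?D = "partial_deriv i g" and ?e = "axis i 1 :: real ^ 'd"
 have gc: "continuous_on UNIV g" using diff differentiable_imp_continuous_on by blast
 have [measurable]: "g \<in> borel_measurable borel" "?D \<in> borel_measurable borel"
  using gc cont borel_measurable_continuous_onI by blast+
 have S0: "?D x = 0" if "x \<notin> S" for x using partial_deriv_eq_0[OF compact_imp_closed[OF S(1)] S(2) that] .
 have "bounded (?D ` S)" using S(1) cont by (meson compact_continuous_image compact_imp_bounded continuous_on_subset subset_UNIV)
 then obtain M where M: "M > 0" "\<And>x. x \<in> S \<Longrightarrow> \<bar>?D x\<bar> \<le> M" unfolding bounded_pos by auto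
 have DM: "\<bar>?D x\<bar> \<le> M" for x using M(1) M(2)[of x] S0[of x] by (cases "x \<in> S") auto
 obtain r where r: "r > 0" "\<And>x. x \<in> S \<Longrightarrow> norm x \<le> r" using compact_imp_bounded[OF S(1)] unfolding bounded_pos by auto
 have deriv: "((\<lambda>t. g (x + t *\<^sub>R ?e)) has_real_derivative ?D (x + t *\<^sub>R ?e)) (at t)" for x t unfolding partial_deriv_def
  by (rule has_derivative_along_axis[OF has_derivative_at_differentiable[OF diff]])
 have int_g: "integrable lborel g" by (rule integrable_continuous_compact_support[OF gc S])
 define q where "q n x = (g (x + (1 / real (Suc n)) *\<^sub>R ?e) - g x) * real (Suc n)" for n x
 have int_shift: "integrable lborel (\<lambda>x. g (x + v))"
   "(LINT x|lborel. g (x + v)) = (LINT x|lborel. g x)" for v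
 proof -
  have *: "lborel = distr lborel borel (\<lambda>x. x + v)" using lborel_distr_plus[of v] by (simp add: add.commute[of _ v])
  show "integrable lborel (\<lambda>x. g (x + v))"
   by (subst integrable_distr_eq[of "\<lambda>x. x + v" lborel borel g, symmetric]) (use int_g * in auto)
  show "(LINT x|lborel. g (x + v)) = (LINT x|lborel. g x)"
   by (subst integral_distr[of "\<lambda>x. x + v" lborel borel g, symmetric]) (use * in auto)
 qed
 have q0: "(LINT x|lborel. q n x) = 0" for n
  unfolding q_def using int_shift int_g by (simp add: Bochner_Integration.integral_diff)
 have "(\<lambda>n. LINT x|lborel. q n x) \<longlonglongrightarrow> (LINT x|lborel. ?D x)"
 proof (rule integral_dominated_convergence[where w = "\<lambda>x. M * indicator (cball 0 (r + 1)) x"])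
  show "?D \<in> borel_measurable lborel" by simp
  show "q n \<in> borel_measurable lborel" for n unfolding q_def[abs_def] by measurable
  show "integrable lborel (\<lambda>x. M * indicator (cball 0 (r + 1)) x)"
   using emeasure_lborel_cball_finite by (intro integrable_mult_right integrable_real_indicator) (auto simp: less_top[symmetric])
  show "AE x in lborel. (\<lambda>n. q n x) \<longlonglongrightarrow> ?D x"
  proof (intro AE_I2)
   fix x
   have "((\<lambda>h. (g (x + h *\<^sub>R ?e) - g x) / h) \<longlongrightarrow> ?D x) (at 0)" using deriv[of x 0] by (simp add: has_field_derivative_iff)
   moreover have "filterlim (\<lambda>n. 1 / real (Suc n)) (at 0) sequentially"
    unfolding filterlim_at using LIMSEQ_Suc[OF lim_1_over_n] by auto
   ultimately have "(\<lambda>n. (g (x + (1 / real (Suc n)) *\<^sub>R ?e) - g x) / (1 / real (Suc n))) \<longlonglongrightarrow> ?D x" by (rule filterlim_compose)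
   then show "(\<lambda>n. q n x) \<longlonglongrightarrow> ?D x" by (simp add: q_def)
  qed
  show "AE x in lborel. norm (q n x) \<le> M * indicator (cball 0 (r + 1)) x" for n
  proof (intro AE_I2)
   fix x
   let ?h = "1 / real (Suc n)"
   \<comment> \<open>By the mean value theorem the quotient is a value of the partial derivative at
     distance less than 1. This bounds it by \<open>M\<close> and confines its support to the ball
     of radius \<open>r + 1\<close>.\<close>
   obtain z where z: "0 < z" "z < ?h" "g (x + ?h *\<^sub>R ?e) - g (x + 0 *\<^sub>R ?e) = (?h - 0) * ?D (x + z *\<^sub>R ?e)"
    using MVT2[of 0 ?h "\<lambda>t. g (x + t *\<^sub>R ?e)" "\<lambda>t. ?D (x + t *\<^sub>R ?e)"] deriv by auto
   then have qz: "q n x = ?D (x + z *\<^sub>R ?e)" by (simp add: q_def)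
   show "norm (q n x) \<le> M * indicator (cball 0 (r + 1)) x"
   proof (cases "x \<in> cball 0 (r + 1)")
    case True
    then show ?thesis using qz DM by simp
   next
    case False
    have "norm x \<le> norm (x + z *\<^sub>R ?e) + norm (z *\<^sub>R ?e)" by (metis add_diff_cancel_right' norm_triangle_ineq4)
    moreover have "norm (z *\<^sub>R ?e) \<le> 1"
    proof -
     have "?h \<le> 1" by simp
     then have "z \<le> 1" using z(2) by linarith
     then show ?thesis using z(1) by (simp add: norm_axis_1)
    qed
    ultimately have "norm (x + z *\<^sub>R ?e) > r" using False by simp
    then show ?thesis using r(2) S0 qz False by fastforce
   qed
  qed
 qed
 then show ?thesis using q0 by (simp add: LIMSEQ_const_iff)
qed

lemma test_function_iterated:
 assumes "test_function \<Omega> \<phi>"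
 shows "foldr partial_deriv is \<phi> differentiable_on UNIV"
  and "x \<notin> closure {x. \<phi> x \<noteq> 0} \<Longrightarrow> foldr partial_deriv is \<phi> x = 0"
proof -
 show "foldr partial_deriv is \<phi> differentiable_on UNIV" using assms by (auto simp: test_function_def smooth_def)
 show "x \<notin> closure {x. \<phi> x \<noteq> 0} \<Longrightarrow> foldr partial_deriv is \<phi> x = 0"
 proof (induction "is" arbitrary: x)
  case Nil
  then show ?case using closure_subset[of "{x. \<phi> x \<noteq> 0}"] by auto
 next
  case (Cons i "is")
  then show ?case using partial_deriv_eq_0[of "closure {x. \<phi> x \<noteq> 0}"] by auto
 qed
qed

text \<open>Each element of the list moves one derivative from \<open>\<phi>\<close> to the tensor
  product and contributes a sign; \<open>m\<close> is general because the tensor product changes on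
  the way.\<close>

lemma integration_by_parts_prodf:
 fixes \<phi> :: "real ^ 'd::finite \<Rightarrow> real"
 assumes b: "\<forall>i. dseq (b i)" and \<phi>: "test_function \<Omega> \<phi>"
 shows "(LINT x|lborel. prodf b m x * foldr partial_deriv is \<phi> x) =
  (- 1) ^ length is * (LINT x|lborel. prodf b (\<lambda>i. m i + count_list is i) x * \<phi> x)"
proof (induction "is" arbitrary: m)
 case (Cons i "is")
 let ?S = "closure {x. \<phi> x \<noteq> 0}" and ?\<psi> = "foldr partial_deriv is \<phi>" and ?m = "m(i := Suc (m i))"
 have S: "compact ?S" using \<phi> by (simp add: test_function_def)
 have d1: "?\<psi> differentiable_on UNIV" and d2: "partial_deriv i ?\<psi> differentiable_on UNIV"
  using test_function_iterated(1)[OF \<phi>, of "is"] test_function_iterated(1)[OF \<phi>, of "i # is"] by auto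
 have c: "continuous_on UNIV ?\<psi>" "continuous_on UNIV (partial_deriv i ?\<psi>)" using d1 d2 differentiable_imp_continuous_on by blast+
 have z: "?\<psi> x = 0" "partial_deriv i ?\<psi> x = 0" if "x \<notin> ?S" for x
  using test_function_iterated(2)[OF \<phi> that, of "is"] test_function_iterated(2)[OF \<phi> that, of "i # is"] by auto
 have pc: "continuous_on UNIV (prodf b m)" for m using prodf_continuous[OF b] .
 have eq: "partial_deriv i (\<lambda>x. prodf b m x * ?\<psi> x) = (\<lambda>x. prodf b m x * partial_deriv i ?\<psi> x + prodf b ?m x * ?\<psi> x)"
 proof
  fix x
  have "(prodf b m has_derivative frechet_derivative (prodf b m) (at x)) (at x)"
   by (rule has_derivative_at_differentiable[OF prodf_differentiable[OF b]])
  from has_derivative_mult[OF this has_derivative_at_differentiable[OF d1]]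
  have "partial_deriv i (\<lambda>x. prodf b m x * ?\<psi> x) x =
    prodf b m x * partial_deriv i ?\<psi> x + partial_deriv i (prodf b m) x * ?\<psi> x"
   by (simp only: partial_deriv_eq partial_deriv_def[of i ?\<psi> x] partial_deriv_def[of i "prodf b m" x])
  then show "partial_deriv i (\<lambda>x. prodf b m x * ?\<psi> x) x = prodf b m x * partial_deriv i ?\<psi> x + prodf b ?m x * ?\<psi> x"
   by (simp add: partial_deriv_prodf[OF b])
 qed
 have i1: "integrable lborel (\<lambda>x. prodf b m x * partial_deriv i ?\<psi> x)"
  by (rule integrable_continuous_compact_support[OF _ S]) (auto intro!: continuous_intros pc c simp: z)
 have i2: "integrable lborel (\<lambda>x. prodf b ?m x * ?\<psi> x)"
  by (rule integrable_continuous_compact_support[OF _ S]) (auto intro!: continuous_intros pc c simp: z)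
 have "(LINT x|lborel. partial_deriv i (\<lambda>x. prodf b m x * ?\<psi> x) x) = 0"
 proof (rule integral_partial_deriv_eq_0[OF _ _ S])
  show "(\<lambda>x. prodf b m x * ?\<psi> x) differentiable_on UNIV" using prodf_differentiable[OF b] d1 by (intro differentiable_on_mult)
  show "continuous_on UNIV (partial_deriv i (\<lambda>x. prodf b m x * ?\<psi> x))" unfolding eq by (intro continuous_intros pc c)
 qed (simp add: z)
 then have "(LINT x|lborel. prodf b m x * partial_deriv i ?\<psi> x) = - (LINT x|lborel. prodf b ?m x * ?\<psi> x)"
  unfolding eq using i1 i2 by (simp add: Bochner_Integration.integral_add)
 also have "\<dots> = - ((- 1) ^ length is * (LINT x|lborel. prodf b (\<lambda>j. ?m j + count_list is j) x * \<phi> x))" by (simp only: Cons.IH)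
 also have "(\<lambda>j. ?m j + count_list is j) = (\<lambda>j. m j + count_list (i # is) j)" by auto
 finally show ?case by simp
qed simp

subsection \<open>Norming sets for polynomials\<close>

definition lagrange_basis :: "nat \<Rightarrow> nat \<Rightarrow> real poly" where
 "lagrange_basis s j = (\<Prod>k\<in>{..<s} - {j}. smult (1 / (real j - real k)) [:- real k, 1:])"

lemma poly_lagrange_basis:
 assumes "i < s" "j < s"
 shows "poly (lagrange_basis s j) (real i) = (if i = j then 1 else 0)"
proof (cases "i = j")
 case True
 then show ?thesis by (auto simp: lagrange_basis_def poly_prod diff_divide_distrib[symmetric] intro!: prod.neutral)
next
 case False
 then show ?thesis using assms by (auto simp: lagrange_basis_def poly_prod intro!: bexI[of _ i])
qed

lemma degree_lagrange_basis:
 assumes "j < s"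
 shows "degree (lagrange_basis s j) < s"
proof -
 have "degree (lagrange_basis s j) \<le> (\<Sum>k\<in>{..<s} - {j}. degree (smult (1 / (real j - real k)) [:- real k, 1:]))"
  unfolding lagrange_basis_def by (rule degree_prod_sum_le[unfolded o_def]) simp
 also have "\<dots> \<le> (\<Sum>k\<in>{..<s} - {j}. 1)" by (rule sum_mono) simp
 also have "\<dots> < s" using assms by simp
 finally show ?thesis .
qed

text \<open>The difference of both sides has degree less than \<open>s\<close> and vanishes at the
  \<open>s\<close> nodes.\<close>

lemma poly_lagrange:
 fixes p :: "real poly"
 assumes "degree p < s"
 shows "poly p x = (\<Sum>j<s. poly p (real j) * poly (lagrange_basis s j) x)"
proof -
 define q where "q = p - (\<Sum>j<s. smult (poly p (real j)) (lagrange_basis s j))"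
 have "degree q < s" unfolding q_def using assms degree_lagrange_basis
  by (intro degree_diff_less degree_sum_less) (auto intro: le_less_trans[OF degree_smult_le])
 have 0: "poly q (real i) = 0" if "i < s" for i
 proof -
  have "(\<Sum>j<s. poly p (real j) * poly (lagrange_basis s j) (real i)) = (\<Sum>j<s. if j = i then poly p (real i) else 0)"
   using that by (intro sum.cong) (auto simp: poly_lagrange_basis)
  then show ?thesis using that by (simp add: q_def poly_sum)
 qed
 have "q = 0"
 proof (rule ccontr)
  assume "q \<noteq> 0"
  then have "card (real ` {..<s}) \<le> degree q"
   using 0 by (intro order_trans[OF card_mono[OF poly_roots_finite] card_poly_roots_bound]) auto
  then show False using \<open>degree q < s\<close> by (simp add: card_image)
 qed
 then have "poly p x = poly (\<Sum>j<s. smult (poly p (real j)) (lagrange_basis s j)) x" by (simp add: q_def)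
 then show ?thesis by (simp add: poly_sum)
qed

text \<open>By Lagrange interpolation a polynomial is a combination of fixed basis polynomials with
  its node values as coefficients. \<open>C\<close> bounds the basis and its derivatives on the
  interval.\<close>

lemma poly_bounds_on_interval:
 fixes R :: real
 obtains C where "C \<ge> 1"
  "\<And>p M x. degree p < s \<Longrightarrow> (\<And>j. j < s \<Longrightarrow> \<bar>poly p (real j)\<bar> \<le> M) \<Longrightarrow> \<bar>x\<bar> \<le> R \<Longrightarrow> \<bar>poly p x\<bar> \<le> C * M"
  "\<And>p M x y. degree p < s \<Longrightarrow> (\<And>j. j < s \<Longrightarrow> \<bar>poly p (real j)\<bar> \<le> M) \<Longrightarrow> \<bar>x\<bar> \<le> R \<Longrightarrow> \<bar>y\<bar> \<le> R \<Longrightarrow>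
    \<bar>poly p x - poly p y\<bar> \<le> C * M * \<bar>x - y\<bar>"
proof -
 let ?L = "\<lambda>j. poly (lagrange_basis s j)" and ?L' = "\<lambda>j. poly (pderiv (lagrange_basis s j))"
 have "\<exists>B\<ge>0. \<forall>x. \<bar>x\<bar> \<le> R \<longrightarrow> \<bar>poly q x\<bar> \<le> B" for q :: "real poly"
 proof -
  have "bounded (poly q ` {-R..R})"
   by (intro compact_imp_bounded compact_continuous_image continuous_on_poly continuous_on_id) auto
  then obtain B where B: "B > 0" "\<And>x. x \<in> {-R..R} \<Longrightarrow> \<bar>poly q x\<bar> \<le> B" unfolding bounded_pos by auto
  have "\<bar>poly q x\<bar> \<le> B" if "\<bar>x\<bar> \<le> R" for x using that by (intro B(2)) (auto simp: abs_le_iff)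
  then show ?thesis using B(1) by (intro exI[of _ B]) auto
 qed
 then obtain B where B: "\<And>q. B q \<ge> 0" "\<And>q x. \<bar>x\<bar> \<le> R \<Longrightarrow> \<bar>poly q x\<bar> \<le> B q" by metis
 define C where "C = 1 + (\<Sum>j<s. B (lagrange_basis s j)) + (\<Sum>j<s. B (pderiv (lagrange_basis s j)))"
 have C1: "C \<ge> 1 + (\<Sum>j<s. B (lagrange_basis s j))" "C \<ge> (\<Sum>j<s. B (pderiv (lagrange_basis s j)))" "C \<ge> 1"
  unfolding C_def using B(1) by (auto intro!: sum_nonneg add_nonneg_nonneg)
 show ?thesis
 proof (rule that[of C])
  fix p :: "real poly" and M x
  assume p: "degree p < s" "\<And>j. j < s \<Longrightarrow> \<bar>poly p (real j)\<bar> \<le> M"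
  have M: "M \<ge> 0" using p(2)[of 0] p(1) by fastforce
  show "\<bar>poly p x\<bar> \<le> C * M" if x: "\<bar>x\<bar> \<le> R"
  proof -
   have "\<bar>poly p x\<bar> \<le> (\<Sum>j<s. \<bar>poly p (real j) * ?L j x\<bar>)" by (subst poly_lagrange[OF p(1)]) (rule sum_abs)
   also have "\<dots> \<le> (\<Sum>j<s. M * B (lagrange_basis s j))"
    using p(2) B(2)[OF x] M by (intro sum_mono) (auto simp: abs_mult intro!: mult_mono)
   also have "\<dots> = (\<Sum>j<s. B (lagrange_basis s j)) * M" by (simp add: sum_distrib_left mult.commute)
   also have "\<dots> \<le> C * M" using C1 M by (intro mult_right_mono) auto
   finally show ?thesis .
  qed
  show "\<bar>poly p x - poly p y\<bar> \<le> C * M * \<bar>x - y\<bar>" if x: "\<bar>x\<bar> \<le> R" and y: "\<bar>y\<bar> \<le> R" for y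
  proof -
   have l: "\<bar>?L j x - ?L j y\<bar> \<le> B (pderiv (lagrange_basis s j)) * \<bar>x - y\<bar>" for j
   proof -
    have "norm (?L j x - ?L j y) \<le> B (pderiv (lagrange_basis s j)) * norm (x - y)"
     by (rule field_differentiable_bound[of "{-R..R}" _ "?L' j"])
       (use x y B(2) in \<open>auto intro!: has_field_derivative_at_within poly_DERIV\<close>)
    then show ?thesis by simp
   qed
   have "poly p x - poly p y = (\<Sum>j<s. poly p (real j) * (?L j x - ?L j y))"
    by (subst (1 2) poly_lagrange[OF p(1)]) (simp add: sum_subtractf algebra_simps)
   then have "\<bar>poly p x - poly p y\<bar> \<le> (\<Sum>j<s. \<bar>poly p (real j) * (?L j x - ?L j y)\<bar>)" by (simp add: sum_abs)
   also have "\<dots> \<le> (\<Sum>j<s. M * (B (pderiv (lagrange_basis s j)) * \<bar>x - y\<bar>))"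
    using p(2) l M by (intro sum_mono) (auto simp: abs_mult intro!: mult_mono)
   also have "\<dots> = (\<Sum>j<s. B (pderiv (lagrange_basis s j))) * (M * \<bar>x - y\<bar>)"
    by (simp add: sum_distrib_left sum_distrib_right mult_ac)
   also have "\<dots> \<le> C * (M * \<bar>x - y\<bar>)" using C1 M by (intro mult_right_mono) auto
   finally show ?thesis by (simp add: mult_ac)
  qed
 qed (use C1 in auto)
qed

section \<open>Functions that are polynomial in each variable\<close>

definition vupd :: "real ^ 'd::finite \<Rightarrow> 'd \<Rightarrow> real \<Rightarrow> real ^ 'd" where
 "vupd y i t = (\<chi> j. if j = i then t else y $ j)"

lemma vupd_nth: "vupd y i t $ j = (if j = i then t else y $ j)" by (simp add: vupd_def)

lemma vupd_same: "vupd y i (y $ i) = y" by (simp add: vec_eq_iff vupd_nth)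

text \<open>The degree is bounded in each variable separately, not in total: such functions are
  controlled by their values on a product grid, and estimates proceed one coordinate at a time.
  Polynomials of total degree less than \<open>s\<close> belong to the class.\<close>

definition sep_poly :: "nat \<Rightarrow> (real ^ 'd::finite \<Rightarrow> real) \<Rightarrow> bool" where
 "sep_poly s Q \<longleftrightarrow> (\<forall>i y. \<exists>p. degree p < s \<and> (\<forall>t. Q (vupd y i t) = poly p t))"

definition grid :: "nat \<Rightarrow> (real ^ 'd::finite) set" where
 "grid s = {g. \<forall>i. g $ i \<in> real ` {..<s}}"

lemma finite_grid: "finite (grid s :: (real ^ 'd::finite) set)"
proof (rule finite_subset)
 show "(grid s :: (real ^ 'd) set) \<subseteq> vec_lambda ` (UNIV \<rightarrow>\<^sub>E real ` {..<s})"
 proof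
  fix g :: "real ^ 'd" assume "g \<in> grid s"
  then have "vec_nth g \<in> UNIV \<rightarrow>\<^sub>E real ` {..<s}" by (auto simp: grid_def PiE_def Pi_def extensional_def)
  then show "g \<in> vec_lambda ` (UNIV \<rightarrow>\<^sub>E real ` {..<s})" by (metis image_eqI vec_nth_inverse)
 qed
qed (intro finite_imageI finite_PiE, auto)

lemma sep_poly_bound:
 fixes R :: real
 obtains C where "C \<ge> 1"
  "\<And>Q :: real ^ 'd::finite \<Rightarrow> real. \<And>M y. sep_poly s Q \<Longrightarrow> (\<And>g. g \<in> grid s \<Longrightarrow> \<bar>Q g\<bar> \<le> M) \<Longrightarrow>
    (\<forall>i. \<bar>y $ i\<bar> \<le> R) \<Longrightarrow> \<bar>Q y\<bar> \<le> C * M"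
  "\<And>Q :: real ^ 'd::finite \<Rightarrow> real. \<And>M x y \<kappa>. sep_poly s Q \<Longrightarrow> (\<And>g. g \<in> grid s \<Longrightarrow> \<bar>Q g\<bar> \<le> M) \<Longrightarrow>
    (\<forall>i. \<bar>x $ i\<bar> \<le> R \<and> \<bar>y $ i\<bar> \<le> R \<and> \<bar>x $ i - y $ i\<bar> \<le> \<kappa>) \<Longrightarrow> \<bar>Q x - Q y\<bar> \<le> C * M * \<kappa>"
proof -
 obtain C0 where C0: "C0 \<ge> 1"
  "\<And>p M x. degree p < s \<Longrightarrow> (\<And>j. j < s \<Longrightarrow> \<bar>poly p (real j)\<bar> \<le> M) \<Longrightarrow> \<bar>x\<bar> \<le> max R (real s) \<Longrightarrow> \<bar>poly p x\<bar> \<le> C0 * M"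
  "\<And>p M x y. degree p < s \<Longrightarrow> (\<And>j. j < s \<Longrightarrow> \<bar>poly p (real j)\<bar> \<le> M) \<Longrightarrow> \<bar>x\<bar> \<le> max R (real s) \<Longrightarrow> \<bar>y\<bar> \<le> max R (real s) \<Longrightarrow>
    \<bar>poly p x - poly p y\<bar> \<le> C0 * M * \<bar>x - y\<bar>"
 proof (rule poly_bounds_on_interval[of s "max R (real s)"], goal_cases)
  case (1 C)
  show ?case by (rule that) (fact 1)+
 qed
 let ?d = "CARD('d)"
 \<comment> \<open>Hybrid points: the coordinates in \<open>I\<close> are free and the others are
   grid values, so that the empty \<open>I\<close> is the hypothesis. Each coordinate that is freed
   costs a factor \<open>C0\<close>. The interval is enlarged to \<open>max R (real s)\<close> in
   order to contain the grid values too.\<close>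
 have growth: "\<bar>Q y\<bar> \<le> C0 ^ card I * M"
  if Q: "sep_poly s Q" and M: "\<And>g. g \<in> grid s \<Longrightarrow> \<bar>Q g\<bar> \<le> M"
   and y: "\<forall>i\<in>I. \<bar>y $ i\<bar> \<le> max R (real s)" "\<forall>i. i \<notin> I \<longrightarrow> y $ i \<in> real ` {..<s}"
  for Q :: "real ^ 'd \<Rightarrow> real" and M y and I :: "'d set"
 proof -
  have "finite I" by simp
  then show ?thesis using y
  proof (induction I arbitrary: y rule: finite_induct)
   case empty
   then show ?case using M[of y] by (simp add: grid_def)
  next
   case (insert i I)
   obtain p where p: "degree p < s" "\<And>t. Q (vupd y i t) = poly p t" using Q unfolding sep_poly_def by metis
   have "\<bar>poly p (real j)\<bar> \<le> C0 ^ card I * M" if "j < s" for j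
    unfolding p(2)[symmetric] by (rule insert.IH) (use insert that in \<open>auto simp: vupd_nth\<close>)
   then have "\<bar>poly p (y $ i)\<bar> \<le> C0 * (C0 ^ card I * M)" by (intro C0(2)[OF p(1)]) (use insert in auto)
   then show ?case using insert.hyps by (simp add: p(2)[symmetric] vupd_same mult_ac)
  qed
 qed
 have lip1: "\<bar>Q (vupd y i t) - Q (vupd y i u)\<bar> \<le> C0 * (C0 ^ ?d * M) * \<bar>t - u\<bar>"
  if Q: "sep_poly s Q" and M: "\<And>g. g \<in> grid s \<Longrightarrow> \<bar>Q g\<bar> \<le> M"
   and y: "\<forall>i. \<bar>y $ i\<bar> \<le> max R (real s)" and tu: "\<bar>t\<bar> \<le> max R (real s)" "\<bar>u\<bar> \<le> max R (real s)"
  for Q :: "real ^ 'd \<Rightarrow> real" and M y i t u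
 proof -
  obtain p where p: "degree p < s" "\<And>t. Q (vupd y i t) = poly p t" using Q unfolding sep_poly_def by metis
  have "\<bar>poly p (real j)\<bar> \<le> C0 ^ ?d * M" if "j < s" for j unfolding p(2)[symmetric]
   by (rule growth[OF Q M, of UNIV]) (use y that in \<open>auto simp: vupd_nth max_def\<close>)
  from C0(3)[OF p(1) this tu] show ?thesis by (simp add: p(2))
 qed
 \<comment> \<open>Moving from \<open>x\<close> to \<open>y\<close> one coordinate at a time;
   \<open>I\<close> contains the coordinates in which they may still differ.\<close>
 have lip: "\<bar>Q x - Q y\<bar> \<le> real (card I) * (C0 * (C0 ^ ?d * M) * \<kappa>)"
  if Q: "sep_poly s Q" and M: "\<And>g. g \<in> grid s \<Longrightarrow> \<bar>Q g\<bar> \<le> M" and M0: "M \<ge> 0"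
   and xy: "\<forall>i. \<bar>x $ i\<bar> \<le> R \<and> \<bar>y $ i\<bar> \<le> R \<and> \<bar>x $ i - y $ i\<bar> \<le> \<kappa>" "\<forall>i. i \<notin> I \<longrightarrow> x $ i = y $ i"
  for Q :: "real ^ 'd \<Rightarrow> real" and M x y \<kappa> and I :: "'d set"
 proof -
  have "finite I" by simp
  then show ?thesis using xy
  proof (induction I arbitrary: x rule: finite_induct)
   case empty
   then have "x = y" by (simp add: vec_eq_iff)
   then show ?case by simp
  next
   case (insert i I)
   have k: "\<kappa> \<ge> 0" using insert.prems(1) abs_ge_zero order_trans by blast
   let ?x = "vupd x i (y $ i)"
   have "\<bar>Q ?x - Q y\<bar> \<le> real (card I) * (C0 * (C0 ^ ?d * M) * \<kappa>)"
    by (rule insert.IH) (use insert.prems k in \<open>auto simp: vupd_nth\<close>)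
   moreover have "\<bar>Q (vupd x i (x $ i)) - Q ?x\<bar> \<le> C0 * (C0 ^ ?d * M) * \<bar>x $ i - y $ i\<bar>"
    by (rule lip1[OF Q M]) (use insert.prems in \<open>auto intro: max.coboundedI1\<close>)
   moreover have "C0 * (C0 ^ ?d * M) * \<bar>x $ i - y $ i\<bar> \<le> C0 * (C0 ^ ?d * M) * \<kappa>"
    using insert.prems(1) C0(1) M0 by (intro mult_left_mono) auto
   ultimately show ?case using insert.hyps by (simp add: vupd_same algebra_simps)
  qed
 qed
 define C where "C = real ?d * (C0 * C0 ^ ?d) + C0 ^ ?d"
 have C0d: "C0 ^ ?d \<ge> 1" using C0(1) by (rule one_le_power)
 have pos: "0 \<le> real ?d * (C0 * C0 ^ ?d)" using C0(1) by simp
 show ?thesis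
 proof (rule that[of C])
  show "C \<ge> 1" unfolding C_def using C0d pos by linarith
  fix Q :: "real ^ 'd \<Rightarrow> real" and M
  assume Q: "sep_poly s Q" and M: "\<And>g. g \<in> grid s \<Longrightarrow> \<bar>Q g\<bar> \<le> M"
  have "s > 0" using Q unfolding sep_poly_def by (metis less_nat_zero_code neq0_conv)
  then have "(0 :: real ^ 'd) \<in> grid s" by (auto simp: grid_def)
  then have M0: "M \<ge> 0" using M[of 0] by linarith
  show "\<bar>Q y\<bar> \<le> C * M" if "\<forall>i. \<bar>y $ i\<bar> \<le> R" for y
  proof -
   have "\<bar>Q y\<bar> \<le> C0 ^ ?d * M" using growth[OF Q M, of UNIV y] that by (auto intro: max.coboundedI1)
   also have "\<dots> \<le> C * M" unfolding C_def using pos M0 by (intro mult_right_mono) auto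
   finally show ?thesis .
  qed
  show "\<bar>Q x - Q y\<bar> \<le> C * M * \<kappa>"
   if xy: "\<forall>i. \<bar>x $ i\<bar> \<le> R \<and> \<bar>y $ i\<bar> \<le> R \<and> \<bar>x $ i - y $ i\<bar> \<le> \<kappa>" for x y \<kappa>
  proof -
   have k: "\<kappa> \<ge> 0" using xy abs_ge_zero order_trans by blast
   have "\<bar>Q x - Q y\<bar> \<le> real ?d * (C0 * (C0 ^ ?d * M) * \<kappa>)" using lip[OF Q M M0 xy, of UNIV] by simp
   also have "\<dots> = real ?d * (C0 * C0 ^ ?d) * (M * \<kappa>)" by (simp add: mult_ac)
   also have "\<dots> \<le> C * (M * \<kappa>)" unfolding C_def using M0 k C0d by (intro mult_right_mono) auto
   finally show ?thesis by (simp add: mult_ac)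
  qed
 qed
qed

text \<open>Any point set close to the grid norms the polynomials: by the Lipschitz bound the maximum
 over the grid changes by at most half of itself under a small perturbation.\<close>

lemma sep_poly_perturbed_grid:
 fixes R :: real
 obtains \<kappa> C where "\<kappa> > 0" "C > 0"
  "\<And>(Q :: real ^ 'd::finite \<Rightarrow> real) (N :: real ^ 'd \<Rightarrow> real ^ 'd) y. sep_poly s Q \<Longrightarrow>
    (\<And>g i. g \<in> grid s \<Longrightarrow> \<bar>N g $ i - g $ i\<bar> \<le> \<kappa>) \<Longrightarrow> (\<forall>i. \<bar>y $ i\<bar> \<le> R) \<Longrightarrow>
    \<bar>Q y\<bar> \<le> C * (\<Sum>g\<in>grid s. \<bar>Q (N g)\<bar>)"
proof -
 \<comment> \<open>Large enough for the evaluation point, for the grid and for its perturbation, as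
   \<open>\<kappa> \<le> 1\<close> below.\<close>
 define R' where "R' = \<bar>R\<bar> + real s + 1"
 obtain C where C: "C \<ge> 1"
  "\<And>Q :: real ^ 'd::finite \<Rightarrow> real. \<And>M y. sep_poly s Q \<Longrightarrow> (\<And>g. g \<in> grid s \<Longrightarrow> \<bar>Q g\<bar> \<le> M) \<Longrightarrow>
    (\<forall>i. \<bar>y $ i\<bar> \<le> R') \<Longrightarrow> \<bar>Q y\<bar> \<le> C * M"
  "\<And>Q :: real ^ 'd::finite \<Rightarrow> real. \<And>M x y \<kappa>. sep_poly s Q \<Longrightarrow> (\<And>g. g \<in> grid s \<Longrightarrow> \<bar>Q g\<bar> \<le> M) \<Longrightarrow>
    (\<forall>i. \<bar>x $ i\<bar> \<le> R' \<and> \<bar>y $ i\<bar> \<le> R' \<and> \<bar>x $ i - y $ i\<bar> \<le> \<kappa>) \<Longrightarrow> \<bar>Q x - Q y\<bar> \<le> C * M * \<kappa>"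
 proof (rule sep_poly_bound[where 'd = 'd, of s R'], goal_cases)
  case (1 C)
  show ?case by (rule that) (fact 1)+
 qed
 \<comment> \<open>Makes the Lipschitz estimate read: the largest grid value changes by at most half
   of itself.\<close>
 define \<kappa> where "\<kappa> = 1 / (2 * C)"
 have \<kappa>: "\<kappa> > 0" "\<kappa> \<le> 1" "C * \<kappa> = 1 / 2" using C(1) by (auto simp: \<kappa>_def field_simps)
 show ?thesis
 proof (rule that[of \<kappa> "2 * C"])
  fix Q :: "real ^ 'd \<Rightarrow> real" and N :: "real ^ 'd \<Rightarrow> real ^ 'd" and y :: "real ^ 'd"
  assume Q: "sep_poly s Q" and N: "\<And>g i. g \<in> grid s \<Longrightarrow> \<bar>N g $ i - g $ i\<bar> \<le> \<kappa>"
   and y: "\<forall>i. \<bar>y $ i\<bar> \<le> R"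
  have "s > 0" using Q unfolding sep_poly_def by (metis less_nat_zero_code neq0_conv)
  then have ne: "(0 :: real ^ 'd) \<in> grid s" by (auto simp: grid_def)
  define M where "M = Max ((\<lambda>g. \<bar>Q g\<bar>) ` grid s)"
  have M: "\<bar>Q g\<bar> \<le> M" if "g \<in> grid s" for g unfolding M_def using finite_grid that by (intro Max_ge) auto
  have "M \<in> (\<lambda>g. \<bar>Q g\<bar>) ` grid s" unfolding M_def using finite_grid ne by (intro Max_in) auto
  then obtain g where g: "g \<in> grid s" "M = \<bar>Q g\<bar>" by auto
  have "\<bar>Q g - Q (N g)\<bar> \<le> C * M * \<kappa>"
  proof (rule C(3)[OF Q M])
   show "\<forall>i. \<bar>g $ i\<bar> \<le> R' \<and> \<bar>N g $ i\<bar> \<le> R' \<and> \<bar>g $ i - N g $ i\<bar> \<le> \<kappa>"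
   proof
    fix i
    have "g $ i \<in> real ` {..<s}" using g by (auto simp: grid_def)
    then have "0 \<le> g $ i" "g $ i \<le> real s" by auto
    then show "\<bar>g $ i\<bar> \<le> R' \<and> \<bar>N g $ i\<bar> \<le> R' \<and> \<bar>g $ i - N g $ i\<bar> \<le> \<kappa>" using N[OF g(1), of i] \<kappa>(2) unfolding R'_def by linarith
   qed
  qed
  also have "C * M * \<kappa> = M / 2" using \<kappa>(3) by (simp add: mult_ac)
  finally have "M \<le> 2 * \<bar>Q (N g)\<bar>" using g(2) by linarith
  also have "\<dots> \<le> 2 * (\<Sum>g\<in>grid s. \<bar>Q (N g)\<bar>)" using member_le_sum[OF g(1) _ finite_grid, of "\<lambda>g. \<bar>Q (N g)\<bar>"] by simp
  finally have M2: "M \<le> 2 * (\<Sum>g\<in>grid s. \<bar>Q (N g)\<bar>)" .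
  have "\<bar>Q y\<bar> \<le> C * M"
  proof (rule C(2)[OF Q M])
   show "\<forall>i. \<bar>y $ i\<bar> \<le> R'"
   proof
    fix i
    have "\<bar>y $ i\<bar> \<le> R" using y by blast
    then show "\<bar>y $ i\<bar> \<le> R'" unfolding R'_def by linarith
   qed
  qed
  also have "\<dots> \<le> C * (2 * (\<Sum>g\<in>grid s. \<bar>Q (N g)\<bar>))" using M2 C(1) by (intro mult_left_mono) auto
  finally show "\<bar>Q y\<bar> \<le> 2 * C * (\<Sum>g\<in>grid s. \<bar>Q (N g)\<bar>)" by simp
 qed (use \<kappa> C(1) in auto)
qed

subsection \<open>Averages over rays and segments\<close>

lemma nn_integral_lborel_affine:
 fixes f :: "'a::euclidean_space \<Rightarrow> ennreal"
 assumes [measurable]: "f \<in> borel_measurable borel" and c: "c \<noteq> 0"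
 shows "(\<integral>\<^sup>+ x. f x \<partial>lborel) = ennreal (\<bar>c\<bar> ^ DIM('a)) * (\<integral>\<^sup>+ x. f (t + c *\<^sub>R x) \<partial>lborel)"
proof -
 have "(\<integral>\<^sup>+ x. f x \<partial>lborel) = (\<integral>\<^sup>+ x. f x \<partial>density (distr lborel borel (\<lambda>x. t + c *\<^sub>R x)) (\<lambda>_. \<bar>c\<bar> ^ DIM('a)))"
  using lborel_affine[OF c, of t] by simp
 also have "\<dots> = (\<integral>\<^sup>+ x. ennreal (\<bar>c\<bar> ^ DIM('a)) * f (t + c *\<^sub>R x) \<partial>lborel)"
  by (subst nn_integral_density) (auto simp: nn_integral_distr)
 finally show ?thesis by (simp add: nn_integral_cmult)
qed

text \<open>Above the threshold, G = G^(1-p) G^p, where the first factor has a nonpositive exponent.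
  The bound is linear in G^p and can be integrated as it stands; optimising \<open>\<mu>\<close>
  afterwards yields what Hoelder's inequality would give.\<close>

lemma young_threshold:
 fixes G \<mu> p :: real
 assumes "p \<ge> 1" "\<mu> > 0" "G \<ge> 0"
 shows "G \<le> \<mu> + \<mu> powr (1 - p) * G powr p"
proof (cases "G \<le> \<mu>")
 case True
 have "0 \<le> \<mu> powr (1 - p) * G powr p" by simp
 then show ?thesis using True by linarith
next
 case False
 then have "G = G powr (1 - p) * G powr p" using assms by (simp add: powr_add[symmetric])
 also have "\<dots> \<le> \<mu> powr (1 - p) * G powr p" using False assms by (intro mult_right_mono powr_mono2') auto
 finally show ?thesis using assms by simp
qed

text \<open>The counterpart for exponents up to 1, taking the place of Jensen's inequality for the
  concave power.\<close>

lemma powr_le_threshold: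
 fixes X \<mu> a :: real
 assumes "0 < a" "a \<le> 1" "\<mu> > 0" "X \<ge> 0"
 shows "X powr a \<le> \<mu> powr a + \<mu> powr (a - 1) * X"
proof (cases "X \<le> \<mu>")
 case True
 then have "X powr a \<le> \<mu> powr a" using assms by (intro powr_mono2) auto
 moreover have "0 \<le> \<mu> powr (a - 1) * X" using assms by simp
 ultimately show ?thesis by linarith
next
 case False
 then have "X powr a = X powr (a - 1) * X" using assms powr_add[of X "a - 1" 1] by simp
 also have "\<dots> \<le> \<mu> powr (a - 1) * X" using False assms by (intro mult_right_mono powr_mono2') auto
 finally show ?thesis by (simp add: add_increasing)
qed

text \<open>Substituting \<open>w = y' + \<sigma> (z - y)\<close> for \<open>z\<close> leaves the weight \<open>1 / \<sigma>\<close>; as \<open>B\<close> has positive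
 distance from \<open>y\<close>, for fixed \<open>w\<close> only \<open>\<sigma>\<close> comparable to \<open>norm (w - y')\<close> contribute.\<close>

lemma nn_integral_rays_le:
 fixes G :: "'a::euclidean_space \<Rightarrow> ennreal" and y y' :: 'a
 assumes [measurable]: "G \<in> borel_measurable borel" "B \<in> sets borel"
  and \<delta>: "0 < \<delta>" and B: "\<And>z. z \<in> B \<Longrightarrow> \<delta> \<le> dist z y \<and> dist z y \<le> D"
 shows "(\<integral>\<^sup>+ \<sigma>. (\<integral>\<^sup>+ z. indicator {0<..1} \<sigma> * indicator B z * ennreal (\<sigma> ^ (DIM('a) - 1)) * G (y' + \<sigma> *\<^sub>R (z - y)) \<partial>lborel) \<partial>lborel)
  \<le> ennreal (D / \<delta>) * (\<integral>\<^sup>+ w. G w * indicator (cball y' D) w \<partial>lborel)"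
proof (cases "B = {}")
 case False
 have [measurable]: "cball y' D \<in> sets borel" by simp
 obtain z where "z \<in> B" using False by auto
 then have D: "D > 0" using B[of z] \<delta> by linarith
 let ?d = "DIM('a)"
 let ?\<xi> = "\<lambda>\<sigma> w. y + (1 / \<sigma>) *\<^sub>R (w - y')"
 have inner: "(\<integral>\<^sup>+ z. indicator {0<..1} \<sigma> * indicator B z * ennreal (\<sigma> ^ (?d - 1)) * G (y' + \<sigma> *\<^sub>R (z - y)) \<partial>lborel)
   = (\<integral>\<^sup>+ w. indicator {0<..1} \<sigma> * ennreal (1 / \<sigma>) * indicator B (?\<xi> \<sigma> w) * G w \<partial>lborel)" for \<sigma> :: real
 proof (cases "0 < \<sigma> \<and> \<sigma> \<le> 1")
  case True
  have "(\<integral>\<^sup>+ z. indicator B z * ennreal (\<sigma> ^ (?d - 1)) * G (y' + \<sigma> *\<^sub>R (z - y)) \<partial>lborel)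
   = ennreal (\<bar>1 / \<sigma>\<bar> ^ ?d) * (\<integral>\<^sup>+ w. indicator B ((y - (1 / \<sigma>) *\<^sub>R y') + (1 / \<sigma>) *\<^sub>R w) * ennreal (\<sigma> ^ (?d - 1)) *
     G (y' + \<sigma> *\<^sub>R (((y - (1 / \<sigma>) *\<^sub>R y') + (1 / \<sigma>) *\<^sub>R w) - y)) \<partial>lborel)" using True by (intro nn_integral_lborel_affine) auto
  also have "\<dots> = ennreal (\<bar>1 / \<sigma>\<bar> ^ ?d) * (\<integral>\<^sup>+ w. ennreal (\<sigma> ^ (?d - 1)) * (indicator B (?\<xi> \<sigma> w) * G w) \<partial>lborel)"
  proof -
   have e1: "(y - (1 / \<sigma>) *\<^sub>R y') + (1 / \<sigma>) *\<^sub>R w = ?\<xi> \<sigma> w" for w by (simp add: algebra_simps)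
   have e2: "y' + \<sigma> *\<^sub>R (?\<xi> \<sigma> w - y) = w" for w using True by simp
   show ?thesis unfolding e1 e2 by (simp add: mult_ac)
  qed
  also have "\<dots> = ennreal (\<bar>1 / \<sigma>\<bar> ^ ?d) * ennreal (\<sigma> ^ (?d - 1)) * (\<integral>\<^sup>+ w. indicator B (?\<xi> \<sigma> w) * G w \<partial>lborel)"
   by (subst nn_integral_cmult) (auto simp: mult.assoc)
  also have "ennreal (\<bar>1 / \<sigma>\<bar> ^ ?d) * ennreal (\<sigma> ^ (?d - 1)) = ennreal (1 / \<sigma>)"
  proof -
   have "?d = Suc (?d - 1)" by simp
   then have "\<bar>1 / \<sigma>\<bar> ^ ?d = (1 / \<sigma>) ^ (?d - 1) * (1 / \<sigma>)" using True by (metis abs_of_pos power_Suc2 zero_less_divide_1_iff)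
   then have "\<bar>1 / \<sigma>\<bar> ^ ?d * \<sigma> ^ (?d - 1) = 1 / \<sigma>" using True by (simp add: power_one_over)
   then show ?thesis using True by (simp add: ennreal_mult[symmetric])
  qed
  also have "\<dots> * (\<integral>\<^sup>+ w. indicator B (?\<xi> \<sigma> w) * G w \<partial>lborel) = (\<integral>\<^sup>+ w. ennreal (1 / \<sigma>) * (indicator B (?\<xi> \<sigma> w) * G w) \<partial>lborel)"
   by (subst nn_integral_cmult) auto
  finally show ?thesis using True by (simp add: mult.assoc)
 qed auto
 have "(\<integral>\<^sup>+ \<sigma>. (\<integral>\<^sup>+ w. indicator {0<..1} \<sigma> * ennreal (1 / \<sigma>) * indicator B (?\<xi> \<sigma> w) * G w \<partial>lborel) \<partial>lborel)
   = (\<integral>\<^sup>+ w. (\<integral>\<^sup>+ \<sigma>. indicator {0<..1} \<sigma> * ennreal (1 / \<sigma>) * indicator B (?\<xi> \<sigma> w) * G w \<partial>lborel) \<partial>lborel)"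
  by (rule lborel_pair.Fubini') measurable
 also have "\<dots> \<le> (\<integral>\<^sup>+ w. ennreal (D / \<delta>) * (G w * indicator (cball y' D) w) \<partial>lborel)"
 proof (rule nn_integral_mono)
  fix w :: 'a
  let ?r = "dist w y'"
  \<comment> \<open>Only \<sigma> between \<open>?r / D\<close> and \<open>?r / \<delta>\<close>
    contribute. There 1/\<sigma> is at most \<open>D / ?r\<close>, on an interval of length at most
    \<open>?r / \<delta>\<close>; the product is \<open>D / \<delta>\<close>, whatever
    \<open>w\<close> is.\<close>
  have b: "indicator {0<..1} \<sigma> * ennreal (1 / \<sigma>) * indicator B (?\<xi> \<sigma> w) * G w
    \<le> ennreal (D / ?r) * indicator {0..?r / \<delta>} \<sigma> * (G w * indicator (cball y' D) w)" for \<sigma> :: real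
  proof (cases "0 < \<sigma> \<and> \<sigma> \<le> 1 \<and> ?\<xi> \<sigma> w \<in> B")
   case True
   have "dist (?\<xi> \<sigma> w) y = ?r / \<sigma>" using True by (simp add: dist_norm)
   then have 1: "\<delta> \<le> ?r / \<sigma>" "?r / \<sigma> \<le> D" using B[of "?\<xi> \<sigma> w"] True by auto
   then have 2: "\<sigma> \<le> ?r / \<delta>" "?r \<le> D * \<sigma>" using True \<delta> by (auto simp: field_simps)
   have r: "?r > 0" using 1(1) True \<delta> by (smt (verit) divide_nonpos_pos)
   have "?r \<le> D" using 2(2) True D by (smt (verit) mult_left_le)
   moreover have "1 / \<sigma> \<le> D / ?r" using 2(2) True r by (simp add: field_simps)
   ultimately show ?thesis using True 2(1) by (auto simp: dist_commute intro!: mult_right_mono ennreal_leI)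
  qed (auto simp: indicator_def)
  have "(\<integral>\<^sup>+ \<sigma>. indicator {0<..1} \<sigma> * ennreal (1 / \<sigma>) * indicator B (?\<xi> \<sigma> w) * G w \<partial>lborel)
    \<le> (\<integral>\<^sup>+ \<sigma>. ennreal (D / ?r) * indicator {0..?r / \<delta>} \<sigma> * (G w * indicator (cball y' D) w) \<partial>lborel)"
   by (intro nn_integral_mono b)
  also have "\<dots> = ennreal (D / ?r) * ennreal (?r / \<delta>) * (G w * indicator (cball y' D) w)"
   using \<delta> by (simp add: nn_integral_multc nn_integral_cmult_indicator)
  also have "\<dots> \<le> ennreal (D / \<delta>) * (G w * indicator (cball y' D) w)"
   using D \<delta> by (intro mult_right_mono) (auto simp: ennreal_mult[symmetric])
  finally show "(\<integral>\<^sup>+ \<sigma>. indicator {0<..1} \<sigma> * ennreal (1 / \<sigma>) * indicator B (?\<xi> \<sigma> w) * G w \<partial>lborel)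
    \<le> ennreal (D / \<delta>) * (G w * indicator (cball y' D) w)" .
 qed
 also have "\<dots> = ennreal (D / \<delta>) * (\<integral>\<^sup>+ w. G w * indicator (cball y' D) w \<partial>lborel)" by (rule nn_integral_cmult) measurable
 finally show ?thesis unfolding inner .
qed simp

text \<open>The integral of \<sigma>^(s - 1 - d/p) over (0,1]. In the borderline case p = 1, s = d
  the estimate has no such term, hence the value 0.\<close>

definition embed_const :: "nat \<Rightarrow> real \<Rightarrow> nat \<Rightarrow> real" where
 "embed_const d p s = (if real d / p < real s then 1 / (real s - real d / p) else 0)"

lemma nn_integral_powr_0_1:
 assumes "a > -1"
 shows "(\<integral>\<^sup>+ \<sigma>. indicator {0<..1} \<sigma> * ennreal (\<sigma> powr a) \<partial>lborel) = ennreal (1 / (a + 1))"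
proof -
 have "((\<lambda>x. x powr a) has_integral (1 powr (a + 1) / (a + 1))) {0..1}" by (rule has_integral_powr_from_0) (use assms in auto)
 then have "((\<lambda>x. if x \<in> {0..1} then x powr a else 0) has_integral (1 / (a + 1))) UNIV" by (subst has_integral_restrict_UNIV) simp
 then have "(\<integral>\<^sup>+ x. ennreal (if x \<in> {0..1} then x powr a else 0) \<partial>lborel) = ennreal (1 / (a + 1))"
  by (rule nn_integral_has_integral_lborel[rotated 2]) auto
 moreover have "(\<integral>\<^sup>+ \<sigma>. indicator {0<..1} \<sigma> * ennreal (\<sigma> powr a) \<partial>lborel) =
   (\<integral>\<^sup>+ x. ennreal (if x \<in> {0..1} then x powr a else 0) \<partial>lborel)" by (intro nn_integral_cong) (auto simp: indicator_def)
 ultimately show ?thesis by simp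
qed

text \<open>Reduces the weight \<sigma>^(s-1) of the Taylor remainder to the weight \<sigma>^(d-1)
  of \<open>nn_integral_rays_le\<close>. The segments start at \<open>y'\<close> instead of
  \<open>y\<close> because mollification shifts them.\<close>

lemma nn_integral_segments_le:
 fixes G :: "'a::euclidean_space \<Rightarrow> real" and y y' :: 'a
 assumes G[measurable]: "G \<in> borel_measurable borel" and B_sets[measurable]: "B \<in> sets borel" and G0: "\<And>x. G x \<ge> 0"
  and \<delta>: "0 < \<delta>" and B: "\<And>z. z \<in> B \<Longrightarrow> \<delta> \<le> dist z y \<and> dist z y \<le> D"
  and p: "p \<ge> 1" and s: "s > 0" "real DIM('a) / p < real s \<or> (p = 1 \<and> s = DIM('a))" and \<Lambda>: "\<Lambda> > 0"
 shows "(\<integral>\<^sup>+ \<sigma>. (\<integral>\<^sup>+ z. indicator {0<..1} \<sigma> * indicator B z * ennreal (\<sigma> ^ (s - 1) * G (y' + \<sigma> *\<^sub>R (z - y))) \<partial>lborel) \<partial>lborel)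
  \<le> ennreal (embed_const DIM('a) p s * \<Lambda>) * emeasure lborel B +
   ennreal (D / \<delta> * \<Lambda> powr (1 - p)) * (\<integral>\<^sup>+ w. ennreal (G w powr p) * indicator (cball y' D) w \<partial>lborel)"
  (is "?L \<le> ?R")
proof -
 let ?d = "DIM('a)" and ?b = "real DIM('a) / p"
 let ?Gp = "\<lambda>w. ennreal (\<Lambda> powr (1 - p)) * ennreal (G w powr p)"
 have [measurable]: "cball y' D \<in> sets borel" by simp
 define A where "A \<sigma> = (if ?b < real s then ennreal (\<Lambda> * \<sigma> powr (real s - 1 - ?b)) else 0)" for \<sigma> :: real
 have [measurable]: "A \<in> borel_measurable borel" unfolding A_def[abs_def] by measurable
 have pw: "ennreal (\<sigma> ^ (s - 1) * g) \<le> A \<sigma> + ennreal (\<sigma> ^ (?d - 1)) * (ennreal (\<Lambda> powr (1 - p)) * ennreal (g powr p))"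
  if \<sigma>: "0 < \<sigma>" "\<sigma> \<le> 1" and g: "g \<ge> 0" for \<sigma> g :: real
 proof (cases "?b < real s")
  case True
  \<comment> \<open>Young's inequality with a threshold that depends on \<sigma>. The first term
    becomes \<Lambda> \<sigma>^(s-1-d/p), which is integrable because s > d/p; in the second the
    power of \<sigma> is s - 1 - d/p + d, which is at least d - 1.\<close>
  define \<mu> where "\<mu> = \<Lambda> * \<sigma> powr (- ?b)"
  have \<mu>: "\<mu> > 0" unfolding \<mu>_def using \<Lambda> \<sigma> by simp
  have sp: "\<sigma> ^ (s - 1) = \<sigma> powr (real s - 1)" using \<sigma> s by (simp add: powr_realpow[symmetric] of_nat_diff)
  have dp: "\<sigma> ^ (?d - 1) = \<sigma> powr (real ?d - 1)" using \<sigma> by (simp add: powr_realpow[symmetric] of_nat_diff Suc_leI)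
  have "\<sigma> ^ (s - 1) * g \<le> \<sigma> ^ (s - 1) * (\<mu> + \<mu> powr (1 - p) * g powr p)"
   using \<sigma> by (intro mult_left_mono young_threshold p \<mu> g) auto
  also have "\<dots> = \<Lambda> * \<sigma> powr (real s - 1 - ?b) + \<sigma> powr (real s - 1 - ?b * (1 - p)) * (\<Lambda> powr (1 - p) * g powr p)"
  proof -
   have "\<mu> powr (1 - p) = \<Lambda> powr (1 - p) * \<sigma> powr (- ?b * (1 - p))" unfolding \<mu>_def using \<Lambda> \<sigma> by (simp add: powr_mult powr_powr)
   moreover have "\<sigma> powr (real s - 1) * \<sigma> powr (- ?b * (1 - p)) = \<sigma> powr (real s - 1 - ?b * (1 - p))"
    by (simp add: powr_add[symmetric])
   moreover have "\<sigma> powr (real s - 1) * \<sigma> powr (- ?b) = \<sigma> powr (real s - 1 - ?b)" by (simp add: powr_add[symmetric])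
   ultimately show ?thesis unfolding sp \<mu>_def by (simp add: distrib_left mult_ac)
  qed
  also have "\<dots> \<le> \<Lambda> * \<sigma> powr (real s - 1 - ?b) + \<sigma> ^ (?d - 1) * (\<Lambda> powr (1 - p) * g powr p)"
  proof -
   have "?b * (1 - p) = ?b - real ?d" using p by (simp add: field_simps)
   then have "real ?d - 1 \<le> real s - 1 - ?b * (1 - p)" using True by linarith
   then have "\<sigma> powr (real s - 1 - ?b * (1 - p)) \<le> \<sigma> ^ (?d - 1)" unfolding dp using \<sigma> by (intro powr_mono') auto
   then show ?thesis by (intro add_left_mono mult_right_mono) auto
  qed
  finally show ?thesis
   using True \<sigma> \<Lambda> by (simp add: A_def ennreal_mult[symmetric] ennreal_plus[symmetric] ennreal_leI del: ennreal_plus)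
 next
  case False
  then have "p = 1" "s = ?d" using s by auto
  then show ?thesis using False \<sigma> g \<Lambda> by (simp add: A_def ennreal_mult)
 qed
 have "?L \<le> (\<integral>\<^sup>+ \<sigma>. (\<integral>\<^sup>+ z. indicator {0<..1} \<sigma> * A \<sigma> * indicator B z +
   indicator {0<..1} \<sigma> * indicator B z * ennreal (\<sigma> ^ (?d - 1)) * ?Gp (y' + \<sigma> *\<^sub>R (z - y)) \<partial>lborel) \<partial>lborel)"
  using pw[OF _ _ G0] by (intro nn_integral_mono) (auto simp: indicator_def mult.assoc)
 also have "\<dots> = (\<integral>\<^sup>+ \<sigma>. (\<integral>\<^sup>+ z. indicator {0<..1} \<sigma> * A \<sigma> * indicator B z \<partial>lborel) \<partial>lborel) +
   (\<integral>\<^sup>+ \<sigma>. (\<integral>\<^sup>+ z. indicator {0<..1} \<sigma> * indicator B z * ennreal (\<sigma> ^ (?d - 1)) * ?Gp (y' + \<sigma> *\<^sub>R (z - y)) \<partial>lborel) \<partial>lborel)"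
  by (subst nn_integral_add[symmetric]) (auto intro!: nn_integral_cong nn_integral_add)
 also have "\<dots> \<le> ?R"
 proof (rule add_mono)
  have "(\<integral>\<^sup>+ \<sigma>. (\<integral>\<^sup>+ z. indicator {0<..1} \<sigma> * A \<sigma> * indicator B z \<partial>lborel) \<partial>lborel) =
    (\<integral>\<^sup>+ \<sigma>. indicator {0<..1} \<sigma> * A \<sigma> \<partial>lborel) * emeasure lborel B" by (simp add: nn_integral_cmult nn_integral_multc)
  also have "(\<integral>\<^sup>+ \<sigma>. indicator {0<..1} \<sigma> * A \<sigma> \<partial>lborel) = ennreal (embed_const ?d p s * \<Lambda>)"
  proof (cases "?b < real s")
   case True
   have "(\<integral>\<^sup>+ \<sigma>. indicator {0<..1} \<sigma> * A \<sigma> \<partial>lborel) =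
     (\<integral>\<^sup>+ \<sigma>. ennreal \<Lambda> * (indicator {0<..1} \<sigma> * ennreal (\<sigma> powr (real s - 1 - ?b))) \<partial>lborel)"
    using True \<Lambda> by (intro nn_integral_cong) (simp add: A_def ennreal_mult mult_ac)
   also have "\<dots> = ennreal \<Lambda> * ennreal (1 / (real s - 1 - ?b + 1))"
    using True by (subst nn_integral_cmult) (auto simp: nn_integral_powr_0_1)
   finally show ?thesis using True \<Lambda> by (simp add: embed_const_def ennreal_mult[symmetric])
  next
   case False
   then show ?thesis by (simp add: A_def embed_const_def)
  qed
  finally show "(\<integral>\<^sup>+ \<sigma>. (\<integral>\<^sup>+ z. indicator {0<..1} \<sigma> * A \<sigma> * indicator B z \<partial>lborel) \<partial>lborel) \<le>
    ennreal (embed_const ?d p s * \<Lambda>) * emeasure lborel B" by simp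
  have "(\<integral>\<^sup>+ \<sigma>. (\<integral>\<^sup>+ z. indicator {0<..1} \<sigma> * indicator B z * ennreal (\<sigma> ^ (?d - 1)) * ?Gp (y' + \<sigma> *\<^sub>R (z - y)) \<partial>lborel) \<partial>lborel)
   \<le> ennreal (D / \<delta>) * (\<integral>\<^sup>+ w. ?Gp w * indicator (cball y' D) w \<partial>lborel)" by (rule nn_integral_rays_le) (use \<delta> B in auto)
  also have "\<dots> = ennreal (D / \<delta> * \<Lambda> powr (1 - p)) * (\<integral>\<^sup>+ w. ennreal (G w powr p) * indicator (cball y' D) w \<partial>lborel)"
  proof -
   have "ennreal (D / \<delta> * \<Lambda> powr (1 - p)) = ennreal (D / \<delta>) * ennreal (\<Lambda> powr (1 - p))" by (rule ennreal_mult'') simp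
   then show ?thesis by (simp add: mult.assoc nn_integral_cmult)
  qed
  finally show "(\<integral>\<^sup>+ \<sigma>. (\<integral>\<^sup>+ z. indicator {0<..1} \<sigma> * indicator B z * ennreal (\<sigma> ^ (?d - 1)) * ?Gp (y' + \<sigma> *\<^sub>R (z - y)) \<partial>lborel) \<partial>lborel)
   \<le> ennreal (D / \<delta> * \<Lambda> powr (1 - p)) * (\<integral>\<^sup>+ w. ennreal (G w powr p) * indicator (cball y' D) w \<partial>lborel)" .
 qed
 finally show ?thesis .
qed

subsection \<open>Taylor formula along segments\<close>

text \<open>If \<open>G \<alpha>\<close> is the \<alpha>-th derivative of a function at some point,
  this is the k-th directional derivative along \<open>v\<close> of its m-th derivative. The
  recursion avoids multinomial coefficients and makes sense for any family \<open>G\<close>, in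
  particular for mollified weak derivatives.\<close>

primrec tay :: "nat \<Rightarrow> real ^ 'd::finite \<Rightarrow> (('d \<Rightarrow> nat) \<Rightarrow> real) \<Rightarrow> ('d \<Rightarrow> nat) \<Rightarrow> real" where
 "tay 0 v G m = G m"
| "tay (Suc k) v G m = (\<Sum>i\<in>UNIV. v $ i * tay k v G (m(i := Suc (m i))))"

lemma sum_upd_Suc: "(\<Sum>j\<in>UNIV. (m(i := Suc (m i))) j) = Suc (\<Sum>j\<in>UNIV. m (j::'d::finite))"
proof -
 have "(\<Sum>j\<in>UNIV. (m(i := Suc (m i))) j) = Suc (m i) + (\<Sum>j\<in>UNIV - {i}. m j)" by (subst sum.remove[of _ i]) auto
 then show ?thesis by (simp add: sum.remove[of UNIV i m])
qed

lemma tay_has_derivative: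
 fixes b :: "'d::finite \<Rightarrow> nat \<Rightarrow> real \<Rightarrow> real"
 assumes b: "\<forall>i. dseq (b i)"
 shows "((\<lambda>t. tay k v (\<lambda>\<alpha>. prodf b \<alpha> (e + t *\<^sub>R v)) m) has_real_derivative
   tay (Suc k) v (\<lambda>\<alpha>. prodf b \<alpha> (e + t *\<^sub>R v)) m) (at t)"
proof (induction k arbitrary: m)
 case 0
 show ?case using has_derivative_along_axis[where x = e and t = t and v = v, OF prodf_has_derivative[OF b, of m]] by simp
next
 case (Suc k)
 show ?case unfolding tay.simps(2)[of "Suc k"] unfolding tay.simps(2)[of k v _ m] by (intro DERIV_sum DERIV_cmult Suc)
qed

lemma tay_scale: "tay k (c *\<^sub>R v) G m = c ^ k * tay k v G m" by (induction k arbitrary: m) (auto simp: sum_distrib_left mult_ac)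

lemma tay_cmult: "tay k v (\<lambda>\<alpha>. c * G \<alpha>) m = c * tay k v G m" by (induction k arbitrary: m) (auto simp: sum_distrib_left mult_ac)

lemma tay_cong:
 "(\<And>\<alpha>. (\<Sum>i\<in>UNIV. \<alpha> i) = (\<Sum>i\<in>UNIV. m i) + k \<Longrightarrow> G \<alpha> = G' \<alpha>) \<Longrightarrow> tay k v G m = tay k v G' m"
proof (induction k arbitrary: m)
 case (Suc k)
 have "tay k v G (m(i := Suc (m i))) = tay k v G' (m(i := Suc (m i)))" for i
  using Suc.prems by (intro Suc.IH) (simp only: sum_upd_Suc add_Suc add_Suc_right)
 then show ?case by simp
qed simp

text \<open>Lets the factors \<epsilon>^|\<alpha>| from differentiating the rescaled bump cancel
  against the direction \<open>(1 / \<epsilon>) *\<^sub>R (y - z)\<close>.\<close>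

lemma tay_weight:
 "tay k v (\<lambda>\<alpha>. r ^ (\<Sum>i\<in>UNIV. \<alpha> i) * G \<alpha>) (\<lambda>_. 0) = r ^ k * tay k v G (\<lambda>_. 0)"
proof -
 have "tay k v (\<lambda>\<alpha>. r ^ (\<Sum>i\<in>UNIV. \<alpha> i) * G \<alpha>) (\<lambda>_. 0) = tay k v (\<lambda>\<alpha>. r ^ k * G \<alpha>) (\<lambda>_. 0)" by (rule tay_cong) simp
 then show ?thesis by (simp add: tay_cmult)
qed

lemma finite_multi_index_eq: "finite {\<alpha> :: 'd::finite \<Rightarrow> nat. (\<Sum>i\<in>UNIV. \<alpha> i) = k}"
proof (rule finite_subset)
 show "{\<alpha> :: 'd \<Rightarrow> nat. (\<Sum>i\<in>UNIV. \<alpha> i) = k} \<subseteq> (UNIV \<rightarrow>\<^sub>E {..k})" by (auto simp: PiE_def extensional_def intro: member_le_sum)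
qed (intro finite_PiE, auto)

lemma finite_multi_indices: "finite (multi_indices k :: ('d::finite \<Rightarrow> nat) set)"
proof -
 have "multi_indices k = (\<Union>j\<le>k. {\<alpha> :: 'd \<Rightarrow> nat. (\<Sum>i\<in>UNIV. \<alpha> i) = j})" by (auto simp: multi_indices_def)
 then show ?thesis by (simp add: finite_multi_index_eq)
qed

lemma tay_bound:
 fixes v :: "real ^ 'd::finite"
 shows "\<bar>tay k v G m\<bar> \<le> (real CARD('d) * norm v) ^ k * (\<Sum>\<alpha>\<in>{\<alpha>. (\<Sum>i\<in>UNIV. \<alpha> i) = (\<Sum>i\<in>UNIV. m i) + k}. \<bar>G \<alpha>\<bar>)"
proof (induction k arbitrary: m)
 case 0
 then show ?case using member_le_sum[of m "{\<alpha>. (\<Sum>i\<in>UNIV. \<alpha> i) = (\<Sum>i\<in>UNIV. m i)}" "\<lambda>\<alpha>. \<bar>G \<alpha>\<bar>"] finite_multi_index_eq by auto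
next
 case (Suc k)
 let ?S = "\<Sum>\<alpha>\<in>{\<alpha>. (\<Sum>i\<in>UNIV. \<alpha> i) = (\<Sum>i\<in>UNIV. m i) + Suc k}. \<bar>G \<alpha>\<bar>"
 have "\<bar>tay k v G (m(i := Suc (m i)))\<bar> \<le> (real CARD('d) * norm v) ^ k * ?S" for i
  using Suc.IH[of "m(i := Suc (m i))"] by (simp only: sum_upd_Suc add_Suc add_Suc_right)
 then have "\<bar>tay (Suc k) v G m\<bar> \<le> (\<Sum>i\<in>(UNIV::'d set). norm v * ((real CARD('d) * norm v) ^ k * ?S))" unfolding tay.simps
  by (intro order_trans[OF sum_abs] sum_mono) (auto simp: abs_mult intro!: mult_mono component_le_norm_cart)
 then show ?case by (simp add: mult_ac)
qed

lemma tay_integral: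
 assumes "\<And>\<alpha>. integrable M (F \<alpha>)"
 shows "integrable M (\<lambda>x. tay k v (\<lambda>\<alpha>. F \<alpha> x) m)"
  and "tay k v (\<lambda>\<alpha>. integral\<^sup>L M (F \<alpha>)) m = (LINT x|M. tay k v (\<lambda>\<alpha>. F \<alpha> x) m)"
proof -
 have "integrable M (\<lambda>x. tay k v (\<lambda>\<alpha>. F \<alpha> x) m) \<and>
   tay k v (\<lambda>\<alpha>. integral\<^sup>L M (F \<alpha>)) m = (LINT x|M. tay k v (\<lambda>\<alpha>. F \<alpha> x) m)" by (induction k arbitrary: m) (use assms in auto)
 then show "integrable M (\<lambda>x. tay k v (\<lambda>\<alpha>. F \<alpha> x) m)"
  "tay k v (\<lambda>\<alpha>. integral\<^sup>L M (F \<alpha>)) m = (LINT x|M. tay k v (\<lambda>\<alpha>. F \<alpha> x) m)" by auto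
qed

lemma borel_measurable_tay:
 assumes "\<And>\<alpha>. (\<lambda>x. G x \<alpha>) \<in> borel_measurable M" "\<And>i. (\<lambda>x. v x $ i) \<in> borel_measurable M"
 shows "(\<lambda>x. tay k (v x) (G x) m) \<in> borel_measurable M"
 by (induction k arbitrary: m) (auto intro!: assms borel_measurable_sum borel_measurable_times)

lemma taylor_prodf:
 fixes b :: "'d::finite \<Rightarrow> nat \<Rightarrow> real \<Rightarrow> real"
 assumes b: "\<forall>i. dseq (b i)" and s: "s > 0"
 shows "prodf b m (e + v) = (\<Sum>k<s. tay k v (\<lambda>\<alpha>. prodf b \<alpha> e) m / fact k) +
   (LINT t|lborel. indicator {0..1} t * ((1 - t) ^ (s - 1) / fact (s - 1) * tay s v (\<lambda>\<alpha>. prodf b \<alpha> (e + t *\<^sub>R v)) m))"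
proof -
 let ?D = "\<lambda>k t. tay k v (\<lambda>\<alpha>. prodf b \<alpha> (e + t *\<^sub>R v)) m"
 let ?i = "\<lambda>x. ((1 - x) ^ (s - 1) / fact (s - 1)) *\<^sub>R ?D s x"
 have "?D 0 1 = (\<Sum>i<s. ((1 - 0) ^ i / fact i) *\<^sub>R ?D i 0) + integral {0..1} ?i" by (rule Taylor_integral[OF s])
    (auto intro!: DERIV_subset[OF tay_has_derivative[OF b], unfolded has_real_derivative_iff_has_vector_derivative]
     simp del: tay.simps(2))
 moreover have "integral {0..1} ?i = (LINT t:{0..1}|lborel. ?i t)"
 proof (rule set_borel_integral_eq_integral(2)[symmetric], rule borel_integrable_atLeastAtMost')
  have "continuous_on {0..1} (\<lambda>t. ?D s t)"
   by (intro continuous_at_imp_continuous_on ballI DERIV_isCont[OF tay_has_derivative[OF b]])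
  then show "continuous_on {0..1} ?i" by (intro continuous_intros) auto
 qed
 ultimately have "prodf b m (e + v) = (\<Sum>k<s. tay k v (\<lambda>\<alpha>. prodf b \<alpha> e) m / fact k) + (LINT t:{0..1}|lborel. ?i t)"
  by (simp only:) (simp add: divide_inverse mult_ac)
 also have "(LINT t:{0..1}|lborel. ?i t) = (LINT t|lborel. indicator {0..1} t * ((1 - t) ^ (s - 1) / fact (s - 1) * ?D s t))"
  unfolding set_lebesgue_integral_def by (intro Bochner_Integration.integral_cong refl) simp
 finally show ?thesis .
qed

section \<open>The standard bump as a mollifier\<close>

abbreviation std_bump :: "'d \<Rightarrow> nat \<Rightarrow> real \<Rightarrow> real" where
 "std_bump \<equiv> \<lambda>_. bump 1 (-1) 1"

lemma prodf_std_bump_eq_0: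
 assumes "prodf std_bump \<alpha> x \<noteq> 0"
 shows "\<bar>x $ i\<bar> < 1"
proof (rule ccontr)
 assume "\<not> \<bar>x $ i\<bar> < 1"
 then have "bump 1 (-1) 1 (\<alpha> i) (x $ i) = 0" by (intro bump_eq_0) auto
 then have "prodf std_bump \<alpha> x = 0" unfolding prodf_def by (intro prod_zero) auto
 then show False using assms by simp
qed

lemma continuous_prodf_std_bump: "continuous_on A (prodf std_bump \<alpha>)" by (intro prodf_continuous allI dseq_bump)

lemma borel_measurable_prodf_std_bump [measurable]: "prodf std_bump \<alpha> \<in> borel_measurable borel"
 by (intro borel_measurable_continuous_onI continuous_prodf_std_bump)

lemma prodf_std_bump_nonneg: "prodf std_bump (\<lambda>_. 0) x \<ge> 0" unfolding prodf_def by (intro prod_nonneg) (auto simp: bump_0_bounds)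

lemma prodf_std_bump_le_1: "prodf std_bump (\<lambda>_. 0) x \<le> 1" unfolding prodf_def by (intro prod_le_1) (auto simp: bump_0_bounds)

lemma prodf_std_bump_zero_outside:
 assumes "x \<notin> cbox (\<chi> i. -1) (\<chi> i. 1)"
 shows "prodf std_bump \<alpha> x = 0"
proof (rule ccontr)
 assume "prodf std_bump \<alpha> x \<noteq> 0"
 then have "\<bar>x $ i\<bar> < 1" for i by (rule prodf_std_bump_eq_0)
 then have "x \<in> cbox (\<chi> i. -1) (\<chi> i. 1)" by (simp add: mem_box_cart abs_less_iff less_imp_le)
 then show False using assms by simp
qed

lemma prodf_std_bump_bounded:
 obtains B where "B > 0" "\<And>x. \<bar>prodf std_bump \<alpha> x\<bar> \<le> B"
proof -
 let ?K = "cbox (\<chi> i. -1) (\<chi> i. 1) :: (real ^ 'a) set"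
 have "bounded (prodf std_bump \<alpha> ` ?K)" by (intro compact_imp_bounded compact_continuous_image continuous_prodf_std_bump) auto
 then obtain B where B: "B > 0" "\<And>x. x \<in> ?K \<Longrightarrow> \<bar>prodf std_bump \<alpha> x\<bar> \<le> B" unfolding bounded_pos by auto
 have "\<bar>prodf std_bump \<alpha> x\<bar> \<le> B" for x using B prodf_std_bump_zero_outside[of x \<alpha>] by (cases "x \<in> ?K") auto
 then show ?thesis using that B(1) by blast
qed

lemma integrable_bounded_times_indicator:
 fixes f :: "'a::euclidean_space \<Rightarrow> real"
 assumes [measurable]: "f \<in> borel_measurable borel" and "\<And>x. \<bar>f x\<bar> \<le> M" "bounded K" "\<And>x. x \<notin> K \<Longrightarrow> f x = 0"
 shows "integrable lborel f"
proof -
 obtain r where "\<forall>x\<in>K. norm x \<le> r" using assms(3) unfolding bounded_pos by blast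
 then have r: "K \<subseteq> cball 0 r" by auto
 have "integrable lborel (\<lambda>x. indicator (cball 0 r) x *\<^sub>R f x)"
 proof (rule integrableI_bounded_set_indicator[where B = M])
  show "emeasure lborel (cball (0::'a) r) < \<infinity>" using emeasure_lborel_cball_finite[of "0::'a" r] by simp
 qed (use assms(2) in auto)
 also have "(\<lambda>x. indicator (cball 0 r) x *\<^sub>R f x) = f" using assms(4) r by (force simp: indicator_def)
 finally show ?thesis .
qed

text \<open>Taylor's formula is applied to the kernel, not to \<open>f\<close>, which is merely
  bounded and measurable; integrating against \<open>f\<close> and Fubini's theorem do the
  rest.\<close>

lemma mollified_taylor:
 fixes f :: "real ^ 'd::finite \<Rightarrow> real" and y z :: "real ^ 'd" and \<epsilon> :: real
 assumes f[measurable]: "f \<in> borel_measurable borel" and f_bd: "\<And>x. \<bar>f x\<bar> \<le> M"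
  and K: "bounded K" "\<And>x. x \<notin> K \<Longrightarrow> f x = 0" and s: "s > 0"
 defines "F \<alpha> p \<equiv> LINT w|lborel. f w * prodf std_bump \<alpha> ((1 / \<epsilon>) *\<^sub>R (p - w))"
 shows "F (\<lambda>_. 0) y = (\<Sum>k<s. tay k ((1 / \<epsilon>) *\<^sub>R (y - z)) (\<lambda>\<alpha>. F \<alpha> z) (\<lambda>_. 0) / fact k) +
   (LINT t|lborel. indicator {0..1} t * ((1 - t) ^ (s - 1) / fact (s - 1) *
    tay s ((1 / \<epsilon>) *\<^sub>R (y - z)) (\<lambda>\<alpha>. F \<alpha> (z + t *\<^sub>R (y - z))) (\<lambda>_. 0)))"
proof -
 let ?H = "\<lambda>\<alpha> p w. prodf std_bump \<alpha> ((1 / \<epsilon>) *\<^sub>R (p - w))" and ?v = "(1 / \<epsilon>) *\<^sub>R (y - z)"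
 let ?p = "\<lambda>t. z + t *\<^sub>R (y - z)" and ?zz = "\<lambda>_. 0 :: nat"
 let ?c = "\<lambda>t. (1 - t) ^ (s - 1) / fact (s - 1) :: real"
 have M: "M \<ge> 0" using f_bd[of 0] abs_ge_zero order_trans by blast
 have "\<exists>B>0. \<forall>x :: real ^ 'd. \<bar>prodf std_bump \<alpha> x\<bar> \<le> B" for \<alpha> using prodf_std_bump_bounded[of \<alpha>] by metis
 then obtain B where B: "\<And>\<alpha>. B \<alpha> > 0" "\<And>\<alpha> x. \<bar>prodf std_bump \<alpha> (x :: real ^ 'd)\<bar> \<le> B \<alpha>" by metis
 have int: "integrable lborel (\<lambda>w. f w * ?H \<alpha> p w)" for \<alpha> p
 proof (rule integrable_bounded_times_indicator[OF _ _ K(1)])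
  show "\<bar>f w * ?H \<alpha> p w\<bar> \<le> M * B \<alpha>" for w unfolding abs_mult using f_bd B M by (intro mult_mono) auto
 qed (use K(2) in auto)
 have tayF: "tay k v (\<lambda>\<alpha>. F \<alpha> p) m = (LINT w|lborel. f w * tay k v (\<lambda>\<alpha>. ?H \<alpha> p w) m)"
  and tay_int: "integrable lborel (\<lambda>w. f w * tay k v (\<lambda>\<alpha>. ?H \<alpha> p w) m)" for k v p m
  using tay_integral[of lborel "\<lambda>\<alpha> w. f w * ?H \<alpha> p w", OF int] unfolding F_def by (simp_all add: tay_cmult)
 have bd: "\<bar>tay s ?v (\<lambda>\<alpha>. ?H \<alpha> p w) ?zz\<bar> \<le> (real CARD('d) * norm ?v) ^ s * (\<Sum>\<alpha>\<in>{\<alpha>. (\<Sum>i\<in>UNIV. \<alpha> i) = s}. B \<alpha>)" for p w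
 proof -
  have "\<bar>tay s ?v (\<lambda>\<alpha>. ?H \<alpha> p w) ?zz\<bar> \<le> (real CARD('d) * norm ?v) ^ s * (\<Sum>\<alpha>\<in>{\<alpha>. (\<Sum>i\<in>UNIV. \<alpha> i) = s}. \<bar>?H \<alpha> p w\<bar>)"
   using tay_bound[of s ?v "\<lambda>\<alpha>. ?H \<alpha> p w" ?zz] by simp
  also have "\<dots> \<le> (real CARD('d) * norm ?v) ^ s * (\<Sum>\<alpha>\<in>{\<alpha>. (\<Sum>i\<in>UNIV. \<alpha> i) = s}. B \<alpha>)"
   using B by (intro mult_left_mono sum_mono) auto
  finally show ?thesis .
 qed
 define U where "U = (real CARD('d) * norm ?v) ^ s * (\<Sum>\<alpha>\<in>{\<alpha> :: 'd \<Rightarrow> nat. (\<Sum>i\<in>UNIV. \<alpha> i) = s}. B \<alpha>)"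
 define \<Phi> where "\<Phi> t w = indicator {0..1} t * (?c t * (f w * tay s ?v (\<lambda>\<alpha>. ?H \<alpha> (?p t) w) ?zz))" for t w
 have \<Phi>_meas: "case_prod \<Phi> \<in> borel_measurable (lborel \<Otimes>\<^sub>M lborel)"
 proof -
  have "(\<lambda>x. tay s ?v (\<lambda>\<alpha>. ?H \<alpha> (?p (fst x)) (snd x)) ?zz) \<in> borel_measurable (lborel \<Otimes>\<^sub>M lborel)"
   by (rule borel_measurable_tay) measurable
  then show ?thesis unfolding \<Phi>_def case_prod_beta' by measurable
 qed
 have \<Phi>_int: "integrable (lborel \<Otimes>\<^sub>M lborel) (case_prod \<Phi>)"
 proof -
  obtain r where "\<forall>x\<in>K. norm x \<le> r" using K(1) unfolding bounded_pos by blast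
  then have r: "K \<subseteq> cball 0 r" by auto
  let ?A = "{0..1::real} \<times> cball (0 :: real ^ 'd) r"
  have fin: "emeasure (lborel \<Otimes>\<^sub>M lborel) ?A < \<infinity>" using emeasure_lborel_cball_finite[of "0 :: real ^ 'd" r]
   by (subst lborel.emeasure_pair_measure_Times) auto
  have "integrable (lborel \<Otimes>\<^sub>M lborel) (\<lambda>x. indicator ?A x *\<^sub>R case_prod \<Phi> x)"
  proof (rule integrableI_bounded_set_indicator[where B = "1 * (M * U)"])
   show "AE x in lborel \<Otimes>\<^sub>M lborel. x \<in> ?A \<longrightarrow> norm (case_prod \<Phi> x) \<le> 1 * (M * U)"
   proof (intro AE_I2 impI)
    fix x :: "real \<times> (real ^ 'd)" assume "x \<in> ?A"
    then obtain t w where x: "x = (t, w)" "0 \<le> t" "t \<le> 1" by auto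
    have c: "\<bar>?c t\<bar> \<le> 1"
    proof -
     have "(1 - t) ^ (s - 1) \<le> 1" using x by (intro power_le_one) auto
     also have "1 \<le> (fact (s - 1) :: real)" by (rule fact_ge_1)
     finally show ?thesis using x by simp
    qed
    have "\<bar>?c t * (f w * tay s ?v (\<lambda>\<alpha>. ?H \<alpha> (?p t) w) ?zz)\<bar> \<le> 1 * (M * U)"
     unfolding abs_mult U_def using c f_bd bd M by (intro mult_mono) auto
    then show "norm (case_prod \<Phi> x) \<le> 1 * (M * U)" using x by (simp add: \<Phi>_def)
   qed
  qed (use fin \<Phi>_meas in auto)
  also have "(\<lambda>x. indicator ?A x *\<^sub>R case_prod \<Phi> x) = case_prod \<Phi>"
  proof
   fix x :: "real \<times> (real ^ 'd)"
   have "f (snd x) = 0" if "snd x \<notin> cball 0 r" using r K(2)[of "snd x"] that by blast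
   then show "indicator ?A x *\<^sub>R case_prod \<Phi> x = case_prod \<Phi> x"
    by (cases x; cases "snd x \<in> cball 0 r") (auto simp: \<Phi>_def indicator_def)
  qed
  finally show ?thesis .
 qed
 have eq: "f w * ?H ?zz y w = (\<Sum>k<s. f w * tay k ?v (\<lambda>\<alpha>. ?H \<alpha> z w) ?zz / fact k) + (LINT t|lborel. \<Phi> t w)" for w
 proof -
  \<comment> \<open>In the argument of the kernel the segment from \<open>z\<close> to
    \<open>y\<close> becomes a segment with direction \<open>?v\<close>.\<close>
  have e: "(1 / \<epsilon>) *\<^sub>R (y - w) = (1 / \<epsilon>) *\<^sub>R (z - w) + ?v"  by (simp add: scaleR_right_distrib[symmetric])
  have e': "(1 / \<epsilon>) *\<^sub>R (?p t - w) = (1 / \<epsilon>) *\<^sub>R (z - w) + t *\<^sub>R ?v" for t by (simp add: algebra_simps)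
  have "?H ?zz y w = (\<Sum>k<s. tay k ?v (\<lambda>\<alpha>. ?H \<alpha> z w) ?zz / fact k) +
    (LINT t|lborel. indicator {0..1} t * (?c t * tay s ?v (\<lambda>\<alpha>. ?H \<alpha> (?p t) w) ?zz))"
   unfolding e e' by (rule taylor_prodf[OF _ s]) (intro allI dseq_bump)
  then have "f w * ?H ?zz y w = (\<Sum>k<s. f w * (tay k ?v (\<lambda>\<alpha>. ?H \<alpha> z w) ?zz / fact k)) +
    (LINT t|lborel. f w * (indicator {0..1} t * (?c t * tay s ?v (\<lambda>\<alpha>. ?H \<alpha> (?p t) w) ?zz)))"
   by (simp only: distrib_left sum_distrib_left integral_mult_right_zero)
  then show ?thesis by (simp add: \<Phi>_def mult_ac)
 qed
 have "F ?zz y = (LINT w|lborel. (\<Sum>k<s. f w * tay k ?v (\<lambda>\<alpha>. ?H \<alpha> z w) ?zz / fact k) + (LINT t|lborel. \<Phi> t w))"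
  unfolding F_def eq ..
 also have "\<dots> = (\<Sum>k<s. (LINT w|lborel. f w * tay k ?v (\<lambda>\<alpha>. ?H \<alpha> z w) ?zz) / fact k) + (LINT w|lborel. (LINT t|lborel. \<Phi> t w))"
 proof -
  have 1: "integrable lborel (\<lambda>w. LINT t|lborel. \<Phi> t w)" using \<Phi>_int by (rule lborel_pair.integrable_snd)
  show ?thesis
   using tay_int 1 by (subst Bochner_Integration.integral_add) (auto intro!: Bochner_Integration.integrable_sum simp: Bochner_Integration.integral_sum)
 qed
 also have "(LINT w|lborel. (LINT t|lborel. \<Phi> t w)) = (LINT t|lborel. (LINT w|lborel. \<Phi> t w))"
  by (rule lborel_pair.Fubini_integral[OF \<Phi>_int])
 also have "(\<lambda>t. LINT w|lborel. \<Phi> t w) = (\<lambda>t. indicator {0..1} t * (?c t * tay s ?v (\<lambda>\<alpha>. F \<alpha> (?p t)) ?zz))"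
  unfolding \<Phi>_def tayF by simp
 finally show ?thesis unfolding tayF .
qed

text \<open>A Sobolev function with a chosen family of weak derivatives. They are defined on the
  whole space, vanish off \<open>\<Omega>\<close> and are integrated with respect to
  \<open>lborel\<close>, which makes Fubini's theorem and substitutions available.\<close>

definition weak_data ::
 "(real ^ 'd::finite) set \<Rightarrow> nat \<Rightarrow> (real ^ 'd \<Rightarrow> real) \<Rightarrow> (('d \<Rightarrow> nat) \<Rightarrow> real ^ 'd \<Rightarrow> real) \<Rightarrow> bool" where
 "weak_data \<Omega> s f g \<longleftrightarrow> continuous_on \<Omega> f \<and>
   (\<forall>\<alpha>\<in>multi_indices s. integrable lborel (g \<alpha>) \<and> (\<forall>x. x \<notin> \<Omega> \<longrightarrow> g \<alpha> x = 0) \<and>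
    (\<forall>\<phi>. test_function \<Omega> \<phi> \<longrightarrow> (LINT x|lborel. indicator \<Omega> x * f x * multi_deriv \<alpha> \<phi> x) =
      (- 1) ^ (\<Sum>i\<in>UNIV. \<alpha> i) * (LINT x|lborel. g \<alpha> x * \<phi> x)))"

text \<open>The test function is the bump reflected and rescaled about \<open>p\<close>. The
  reflection yields a sign (-1)^|\<alpha>|, which cancels the one in the definition of the weak
  derivative; the rescaling leaves \<epsilon>^|\<alpha>|.\<close>

lemma weak_data_mollified:
 fixes f :: "real ^ 'd::finite \<Rightarrow> real"
 assumes wd: "weak_data \<Omega> s f g" and \<alpha>: "\<alpha> \<in> multi_indices s" and \<epsilon>: "\<epsilon> > 0"
  and p: "cbox (p - (\<chi> i. \<epsilon>)) (p + (\<chi> i. \<epsilon>)) \<subseteq> \<Omega>"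
 shows "(LINT w|lborel. indicator \<Omega> w * f w * prodf std_bump \<alpha> ((1 / \<epsilon>) *\<^sub>R (p - w))) =
  \<epsilon> ^ (\<Sum>i\<in>UNIV. \<alpha> i) * (LINT w|lborel. g \<alpha> w * prodf std_bump (\<lambda>_. 0) ((1 / \<epsilon>) *\<^sub>R (p - w)))"
proof -
 define b where "b i k t = (- (1 / \<epsilon>)) ^ k * bump 1 (-1) 1 k (- (1 / \<epsilon>) * t + p $ i / \<epsilon>)" for i k t
 have b: "\<forall>i. dseq (b i)" unfolding b_def[abs_def] by (intro allI dseq_affine dseq_bump)
 have pb: "prodf b m w = (- (1 / \<epsilon>)) ^ (\<Sum>i\<in>UNIV. m i) * prodf std_bump m ((1 / \<epsilon>) *\<^sub>R (p - w))" for m w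
  unfolding prodf_def b_def prod.distrib power_sum
  by (intro arg_cong2[where f = "(*)"] prod.cong refl arg_cong2[where f = "bump 1 (-1) 1"]) (auto simp: field_simps)
 have "test_function \<Omega> (prodf b (\<lambda>_. 0))"
 proof (rule test_function_prodf[OF b _ p])
  fix i t assume "t \<le> (p - (\<chi> i. \<epsilon>)) $ i \<or> (p + (\<chi> i. \<epsilon>)) $ i \<le> t"
  then have "- (1 / \<epsilon>) * t + p $ i / \<epsilon> \<le> -1 \<or> 1 \<le> - (1 / \<epsilon>) * t + p $ i / \<epsilon>" using \<epsilon> by (auto simp: field_simps)
  then show "b i 0 t = 0" unfolding b_def by (subst bump_eq_0) auto
 qed
 then have "(LINT x|lborel. indicator \<Omega> x * f x * prodf b \<alpha> x) =
   (- 1) ^ (\<Sum>i\<in>UNIV. \<alpha> i) * (LINT x|lborel. g \<alpha> x * prodf b (\<lambda>_. 0) x)"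
  using wd \<alpha> multi_deriv_prodf[OF b, of \<alpha>] unfolding weak_data_def by fastforce
 then have "(- (1 / \<epsilon>)) ^ (\<Sum>i\<in>UNIV. \<alpha> i) * (LINT w|lborel. indicator \<Omega> w * f w * prodf std_bump \<alpha> ((1 / \<epsilon>) *\<^sub>R (p - w))) =
   (- 1) ^ (\<Sum>i\<in>UNIV. \<alpha> i) * (LINT w|lborel. g \<alpha> w * prodf std_bump (\<lambda>_. 0) ((1 / \<epsilon>) *\<^sub>R (p - w)))"
  unfolding pb by (simp add: mult.left_commute[of _ "(- (1 / \<epsilon>)) ^ _"])
 moreover have "(- (1 / \<epsilon>)) ^ (\<Sum>i\<in>UNIV. \<alpha> i) = (- 1) ^ (\<Sum>i\<in>UNIV. \<alpha> i) / \<epsilon> ^ (\<Sum>i\<in>UNIV. \<alpha> i)"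
  by (metis minus_divide_left power_divide)
 ultimately show ?thesis using \<epsilon> by (simp add: field_simps)
qed

subsection \<open>Mollified Taylor expansions\<close>

text \<open>The mollification without its normalising factor \<epsilon>^d \<open>bump_mass\<close>.
  All terms of the final estimates carry this factor, and it cancels there.\<close>

definition moll :: "(real ^ 'd::finite \<Rightarrow> real) \<Rightarrow> real \<Rightarrow> real ^ 'd \<Rightarrow> real" where
 "moll h \<epsilon> p = (LINT w|lborel. h w * prodf std_bump (\<lambda>_. 0) ((1 / \<epsilon>) *\<^sub>R (p - w)))"

text \<open>The Taylor polynomial about \<open>z\<close>, evaluated at \<open>y\<close>, of the
  mollified function, the derivatives of which are the mollified weak derivatives.\<close>

definition taylor_poly :: "nat \<Rightarrow> (('d \<Rightarrow> nat) \<Rightarrow> real ^ 'd::finite \<Rightarrow> real) \<Rightarrow> real \<Rightarrow> real ^ 'd \<Rightarrow> real ^ 'd \<Rightarrow> real" where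
 "taylor_poly s g \<epsilon> z y = (\<Sum>k<s. tay k (y - z) (\<lambda>\<alpha>. moll (g \<alpha>) \<epsilon> z) (\<lambda>_. 0) / fact k)"

lemma tay_sep_poly: "\<exists>p. degree p \<le> k \<and> (\<forall>t. tay k (vupd y i t - z) G m = poly p t)"
proof (induction k arbitrary: m)
 case 0
 show ?case by (rule exI[of _ "[:G m:]"]) simp
next
 case (Suc k)
 then have "\<forall>j. \<exists>p. degree p \<le> k \<and> (\<forall>t. tay k (vupd y i t - z) G (m(j := Suc (m j))) = poly p t)" by blast
 then obtain P where P: "\<And>j. degree (P j) \<le> k"
  "\<And>j t. tay k (vupd y i t - z) G (m(j := Suc (m j))) = poly (P j) t" by metis
 define L where "L j = (if j = i then [:- z $ i, 1:] else [:y $ j - z $ j:])" for j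
 have L: "(vupd y i t - z) $ j = poly (L j) t" "degree (L j) \<le> 1" for j t by (auto simp: L_def vupd_nth)
 have "tay (Suc k) (vupd y i t - z) G m = poly (\<Sum>j\<in>UNIV. L j * P j) t" for t unfolding tay.simps P(2) L(1) by (simp add: poly_sum)
 moreover have "degree (\<Sum>j\<in>UNIV. L j * P j) \<le> Suc k"
 proof (rule degree_sum_le)
  show "degree (L j * P j) \<le> Suc k" for j using degree_mult_le[of "L j" "P j"] L(2)[of j] P(1)[of j] by linarith
 qed simp
 ultimately show ?case by blast
qed

lemma sep_poly_taylor_poly:
 assumes "s > 0"
 shows "sep_poly s (taylor_poly s g \<epsilon> z)" unfolding sep_poly_def
proof (intro allI)
 fix i y
 let ?G = "\<lambda>\<alpha>. moll (g \<alpha>) \<epsilon> z"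
 have "\<forall>k. \<exists>p. degree p \<le> k \<and> (\<forall>t. tay k (vupd y i t - z) ?G (\<lambda>_. 0) = poly p t)" using tay_sep_poly by blast
 then obtain P where P: "\<And>k. degree (P k) \<le> k" "\<And>k t. tay k (vupd y i t - z) ?G (\<lambda>_. 0) = poly (P k) t" by metis
 have "degree (\<Sum>k<s. smult (1 / fact k) (P k)) < s"
  using assms P(1) by (intro degree_sum_less) (auto intro: le_less_trans[OF degree_smult_le] le_less_trans[OF P(1)])
 moreover have "taylor_poly s g \<epsilon> z (vupd y i t) = poly (\<Sum>k<s. smult (1 / fact k) (P k)) t" for t
  unfolding taylor_poly_def P(2) by (simp add: poly_sum)
 ultimately show "\<exists>p. degree p < s \<and> (\<forall>t. taylor_poly s g \<epsilon> z (vupd y i t) = poly p t)" by blast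
qed

lemma borel_measurable_moll [measurable]:
 assumes [measurable]: "h \<in> borel_measurable borel"
 shows "moll h \<epsilon> \<in> borel_measurable borel" unfolding moll_def[abs_def] by measurable

lemma borel_measurable_taylor_poly:
 assumes [measurable]: "\<And>\<alpha>. g \<alpha> \<in> borel_measurable borel"
 shows "(\<lambda>z. taylor_poly s g \<epsilon> z y) \<in> borel_measurable borel" unfolding taylor_poly_def
 by (intro borel_measurable_sum borel_measurable_divide borel_measurable_tay borel_measurable_const)
   (auto intro!: borel_measurable_continuous_onI continuous_intros)

lemma prodf_std_bump_scaled_zero:
 assumes "\<epsilon> > 0" "w \<notin> cbox (p - (\<chi> i. \<epsilon>)) (p + (\<chi> i. \<epsilon>))"
 shows "prodf std_bump \<alpha> ((1 / \<epsilon>) *\<^sub>R (p - w)) = 0"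
proof (rule ccontr)
 assume "prodf std_bump \<alpha> ((1 / \<epsilon>) *\<^sub>R (p - w)) \<noteq> 0"
 then have "\<bar>((1 / \<epsilon>) *\<^sub>R (p - w)) $ i\<bar> < 1" for i by (rule prodf_std_bump_eq_0)
 then have "\<bar>p $ i - w $ i\<bar> < \<epsilon>" for i using assms(1) by (simp add: abs_mult field_simps)
 then have "w \<in> cbox (p - (\<chi> i. \<epsilon>)) (p + (\<chi> i. \<epsilon>))" unfolding mem_box_cart by (auto simp: abs_less_iff) (smt (verit))+
 then show False using assms by simp
qed

abbreviation moll_remainder :: "nat \<Rightarrow> (('d::finite \<Rightarrow> nat) \<Rightarrow> real ^ 'd \<Rightarrow> real) \<Rightarrow> real \<Rightarrow> real ^ 'd \<Rightarrow> real ^ 'd \<Rightarrow> real" where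
 "moll_remainder s g \<epsilon> y z \<equiv> (LINT t|lborel. indicator {0..1} t * ((1 - t) ^ (s - 1) / fact (s - 1) *
  tay s (y - z) (\<lambda>\<alpha>. moll (g \<alpha>) \<epsilon> (z + t *\<^sub>R (y - z))) (\<lambda>_. 0)))"

text \<open>\<open>f\<close> is only continuous on \<open>\<Omega>\<close> and may be unbounded
  there a priori, so it is cut off to a compact \<open>K\<close>. The cut-off is invisible along the
  segment, since the kernel about each of its points is supported in \<open>K\<close>.\<close>

lemma moll_taylor:
 fixes f :: "real ^ 'd::finite \<Rightarrow> real"
 assumes wd: "weak_data \<Omega> s f g" and s: "s > 0" and \<epsilon>: "\<epsilon> > 0"
  and K: "compact K" "K \<subseteq> \<Omega>"
  and seg: "\<And>t. 0 \<le> t \<Longrightarrow> t \<le> 1 \<Longrightarrow>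
    cbox (z + t *\<^sub>R (y - z) - (\<chi> i. \<epsilon>)) (z + t *\<^sub>R (y - z) + (\<chi> i. \<epsilon>)) \<subseteq> K"
 shows "moll (\<lambda>w. indicator K w * f w) \<epsilon> y = taylor_poly s g \<epsilon> z y +
   moll_remainder s g \<epsilon> y z"
proof -
 let ?f = "\<lambda>w. indicator K w * f w" and ?p = "\<lambda>t. z + t *\<^sub>R (y - z)"
 define F where "F \<alpha> p = (LINT w|lborel. ?f w * prodf std_bump \<alpha> ((1 / \<epsilon>) *\<^sub>R (p - w)))" for \<alpha> p
 have fc: "continuous_on K f" using wd K(2) continuous_on_subset unfolding weak_data_def by blast
 have meas: "?f \<in> borel_measurable borel"
  using borel_measurable_continuous_on_indicator[OF _ fc] K(1) by (simp add: compact_imp_closed)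
 have "bounded (f ` K)" using K(1) fc compact_continuous_image compact_imp_bounded by blast
 then obtain M where M: "M > 0" "\<And>x. x \<in> K \<Longrightarrow> \<bar>f x\<bar> \<le> M" unfolding bounded_pos by auto
 have bd: "\<bar>?f x\<bar> \<le> M" for x using M by (auto simp: indicator_def)
 have F: "F \<alpha> (?p t) = \<epsilon> ^ (\<Sum>i\<in>UNIV. \<alpha> i) * moll (g \<alpha>) \<epsilon> (?p t)"
  if "\<alpha> \<in> multi_indices s" "0 \<le> t" "t \<le> 1" for \<alpha> t
 proof -
  have E: "?f w * prodf std_bump \<alpha> ((1 / \<epsilon>) *\<^sub>R (?p t - w)) =
    indicator \<Omega> w * f w * prodf std_bump \<alpha> ((1 / \<epsilon>) *\<^sub>R (?p t - w))" for w
   using seg[OF that(2,3)] K(2) prodf_std_bump_scaled_zero[OF \<epsilon>, of w "?p t" \<alpha>]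
   by (cases "w \<in> K") (auto simp: indicator_def subset_eq)
  show ?thesis unfolding F_def moll_def E by (rule weak_data_mollified[OF wd that(1) \<epsilon>]) (use seg[OF that(2,3)] K(2) in blast)
 qed
 have T: "tay k ((1 / \<epsilon>) *\<^sub>R (y - z)) (\<lambda>\<alpha>. F \<alpha> (?p t)) (\<lambda>_. 0) = tay k (y - z) (\<lambda>\<alpha>. moll (g \<alpha>) \<epsilon> (?p t)) (\<lambda>_. 0)"
  if "k \<le> s" "0 \<le> t" "t \<le> 1" for k t
 proof -
  have "tay k (y - z) (\<lambda>\<alpha>. F \<alpha> (?p t)) (\<lambda>_. 0) =
    tay k (y - z) (\<lambda>\<alpha>. \<epsilon> ^ (\<Sum>i\<in>UNIV. \<alpha> i) * moll (g \<alpha>) \<epsilon> (?p t)) (\<lambda>_. 0)"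
   using that by (intro tay_cong F) (auto simp: multi_indices_def)
  then show ?thesis unfolding tay_scale tay_weight using \<epsilon> by (simp add: power_one_over)
 qed
 have "moll ?f \<epsilon> y = F (\<lambda>_. 0) y" by (simp add: moll_def F_def)
 also have "\<dots> = (\<Sum>k<s. tay k ((1 / \<epsilon>) *\<^sub>R (y - z)) (\<lambda>\<alpha>. F \<alpha> z) (\<lambda>_. 0) / fact k) +
   (LINT t|lborel. indicator {0..1} t * ((1 - t) ^ (s - 1) / fact (s - 1) *
    tay s ((1 / \<epsilon>) *\<^sub>R (y - z)) (\<lambda>\<alpha>. F \<alpha> (?p t)) (\<lambda>_. 0)))"
  unfolding F_def by (rule mollified_taylor[OF meas bd compact_imp_bounded[OF K(1)] _ s]) simp
 also have "(\<Sum>k<s. tay k ((1 / \<epsilon>) *\<^sub>R (y - z)) (\<lambda>\<alpha>. F \<alpha> z) (\<lambda>_. 0) / fact k) = taylor_poly s g \<epsilon> z y"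
  unfolding taylor_poly_def using T[of _ 0] by (intro sum.cong) auto
 also have "(LINT t|lborel. indicator {0..1} t * ((1 - t) ^ (s - 1) / fact (s - 1) *
    tay s ((1 / \<epsilon>) *\<^sub>R (y - z)) (\<lambda>\<alpha>. F \<alpha> (?p t)) (\<lambda>_. 0))) =
   (LINT t|lborel. indicator {0..1} t * ((1 - t) ^ (s - 1) / fact (s - 1) *
    tay s (y - z) (\<lambda>\<alpha>. moll (g \<alpha>) \<epsilon> (?p t)) (\<lambda>_. 0)))"
  using T[of s] by (intro Bochner_Integration.integral_cong) (auto simp: indicator_def)
 finally show ?thesis .
qed

definition bump_mass :: "'d::finite itself \<Rightarrow> real" where
 "bump_mass _ = (LINT w|lborel. prodf std_bump (\<lambda>_. 0) (w :: real ^ 'd))"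

lemma integrable_std_bump: "integrable lborel (prodf std_bump \<alpha>)"
 by (rule integrable_continuous_compact_support[OF continuous_prodf_std_bump compact_cbox prodf_std_bump_zero_outside])

lemma bump_mass_pos: "bump_mass TYPE('d::finite) > 0"
proof -
 let ?H = "prodf std_bump (\<lambda>_. 0) :: real ^ 'd \<Rightarrow> real"
 have "bump_mass TYPE('d) \<noteq> 0"
 proof
  assume "bump_mass TYPE('d) = 0"
  then have a: "AE w in lborel. ?H w = 0" unfolding bump_mass_def
   using integral_nonneg_eq_0_iff_AE[OF integrable_std_bump] prodf_std_bump_nonneg by blast
  have pos: "?H w > 0" if "w \<in> box (\<chi> i. -1) (\<chi> i. 1)" for w
   unfolding prodf_def using that by (intro prod_pos) (auto simp: mem_box_cart bump_0_pos)
  from a have "AE w in lborel. (w :: real ^ 'd) \<notin> box (\<chi> i. -1) (\<chi> i. 1)" by eventually_elim (use pos in force)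
  then have "emeasure lborel (box (\<chi> i. -1) (\<chi> i. 1) :: (real ^ 'd) set) = 0" by (subst (asm) AE_iff_measurable[OF _ refl]) auto
  then have "negligible (box (\<chi> i. -1) (\<chi> i. 1) :: (real ^ 'd) set)"
   by (simp add: negligible_iff_null_sets null_sets_completionI null_setsI)
  moreover have "(0 :: real ^ 'd) \<in> box (\<chi> i. -1) (\<chi> i. 1)" by (simp add: mem_box_cart)
  ultimately show False using open_not_negligible[OF open_box] by blast
 qed
 moreover have "bump_mass TYPE('d) \<ge> 0"
  unfolding bump_mass_def using prodf_std_bump_nonneg by (intro Bochner_Integration.integral_nonneg) auto
 ultimately show ?thesis by linarith
qed

lemma nn_integral_std_bump:
 "(\<integral>\<^sup>+ w. ennreal (prodf std_bump (\<lambda>_. 0) (w :: real ^ 'd::finite)) \<partial>lborel) = ennreal (bump_mass TYPE('d))"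
 unfolding bump_mass_def by (rule nn_integral_eq_integral[OF integrable_std_bump]) (auto simp: prodf_std_bump_nonneg)

lemma nn_integral_moll_substitution:
 fixes h :: "real ^ 'd::finite \<Rightarrow> ennreal"
 assumes [measurable]: "h \<in> borel_measurable borel" and \<epsilon>: "\<epsilon> > 0"
 shows "(\<integral>\<^sup>+ w. h w * ennreal (prodf std_bump (\<lambda>_. 0) ((1 / \<epsilon>) *\<^sub>R (p - w))) \<partial>lborel) =
  ennreal (\<epsilon> ^ CARD('d)) * (\<integral>\<^sup>+ \<omega>. h (p - \<epsilon> *\<^sub>R \<omega>) * ennreal (prodf std_bump (\<lambda>_. 0) \<omega>) \<partial>lborel)"
proof -
 have "(\<integral>\<^sup>+ w. h w * ennreal (prodf std_bump (\<lambda>_. 0) ((1 / \<epsilon>) *\<^sub>R (p - w))) \<partial>lborel) =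
  ennreal (\<bar>- \<epsilon>\<bar> ^ DIM(real ^ 'd)) * (\<integral>\<^sup>+ \<omega>. h (p + (- \<epsilon>) *\<^sub>R \<omega>) * ennreal (prodf std_bump (\<lambda>_. 0) ((1 / \<epsilon>) *\<^sub>R (p - (p + (- \<epsilon>) *\<^sub>R \<omega>)))) \<partial>lborel)"
  by (rule nn_integral_lborel_affine) (use \<epsilon> in auto)
 then show ?thesis using \<epsilon> by simp
qed

lemma moll_const:
 fixes p :: "real ^ 'd::finite"
 assumes "\<epsilon> > 0"
 shows "(\<integral>\<^sup>+ w. ennreal (prodf std_bump (\<lambda>_. 0) ((1 / \<epsilon>) *\<^sub>R (p - w))) \<partial>lborel) =
  ennreal (\<epsilon> ^ CARD('d) * bump_mass TYPE('d))"
 using nn_integral_moll_substitution[of "\<lambda>_. 1" \<epsilon> p] assms bump_mass_pos[where 'd = 'd]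
 by (simp add: nn_integral_std_bump ennreal_mult[symmetric] less_imp_le)

lemma ennreal_abs_integral_le:
 fixes h :: "'a \<Rightarrow> real"
 shows "ennreal \<bar>integral\<^sup>L M h\<bar> \<le> (\<integral>\<^sup>+ x. ennreal \<bar>h x\<bar> \<partial>M)"
 using integral_norm_bound_ennreal[of M h] by (cases "integrable M h") (auto simp: not_integrable_integral_eq)

lemma abs_moll_le:
 fixes h :: "real ^ 'd::finite \<Rightarrow> real"
 assumes [measurable]: "h \<in> borel_measurable borel" and \<epsilon>: "\<epsilon> > 0"
 shows "ennreal \<bar>moll h \<epsilon> p\<bar> \<le> (\<integral>\<^sup>+ w. ennreal \<bar>h w\<bar> * ennreal (prodf std_bump (\<lambda>_. 0) ((1 / \<epsilon>) *\<^sub>R (p - w))) \<partial>lborel)"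
proof -
 have "ennreal \<bar>moll h \<epsilon> p\<bar> \<le> (\<integral>\<^sup>+ w. ennreal \<bar>h w * prodf std_bump (\<lambda>_. 0) ((1 / \<epsilon>) *\<^sub>R (p - w))\<bar> \<partial>lborel)"
  unfolding moll_def by (rule ennreal_abs_integral_le)
 also have "\<dots> = (\<integral>\<^sup>+ w. ennreal \<bar>h w\<bar> * ennreal (prodf std_bump (\<lambda>_. 0) ((1 / \<epsilon>) *\<^sub>R (p - w))) \<partial>lborel)"
  by (intro nn_integral_cong) (simp add: abs_mult ennreal_mult' prodf_std_bump_nonneg)
 finally show ?thesis .
qed

definition top_derivs :: "nat \<Rightarrow> (('d::finite \<Rightarrow> nat) \<Rightarrow> real ^ 'd \<Rightarrow> real) \<Rightarrow> real ^ 'd \<Rightarrow> real" where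
 "top_derivs s g w = (\<Sum>\<alpha>\<in>{\<alpha>. (\<Sum>i\<in>UNIV. \<alpha> i) = s}. \<bar>g \<alpha> w\<bar>)"

abbreviation local_energy :: "nat \<Rightarrow> (('d::finite \<Rightarrow> nat) \<Rightarrow> real ^ 'd \<Rightarrow> real) \<Rightarrow> real \<Rightarrow> real ^ 'd \<Rightarrow> real \<Rightarrow> ennreal" where
 "local_energy s g p x r \<equiv> (\<integral>\<^sup>+ w. ennreal (top_derivs s g w powr p) * indicator (cball x r) w \<partial>lborel)"

lemma top_derivs_nonneg: "top_derivs s g w \<ge> 0" unfolding top_derivs_def by (rule sum_nonneg) simp

lemma borel_measurable_top_derivs [measurable]:
 "(\<And>\<alpha>. g \<alpha> \<in> borel_measurable borel) \<Longrightarrow> top_derivs s g \<in> borel_measurable borel" unfolding top_derivs_def[abs_def] by measurable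

text \<open>\<open>tay_bound\<close> extracts the direction and leaves mollified top derivatives.
  The substitution \<sigma> = 1 - t runs through the segment from \<open>y\<close> to
  \<open>z\<close>, so that (1-t)^(s-1) becomes a weight that vanishes towards \<open>y\<close> if s
  > 1; rescaling the kernel moves the mollification into the shift
  \<open>y - \<epsilon> *\<^sub>R \<omega>\<close>.\<close>

lemma moll_remainder_le:
 fixes g :: "('d::finite \<Rightarrow> nat) \<Rightarrow> real ^ 'd \<Rightarrow> real"
 assumes g[measurable]: "\<And>\<alpha>. g \<alpha> \<in> borel_measurable borel" and \<epsilon>: "\<epsilon> > 0" and s: "s > 0"
  and D: "norm (y - z) \<le> D"
 shows "ennreal \<bar>LINT t|lborel. indicator {0..1} t * ((1 - t) ^ (s - 1) / fact (s - 1) *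
    tay s (y - z) (\<lambda>\<alpha>. moll (g \<alpha>) \<epsilon> (z + t *\<^sub>R (y - z))) (\<lambda>_. 0))\<bar>
  \<le> ennreal ((real CARD('d) * D) ^ s * \<epsilon> ^ CARD('d)) *
    (\<integral>\<^sup>+ \<sigma>. (\<integral>\<^sup>+ \<omega>. indicator {0<..1} \<sigma> * ennreal (\<sigma> ^ (s - 1) * top_derivs s g ((y - \<epsilon> *\<^sub>R \<omega>) + \<sigma> *\<^sub>R (z - y))) *
     ennreal (prodf std_bump (\<lambda>_. 0) \<omega>) \<partial>lborel) \<partial>lborel)"
  (is "ennreal \<bar>?L\<bar> \<le> ?R")
proof -
 let ?d = "real CARD('d)" and ?H = "prodf std_bump (\<lambda>_. 0) :: real ^ 'd \<Rightarrow> real"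
 let ?p = "\<lambda>t. z + t *\<^sub>R (y - z)" and ?A = "{\<alpha> :: 'd \<Rightarrow> nat. (\<Sum>i\<in>UNIV. \<alpha> i) = s}"
 let ?T = "\<lambda>t. tay s (y - z) (\<lambda>\<alpha>. moll (g \<alpha>) \<epsilon> (?p t)) (\<lambda>_. 0)"
 have D0: "D \<ge> 0" using D norm_ge_zero order_trans by blast
 have [measurable]: "?T \<in> borel_measurable borel" by (rule borel_measurable_tay) measurable
 have T: "ennreal \<bar>?T t\<bar> \<le> ennreal ((?d * D) ^ s) *
   (ennreal (\<epsilon> ^ CARD('d)) * (\<integral>\<^sup>+ \<omega>. ennreal (top_derivs s g (?p t - \<epsilon> *\<^sub>R \<omega>)) * ennreal (?H \<omega>) \<partial>lborel))" for t
 proof -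
  have "\<bar>?T t\<bar> \<le> (?d * norm (y - z)) ^ s * (\<Sum>\<alpha>\<in>?A. \<bar>moll (g \<alpha>) \<epsilon> (?p t)\<bar>)"
   using tay_bound[of s "y - z" "\<lambda>\<alpha>. moll (g \<alpha>) \<epsilon> (?p t)" "\<lambda>_. 0"] by simp
  also have "\<dots> \<le> (?d * D) ^ s * (\<Sum>\<alpha>\<in>?A. \<bar>moll (g \<alpha>) \<epsilon> (?p t)\<bar>)"
   using D by (intro mult_right_mono power_mono mult_left_mono sum_nonneg) auto
  finally have "ennreal \<bar>?T t\<bar> \<le> ennreal ((?d * D) ^ s) * (\<Sum>\<alpha>\<in>?A. ennreal \<bar>moll (g \<alpha>) \<epsilon> (?p t)\<bar>)"
   using D0 by (subst sum_ennreal) (auto simp: ennreal_mult[symmetric] sum_nonneg intro: ennreal_leI)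
  also have "(\<Sum>\<alpha>\<in>?A. ennreal \<bar>moll (g \<alpha>) \<epsilon> (?p t)\<bar>) \<le>
    (\<Sum>\<alpha>\<in>?A. (\<integral>\<^sup>+ w. ennreal \<bar>g \<alpha> w\<bar> * ennreal (?H ((1 / \<epsilon>) *\<^sub>R (?p t - w))) \<partial>lborel))" by (intro sum_mono abs_moll_le g \<epsilon>)
  also have "\<dots> = (\<integral>\<^sup>+ w. ennreal (top_derivs s g w) * ennreal (?H ((1 / \<epsilon>) *\<^sub>R (?p t - w))) \<partial>lborel)"
   unfolding top_derivs_def by (subst nn_integral_sum[symmetric]) (auto simp: sum_distrib_right sum_ennreal[symmetric] simp del: sum_ennreal)
  also have "\<dots> = ennreal (\<epsilon> ^ CARD('d)) * (\<integral>\<^sup>+ \<omega>. ennreal (top_derivs s g (?p t - \<epsilon> *\<^sub>R \<omega>)) * ennreal (?H \<omega>) \<partial>lborel)"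
   by (rule nn_integral_moll_substitution[OF _ \<epsilon>]) measurable
  finally show ?thesis by (simp add: mult_left_mono)
 qed
 let ?I = "\<lambda>p. \<integral>\<^sup>+ \<omega>. ennreal (top_derivs s g (p - \<epsilon> *\<^sub>R \<omega>)) * ennreal (?H \<omega>) \<partial>lborel"
 have "ennreal \<bar>?L\<bar> \<le> (\<integral>\<^sup>+ t. ennreal (norm (indicator {0..1} t * ((1 - t) ^ (s - 1) / fact (s - 1) * ?T t))) \<partial>lborel)"
  unfolding real_norm_def by (rule ennreal_abs_integral_le)
 also have "\<dots> \<le> (\<integral>\<^sup>+ t. indicator {0..1} t * (ennreal ((1 - t) ^ (s - 1)) * (ennreal ((?d * D) ^ s) * (ennreal (\<epsilon> ^ CARD('d)) * ?I (?p t)))) \<partial>lborel)"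
 proof (intro nn_integral_mono)
  fix t :: real
  show "ennreal (norm (indicator {0..1} t * ((1 - t) ^ (s - 1) / fact (s - 1) * ?T t))) \<le>
   indicator {0..1} t * (ennreal ((1 - t) ^ (s - 1)) * (ennreal ((?d * D) ^ s) * (ennreal (\<epsilon> ^ CARD('d)) * ?I (?p t))))"
  proof (cases "t \<in> {0..1}")
   case True
   have "(1 - t) ^ (s - 1) / fact (s - 1) \<le> (1 - t) ^ (s - 1)"
    using True fact_ge_1[of "s - 1", where 'a = real] by (simp add: divide_le_eq mult_le_cancel_left1)
   then have "norm (indicator {0..1} t * ((1 - t) ^ (s - 1) / fact (s - 1) * ?T t)) \<le> (1 - t) ^ (s - 1) * \<bar>?T t\<bar>"
    using True by (simp add: abs_mult mult_right_mono del: times_divide_eq_left)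
   then have "ennreal (norm (indicator {0..1} t * ((1 - t) ^ (s - 1) / fact (s - 1) * ?T t))) \<le> ennreal ((1 - t) ^ (s - 1)) * ennreal \<bar>?T t\<bar>"
    using True by (subst ennreal_mult[symmetric]) (auto intro: ennreal_leI)
   also have "\<dots> \<le> ennreal ((1 - t) ^ (s - 1)) * (ennreal ((?d * D) ^ s) * (ennreal (\<epsilon> ^ CARD('d)) * ?I (?p t)))"
    by (intro mult_left_mono T) simp
   finally show ?thesis using True by simp
  qed simp
 qed
 also have "\<dots> = ennreal ((?d * D) ^ s) * ennreal (\<epsilon> ^ CARD('d)) * (\<integral>\<^sup>+ t. indicator {0..1} t * (ennreal ((1 - t) ^ (s - 1)) * ?I (?p t)) \<partial>lborel)"
  by (subst nn_integral_cmult[symmetric]) (auto intro!: nn_integral_cong simp: mult_ac)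
 also have "(\<integral>\<^sup>+ t. indicator {0..1} t * (ennreal ((1 - t) ^ (s - 1)) * ?I (?p t)) \<partial>lborel) =
   (\<integral>\<^sup>+ \<sigma>. indicator {0..1} (1 + (-1) * \<sigma>) * (ennreal ((1 - (1 + (-1) * \<sigma>)) ^ (s - 1)) * ?I (?p (1 + (-1) * \<sigma>))) \<partial>lborel)"
  by (subst nn_integral_real_affine[where c = "-1" and t = 1]) auto
 also have "\<dots> = (\<integral>\<^sup>+ \<sigma>. indicator {0<..1} \<sigma> * (ennreal (\<sigma> ^ (s - 1)) * ?I (y + \<sigma> *\<^sub>R (z - y))) \<partial>lborel)"
 proof (rule nn_integral_cong_AE)
  have "AE \<sigma> in lborel. \<sigma> \<noteq> (0::real)" by (rule AE_lborel_singleton)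
  then show "AE \<sigma> in lborel. indicator {0..1} (1 + (-1) * \<sigma>) * (ennreal ((1 - (1 + (-1) * \<sigma>)) ^ (s - 1)) * ?I (?p (1 + (-1) * \<sigma>))) =
    indicator {0<..1} \<sigma> * (ennreal (\<sigma> ^ (s - 1)) * ?I (y + \<sigma> *\<^sub>R (z - y)))"
  proof eventually_elim
   case (elim \<sigma>)
   have "?p (1 + (-1) * \<sigma>) = y + \<sigma> *\<^sub>R (z - y)" by (simp add: algebra_simps)
   then show ?case using elim by (auto simp: indicator_def)
  qed
 qed
 also have "\<dots> = (\<integral>\<^sup>+ \<sigma>. (\<integral>\<^sup>+ \<omega>. indicator {0<..1} \<sigma> * ennreal (\<sigma> ^ (s - 1) * top_derivs s g ((y - \<epsilon> *\<^sub>R \<omega>) + \<sigma> *\<^sub>R (z - y))) *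
     ennreal (?H \<omega>) \<partial>lborel) \<partial>lborel)"
 proof (rule nn_integral_cong)
  fix \<sigma> :: real
  show "indicator {0<..1} \<sigma> * (ennreal (\<sigma> ^ (s - 1)) * ?I (y + \<sigma> *\<^sub>R (z - y))) =
   (\<integral>\<^sup>+ \<omega>. indicator {0<..1} \<sigma> * ennreal (\<sigma> ^ (s - 1) * top_derivs s g ((y - \<epsilon> *\<^sub>R \<omega>) + \<sigma> *\<^sub>R (z - y))) * ennreal (?H \<omega>) \<partial>lborel)"
  proof (cases "\<sigma> \<in> {0<..1}")
   case True
   have e: "(y + \<sigma> *\<^sub>R (z - y)) - \<epsilon> *\<^sub>R \<omega> = (y - \<epsilon> *\<^sub>R \<omega>) + \<sigma> *\<^sub>R (z - y)" for \<omega> by simp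
   show ?thesis unfolding e using True by (simp add: nn_integral_cmult[symmetric] ennreal_mult top_derivs_nonneg mult.assoc)
  qed simp
 qed
 finally show ?thesis using \<epsilon> D0 by (simp add: ennreal_mult)
qed

text \<open>After Fubini the kernel variable \<omega> is outermost. For fixed \<omega> the segments
  emanate from \<open>y - \<epsilon> *\<^sub>R \<omega>\<close>, and
  \<open>nn_integral_segments_le\<close> applies to the average over \<open>z\<close>. The condition
  on \<open>\<epsilon>\<close> keeps the ball of radius \<open>D\<close> about the shifted point
  inside the one of radius \<open>2 * D\<close> about \<open>y\<close>.\<close>

lemma moll_remainder_average:
 fixes g :: "('d::finite \<Rightarrow> nat) \<Rightarrow> real ^ 'd \<Rightarrow> real"
 assumes g[measurable]: "\<And>\<alpha>. g \<alpha> \<in> borel_measurable borel" and \<epsilon>: "\<epsilon> > 0" "\<epsilon> * real CARD('d) \<le> D" and s: "s > 0"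
  and B_sets[measurable]: "B \<in> sets borel" and \<delta>: "0 < \<delta>" and B: "\<And>z. z \<in> B \<Longrightarrow> \<delta> \<le> dist z y \<and> dist z y \<le> D"
  and p: "p \<ge> 1" "real CARD('d) / p < real s \<or> (p = 1 \<and> s = CARD('d))" and \<Lambda>: "\<Lambda> > 0"
  and R: "\<And>z. z \<in> B \<Longrightarrow> R z = moll_remainder s g \<epsilon> y z"
 shows "(\<integral>\<^sup>+ z. indicator B z * ennreal \<bar>R z\<bar> \<partial>lborel) \<le>
   ennreal ((real CARD('d) * D) ^ s) * ennreal (\<epsilon> ^ CARD('d) * bump_mass TYPE('d)) *
   (ennreal (embed_const CARD('d) p s * \<Lambda>) * emeasure lborel B +
   ennreal (D / \<delta> * \<Lambda> powr (1 - p)) * local_energy s g p y (2 * D))"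
proof -
 let ?d = "real CARD('d)" and ?H = "prodf std_bump (\<lambda>_. 0) :: real ^ 'd \<Rightarrow> real" and ?G = "top_derivs s g"
 have [measurable]: "cball y (2 * D) \<in> sets borel" by simp
 have D: "D \<ge> 0" using \<epsilon> by (smt (verit) mult_nonneg_nonneg of_nat_0_le_iff)
 let ?\<Psi> = "\<lambda>z \<sigma> \<omega>. indicator B z * (indicator {0<..1} \<sigma> * ennreal (\<sigma> ^ (s - 1) * ?G ((y - \<epsilon> *\<^sub>R \<omega>) + \<sigma> *\<^sub>R (z - y))) * ennreal (?H \<omega>))"
 let ?Br = "ennreal (embed_const CARD('d) p s * \<Lambda>) * emeasure lborel B +
   ennreal (D / \<delta> * \<Lambda> powr (1 - p)) * (\<integral>\<^sup>+ w. ennreal (?G w powr p) * indicator (cball y (2 * D)) w \<partial>lborel)"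
 let ?c = "ennreal ((?d * D) ^ s * \<epsilon> ^ CARD('d))"
 have [measurable]: "?G \<in> borel_measurable borel" by measurable
 have "(\<integral>\<^sup>+ z. indicator B z * ennreal \<bar>R z\<bar> \<partial>lborel) \<le> (\<integral>\<^sup>+ z. ?c * (\<integral>\<^sup>+ \<sigma>. (\<integral>\<^sup>+ \<omega>. ?\<Psi> z \<sigma> \<omega> \<partial>lborel) \<partial>lborel) \<partial>lborel)"
 proof (rule nn_integral_mono)
  fix z :: "real ^ 'd"
  show "indicator B z * ennreal \<bar>R z\<bar> \<le> ?c * (\<integral>\<^sup>+ \<sigma>. (\<integral>\<^sup>+ \<omega>. ?\<Psi> z \<sigma> \<omega> \<partial>lborel) \<partial>lborel)"
  proof (cases "z \<in> B")
   case True
   have "norm (y - z) \<le> D" using B[OF True] by (simp add: dist_norm norm_minus_commute)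
   from moll_remainder_le[of g, OF g \<epsilon>(1) s this] show ?thesis using True by (simp add: R)
  qed simp
 qed
 also have "\<dots> = ?c * (\<integral>\<^sup>+ z. (\<integral>\<^sup>+ \<sigma>. (\<integral>\<^sup>+ \<omega>. ?\<Psi> z \<sigma> \<omega> \<partial>lborel) \<partial>lborel) \<partial>lborel)" by (rule nn_integral_cmult) measurable
 finally have 1: "(\<integral>\<^sup>+ z. indicator B z * ennreal \<bar>R z\<bar> \<partial>lborel) \<le>
   ?c * (\<integral>\<^sup>+ z. (\<integral>\<^sup>+ \<sigma>. (\<integral>\<^sup>+ \<omega>. ?\<Psi> z \<sigma> \<omega> \<partial>lborel) \<partial>lborel) \<partial>lborel)" .
 have "(\<integral>\<^sup>+ z. (\<integral>\<^sup>+ \<sigma>. (\<integral>\<^sup>+ \<omega>. ?\<Psi> z \<sigma> \<omega> \<partial>lborel) \<partial>lborel) \<partial>lborel) =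
   (\<integral>\<^sup>+ \<sigma>. (\<integral>\<^sup>+ z. (\<integral>\<^sup>+ \<omega>. ?\<Psi> z \<sigma> \<omega> \<partial>lborel) \<partial>lborel) \<partial>lborel)" by (rule lborel_pair.Fubini') measurable
 also have "\<dots> = (\<integral>\<^sup>+ \<sigma>. (\<integral>\<^sup>+ \<omega>. (\<integral>\<^sup>+ z. ?\<Psi> z \<sigma> \<omega> \<partial>lborel) \<partial>lborel) \<partial>lborel)"
  by (intro nn_integral_cong lborel_pair.Fubini') measurable
 also have "\<dots> = (\<integral>\<^sup>+ \<omega>. (\<integral>\<^sup>+ \<sigma>. (\<integral>\<^sup>+ z. ?\<Psi> z \<sigma> \<omega> \<partial>lborel) \<partial>lborel) \<partial>lborel)" by (rule lborel_pair.Fubini') measurable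
 also have "\<dots> \<le> (\<integral>\<^sup>+ \<omega>. ?Br * ennreal (?H \<omega>) \<partial>lborel)"
 proof (rule nn_integral_mono)
  fix \<omega> :: "real ^ 'd"
  show "(\<integral>\<^sup>+ \<sigma>. (\<integral>\<^sup>+ z. ?\<Psi> z \<sigma> \<omega> \<partial>lborel) \<partial>lborel) \<le> ?Br * ennreal (?H \<omega>)"
  proof (cases "?H \<omega> = 0")
   case False
   let ?y = "y - \<epsilon> *\<^sub>R \<omega>"
   have "(\<integral>\<^sup>+ \<sigma>. (\<integral>\<^sup>+ z. ?\<Psi> z \<sigma> \<omega> \<partial>lborel) \<partial>lborel) =
     (\<integral>\<^sup>+ \<sigma>. (\<integral>\<^sup>+ z. (indicator {0<..1} \<sigma> * indicator B z * ennreal (\<sigma> ^ (s - 1) * ?G (?y + \<sigma> *\<^sub>R (z - y)))) * ennreal (?H \<omega>) \<partial>lborel) \<partial>lborel)"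
    by (intro nn_integral_cong) (simp add: mult_ac)
   also have "\<dots> = (\<integral>\<^sup>+ \<sigma>. (\<integral>\<^sup>+ z. indicator {0<..1} \<sigma> * indicator B z * ennreal (\<sigma> ^ (s - 1) * ?G (?y + \<sigma> *\<^sub>R (z - y))) \<partial>lborel) \<partial>lborel) * ennreal (?H \<omega>)"
    by (simp add: nn_integral_multc)
   also have "(\<integral>\<^sup>+ \<sigma>. (\<integral>\<^sup>+ z. indicator {0<..1} \<sigma> * indicator B z * ennreal (\<sigma> ^ (s - 1) * ?G (?y + \<sigma> *\<^sub>R (z - y))) \<partial>lborel) \<partial>lborel)
     \<le> ennreal (embed_const DIM(real ^ 'd) p s * \<Lambda>) * emeasure lborel B +
      ennreal (D / \<delta> * \<Lambda> powr (1 - p)) * (\<integral>\<^sup>+ w. ennreal (?G w powr p) * indicator (cball ?y D) w \<partial>lborel)"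
    by (rule nn_integral_segments_le[OF _ B_sets top_derivs_nonneg \<delta> B p(1) s _ \<Lambda>]) (use p(2) in auto)
   also have "(\<integral>\<^sup>+ w. ennreal (?G w powr p) * indicator (cball ?y D) w \<partial>lborel) \<le>
     (\<integral>\<^sup>+ w. ennreal (?G w powr p) * indicator (cball y (2 * D)) w \<partial>lborel)"
   proof (intro nn_integral_mono mult_left_mono)
    have "norm \<omega> \<le> (\<Sum>i\<in>UNIV. \<bar>\<omega> $ i\<bar>)" by (rule norm_le_l1_cart)
    also have "\<dots> \<le> (\<Sum>i\<in>(UNIV::'d set). 1)" using prodf_std_bump_eq_0[OF False] by (intro sum_mono) (simp add: less_imp_le)
    finally have nD: "norm (\<epsilon> *\<^sub>R \<omega>) \<le> D" using \<epsilon> by (simp add: order_trans[OF mult_left_mono])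
    have "cball ?y D \<subseteq> cball y (2 * D)"
    proof (intro subsetI)
     fix v assume "v \<in> cball ?y D"
     moreover note nD
     moreover have "dist y v \<le> dist y ?y + dist ?y v" by (rule dist_triangle)
     moreover have "dist y ?y = norm (\<epsilon> *\<^sub>R \<omega>)" by (simp add: dist_norm)
     ultimately show "v \<in> cball y (2 * D)" by simp
    qed
    then show "indicator (cball ?y D) w \<le> (indicator (cball y (2 * D)) w :: ennreal)" for w by (auto simp: indicator_def)
   qed simp
   finally show ?thesis by (simp add: add_left_mono mult_left_mono mult_right_mono)
  qed simp
 qed
 also have "\<dots> = ?Br * ennreal (bump_mass TYPE('d))" by (subst nn_integral_cmult) (auto simp: nn_integral_std_bump)
 finally have "(\<integral>\<^sup>+ z. indicator B z * ennreal \<bar>R z\<bar> \<partial>lborel) \<le> ?c * (?Br * ennreal (bump_mass TYPE('d)))"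
  by (intro order_trans[OF 1] mult_left_mono) auto
 then show ?thesis using \<epsilon> D bump_mass_pos[where 'd = 'd] by (simp add: ennreal_mult mult_ac)
qed

lemma moll_approximates:
 fixes f :: "real ^ 'd::finite \<Rightarrow> real"
 assumes f: "integrable lborel f" and \<epsilon>: "\<epsilon> > 0"
  and \<kappa>: "\<And>w. w \<in> cbox (y - (\<chi> i. \<epsilon>)) (y + (\<chi> i. \<epsilon>)) \<Longrightarrow> \<bar>f w - f y\<bar> \<le> \<kappa>"
 shows "\<bar>moll f \<epsilon> y - \<epsilon> ^ CARD('d) * bump_mass TYPE('d) * f y\<bar> \<le> \<kappa> * (\<epsilon> ^ CARD('d) * bump_mass TYPE('d))"
proof -
 let ?h = "\<lambda>w. prodf std_bump (\<lambda>_. 0) ((1 / \<epsilon>) *\<^sub>R (y - w))" and ?N = "\<epsilon> ^ CARD('d) * bump_mass TYPE('d)"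
 have [measurable]: "f \<in> borel_measurable borel" using borel_measurable_integrable[OF f] by simp
 have N: "?N \<ge> 0" using \<epsilon> bump_mass_pos[where 'd = 'd] by simp
 have h: "integrable lborel ?h" "(LINT w|lborel. ?h w) = ?N"
 proof -
  have 1: "(\<integral>\<^sup>+ w. ennreal (?h w) \<partial>lborel) = ennreal ?N" by (rule moll_const[OF \<epsilon>])
  then show "integrable lborel ?h" by (intro integrableI_nonneg) (auto simp: prodf_std_bump_nonneg)
  show "(LINT w|lborel. ?h w) = ?N" using 1 N by (subst integral_eq_nn_integral) (auto simp: prodf_std_bump_nonneg)
 qed
 have fh: "integrable lborel (\<lambda>w. f w * ?h w)"
 proof (rule Bochner_Integration.integrable_bound[OF f])
  show "AE w in lborel. norm (f w * ?h w) \<le> norm (f w)"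
   by (intro AE_I2) (auto simp: abs_mult prodf_std_bump_nonneg prodf_std_bump_le_1 intro!: mult_left_le)
 qed measurable
 have eq: "moll f \<epsilon> y - ?N * f y = (LINT w|lborel. f w * ?h w - f y * ?h w)" unfolding moll_def using fh h by simp
 have le: "\<bar>LINT w|lborel. f w * ?h w - f y * ?h w\<bar> \<le> (LINT w|lborel. \<kappa> * ?h w)"
 proof (intro integral_abs_bound_integral)
  show "integrable lborel (\<lambda>w. f w * ?h w - f y * ?h w)" "integrable lborel (\<lambda>w. \<kappa> * ?h w)" using fh h by auto
  show "\<bar>f w * ?h w - f y * ?h w\<bar> \<le> \<kappa> * ?h w" for w
  proof (cases "w \<in> cbox (y - (\<chi> i. \<epsilon>)) (y + (\<chi> i. \<epsilon>))")
   case True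
   have "\<bar>f w * ?h w - f y * ?h w\<bar> = \<bar>f w - f y\<bar> * ?h w"
    by (simp add: left_diff_distrib[symmetric] abs_mult prodf_std_bump_nonneg)
   then show ?thesis using \<kappa>[OF True] by (simp add: mult_right_mono prodf_std_bump_nonneg)
  next
   case False
   show ?thesis using prodf_std_bump_scaled_zero[OF \<epsilon> False, of "\<lambda>_. 0"] by simp
  qed
 qed
 have "(LINT w|lborel. \<kappa> * ?h w) = \<kappa> * (LINT w|lborel. ?h w)" by (rule integral_mult_right_zero)
 then show ?thesis unfolding eq using le by (simp only: h(2))
qed

text \<open>\<open>\<epsilon>\<close> depends on the modulus of continuity of \<open>f\<close> at
  the points of \<open>Y\<close>. This is harmless because the remainder estimates, divided by the
  mass of the kernel, do not depend on \<open>\<epsilon>\<close>.\<close>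

lemma moll_at_small_scale:
 fixes f :: "real ^ 'd::finite \<Rightarrow> real"
 assumes wd: "weak_data \<Omega> s f g" and \<Omega>: "open \<Omega>" and s: "s > 0"
  and T: "compact T" "convex T" "T \<subseteq> \<Omega>" and Y: "finite Y" "Y \<subseteq> T" and \<kappa>: "\<kappa> > 0" and D: "D > 0"
 obtains \<epsilon> F where "\<epsilon> > 0" "\<epsilon> * real CARD('d) \<le> D"
  "\<And>y. y \<in> Y \<Longrightarrow> \<bar>F y - \<epsilon> ^ CARD('d) * bump_mass TYPE('d) * f y\<bar> \<le> \<kappa> * (\<epsilon> ^ CARD('d) * bump_mass TYPE('d))"
  "\<And>y z. y \<in> T \<Longrightarrow> z \<in> T \<Longrightarrow> F y = taylor_poly s g \<epsilon> z y +
    moll_remainder s g \<epsilon> y z"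
proof -
 obtain \<epsilon>0 where \<epsilon>0: "\<epsilon>0 > 0" "(\<Union>x\<in>T. cball x \<epsilon>0) \<subseteq> \<Omega>" using compact_subset_open_imp_cball_epsilon_subset[OF T(1) \<Omega> T(3)] by blast
 define K where "K = {x + y | x y. x \<in> T \<and> y \<in> cball 0 \<epsilon>0}"
 have K: "compact K" unfolding K_def by (intro compact_sums T compact_cball)
 have cK: "cball x \<epsilon>0 \<subseteq> K" if "x \<in> T" for x
 proof
  fix w assume "w \<in> cball x \<epsilon>0"
  then have "w - x \<in> cball 0 \<epsilon>0" by (simp add: dist_norm norm_minus_commute)
  moreover have "w = x + (w - x)" by simp
  ultimately show "w \<in> K" unfolding K_def using that by blast
 qed
 have K\<Omega>: "K \<subseteq> \<Omega>"
 proof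
  fix w assume "w \<in> K"
  then obtain x v where xv: "x \<in> T" "v \<in> cball 0 \<epsilon>0" "w = x + v" unfolding K_def by blast
  then have "w \<in> cball x \<epsilon>0" by (simp add: dist_norm)
  then show "w \<in> \<Omega>" using \<epsilon>0(2) xv(1) by blast
 qed
 have fc: "continuous_on \<Omega> f" using wd by (simp add: weak_data_def)
 have "\<forall>y\<in>Y. \<exists>\<eta>>0. \<forall>w. dist w y < \<eta> \<longrightarrow> \<bar>f w - f y\<bar> \<le> \<kappa>"
 proof
  fix y assume "y \<in> Y"
  then have "y \<in> \<Omega>" using Y T by blast
  then have "isCont f y" using fc \<Omega> continuous_on_eq_continuous_at by blast
  then obtain \<eta> where "\<eta> > 0" "\<And>w. dist w y < \<eta> \<Longrightarrow> dist (f w) (f y) < \<kappa>" using \<kappa> unfolding continuous_at_eps_delta by blast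
  then show "\<exists>\<eta>>0. \<forall>w. dist w y < \<eta> \<longrightarrow> \<bar>f w - f y\<bar> \<le> \<kappa>" by (intro exI[of _ \<eta>]) (auto simp: dist_real_def less_imp_le)
 qed
 then obtain \<eta> where \<eta>: "\<And>y. y \<in> Y \<Longrightarrow> \<eta> y > 0" "\<And>y w. y \<in> Y \<Longrightarrow> dist w y < \<eta> y \<Longrightarrow> \<bar>f w - f y\<bar> \<le> \<kappa>" by metis
 let ?d = "real CARD('d)"
 define m where "m = Min (insert \<epsilon>0 (insert D (\<eta> ` Y)))"
 have "m > 0" unfolding m_def using Y(1) \<epsilon>0(1) D \<eta>(1) by (subst Min_gr_iff) auto
 moreover have "m \<le> a" if "a \<in> insert \<epsilon>0 (insert D (\<eta> ` Y))" for a unfolding m_def using Y(1) that by (intro Min_le) auto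
 ultimately have m: "m > 0" "m \<le> \<epsilon>0" "m \<le> D" "\<And>y. y \<in> Y \<Longrightarrow> m \<le> \<eta> y" by auto
 \<comment> \<open>By comparison with the sum norm, a cube of half side \<open>\<epsilon>\<close>
   stays within distance \<open>m / 2\<close> of its centre.\<close>
 define \<epsilon> where "\<epsilon> = m / (2 * ?d)"
 have d: "?d > 0" by simp
 have \<epsilon>: "\<epsilon> > 0" "\<epsilon> * ?d = m / 2" unfolding \<epsilon>_def using m d by auto
 have cb: "dist w p \<le> m / 2" if "w \<in> cbox (p - (\<chi> i. \<epsilon>)) (p + (\<chi> i. \<epsilon>))" for w p :: "real ^ 'd"
 proof -
  have "\<bar>(w - p) $ i\<bar> \<le> \<epsilon>" for i using that by (auto simp: mem_box_cart abs_le_iff algebra_simps)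
  then have "(\<Sum>i\<in>UNIV. \<bar>(w - p) $ i\<bar>) \<le> ?d * \<epsilon>" using sum_mono[of UNIV "\<lambda>i. \<bar>(w - p) $ i\<bar>" "\<lambda>_. \<epsilon>"] by simp
  then show ?thesis using norm_le_l1_cart[of "w - p"] \<epsilon>(2) by (simp add: dist_norm mult.commute)
 qed
 have cbK: "cbox (p - (\<chi> i. \<epsilon>)) (p + (\<chi> i. \<epsilon>)) \<subseteq> K" if "p \<in> T" for p
 proof
  fix w assume "w \<in> cbox (p - (\<chi> i. \<epsilon>)) (p + (\<chi> i. \<epsilon>))"
  from cb[OF this] have "w \<in> cball p \<epsilon>0" using m by (simp add: dist_commute)
  then show "w \<in> K" using cK[OF that] by blast
 qed
 have fint: "integrable lborel (\<lambda>w. indicator K w * f w)"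
  using borel_integrable_compact[OF K continuous_on_subset[OF fc K\<Omega>]] by simp
 show ?thesis
 proof (rule that[of \<epsilon> "moll (\<lambda>w. indicator K w * f w) \<epsilon>"])
  show "\<epsilon> > 0" "\<epsilon> * real CARD('d) \<le> D" using \<epsilon> m by auto
  show "\<bar>moll (\<lambda>w. indicator K w * f w) \<epsilon> y - \<epsilon> ^ CARD('d) * bump_mass TYPE('d) * f y\<bar> \<le> \<kappa> * (\<epsilon> ^ CARD('d) * bump_mass TYPE('d))"
   if y: "y \<in> Y" for y
  proof -
   have yK: "y \<in> K" using cK[of y] y Y(2) \<epsilon>0(1) centre_in_cball[of y \<epsilon>0] by (meson less_imp_le subset_eq)
   have "\<bar>indicator K w * f w - indicator K y * f y\<bar> \<le> \<kappa>" if "w \<in> cbox (y - (\<chi> i. \<epsilon>)) (y + (\<chi> i. \<epsilon>))" for w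
   proof -
    have "w \<in> K" using cbK[of y] y Y that by blast
    moreover have "dist w y < \<eta> y" using cb[OF that] m(1) m(4)[OF y] by linarith
    ultimately show ?thesis using \<eta>(2)[OF y] yK by simp
   qed
   from moll_approximates[OF fint \<epsilon>(1) this] show ?thesis using yK by simp
  qed
  show "moll (\<lambda>w. indicator K w * f w) \<epsilon> y = taylor_poly s g \<epsilon> z y +
    moll_remainder s g \<epsilon> y z"
   if y: "y \<in> T" "z \<in> T" for y z
  proof (rule moll_taylor[OF wd s \<epsilon>(1) K K\<Omega>])
   fix t :: real assume t: "0 \<le> t" "t \<le> 1"
   have "z + t *\<^sub>R (y - z) = (1 - t) *\<^sub>R z + t *\<^sub>R y" by (simp add: algebra_simps)
   then have "z + t *\<^sub>R (y - z) \<in> T" using T(2) y t unfolding convex_alt by metis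
   then show "cbox (z + t *\<^sub>R (y - z) - (\<chi> i. \<epsilon>)) (z + t *\<^sub>R (y - z) + (\<chi> i. \<epsilon>)) \<subseteq> K" by (rule cbK)
  qed
 qed
qed

text \<open>The mollified \<open>f\<close> is a polynomial plus a remainder, for every base point
  \<open>z\<close> in \<open>B\<close>. The polynomial at \<open>x\<close> is bounded by its values
  at the nodes, which are again those of \<open>f\<close> up to remainders. Integration over
  \<open>B\<close> controls all remainders at once and is the source of the factor \<open>b\<close>
  on both sides.\<close>

theorem pointwise_estimate:
 fixes f :: "real ^ 'd::finite \<Rightarrow> real" and X :: "'i \<Rightarrow> real ^ 'd"
 assumes wd: "weak_data \<Omega> s f g" and \<Omega>: "open \<Omega>" and s: "s > 0"
  and g: "\<And>\<alpha>. g \<alpha> \<in> borel_measurable borel"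
  and T: "compact T" "convex T" "T \<subseteq> \<Omega>"
  and B: "B \<in> sets borel" "B \<subseteq> T" "emeasure lborel B = ennreal b" "b > 0"
  and J: "finite J" "x \<in> T" "\<And>j. j \<in> J \<Longrightarrow> X j \<in> T"
  and \<delta>: "0 < \<delta>" and dist: "\<And>y z. y \<in> insert x (X ` J) \<Longrightarrow> z \<in> B \<Longrightarrow> \<delta> \<le> dist z y \<and> dist z y \<le> D"
  and norming: "\<And>Q. sep_poly s Q \<Longrightarrow> \<bar>Q x\<bar> \<le> Cn * (\<Sum>j\<in>J. \<bar>Q (X j)\<bar>)" and Cn: "Cn \<ge> 0"
  and p: "p \<ge> 1" "real CARD('d) / p < real s \<or> (p = 1 \<and> s = CARD('d))" and \<Lambda>: "\<Lambda> > 0"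
  and S: "S \<ge> 0" "\<And>y. y \<in> insert x (X ` J) \<Longrightarrow>
    local_energy s g p y (2 * D) \<le> ennreal S"
 shows "b * \<bar>f x\<bar> \<le> (1 + Cn * real (card J)) * (real CARD('d) * D) ^ s *
   (embed_const CARD('d) p s * \<Lambda> * b + D / \<delta> * \<Lambda> powr (1 - p) * S) + Cn * (\<Sum>j\<in>J. b * \<bar>f (X j)\<bar>)"
proof -
 let ?d = "real CARD('d)"
 let ?A = "embed_const CARD('d) p s * \<Lambda> * b + D / \<delta> * \<Lambda> powr (1 - p) * S"
 have "B \<noteq> {}" using B(3,4) by auto
 then obtain z0 where "z0 \<in> B" by auto
 then have D: "D > 0" using dist[of x z0] \<delta> by auto
 have ec: "embed_const CARD('d) p s \<ge> 0" unfolding embed_const_def using p by auto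
 have A: "?A \<ge> 0" using ec \<Lambda> B(4) D \<delta> S(1) by (intro add_nonneg_nonneg mult_nonneg_nonneg) auto
 \<comment> \<open>\<kappa> is the error of mollification at \<open>x\<close> and at the nodes; it
   is sent to 0 after \<open>\<epsilon>\<close> has disappeared.\<close>
 have key: "b * \<bar>f x\<bar> \<le> (1 + Cn * real (card J)) * (?d * D) ^ s * ?A + Cn * (\<Sum>j\<in>J. b * \<bar>f (X j)\<bar>) + \<kappa> * (b + Cn * real (card J) * b)"
  if \<kappa>: "\<kappa> > 0" for \<kappa>
 proof -
  obtain \<epsilon> F where \<epsilon>: "\<epsilon> > 0" "\<epsilon> * ?d \<le> D"
   and Fapp: "\<And>y. y \<in> insert x (X ` J) \<Longrightarrow> \<bar>F y - \<epsilon> ^ CARD('d) * bump_mass TYPE('d) * f y\<bar> \<le> \<kappa> * (\<epsilon> ^ CARD('d) * bump_mass TYPE('d))"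
   and F: "\<And>y z. y \<in> T \<Longrightarrow> z \<in> T \<Longrightarrow> F y = taylor_poly s g \<epsilon> z y +
    moll_remainder s g \<epsilon> y z"
  proof (rule moll_at_small_scale[OF wd \<Omega> s T _ _ \<kappa> D, of "insert x (X ` J)"], goal_cases)
   case (3 \<epsilon> F)
   show ?case by (rule that) (fact 3)+
  qed (use J in auto)
  define N where "N = \<epsilon> ^ CARD('d) * bump_mass TYPE('d)"
  have N: "N > 0" unfolding N_def using \<epsilon>(1) bump_mass_pos[where 'd = 'd] by simp
  define R where "R y z = F y - taylor_poly s g \<epsilon> z y" for y z
  have Rm: "(\<lambda>z. R y z) \<in> borel_measurable borel" for y
   unfolding R_def by (intro borel_measurable_diff borel_measurable_const borel_measurable_taylor_poly g)
  have R: "(\<integral>\<^sup>+ z. indicator B z * ennreal \<bar>R y z\<bar> \<partial>lborel) \<le> ennreal ((?d * D) ^ s * N * ?A)"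
   if y: "y \<in> insert x (X ` J)" for y
  proof -
   have yT: "y \<in> T" using y J by auto
   have "(\<integral>\<^sup>+ z. indicator B z * ennreal \<bar>R y z\<bar> \<partial>lborel) \<le>
     ennreal ((?d * D) ^ s) * ennreal (\<epsilon> ^ CARD('d) * bump_mass TYPE('d)) *
     (ennreal (embed_const CARD('d) p s * \<Lambda>) * emeasure lborel B +
     ennreal (D / \<delta> * \<Lambda> powr (1 - p)) * local_energy s g p y (2 * D))"
    by (rule moll_remainder_average[OF g \<epsilon> s B(1) \<delta> dist[OF y] p \<Lambda>])
      (use F[OF yT] B(2) in \<open>auto simp: R_def\<close>)
   also have "\<dots> \<le> ennreal ((?d * D) ^ s) * ennreal N * (ennreal (embed_const CARD('d) p s * \<Lambda>) * ennreal b +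
     ennreal (D / \<delta> * \<Lambda> powr (1 - p)) * ennreal S)" unfolding B(3) N_def by (intro mult_left_mono add_left_mono S(2)[OF y]) auto
   also have "\<dots> = ennreal ((?d * D) ^ s * N * ?A)" using D N ec \<Lambda> B(4) \<delta> S(1)
    by (simp add: ennreal_mult[symmetric] ennreal_plus[symmetric] del: ennreal_plus)
   finally show ?thesis .
  qed
  \<comment> \<open>Norming is applied to the Taylor polynomial about this particular
    \<open>z\<close>; its values are then expressed by \<open>F\<close> and
    \<open>R\<close>.\<close>
  have pw: "\<bar>F x\<bar> \<le> \<bar>R x z\<bar> + Cn * (\<Sum>j\<in>J. \<bar>F (X j)\<bar> + \<bar>R (X j) z\<bar>)" for z
  proof -
   have "\<bar>taylor_poly s g \<epsilon> z x\<bar> \<le> Cn * (\<Sum>j\<in>J. \<bar>taylor_poly s g \<epsilon> z (X j)\<bar>)" by (rule norming[OF sep_poly_taylor_poly[OF s]])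
   also have "\<dots> \<le> Cn * (\<Sum>j\<in>J. \<bar>F (X j)\<bar> + \<bar>R (X j) z\<bar>)" using Cn by (intro mult_left_mono sum_mono) (auto simp: R_def)
   finally show ?thesis unfolding R_def by linarith
  qed
  have "ennreal (b * \<bar>F x\<bar>) = (\<integral>\<^sup>+ z. indicator B z * ennreal \<bar>F x\<bar> \<partial>lborel)"
   using B by (simp add: nn_integral_multc ennreal_mult)
  also have "\<dots> \<le> (\<integral>\<^sup>+ z. indicator B z * ennreal \<bar>R x z\<bar> + ennreal Cn * (\<Sum>j\<in>J. indicator B z * ennreal \<bar>F (X j)\<bar> + indicator B z * ennreal \<bar>R (X j) z\<bar>) \<partial>lborel)"
  proof (rule nn_integral_mono)
   fix z
   have "ennreal \<bar>F x\<bar> \<le> ennreal \<bar>R x z\<bar> + ennreal Cn * (\<Sum>j\<in>J. ennreal \<bar>F (X j)\<bar> + ennreal \<bar>R (X j) z\<bar>)"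
   proof -
    have "(\<Sum>j\<in>J. ennreal \<bar>F (X j)\<bar> + ennreal \<bar>R (X j) z\<bar>) = ennreal (\<Sum>j\<in>J. \<bar>F (X j)\<bar> + \<bar>R (X j) z\<bar>)"
     by (subst sum_ennreal[symmetric]) auto
    then have "ennreal \<bar>R x z\<bar> + ennreal Cn * (\<Sum>j\<in>J. ennreal \<bar>F (X j)\<bar> + ennreal \<bar>R (X j) z\<bar>) =
      ennreal (\<bar>R x z\<bar> + Cn * (\<Sum>j\<in>J. \<bar>F (X j)\<bar> + \<bar>R (X j) z\<bar>))" using Cn by (simp add: ennreal_mult sum_nonneg)
    then show ?thesis using pw[of z] by (simp add: ennreal_leI del: ennreal_plus)
   qed
   then show "indicator B z * ennreal \<bar>F x\<bar> \<le> indicator B z * ennreal \<bar>R x z\<bar> +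
     ennreal Cn * (\<Sum>j\<in>J. indicator B z * ennreal \<bar>F (X j)\<bar> + indicator B z * ennreal \<bar>R (X j) z\<bar>)" by (auto simp: indicator_def)
  qed
  also have "\<dots> = (\<integral>\<^sup>+ z. indicator B z * ennreal \<bar>R x z\<bar> \<partial>lborel) +
    ennreal Cn * (\<Sum>j\<in>J. (\<integral>\<^sup>+ z. indicator B z * ennreal \<bar>F (X j)\<bar> \<partial>lborel) + (\<integral>\<^sup>+ z. indicator B z * ennreal \<bar>R (X j) z\<bar> \<partial>lborel))"
   using Rm B(1) by (subst nn_integral_add) (auto simp: nn_integral_cmult nn_integral_sum nn_integral_add)
  also have "\<dots> \<le> ennreal ((?d * D) ^ s * N * ?A) + ennreal Cn * (\<Sum>j\<in>J. ennreal (b * \<bar>F (X j)\<bar>) + ennreal ((?d * D) ^ s * N * ?A))"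
   using B R by (intro add_mono mult_left_mono sum_mono) (auto simp: nn_integral_multc ennreal_mult)
  also have "(\<Sum>j\<in>J. ennreal (b * \<bar>F (X j)\<bar>) + ennreal ((?d * D) ^ s * N * ?A)) =
    ennreal (\<Sum>j\<in>J. b * \<bar>F (X j)\<bar> + (?d * D) ^ s * N * ?A)" using B(4) D N A by (subst sum_ennreal[symmetric]) auto
  also have "ennreal ((?d * D) ^ s * N * ?A) + ennreal Cn * \<dots> =
    ennreal ((?d * D) ^ s * N * ?A + Cn * (\<Sum>j\<in>J. b * \<bar>F (X j)\<bar> + (?d * D) ^ s * N * ?A))"
   using B(4) D N A Cn by (subst ennreal_plus) (auto simp: ennreal_mult sum_nonneg)
  finally have 1: "b * \<bar>F x\<bar> \<le> (?d * D) ^ s * N * ?A + Cn * (\<Sum>j\<in>J. b * \<bar>F (X j)\<bar> + (?d * D) ^ s * N * ?A)"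
   by (rule ennreal_le_iff[THEN iffD1, rotated])
     (use B(4) D N A Cn in \<open>auto intro!: add_nonneg_nonneg mult_nonneg_nonneg sum_nonneg\<close>)
  have Fle: "\<bar>F y\<bar> \<le> N * \<bar>f y\<bar> + \<kappa> * N" "N * \<bar>f y\<bar> \<le> \<bar>F y\<bar> + \<kappa> * N" if "y \<in> insert x (X ` J)" for y
  proof -
   have "\<bar>F y - N * f y\<bar> \<le> \<kappa> * N" using Fapp[OF that] by (simp add: N_def)
   moreover have "\<bar>N * f y\<bar> = N * \<bar>f y\<bar>" using N by (simp add: abs_mult)
   ultimately show "\<bar>F y\<bar> \<le> N * \<bar>f y\<bar> + \<kappa> * N" "N * \<bar>f y\<bar> \<le> \<bar>F y\<bar> + \<kappa> * N" by linarith+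
  qed
  have "N * (b * \<bar>f x\<bar>) = b * (N * \<bar>f x\<bar>)" by simp
  also have "\<dots> \<le> b * (\<bar>F x\<bar> + \<kappa> * N)" using Fle(2)[of x] B(4) by (intro mult_left_mono) auto
  also have "\<dots> \<le> (?d * D) ^ s * N * ?A + Cn * (\<Sum>j\<in>J. b * \<bar>F (X j)\<bar> + (?d * D) ^ s * N * ?A) + b * (\<kappa> * N)"
   using 1 by (simp add: distrib_left)
  also have "\<dots> \<le> (?d * D) ^ s * N * ?A + Cn * (\<Sum>j\<in>J. b * (N * \<bar>f (X j)\<bar> + \<kappa> * N) + (?d * D) ^ s * N * ?A) + b * (\<kappa> * N)"
   using Fle(1) B(4) Cn by (intro add_right_mono add_left_mono mult_left_mono sum_mono) auto
  also have "\<dots> = N * ((1 + Cn * real (card J)) * (?d * D) ^ s * ?A + Cn * (\<Sum>j\<in>J. b * \<bar>f (X j)\<bar>) + \<kappa> * (b + Cn * real (card J) * b))"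
   by (simp add: sum.distrib sum_distrib_left algebra_simps)
  finally show ?thesis using N by (simp only: mult_le_cancel_left_pos)
 qed
 let ?W = "b + Cn * real (card J) * b"
 have W: "?W > 0" using B(4) Cn by (intro add_pos_nonneg) auto
 show ?thesis
 proof (rule field_le_epsilon)
  fix e :: real assume "e > 0"
  then have "e / ?W > 0" using W by simp
  from key[OF this] show "b * \<bar>f x\<bar> \<le> (1 + Cn * real (card J)) * (?d * D) ^ s * ?A + Cn * (\<Sum>j\<in>J. b * \<bar>f (X j)\<bar>) + e"
   using W by simp
 qed
qed

text \<open>The variant without nodes. The Taylor polynomial is bounded instead by the integrals
  over \<open>B\<close> of the mollified derivatives of lower order.\<close>

theorem pointwise_embedding:
 fixes f :: "real ^ 'd::finite \<Rightarrow> real"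
 assumes wd: "weak_data \<Omega> s f g" and \<Omega>: "open \<Omega>" and s: "s > 0"
  and g: "\<And>\<alpha>. g \<alpha> \<in> borel_measurable borel"
  and T: "compact T" "convex T" "T \<subseteq> \<Omega>"
  and B: "B \<in> sets borel" "B \<subseteq> T" "emeasure lborel B = ennreal b" "b > 0"
  and x: "x \<in> T"
  and \<delta>: "0 < \<delta>" and dist: "\<And>z. z \<in> B \<Longrightarrow> \<delta> \<le> dist z x \<and> dist z x \<le> D"
  and p: "p \<ge> 1" "real CARD('d) / p < real s \<or> (p = 1 \<and> s = CARD('d))" and \<Lambda>: "\<Lambda> > 0"
  and S: "S \<ge> 0" "local_energy s g p x (2 * D) \<le> ennreal S"
  and E: "E \<ge> 0" "\<And>\<alpha>. \<alpha> \<in> multi_indices s \<Longrightarrow> (\<integral>\<^sup>+ w. ennreal \<bar>g \<alpha> w\<bar> \<partial>lborel) \<le> ennreal E"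
 shows "b * \<bar>f x\<bar> \<le> (real CARD('d) * D) ^ s * (embed_const CARD('d) p s * \<Lambda> * b + D / \<delta> * \<Lambda> powr (1 - p) * S) +
   (\<Sum>k<s. (real CARD('d) * D) ^ k * (real (card (multi_indices s :: ('d \<Rightarrow> nat) set)) * E))"
proof -
 let ?d = "real CARD('d)" and ?m = "real (card (multi_indices s :: ('d \<Rightarrow> nat) set))"
 let ?A = "embed_const CARD('d) p s * \<Lambda> * b + D / \<delta> * \<Lambda> powr (1 - p) * S"
 let ?E = "\<Sum>k<s. (?d * D) ^ k * (?m * E)"
 have "B \<noteq> {}" using B(3,4) by auto
 then obtain z0 where "z0 \<in> B" by auto
 then have D: "D > 0" using dist[of z0] \<delta> by auto
 have ec: "embed_const CARD('d) p s \<ge> 0" unfolding embed_const_def using p by auto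
 have A: "?A \<ge> 0" using ec \<Lambda> B(4) D \<delta> S(1) by (intro add_nonneg_nonneg mult_nonneg_nonneg) auto
 have E0: "?E \<ge> 0" using D E(1) by (intro sum_nonneg mult_nonneg_nonneg) auto
 have key: "b * \<bar>f x\<bar> \<le> (?d * D) ^ s * ?A + ?E + \<kappa> * b" if \<kappa>: "\<kappa> > 0" for \<kappa>
 proof -
  obtain \<epsilon> F where \<epsilon>: "\<epsilon> > 0" "\<epsilon> * ?d \<le> D"
   and Fapp: "\<bar>F x - \<epsilon> ^ CARD('d) * bump_mass TYPE('d) * f x\<bar> \<le> \<kappa> * (\<epsilon> ^ CARD('d) * bump_mass TYPE('d))"
   and F: "\<And>y z. y \<in> T \<Longrightarrow> z \<in> T \<Longrightarrow> F y = taylor_poly s g \<epsilon> z y +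
    moll_remainder s g \<epsilon> y z"
  proof (rule moll_at_small_scale[OF wd \<Omega> s T _ _ \<kappa> D, of "{x}"], goal_cases)
   case (3 \<epsilon> F)
   have 33: "\<bar>F x - \<epsilon> ^ CARD('d) * bump_mass TYPE('d) * f x\<bar> \<le> \<kappa> * (\<epsilon> ^ CARD('d) * bump_mass TYPE('d))" using 3 by simp
   show ?case by (rule that) (fact 3 33)+
  qed (use x in auto)
  define N where "N = \<epsilon> ^ CARD('d) * bump_mass TYPE('d)"
  have N: "N > 0" unfolding N_def using \<epsilon>(1) bump_mass_pos[where 'd = 'd] by simp
  define R where "R z = F x - taylor_poly s g \<epsilon> z x" for z
  have Tm[measurable]: "(\<lambda>z. taylor_poly s g \<epsilon> z x) \<in> borel_measurable borel" by (rule borel_measurable_taylor_poly[OF g])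
  have Rm[measurable]: "R \<in> borel_measurable borel" unfolding R_def[abs_def] by measurable
  have [measurable]: "B \<in> sets borel" "\<And>\<alpha>. g \<alpha> \<in> borel_measurable borel" by (fact B g)+
  have R: "(\<integral>\<^sup>+ z. indicator B z * ennreal \<bar>R z\<bar> \<partial>lborel) \<le> ennreal ((?d * D) ^ s * N * ?A)"
  proof -
   have "(\<integral>\<^sup>+ z. indicator B z * ennreal \<bar>R z\<bar> \<partial>lborel) \<le>
     ennreal ((?d * D) ^ s) * ennreal (\<epsilon> ^ CARD('d) * bump_mass TYPE('d)) *
     (ennreal (embed_const CARD('d) p s * \<Lambda>) * emeasure lborel B +
     ennreal (D / \<delta> * \<Lambda> powr (1 - p)) * local_energy s g p x (2 * D))" by (rule moll_remainder_average[OF g \<epsilon> s B(1) \<delta> dist p \<Lambda>])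
      (use F[OF x] B(2) in \<open>auto simp: R_def\<close>)
   also have "\<dots> \<le> ennreal ((?d * D) ^ s) * ennreal N * (ennreal (embed_const CARD('d) p s * \<Lambda>) * ennreal b +
     ennreal (D / \<delta> * \<Lambda> powr (1 - p)) * ennreal S)" unfolding B(3) N_def by (intro mult_left_mono add_left_mono S(2)) auto
   also have "\<dots> = ennreal ((?d * D) ^ s * N * ?A)" using D N ec \<Lambda> B(4) \<delta> S(1)
    by (simp add: ennreal_mult[symmetric] ennreal_plus[symmetric] del: ennreal_plus)
   finally show ?thesis .
  qed
  \<comment> \<open>Mollifying multiplies the integral of the absolute value by at most the mass of
    the kernel.\<close>
  have M: "(\<integral>\<^sup>+ z. ennreal \<bar>moll (g \<alpha>) \<epsilon> z\<bar> \<partial>lborel) \<le> ennreal (N * E)" if \<alpha>: "\<alpha> \<in> multi_indices s" for \<alpha>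
  proof -
   let ?h = "\<lambda>z w. ennreal (prodf std_bump (\<lambda>_. 0) ((1 / \<epsilon>) *\<^sub>R (z - w)))"
   have "(\<integral>\<^sup>+ z. ennreal \<bar>moll (g \<alpha>) \<epsilon> z\<bar> \<partial>lborel) \<le> (\<integral>\<^sup>+ z. (\<integral>\<^sup>+ w. ennreal \<bar>g \<alpha> w\<bar> * ?h z w \<partial>lborel) \<partial>lborel)"
    by (intro nn_integral_mono abs_moll_le g \<epsilon>(1))
   also have "\<dots> = (\<integral>\<^sup>+ w. (\<integral>\<^sup>+ z. ennreal \<bar>g \<alpha> w\<bar> * ?h z w \<partial>lborel) \<partial>lborel)" by (rule lborel_pair.Fubini') measurable
   also have "\<dots> = (\<integral>\<^sup>+ w. ennreal \<bar>g \<alpha> w\<bar> * ennreal N \<partial>lborel)"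
   proof (rule nn_integral_cong)
    fix w :: "real ^ 'd"
    have "(\<integral>\<^sup>+ z. ?h z w \<partial>lborel) = ennreal (\<bar>\<epsilon>\<bar> ^ DIM(real ^ 'd)) * (\<integral>\<^sup>+ z. ?h (w + \<epsilon> *\<^sub>R z) w \<partial>lborel)"
     using \<epsilon> by (intro nn_integral_lborel_affine[of "\<lambda>z. ?h z w" \<epsilon> w]) auto
    also have "\<dots> = ennreal N" using \<epsilon>(1) bump_mass_pos[where 'd = 'd] by (simp add: nn_integral_std_bump N_def ennreal_mult)
    finally show "(\<integral>\<^sup>+ z. ennreal \<bar>g \<alpha> w\<bar> * ?h z w \<partial>lborel) = ennreal \<bar>g \<alpha> w\<bar> * ennreal N" by (subst nn_integral_cmult) auto
   qed
   also have "\<dots> = (\<integral>\<^sup>+ w. ennreal \<bar>g \<alpha> w\<bar> \<partial>lborel) * ennreal N" by (rule nn_integral_multc) measurable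
   also have "\<dots> \<le> ennreal E * ennreal N" by (intro mult_right_mono E(2)[OF \<alpha>]) simp
   finally show ?thesis using E(1) N by (simp add: ennreal_mult mult.commute)
  qed
  have Q: "(\<integral>\<^sup>+ z. indicator B z * ennreal \<bar>taylor_poly s g \<epsilon> z x\<bar> \<partial>lborel) \<le> ennreal (N * ?E)"
  proof -
   let ?c = "\<lambda>z. \<Sum>\<alpha>\<in>multi_indices s. ennreal \<bar>moll (g \<alpha>) \<epsilon> z\<bar>"
   have "(\<integral>\<^sup>+ z. indicator B z * ennreal \<bar>taylor_poly s g \<epsilon> z x\<bar> \<partial>lborel) \<le>
     (\<integral>\<^sup>+ z. (\<Sum>k<s. ennreal ((?d * D) ^ k) * ?c z) \<partial>lborel)"
   proof (rule nn_integral_mono)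
    fix z
    show "indicator B z * ennreal \<bar>taylor_poly s g \<epsilon> z x\<bar> \<le> (\<Sum>k<s. ennreal ((?d * D) ^ k) * ?c z)"
    proof (cases "z \<in> B")
     case True
     have "\<bar>tay k (x - z) (\<lambda>\<alpha>. moll (g \<alpha>) \<epsilon> z) (\<lambda>_. 0) / fact k\<bar> \<le> (?d * D) ^ k * (\<Sum>\<alpha>\<in>multi_indices s. \<bar>moll (g \<alpha>) \<epsilon> z\<bar>)"
      if k: "k < s" for k
     proof -
      have "\<bar>tay k (x - z) (\<lambda>\<alpha>. moll (g \<alpha>) \<epsilon> z) (\<lambda>_. 0) / fact k\<bar> \<le> \<bar>tay k (x - z) (\<lambda>\<alpha>. moll (g \<alpha>) \<epsilon> z) (\<lambda>_. 0)\<bar>"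
       using fact_ge_1[of k, where 'a = real] by (simp add: divide_le_eq mult_le_cancel_left1)
      also have "\<dots> \<le> (?d * norm (x - z)) ^ k * (\<Sum>\<alpha>\<in>{\<alpha>. (\<Sum>i\<in>UNIV. \<alpha> i) = k}. \<bar>moll (g \<alpha>) \<epsilon> z\<bar>)"
       using tay_bound[of k "x - z" "\<lambda>\<alpha>. moll (g \<alpha>) \<epsilon> z" "\<lambda>_. 0"] by simp
      also have "\<dots> \<le> (?d * D) ^ k * (\<Sum>\<alpha>\<in>multi_indices s. \<bar>moll (g \<alpha>) \<epsilon> z\<bar>)"
      proof (intro mult_mono power_mono mult_left_mono sum_mono2 finite_multi_indices)
       show "norm (x - z) \<le> D" using dist[OF True] by (simp add: dist_norm norm_minus_commute)
       show "{\<alpha>. (\<Sum>i\<in>UNIV. \<alpha> i) = k} \<subseteq> multi_indices s" using k by (auto simp: multi_indices_def)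
      qed (auto intro!: sum_nonneg zero_le_power mult_nonneg_nonneg simp: D less_imp_le)
      finally show ?thesis .
     qed
     then have "\<bar>taylor_poly s g \<epsilon> z x\<bar> \<le> (\<Sum>k<s. (?d * D) ^ k * (\<Sum>\<alpha>\<in>multi_indices s. \<bar>moll (g \<alpha>) \<epsilon> z\<bar>))"
      unfolding taylor_poly_def by (intro order_trans[OF sum_abs] sum_mono) auto
     then have "ennreal \<bar>taylor_poly s g \<epsilon> z x\<bar> \<le> ennreal (\<Sum>k<s. (?d * D) ^ k * (\<Sum>\<alpha>\<in>multi_indices s. \<bar>moll (g \<alpha>) \<epsilon> z\<bar>))"
      by (rule ennreal_leI)
     also have "\<dots> = (\<Sum>k<s. ennreal ((?d * D) ^ k) * ?c z)"
      using D by (subst sum_ennreal[symmetric]) (auto simp: ennreal_mult sum_nonneg intro!: sum.cong mult_nonneg_nonneg)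
     finally show ?thesis using True by simp
    qed simp
   qed
   also have "\<dots> = (\<Sum>k<s. ennreal ((?d * D) ^ k) * (\<Sum>\<alpha>\<in>multi_indices s. (\<integral>\<^sup>+ z. ennreal \<bar>moll (g \<alpha>) \<epsilon> z\<bar> \<partial>lborel)))"
    by (simp add: nn_integral_sum nn_integral_cmult del: sum_ennreal)
   also have "\<dots> \<le> (\<Sum>k<s. ennreal ((?d * D) ^ k) * (\<Sum>\<alpha>\<in>(multi_indices s :: ('d \<Rightarrow> nat) set). ennreal (N * E)))"
    by (intro sum_mono mult_left_mono M) auto
   also have "\<dots> = ennreal (\<Sum>k<s. (?d * D) ^ k * (?m * (N * E)))"
    using D N E(1) by (subst sum_ennreal[symmetric]) (auto simp: ennreal_mult ennreal_of_nat_eq_real_of_nat intro!: sum.cong mult_nonneg_nonneg)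
   also have "(\<Sum>k<s. (?d * D) ^ k * (?m * (N * E))) = N * ?E" by (simp add: sum_distrib_left mult_ac)
   finally show ?thesis .
  qed
  have "ennreal (b * \<bar>F x\<bar>) = (\<integral>\<^sup>+ z. indicator B z * ennreal \<bar>F x\<bar> \<partial>lborel)"
   using B by (simp add: nn_integral_multc ennreal_mult)
  also have "\<dots> \<le> (\<integral>\<^sup>+ z. indicator B z * ennreal \<bar>R z\<bar> + indicator B z * ennreal \<bar>taylor_poly s g \<epsilon> z x\<bar> \<partial>lborel)"
   by (intro nn_integral_mono) (auto simp: indicator_def R_def ennreal_plus[symmetric] simp del: ennreal_plus intro!: ennreal_leI)
  also have "\<dots> = (\<integral>\<^sup>+ z. indicator B z * ennreal \<bar>R z\<bar> \<partial>lborel) + (\<integral>\<^sup>+ z. indicator B z * ennreal \<bar>taylor_poly s g \<epsilon> z x\<bar> \<partial>lborel)"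
   by (rule nn_integral_add) measurable
  also have "\<dots> \<le> ennreal ((?d * D) ^ s * N * ?A) + ennreal (N * ?E)" by (intro add_mono R Q)
  also have "\<dots> = ennreal ((?d * D) ^ s * N * ?A + N * ?E)"
   using D N A E0 by (subst ennreal_plus) (auto intro!: mult_nonneg_nonneg)
  finally have 1: "b * \<bar>F x\<bar> \<le> (?d * D) ^ s * N * ?A + N * ?E" by (rule ennreal_le_iff[THEN iffD1, rotated])
     (use D N A E0 in \<open>auto intro!: add_nonneg_nonneg mult_nonneg_nonneg\<close>)
  have "\<bar>F x - N * f x\<bar> \<le> \<kappa> * N" using Fapp by (simp add: N_def)
  moreover have "\<bar>N * f x\<bar> = N * \<bar>f x\<bar>" using N by (simp add: abs_mult)
  ultimately have "N * \<bar>f x\<bar> \<le> \<bar>F x\<bar> + \<kappa> * N" by linarith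
  then have "b * (N * \<bar>f x\<bar>) \<le> b * (\<bar>F x\<bar> + \<kappa> * N)" using B(4) by (intro mult_left_mono) auto
  then have "N * (b * \<bar>f x\<bar>) \<le> (?d * D) ^ s * N * ?A + N * ?E + b * (\<kappa> * N)" using 1 by (simp add: distrib_left mult.left_commute)
  also have "\<dots> = N * ((?d * D) ^ s * ?A + ?E + \<kappa> * b)" by (simp add: algebra_simps)
  finally show ?thesis using N by (simp only: mult_le_cancel_left_pos)
 qed
 show ?thesis
 proof (rule field_le_epsilon)
  fix e :: real assume "e > 0"
  then have "e / b > 0" using B(4) by simp
  from key[OF this] show "b * \<bar>f x\<bar> \<le> (?d * D) ^ s * ?A + ?E + e" using B(4) by simp
 qed
qed

subsection \<open>The local estimate on cone domains\<close>

text \<open>The direction of the cone varies with \<open>x\<close>. A finite net on a sphere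
  replaces it by one of finitely many vectors, at the price of a slightly thinner cone; later
  constants need to be uniform only over this finite set.\<close>

lemma interior_cone_finite_directions:
 fixes \<Omega> :: "(real ^ 'd::finite) set"
 assumes "interior_cone_condition \<Omega>"
 obtains V \<rho> c where "finite V" "c > 0" "8 * c \<le> \<rho>" "\<And>v. v \<in> V \<Longrightarrow> norm v = \<rho>"
  "\<And>x. x \<in> \<Omega> \<Longrightarrow> \<exists>v\<in>V. \<forall>\<tau>\<in>{0..1}. cball (x + \<tau> *\<^sub>R v) (\<tau> * c) \<subseteq> \<Omega>"
proof -
 obtain r \<theta> where r: "r > 0" and \<theta>: "0 < \<theta>" "\<theta> \<le> pi"
  and cone: "\<And>x. x \<in> \<Omega> \<Longrightarrow> \<exists>\<xi>. norm \<xi> = 1 \<and> finite_cone r \<theta> x \<xi> \<subseteq> \<Omega>" using assms unfolding interior_cone_condition_def by auto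
 define k where "k = cos \<theta>"
 have k: "k < 1" "k \<ge> -1" unfolding k_def using cos_monotone_0_pi[of 0 \<theta>] \<theta> by auto
 define \<rho> where "\<rho> = r / 2"
 \<comment> \<open>Chosen such that all points within \<open>2 * c\<close> of
   \<open>\<rho> *\<^sub>R \<xi>\<close> have norm at most \<open>r\<close> and make an admissible
   angle with \<open>\<xi>\<close>. One \<open>c\<close> is the mesh of the net of directions, the
   other the radius of the balls along the axis.\<close>
 define c where "c = \<rho> * min (1 / 4) ((1 - k) / 4) / 2"
 have \<rho>: "\<rho> > 0" unfolding \<rho>_def using r by simp
 have "min (1 / 4) ((1 - k) / 4) > 0" using k by simp
 then have c: "c > 0" unfolding c_def using \<rho> by simp
 have "c \<le> \<rho> * (1 / 4) / 2" unfolding c_def using \<rho> by (intro divide_right_mono mult_left_mono min.cobounded1) auto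
 then have c8: "8 * c \<le> \<rho>" by simp
 have "c \<le> \<rho> * ((1 - k) / 4) / 2" unfolding c_def using \<rho> by (intro divide_right_mono mult_left_mono min.cobounded2) auto
 then have ck: "8 * c \<le> \<rho> * (1 - k)" by simp
 have ck1: "c * k \<le> c" using c k by (intro mult_left_le) auto
 have ck2: "8 * c \<le> \<rho> - k * \<rho>" using ck by (simp add: algebra_simps)
 have "k * \<rho> + 2 * (c * k) \<le> \<rho> - 2 * c" using ck1 ck2 c by linarith
 then have ck': "k * (\<rho> + 2 * c) \<le> \<rho> - 2 * c" by (simp add: algebra_simps)
 have inc: "x + \<tau> *\<^sub>R w \<in> finite_cone r \<theta> x \<xi>"
  if w: "dist w (\<rho> *\<^sub>R \<xi>) \<le> 2 * c" and \<xi>: "norm \<xi> = 1" and \<tau>: "0 \<le> \<tau>" "\<tau> \<le> 1" for x w \<xi> :: "real ^ 'd" and \<tau>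
 proof -
  let ?n = "norm w"
  have "norm (\<rho> *\<^sub>R \<xi>) = \<rho>" using \<xi> \<rho> by simp
  then have n: "\<rho> - 2 * c \<le> ?n" "?n \<le> \<rho> + 2 * c" using w norm_triangle_ineq2[of "\<rho> *\<^sub>R \<xi>" w] norm_triangle_ineq2[of w "\<rho> *\<^sub>R \<xi>"]
   by (auto simp: dist_norm norm_minus_commute)
  have np: "?n > 0" "?n \<le> r" using n c8 c by (auto simp: \<rho>_def)
  have "(w - \<rho> *\<^sub>R \<xi>) \<bullet> \<xi> \<ge> - (2 * c)" using Cauchy_Schwarz_ineq2[of "w - \<rho> *\<^sub>R \<xi>" \<xi>] w \<xi> by (simp add: dist_norm abs_le_iff)
  moreover have "(w - \<rho> *\<^sub>R \<xi>) \<bullet> \<xi> = w \<bullet> \<xi> - \<rho>" using \<xi> by (simp add: inner_diff_left dot_square_norm)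
  ultimately have wx: "w \<bullet> \<xi> \<ge> \<rho> - 2 * c" by simp
  have "k * ?n \<le> w \<bullet> \<xi>"
  proof (cases "k \<ge> 0")
   case True
   then have "k * ?n \<le> k * (\<rho> + 2 * c)" using n by (intro mult_left_mono) auto
   then show ?thesis using ck' wx by linarith
  next
   case False
   then have "k * ?n \<le> 0" using np by (simp add: mult_nonpos_nonneg)
   then show ?thesis using wx c8 c by linarith
  qed
  then have "((1 / ?n) *\<^sub>R w) \<bullet> \<xi> \<ge> k" using np by (simp add: field_simps)
  moreover have "norm ((1 / ?n) *\<^sub>R w) = 1" using np by simp
  moreover have "\<tau> * ?n \<in> {0..r}"
  proof -
   have "\<tau> * ?n \<le> ?n" using \<tau> np by (intro mult_left_le_one_le) auto
   then have "\<tau> * ?n \<le> r" using np by linarith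
   then show ?thesis using \<tau> by simp
  qed
  moreover have "x + \<tau> *\<^sub>R w = x + (\<tau> * ?n) *\<^sub>R ((1 / ?n) *\<^sub>R w)" using np by simp
  ultimately show ?thesis unfolding finite_cone_def k_def by blast
 qed
 have "compact (sphere (0 :: real ^ 'd) \<rho>)" by simp
 moreover have "sphere (0 :: real ^ 'd) \<rho> \<subseteq> (\<Union>v\<in>sphere 0 \<rho>. ball v c)" using c by force
 ultimately obtain V where V: "V \<subseteq> sphere (0 :: real ^ 'd) \<rho>" "finite V" "sphere (0 :: real ^ 'd) \<rho> \<subseteq> (\<Union>v\<in>V. ball v c)"
  using compactE_image[of "sphere (0 :: real ^ 'd) \<rho>" "sphere 0 \<rho>" "\<lambda>v. ball v c"] by auto
 show ?thesis
 proof (rule that[OF V(2) c c8])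
  show "norm v = \<rho>" if "v \<in> V" for v using V(1) that by auto
  fix x assume "x \<in> \<Omega>"
  then obtain \<xi> where \<xi>: "norm \<xi> = 1" "finite_cone r \<theta> x \<xi> \<subseteq> \<Omega>" using cone by blast
  have "\<rho> *\<^sub>R \<xi> \<in> sphere 0 \<rho>" using \<xi> \<rho> by simp
  then have "\<rho> *\<^sub>R \<xi> \<in> (\<Union>v\<in>V. ball v c)" using V(3) by blast
  then obtain v where v: "v \<in> V" "dist v (\<rho> *\<^sub>R \<xi>) < c" by auto
  have "cball (x + \<tau> *\<^sub>R v) (\<tau> * c) \<subseteq> \<Omega>" if \<tau>: "\<tau> \<in> {0..1}" for \<tau>
  proof
   fix u assume u: "u \<in> cball (x + \<tau> *\<^sub>R v) (\<tau> * c)"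
   show "u \<in> \<Omega>"
   proof (cases "\<tau> = 0")
    case True
    have "x + 0 *\<^sub>R (\<rho> *\<^sub>R \<xi>) \<in> finite_cone r \<theta> x \<xi>" by (rule inc) (use \<xi> c in auto)
    then show ?thesis using True u \<xi> by auto
   next
    case False
    then have \<tau>0: "\<tau> > 0" using \<tau> by simp
    define w where "w = (1 / \<tau>) *\<^sub>R (u - x)"
    have "w - v = (1 / \<tau>) *\<^sub>R (u - (x + \<tau> *\<^sub>R v))" unfolding w_def using \<tau>0 by (simp add: algebra_simps)
    then have "norm (w - v) = (1 / \<tau>) * dist u (x + \<tau> *\<^sub>R v)" using \<tau>0 by (simp add: dist_norm)
    also have "\<dots> \<le> (1 / \<tau>) * (\<tau> * c)" using u \<tau>0 by (intro mult_left_mono) (auto simp: dist_commute)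
    finally have "dist w v \<le> c" using \<tau>0 by (simp add: dist_norm)
    then have "dist w (\<rho> *\<^sub>R \<xi>) \<le> 2 * c" using dist_triangle[of w "\<rho> *\<^sub>R \<xi>" v] v(2) by linarith
    then have "x + \<tau> *\<^sub>R w \<in> finite_cone r \<theta> x \<xi>" using \<xi>(1) \<tau> by (intro inc) auto
    moreover have "x + \<tau> *\<^sub>R w = u" unfolding w_def using \<tau>0 by simp
    ultimately show ?thesis using \<xi>(2) by auto
   qed
  qed
  then show "\<exists>v\<in>V. \<forall>\<tau>\<in>{0..1}. cball (x + \<tau> *\<^sub>R v) (\<tau> * c) \<subseteq> \<Omega>" using v(1) by blast
 qed
qed

text \<open>The convex hull of 0 and \<open>cball v c\<close>, written as the union of the balls
  shrunk towards 0. Its scaled translates are the compact convex sets in which the Taylor expansions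
  take place.\<close>

definition ice_cone :: "real ^ 'd::finite \<Rightarrow> real \<Rightarrow> (real ^ 'd) set" where
 "ice_cone v c = {w. \<exists>\<tau>\<in>{0..1}. dist w (\<tau> *\<^sub>R v) \<le> \<tau> * c}"

lemma compact_ice_cone:
 fixes v :: "real ^ 'd::finite"
 assumes "c \<ge> 0"
 shows "compact (ice_cone v c)"
proof -
 have "ice_cone v c = (\<lambda>(\<tau>, u). \<tau> *\<^sub>R v + (\<tau> * c) *\<^sub>R u) ` ({0..1} \<times> cball 0 1)" (is "_ = ?F ` _")
 proof
  show "ice_cone v c \<subseteq> ?F ` ({0..1} \<times> cball 0 1)"
  proof
   fix w assume "w \<in> ice_cone v c"
   then obtain \<tau> where \<tau>: "\<tau> \<in> {0..1}" "dist w (\<tau> *\<^sub>R v) \<le> \<tau> * c" unfolding ice_cone_def by blast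
   show "w \<in> ?F ` ({0..1} \<times> cball 0 1)"
   proof (cases "\<tau> * c = 0")
    case True
    then have "w = \<tau> *\<^sub>R v" using \<tau>(2) by (metis dist_le_zero_iff)
    then have "w = ?F (\<tau>, 0)" by simp
    then show ?thesis using \<tau> by (intro image_eqI[of _ _ "(\<tau>, 0)"]) auto
   next
    case False
    then have pos: "\<tau> * c > 0" using \<tau>(1) assms by (simp add: less_le)
    define u where "u = (1 / (\<tau> * c)) *\<^sub>R (w - \<tau> *\<^sub>R v)"
    have "norm u = dist w (\<tau> *\<^sub>R v) / (\<tau> * c)" unfolding u_def using pos \<tau>(1) assms by (simp add: dist_norm)
    then have "norm u \<le> 1" using \<tau>(2) pos by (simp add: divide_le_eq_1)
    moreover have "w = ?F (\<tau>, u)" unfolding u_def using False by simp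
    ultimately show ?thesis using \<tau> by (intro image_eqI[of _ _ "(\<tau>, u)"]) auto
   qed
  qed
  show "?F ` ({0..1} \<times> cball 0 1) \<subseteq> ice_cone v c"
  proof (clarsimp simp: ice_cone_def)
   fix \<tau> :: real and u :: "real ^ 'd" assume "0 \<le> \<tau>" "\<tau> \<le> 1" "norm u \<le> 1"
   then show "\<exists>\<tau>'\<in>{0..1}. dist (\<tau> *\<^sub>R v + (\<tau> * c) *\<^sub>R u) (\<tau>' *\<^sub>R v) \<le> \<tau>' * c"
    using assms by (intro bexI[of _ \<tau>]) (auto simp: dist_norm abs_mult intro: mult_left_le)
  qed
 qed
 moreover have "compact (?F ` ({0..1} \<times> cball 0 1))"
  unfolding case_prod_beta by (intro compact_continuous_image continuous_intros compact_Times) auto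
 ultimately show ?thesis by simp
qed

lemma convex_ice_cone: "convex (ice_cone v c)" unfolding convex_def
proof (intro ballI allI impI)
 fix w1 w2 and a b :: real
 assume "w1 \<in> ice_cone v c" "w2 \<in> ice_cone v c" and ab: "0 \<le> a" "0 \<le> b" "a + b = 1"
 then obtain t1 t2 where t1: "t1 \<in> {0..1}" "dist w1 (t1 *\<^sub>R v) \<le> t1 * c"
  and t2: "t2 \<in> {0..1}" "dist w2 (t2 *\<^sub>R v) \<le> t2 * c" unfolding ice_cone_def by blast
 let ?t = "a * t1 + b * t2"
 have "?t \<le> a * 1 + b * 1" using ab t1 t2 by (intro add_mono mult_left_mono) auto
 then have "?t \<in> {0..1}" using ab t1 t2 by auto
 moreover have "dist (a *\<^sub>R w1 + b *\<^sub>R w2) (?t *\<^sub>R v) \<le> ?t * c"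
 proof -
  have "a *\<^sub>R w1 + b *\<^sub>R w2 - ?t *\<^sub>R v = a *\<^sub>R (w1 - t1 *\<^sub>R v) + b *\<^sub>R (w2 - t2 *\<^sub>R v)" by (simp add: algebra_simps)
  then have "dist (a *\<^sub>R w1 + b *\<^sub>R w2) (?t *\<^sub>R v) \<le> norm (a *\<^sub>R (w1 - t1 *\<^sub>R v)) + norm (b *\<^sub>R (w2 - t2 *\<^sub>R v))"
   unfolding dist_norm by (metis norm_triangle_ineq)
  also have "\<dots> \<le> a * (t1 * c) + b * (t2 * c)" using ab t1 t2 by (intro add_mono) (auto simp: dist_norm intro!: mult_left_mono)
  finally show ?thesis by (simp add: algebra_simps)
 qed
 ultimately show "a *\<^sub>R w1 + b *\<^sub>R w2 \<in> ice_cone v c" unfolding ice_cone_def by blast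
qed

text \<open>Carries norming from the integer grid to a grid of any position and mesh.\<close>

lemma sep_poly_affine:
 assumes "sep_poly s Q"
 shows "sep_poly s (\<lambda>u. Q (a + k *\<^sub>R u))" unfolding sep_poly_def
proof (intro allI)
 fix i u
 obtain q where q: "degree q < s" "\<And>t. Q (vupd (a + k *\<^sub>R u) i t) = poly q t" using assms unfolding sep_poly_def by metis
 have "a + k *\<^sub>R vupd u i t = vupd (a + k *\<^sub>R u) i (a $ i + k * t)" for t by (simp add: vec_eq_iff vupd_nth)
 then have "Q (a + k *\<^sub>R vupd u i t) = poly (pcompose q [:a $ i, k:]) t" for t by (simp add: q(2) poly_pcompose mult.commute)
 moreover have "degree (pcompose q [:a $ i, k:]) < s"
 proof -
  have "degree (pcompose q [:a $ i, k:]) \<le> degree q * degree [:a $ i, k:]" by (rule degree_pcompose_le)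
  also have "\<dots> \<le> degree q * 1" by (intro mult_left_mono) auto
  finally show ?thesis using q(1) by simp
 qed
 ultimately show "\<exists>p. degree p < s \<and> (\<forall>t. Q (a + k *\<^sub>R vupd u i t) = poly p t)" by blast
qed

lemma measure_cball_pos:
 fixes x :: "'a::euclidean_space"
 assumes "r > 0"
 shows "emeasure lborel (cball x r) = ennreal (measure lborel (cball x r))" "measure lborel (cball x r) > 0"
proof -
 show "emeasure lborel (cball x r) = ennreal (measure lborel (cball x r))"
  using emeasure_lborel_cball_finite[of x r] by (intro emeasure_eq_ennreal_measure) auto
 show "measure lborel (cball x r) > 0" using content_cball_pos[OF assms, of x] by (simp add: measure_completion)
qed

lemma measure_cball_scale:
 fixes x :: "real ^ 'd::finite"
 assumes "t > 0" "r > 0"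
 shows "measure lborel (cball x (t * r)) = t ^ CARD('d) * measure lborel (cball (y :: real ^ 'd) r)"
 using assms content_cball[of "t * r" x] content_cball[of r y] by (simp add: measure_completion power_mult_distrib)

lemma le_twice_threshold:
 fixes a C I p T :: real
 assumes a: "a \<ge> 0" and C: "C \<ge> 0" and T: "T \<ge> 0" and I: "I \<ge> 0" and p: "p \<ge> 1"
  and le: "\<And>\<Lambda>. \<Lambda> > 0 \<Longrightarrow> a \<le> C * T * (\<Lambda> + \<Lambda> powr (1 - p) * I)"
 shows "a powr p \<le> (2 * C) powr p * T powr p * I"
proof (cases "I = 0")
 case True
 have "a \<le> 0"
 proof (rule field_le_epsilon)
  fix e :: real assume e: "e > 0"
  have "a \<le> C * T * (e / (C * T + 1))" using le[of "e / (C * T + 1)"] e C T True by (simp add: add_nonneg_pos)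
  also have "\<dots> = e * ((C * T) / (C * T + 1))" by simp
  also have "\<dots> \<le> e * 1" using e C T by (intro mult_left_mono) (auto simp: divide_le_eq_1 add_nonneg_pos)
  finally show "a \<le> 0 + e" by simp
 qed
 then have "a = 0" using a by simp
 then show ?thesis using True by simp
next
 case False
 then have I0: "I > 0" using I by simp
 define \<Lambda> where "\<Lambda> = I powr (1 / p)"
 have L: "\<Lambda> > 0" "\<Lambda> powr p = I" unfolding \<Lambda>_def using I0 p by (auto simp: powr_powr)
 have "\<Lambda> powr (1 - p) * I = \<Lambda> powr (1 - p) * \<Lambda> powr p" using L by simp
 also have "\<dots> = \<Lambda>" using L(1) powr_add[of \<Lambda> "1 - p" p] by simp
 finally have "a \<le> 2 * C * T * \<Lambda>" using le[OF L(1)] by (simp add: mult_ac)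
 then have "a powr p \<le> (2 * C * T * \<Lambda>) powr p" using a p by (intro powr_mono2) auto
 also have "\<dots> = (2 * C) powr p * T powr p * I" using C T L by (simp add: powr_mult)
 finally show ?thesis .
qed

text \<open>The centres are a small grid at \<open>v\<close>, in the wide part of the cone. If
  \<open>f\<close> vanishes near each scaled centre, these zeros are a perturbed grid and norm the
  polynomials at the apex \<open>x\<close>. Base points are taken near \<open>v / 2\<close>, away
  from the apex and from the zeros alike. Everything scales with \<open>t\<close>; the volume of
  \<open>B\<close> produces the power t^(-d).\<close>

lemma local_estimate_direction:
 fixes v :: "real ^ 'd::finite"
 assumes c: "c > 0" and vc: "8 * c \<le> norm v" and s: "s > 0"
  and p: "p \<ge> 1" "real CARD('d) / p < real s \<or> (p = 1 \<and> s = CARD('d))"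
 obtains Y \<eta> C where "finite Y" "\<eta> > 0" "C > 0" "\<And>y. y \<in> Y \<Longrightarrow> cball y \<eta> \<subseteq> cball v c"
  "\<And>\<Omega> f g x t I. weak_data \<Omega> s f g \<Longrightarrow> open \<Omega> \<Longrightarrow> (\<And>\<alpha>. g \<alpha> \<in> borel_measurable borel) \<Longrightarrow>
    (\<And>\<tau>. \<tau> \<in> {0..1} \<Longrightarrow> cball (x + \<tau> *\<^sub>R v) (\<tau> * c) \<subseteq> \<Omega>) \<Longrightarrow> 0 < t \<Longrightarrow> t \<le> 1 \<Longrightarrow>
    (\<And>y. y \<in> Y \<Longrightarrow> \<exists>u\<in>cball (x + t *\<^sub>R y) (t * \<eta>). f u = 0) \<Longrightarrow> I \<ge> 0 \<Longrightarrow>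
    local_energy s g p x (4 * norm v * t) \<le> ennreal I \<Longrightarrow>
    \<bar>f x\<bar> powr p \<le> C * t powr (real s * p - real CARD('d)) * I"
proof -
 let ?\<rho> = "norm v" and ?d = "real CARD('d)"
 have \<rho>: "?\<rho> > 0" using c vc by linarith
 \<comment> \<open>The mesh. Grid vectors have norm at most \<open>?d * real s\<close>, so all
   centres lie within \<open>c / 2\<close> of \<open>v\<close>.\<close>
 define \<beta> where "\<beta> = c / (2 * (?d * real s))"
 have ds: "?d * real s > 0" using s by simp
 have \<beta>: "\<beta> > 0" unfolding \<beta>_def using c ds by simp
 obtain \<kappa> Cn where \<kappa>: "\<kappa> > 0" and Cn: "Cn > 0"
  and norming: "\<And>(Q :: real ^ 'd \<Rightarrow> real) (N :: real ^ 'd \<Rightarrow> real ^ 'd) y. sep_poly s Q \<Longrightarrow>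
    (\<And>g i. g \<in> grid s \<Longrightarrow> \<bar>N g $ i - g $ i\<bar> \<le> \<kappa>) \<Longrightarrow> (\<forall>i. \<bar>y $ i\<bar> \<le> ?\<rho> / \<beta>) \<Longrightarrow>
    \<bar>Q y\<bar> \<le> Cn * (\<Sum>g\<in>grid s. \<bar>Q (N g)\<bar>)"
 proof (rule sep_poly_perturbed_grid[where 'd = 'd, of s "?\<rho> / \<beta>"], goal_cases)
  case (1 \<kappa> C)
  show ?case by (rule that) (fact 1)+
 qed
 let ?J = "grid s :: (real ^ 'd) set"
 let ?y = "\<lambda>j. v + \<beta> *\<^sub>R j"
 \<comment> \<open>In units of the mesh the zeros then deviate from the grid by at most \<kappa>,
   and they remain in \<open>cball v c\<close>.\<close>
 define \<eta> where "\<eta> = min (\<kappa> * \<beta>) (c / 2)"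
 have \<eta>: "\<eta> > 0" "\<eta> \<le> \<kappa> * \<beta>" "\<eta> \<le> c / 2" unfolding \<eta>_def using \<kappa> \<beta> c by auto
 have jn: "norm (\<beta> *\<^sub>R j) \<le> c / 2" if "j \<in> ?J" for j
 proof -
  have "norm j \<le> (\<Sum>i\<in>UNIV. \<bar>j $ i\<bar>)" by (rule norm_le_l1_cart)
  also have "\<dots> \<le> (\<Sum>i\<in>(UNIV::'d set). real s)"
  proof (rule sum_mono)
   fix i
   have "j $ i \<in> real ` {..<s}" using that by (simp add: grid_def)
   then show "\<bar>j $ i\<bar> \<le> real s" by auto
  qed
  finally have "norm j \<le> ?d * real s" by simp
  then have "\<beta> * norm j \<le> \<beta> * (?d * real s)" using \<beta> by (intro mult_left_mono) auto
  also have "\<dots> = c / 2" unfolding \<beta>_def using ds s by (simp add: field_simps)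
  finally show ?thesis using \<beta> by simp
 qed
 have yc: "cball (?y j) \<eta> \<subseteq> cball v c" if "j \<in> ?J" for j
 proof
  fix u assume "u \<in> cball (?y j) \<eta>"
  moreover have "dist v u \<le> dist v (?y j) + dist (?y j) u" by (rule dist_triangle)
  moreover have "dist v (?y j) = norm (\<beta> *\<^sub>R j)" by (simp add: dist_norm)
  ultimately show "u \<in> cball v c" using jn[OF that] \<eta>(3) by simp
 qed
 define b0 where "b0 = measure lborel (cball ((1 / 2) *\<^sub>R v) (c / 2))"
 have b0: "b0 > 0" unfolding b0_def using c by (intro measure_cball_pos) simp
 define e where "e = embed_const CARD('d) p s"
 have e: "e \<ge> 0" unfolding e_def embed_const_def using p by auto
 define C1 where "C1 = (1 + Cn * real (card ?J)) * (?d * ?\<rho>) ^ s"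
 have C1: "C1 > 0" unfolding C1_def using Cn \<rho> by (intro mult_pos_pos add_pos_nonneg) auto
 define C2 where "C2 = C1 * (e + 4 / b0 + 1)"
 have C2: "C2 > 0" unfolding C2_def using C1 e b0 by (intro mult_pos_pos add_nonneg_pos) auto
 show ?thesis
 proof (rule that[of "?y ` ?J" \<eta> "(2 * C2) powr p"])
  show "finite (?y ` ?J)" by (intro finite_imageI finite_grid)
  show "cball y \<eta> \<subseteq> cball v c" if "y \<in> ?y ` ?J" for y using that yc by blast
  show "\<eta> > 0" "(2 * C2) powr p > 0" using \<eta> C2 by auto
  fix \<Omega> f g x t I
  assume wd: "weak_data \<Omega> s f g" and \<Omega>: "open \<Omega>" and g: "\<And>\<alpha>. g \<alpha> \<in> borel_measurable borel"
   and cone: "\<And>\<tau>. \<tau> \<in> {0..1} \<Longrightarrow> cball (x + \<tau> *\<^sub>R v) (\<tau> * c) \<subseteq> \<Omega>" and t: "0 < t" "t \<le> 1"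
   and zero: "\<And>y. y \<in> ?y ` ?J \<Longrightarrow> \<exists>u\<in>cball (x + t *\<^sub>R y) (t * \<eta>). f u = 0"
   and I: "I \<ge> 0" "local_energy s g p x (4 * norm v * t) \<le> ennreal I"
  have "\<forall>j\<in>?J. \<exists>u. u \<in> cball (x + t *\<^sub>R ?y j) (t * \<eta>) \<and> f u = 0" using zero by blast
  then obtain X where X: "\<And>j. j \<in> ?J \<Longrightarrow> X j \<in> cball (x + t *\<^sub>R ?y j) (t * \<eta>)" "\<And>j. j \<in> ?J \<Longrightarrow> f (X j) = 0" by metis
  have Xv: "dist (X j) (x + t *\<^sub>R v) \<le> t * c" if "j \<in> ?J" for j
  proof -
   define u where "u = (1 / t) *\<^sub>R (X j - x)"
   have Xu: "X j = x + t *\<^sub>R u" unfolding u_def using t by simp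
   have "t * dist u (?y j) \<le> t * \<eta>"
    using X(1)[OF that] t unfolding Xu by (simp add: dist_norm scaleR_diff_right[symmetric] norm_minus_commute)
   then have "u \<in> cball (?y j) \<eta>" using t by (simp add: dist_commute)
   then have "dist u v \<le> c" using yc[OF that] by (auto simp: dist_commute)
   then show ?thesis unfolding Xu using t by (simp add: dist_norm scaleR_diff_right[symmetric])
  qed
  define T where "T = (\<lambda>w. x + t *\<^sub>R w) ` ice_cone v c"
  have T: "compact T" "convex T" unfolding T_def
   using c by (auto intro!: compact_continuous_image continuous_intros compact_ice_cone convex_affinity convex_ice_cone)
  have Tm: "x + t *\<^sub>R w \<in> T" if "dist w (\<tau> *\<^sub>R v) \<le> \<tau> * c" "\<tau> \<in> {0..1}" for w \<tau> unfolding T_def ice_cone_def using that by blast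
  have T\<Omega>: "T \<subseteq> \<Omega>"
  proof
   fix u assume "u \<in> T"
   then obtain w \<tau> where w: "u = x + t *\<^sub>R w" "\<tau> \<in> {0..1}" "dist w (\<tau> *\<^sub>R v) \<le> \<tau> * c" unfolding T_def ice_cone_def by blast
   have "t * \<tau> \<in> {0..1}" using t w(2) by (auto intro: mult_le_one)
   moreover have "dist (x + (t * \<tau>) *\<^sub>R v) u \<le> (t * \<tau>) * c"
   proof -
    have "dist (x + (t * \<tau>) *\<^sub>R v) u = norm (t *\<^sub>R (\<tau> *\<^sub>R v - w))" unfolding w(1) by (simp add: dist_norm algebra_simps)
    also have "\<dots> = t * dist w (\<tau> *\<^sub>R v)" using t by (simp add: dist_norm norm_minus_commute)
    also have "\<dots> \<le> t * (\<tau> * c)" using w(3) t by (intro mult_left_mono) auto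
    finally show ?thesis by (simp add: mult.assoc)
   qed
   ultimately show "u \<in> \<Omega>" using cone[of "t * \<tau>"] by (meson mem_cball subsetD)
  qed
  \<comment> \<open>The ball of the cone at half height: by \<open>8 * c \<le> norm v\<close> its
    distance from the apex and from the zeros is at least a quarter of
    \<open>t * norm v\<close>.\<close>
  define B where "B = cball (x + t *\<^sub>R ((1 / 2) *\<^sub>R v)) (t * (c / 2))"
  have Bd: "\<exists>w. z = x + t *\<^sub>R w \<and> dist w ((1 / 2) *\<^sub>R v) \<le> c / 2" if "z \<in> B" for z
  proof (intro exI conjI)
   let ?w = "(1 / t) *\<^sub>R (z - x)"
   show eq: "z = x + t *\<^sub>R ?w" using t by simp
   have "dist z (x + t *\<^sub>R ((1 / 2) *\<^sub>R v)) \<le> t * (c / 2)" using that by (simp add: B_def dist_commute)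
   moreover have "dist (x + t *\<^sub>R ?w) (x + t *\<^sub>R ((1 / 2) *\<^sub>R v)) = t * dist ?w ((1 / 2) *\<^sub>R v)"
   proof -
    have "(x + t *\<^sub>R ?w) - (x + t *\<^sub>R ((1 / 2) *\<^sub>R v)) = t *\<^sub>R (?w - (1 / 2) *\<^sub>R v)" by (simp add: scaleR_diff_right)
    then show ?thesis using t by (simp only: dist_norm norm_scaleR abs_of_pos)
   qed
   ultimately have "t * dist ?w ((1 / 2) *\<^sub>R v) \<le> t * (c / 2)" using eq by metis
   then show "dist ?w ((1 / 2) *\<^sub>R v) \<le> c / 2" using t by (simp only: mult_le_cancel_left_pos)
  qed
  have BT: "B \<subseteq> T"
  proof
   fix z assume "z \<in> B"
   from Bd[OF this] obtain w where w: "z = x + t *\<^sub>R w" "dist w ((1 / 2) *\<^sub>R v) \<le> c / 2" by blast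
   then show "z \<in> T" using Tm[of w "1 / 2"] by simp
  qed
  define b where "b = t ^ CARD('d) * b0"
  have b: "b > 0" "emeasure lborel B = ennreal b"
   unfolding b_def B_def b0_def using measure_cball_pos[of "t * (c / 2)" "x + t *\<^sub>R ((1 / 2) *\<^sub>R v)"]
    measure_cball_scale[of t "c / 2" "x + t *\<^sub>R ((1 / 2) *\<^sub>R v)" "(1 / 2) *\<^sub>R v"] t c by auto
  have dist: "t * (?\<rho> / 4) \<le> dist z y \<and> dist z y \<le> t * ?\<rho>"
   if y: "y \<in> insert x (X ` ?J)" and z: "z \<in> B" for y z
  proof -
   obtain w where w: "z = x + t *\<^sub>R w" "dist w ((1 / 2) *\<^sub>R v) \<le> c / 2" using Bd[OF z] by blast
   define u where "u = (1 / t) *\<^sub>R (y - x)"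
   have u: "y = x + t *\<^sub>R u" unfolding u_def using t by simp
   have "u = 0 \<or> dist u v \<le> c"
   proof (cases "y = x")
    case False
    then have "dist y (x + t *\<^sub>R v) \<le> t * c" using y Xv by auto
    then have "t * dist u v \<le> t * c" unfolding u using t by (simp add: dist_norm scaleR_diff_right[symmetric])
    then show ?thesis using t by simp
   qed (simp add: u_def)
   moreover have "norm ((1 / 2) *\<^sub>R v) = ?\<rho> / 2" by simp
   moreover have "dist ((1 / 2) *\<^sub>R v) v = ?\<rho> / 2"
   proof -
    have "(1 / 2) *\<^sub>R v - v = (1 / 2 - 1) *\<^sub>R v" by (simp only: scaleR_left_diff_distrib scaleR_one)
    then have "dist ((1 / 2) *\<^sub>R v) v = \<bar>1 / 2 - 1\<bar> * ?\<rho>" by (simp only: dist_norm norm_scaleR)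
    then show ?thesis by simp
   qed
   ultimately have "?\<rho> / 4 \<le> dist w u \<and> dist w u \<le> ?\<rho>"
   proof (elim disjE)
    assume *: "u = 0" "norm ((1 / 2) *\<^sub>R v) = ?\<rho> / 2"
    show ?thesis using * w(2) vc c dist_triangle[of w 0 "(1 / 2) *\<^sub>R v"] dist_triangle[of "(1 / 2) *\<^sub>R v" 0 w]
     by (simp add: dist_commute[of w])
   next
    assume *: "dist u v \<le> c" "dist ((1 / 2) *\<^sub>R v) v = ?\<rho> / 2"
    have "dist w u \<le> dist w ((1 / 2) *\<^sub>R v) + (dist ((1 / 2) *\<^sub>R v) v + dist v u)"
     by (meson add_left_mono dist_triangle order_trans)
    moreover have "dist ((1 / 2) *\<^sub>R v) v \<le> dist ((1 / 2) *\<^sub>R v) w + (dist w u + dist u v)"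
     by (meson add_left_mono dist_triangle order_trans)
    ultimately show ?thesis using * w(2) vc c by (simp add: dist_commute)
   qed
   moreover have "dist z y = t * dist w u" unfolding w u using t by (simp add: dist_norm scaleR_diff_right[symmetric])
   ultimately show ?thesis using t by simp
  qed
  have norm': "\<bar>Q x\<bar> \<le> Cn * (\<Sum>j\<in>?J. \<bar>Q (X j)\<bar>)" if Q: "sep_poly s Q" for Q
  proof -
   define N where "N j = (1 / (t * \<beta>)) *\<^sub>R (X j - (x + t *\<^sub>R v))" for j
   have A: "(x + t *\<^sub>R v) + (t * \<beta>) *\<^sub>R N j = X j" for j unfolding N_def using t \<beta> by simp
   \<comment> \<open>In grid coordinates the apex is \<open>(- 1 / \<beta>) *\<^sub>R v\<close>,
     which explains the range \<open>?\<rho> / \<beta>\<close> in the norming inequality.\<close>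
   have A0: "(x + t *\<^sub>R v) + (t * \<beta>) *\<^sub>R ((- 1 / \<beta>) *\<^sub>R v) = x" using \<beta> by simp
   have "\<bar>N j $ i - j $ i\<bar> \<le> \<kappa>" if "j \<in> ?J" for j i
   proof -
    have "N j - j = (1 / (t * \<beta>)) *\<^sub>R (X j - (x + t *\<^sub>R ?y j))" unfolding N_def using t \<beta> by (simp add: algebra_simps)
    then have "norm (N j - j) = (1 / (t * \<beta>)) * dist (X j) (x + t *\<^sub>R ?y j)" using t \<beta> by (simp add: dist_norm)
    also have "\<dots> \<le> (1 / (t * \<beta>)) * (t * \<eta>)" using X(1)[OF that] t \<beta> by (intro mult_left_mono) (auto simp: dist_commute)
    also have "\<dots> \<le> \<kappa>" using \<eta>(2) t \<beta> by (simp add: divide_le_eq)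
    finally show ?thesis using component_le_norm_cart[of "N j - j" i] by simp
   qed
   moreover have "\<forall>i. \<bar>((- 1 / \<beta>) *\<^sub>R v) $ i\<bar> \<le> ?\<rho> / \<beta>"
    using \<beta> component_le_norm_cart[of v] by (auto simp: abs_mult divide_right_mono)
   ultimately have "\<bar>Q ((x + t *\<^sub>R v) + (t * \<beta>) *\<^sub>R ((- 1 / \<beta>) *\<^sub>R v))\<bar> \<le>
     Cn * (\<Sum>j\<in>?J. \<bar>Q ((x + t *\<^sub>R v) + (t * \<beta>) *\<^sub>R N j)\<bar>)" by (intro norming[OF sep_poly_affine[OF Q]])
   then show ?thesis unfolding A A0 .
  qed
  have xT: "x \<in> T" using Tm[of 0 0] by simp
  have XT: "X j \<in> T" if "j \<in> ?J" for j
  proof -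
   let ?w = "(1 / t) *\<^sub>R (X j - x)"
   have eq: "X j = x + t *\<^sub>R ?w" using t by simp
   have "(x + t *\<^sub>R ?w) - (x + t *\<^sub>R v) = t *\<^sub>R (?w - v)" by (simp add: scaleR_diff_right)
   then have "dist (x + t *\<^sub>R ?w) (x + t *\<^sub>R v) = t * dist ?w v" using t by (simp only: dist_norm norm_scaleR abs_of_pos)
   then have "t * dist ?w v \<le> t * c" using Xv[OF that] eq by metis
   then have "dist ?w (1 *\<^sub>R v) \<le> 1 * c" using t by simp
   from Tm[OF this] show ?thesis using eq by simp
  qed
  have Iy: "local_energy s g p y (2 * (t * ?\<rho>)) \<le> ennreal I"
   if y: "y \<in> insert x (X ` ?J)" for y
  proof -
   have "dist x y \<le> t * (?\<rho> + c)"
   proof (cases "y = x")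
    case False
    then have "dist y (x + t *\<^sub>R v) \<le> t * c" using y Xv by auto
    moreover have "dist x (x + t *\<^sub>R v) = t * ?\<rho>" using t by (simp add: dist_norm)
    ultimately show ?thesis using dist_triangle[of x y "x + t *\<^sub>R v"] by (simp add: dist_commute distrib_left)
   qed (use t \<rho> c in simp)
   also have "\<dots> \<le> t * (2 * ?\<rho>)" using vc c t by (intro mult_left_mono) auto
   finally have "cball y (2 * (t * ?\<rho>)) \<subseteq> cball x (4 * ?\<rho> * t)"
   proof (intro subsetI)
    fix u assume "dist x y \<le> t * (2 * ?\<rho>)" "u \<in> cball y (2 * (t * ?\<rho>))"
    then show "u \<in> cball x (4 * ?\<rho> * t)" using dist_triangle[of x u y] by (simp add: mult_ac)
   qed
   then have "local_energy s g p y (2 * (t * ?\<rho>)) \<le>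
     local_energy s g p x (4 * ?\<rho> * t)" by (intro nn_integral_mono mult_left_mono) (auto simp: indicator_def)
   then show ?thesis using I(2) by (rule order_trans)
  qed
  have "\<bar>f x\<bar> \<le> C2 * t ^ s * (\<Lambda> + \<Lambda> powr (1 - p) * (I / t ^ CARD('d)))" if \<Lambda>: "\<Lambda> > 0" for \<Lambda>
  proof -
   have "b * \<bar>f x\<bar> \<le> (1 + Cn * real (card ?J)) * (?d * (t * ?\<rho>)) ^ s *
     (embed_const CARD('d) p s * \<Lambda> * b + (t * ?\<rho>) / (t * (?\<rho> / 4)) * \<Lambda> powr (1 - p) * I) + Cn * (\<Sum>j\<in>?J. b * \<bar>f (X j)\<bar>)"
   proof (rule pointwise_estimate[where X = X and J = ?J, OF wd \<Omega> s g T T\<Omega> _ BT b(2,1) finite_grid xT XT _ dist norm' _ p \<Lambda> I(1) Iy])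
    show "B \<in> sets borel" unfolding B_def by simp
    show "0 < t * (?\<rho> / 4)" using t \<rho> by simp
    show "0 \<le> Cn" using Cn by simp
   qed auto
   also have "(\<Sum>j\<in>?J. b * \<bar>f (X j)\<bar>) = 0" using X(2) by simp
   also have "(t * ?\<rho>) / (t * (?\<rho> / 4)) = 4" using t \<rho> by simp
   also have "(1 + Cn * real (card ?J)) * (?d * (t * ?\<rho>)) ^ s = C1 * t ^ s"
    unfolding C1_def by (simp add: power_mult_distrib mult_ac)
   finally have 1: "b * \<bar>f x\<bar> \<le> C1 * t ^ s * (e * \<Lambda> * b + 4 * \<Lambda> powr (1 - p) * I)" by (simp add: e_def)
   also have "e * \<Lambda> * b + 4 * \<Lambda> powr (1 - p) * I = b * (e * \<Lambda> + 4 / b0 * (\<Lambda> powr (1 - p) * (I / t ^ CARD('d))))"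
    unfolding b_def using b0 t by (simp add: field_simps)
   also have "\<dots> \<le> b * ((e + 4 / b0 + 1) * (\<Lambda> + \<Lambda> powr (1 - p) * (I / t ^ CARD('d))))"
   proof (intro mult_left_mono)
    define Z where "Z = \<Lambda> powr (1 - p) * (I / t ^ CARD('d))"
    have Z: "Z \<ge> 0" unfolding Z_def using I t by simp
    have "0 \<le> e * Z" "0 \<le> 4 / b0 * \<Lambda>" using e Z b0 \<Lambda> by auto
    then show "e * \<Lambda> + 4 / b0 * (\<Lambda> powr (1 - p) * (I / t ^ CARD('d))) \<le> (e + 4 / b0 + 1) * (\<Lambda> + \<Lambda> powr (1 - p) * (I / t ^ CARD('d)))"
     unfolding Z_def[symmetric] using Z \<Lambda> by (simp add: distrib_left distrib_right)
   qed (use b in simp)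
   finally have "b * \<bar>f x\<bar> \<le> C1 * t ^ s * (b * ((e + 4 / b0 + 1) * (\<Lambda> + \<Lambda> powr (1 - p) * (I / t ^ CARD('d)))))"
    using C1 t by (simp add: mult_left_mono)
   also have "\<dots> = b * (C2 * t ^ s * (\<Lambda> + \<Lambda> powr (1 - p) * (I / t ^ CARD('d))))" unfolding C2_def by (simp add: mult_ac)
   finally show ?thesis using b by (simp only: mult_le_cancel_left_pos)
  qed
  then have le: "\<bar>f x\<bar> powr p \<le> (2 * C2) powr p * (t ^ s) powr p * (I / t ^ CARD('d))"
   using C2 t I p by (intro le_twice_threshold) auto
  have "(t ^ s) powr p * (I / t ^ CARD('d)) = t powr (real s * p - ?d) * I"
   using t by (simp add: powr_realpow[symmetric] powr_powr powr_diff)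
  then show "\<bar>f x\<bar> powr p \<le> (2 * C2) powr p * t powr (real s * p - real CARD('d)) * I" using le by (simp only: mult.assoc)
 qed
qed

text \<open>\<open>Y\<close> is the union of the centres for all directions, although only one
  direction fits a given \<open>x\<close>. Therefore a zero is demanded only in those balls that lie
  in \<open>\<Omega>\<close>; this includes all balls of the fitting direction.\<close>

theorem local_estimate:
 fixes \<Omega> :: "(real ^ 'd::finite) set"
 assumes \<Omega>: "open \<Omega>" "interior_cone_condition \<Omega>" and s: "s > 0"
  and p: "p \<ge> 1" "real CARD('d) / p < real s \<or> (p = 1 \<and> s = CARD('d))"
 obtains Y \<eta> R C where "finite Y" "\<eta> > 0" "R > 0" "C > 0"
  "\<And>f g x t I. weak_data \<Omega> s f g \<Longrightarrow> (\<And>\<alpha>. g \<alpha> \<in> borel_measurable borel) \<Longrightarrow> x \<in> \<Omega> \<Longrightarrow> 0 < t \<Longrightarrow> t \<le> 1 \<Longrightarrow>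
    (\<And>y. y \<in> Y \<Longrightarrow> cball (x + t *\<^sub>R y) (t * \<eta>) \<subseteq> \<Omega> \<Longrightarrow> \<exists>u\<in>cball (x + t *\<^sub>R y) (t * \<eta>). f u = 0) \<Longrightarrow> I \<ge> 0 \<Longrightarrow>
    local_energy s g p x (R * t) \<le> ennreal I \<Longrightarrow>
    \<bar>f x\<bar> powr p \<le> C * t powr (real s * p - real CARD('d)) * I"
proof -
 obtain V \<rho> c where V: "finite V" "c > 0" "8 * c \<le> \<rho>" "\<And>v. v \<in> V \<Longrightarrow> norm v = \<rho>"
  "\<And>x. x \<in> \<Omega> \<Longrightarrow> \<exists>v\<in>V. \<forall>\<tau>\<in>{0..1}. cball (x + \<tau> *\<^sub>R v) (\<tau> * c) \<subseteq> \<Omega>"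
 proof (rule interior_cone_finite_directions[OF \<Omega>(2)], goal_cases)
  case (1 V c \<rho>)
  show ?case by (rule that) (fact 1)+
 qed
 define good where "good v Y \<eta> C \<longleftrightarrow> finite Y \<and> \<eta> > 0 \<and> C > 0 \<and> (\<forall>y\<in>Y. cball y \<eta> \<subseteq> cball v c) \<and>
  (\<forall>f g x t I. weak_data \<Omega> s f g \<longrightarrow> (\<forall>\<alpha>. g \<alpha> \<in> borel_measurable borel) \<longrightarrow>
    (\<forall>\<tau>\<in>{0..1}. cball (x + \<tau> *\<^sub>R v) (\<tau> * c) \<subseteq> \<Omega>) \<longrightarrow> 0 < t \<longrightarrow> t \<le> 1 \<longrightarrow>
    (\<forall>y\<in>Y. \<exists>u\<in>cball (x + t *\<^sub>R y) (t * \<eta>). f u = 0) \<longrightarrow> I \<ge> 0 \<longrightarrow>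
    local_energy s g p x (4 * norm v * t) \<le> ennreal I \<longrightarrow>
    \<bar>f x\<bar> powr p \<le> C * t powr (real s * p - real CARD('d)) * I)" for v :: "real ^ 'd" and Y \<eta> C
 have "\<exists>Y \<eta> C. good v Y \<eta> C" if v: "v \<in> V" for v
 proof (rule local_estimate_direction[OF V(2) _ s p, of v], goal_cases)
  case 1
  show ?case using V(3,4) v by simp
 next
  case (2 Y \<eta> C)
  have "good v Y \<eta> C" unfolding good_def
  proof (intro conjI allI impI ballI)
   fix f g x t I
   assume "weak_data \<Omega> s f g" "\<forall>\<alpha>. g \<alpha> \<in> borel_measurable borel"
    "\<forall>\<tau>\<in>{0..1}. cball (x + \<tau> *\<^sub>R v) (\<tau> * c) \<subseteq> \<Omega>" "0 < t" "t \<le> 1"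
    "\<forall>y\<in>Y. \<exists>u\<in>cball (x + t *\<^sub>R y) (t * \<eta>). f u = 0" "I \<ge> 0"
    "local_energy s g p x (4 * norm v * t) \<le> ennreal I"
   then show "\<bar>f x\<bar> powr p \<le> C * t powr (real s * p - real CARD('d)) * I" using 2(5)[of \<Omega> f g x t I] \<Omega>(1) by blast
  qed (use 2 in auto)
  then show ?case by blast
 qed
 then obtain Y \<eta> C where good: "\<And>v. v \<in> V \<Longrightarrow> good v (Y v) (\<eta> v) (C v)" by metis
 define \<eta>' where "\<eta>' = Min (insert 1 (\<eta> ` V))"
 have pos: "\<eta> v > 0" "C v > 0" if "v \<in> V" for v using good[OF that] by (auto simp: good_def)
 have "\<eta>' > 0" unfolding \<eta>'_def using V(1) pos by (subst Min_gr_iff) auto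
 have \<eta>': "\<eta>' \<le> \<eta> v" if "v \<in> V" for v unfolding \<eta>'_def using V(1) that by (intro Min_le) auto
 define C' where "C' = 1 + (\<Sum>v\<in>V. C v)"
 have C'0: "C' > 0" unfolding C'_def using pos by (intro add_pos_nonneg sum_nonneg) (auto simp: less_imp_le)
 have C': "C v \<le> C'" if "v \<in> V" for v
 proof -
  have "C v \<le> (\<Sum>v\<in>V. C v)" using pos V(1) that by (intro member_le_sum) (auto simp: less_imp_le)
  then show ?thesis by (simp add: C'_def)
 qed
 show ?thesis
 proof (rule that[of "\<Union>v\<in>V. Y v" \<eta>' "4 * \<rho>" C'])
  show "finite (\<Union>v\<in>V. Y v)" using V(1) good by (auto simp: good_def)
  show "4 * \<rho> > 0" using V by linarith
  fix f g x t I
  assume wd: "weak_data \<Omega> s f g" and g: "\<And>\<alpha>. g \<alpha> \<in> borel_measurable borel" and x: "x \<in> \<Omega>" and t: "0 < t" "t \<le> 1"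
   and zero: "\<And>y. y \<in> (\<Union>v\<in>V. Y v) \<Longrightarrow> cball (x + t *\<^sub>R y) (t * \<eta>') \<subseteq> \<Omega> \<Longrightarrow> \<exists>u\<in>cball (x + t *\<^sub>R y) (t * \<eta>'). f u = 0"
   and I: "I \<ge> 0" "local_energy s g p x (4 * \<rho> * t) \<le> ennreal I"
  obtain v where v: "v \<in> V" "\<forall>\<tau>\<in>{0..1}. cball (x + \<tau> *\<^sub>R v) (\<tau> * c) \<subseteq> \<Omega>" using V(5)[OF x] by blast
  have sub: "cball (x + t *\<^sub>R y) (t * \<eta>') \<subseteq> cball (x + t *\<^sub>R y) (t * \<eta> v)" for y
   using \<eta>'[OF v(1)] t by (intro subset_cball mult_left_mono) auto
  have "\<forall>y\<in>Y v. \<exists>u\<in>cball (x + t *\<^sub>R y) (t * \<eta> v). f u = 0"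
  proof
   fix y assume y: "y \<in> Y v"
   have "cball (x + t *\<^sub>R y) (t * \<eta> v) \<subseteq> cball (x + t *\<^sub>R v) (t * c)"
   proof
    fix u assume u: "u \<in> cball (x + t *\<^sub>R y) (t * \<eta> v)"
    define w where "w = (1 / t) *\<^sub>R (u - x)"
    have uw: "u = x + t *\<^sub>R w" unfolding w_def using t by simp
    have ds: "dist (x + t *\<^sub>R a) (x + t *\<^sub>R w) = t * dist a w" for a
    proof -
     have "(x + t *\<^sub>R a) - (x + t *\<^sub>R w) = t *\<^sub>R (a - w)" by (simp add: scaleR_diff_right)
     then show ?thesis using t by (simp only: dist_norm norm_scaleR abs_of_pos)
    qed
    have "w \<in> cball y (\<eta> v)" using u t unfolding uw mem_cball ds by simp
    then have "w \<in> cball v c" using good[OF v(1)] y unfolding good_def by blast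
    then show "u \<in> cball (x + t *\<^sub>R v) (t * c)" using t unfolding uw mem_cball ds by simp
   qed
   also have "\<dots> \<subseteq> \<Omega>" using v(2) t by auto
   finally have "cball (x + t *\<^sub>R y) (t * \<eta>') \<subseteq> \<Omega>" using sub by blast
   then have "\<exists>u\<in>cball (x + t *\<^sub>R y) (t * \<eta>'). f u = 0" using y v(1) by (intro zero) auto
   then show "\<exists>u\<in>cball (x + t *\<^sub>R y) (t * \<eta> v). f u = 0" using sub by blast
  qed
  then have "\<bar>f x\<bar> powr p \<le> C v * t powr (real s * p - real CARD('d)) * I"
   using good[OF v(1)] wd g v(2) t I V(4)[OF v(1)] unfolding good_def by blast
  also have "\<dots> \<le> C' * t powr (real s * p - real CARD('d)) * I" using C'[OF v(1)] I(1) by (intro mult_right_mono) auto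
  finally show "\<bar>f x\<bar> powr p \<le> C' * t powr (real s * p - real CARD('d)) * I" .
 qed fact+
qed

section \<open>Energies and boundedness of function values\<close>

definition energy_le :: "real \<Rightarrow> nat \<Rightarrow> (('d::finite \<Rightarrow> nat) \<Rightarrow> real ^ 'd \<Rightarrow> real) \<Rightarrow> real \<Rightarrow> bool" where
 "energy_le p s g E \<longleftrightarrow> (\<forall>\<alpha>\<in>multi_indices s. (\<integral>\<^sup>+ w. ennreal (\<bar>g \<alpha> w\<bar> powr p) \<partial>lborel) \<le> ennreal E)"

lemma sum_powr_le:
 fixes a :: "'i \<Rightarrow> real"
 assumes "finite A" "\<And>i. i \<in> A \<Longrightarrow> a i \<ge> 0" "p \<ge> 0"
 shows "(\<Sum>i\<in>A. a i) powr p \<le> real (card A) powr p * (\<Sum>i\<in>A. a i powr p)"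
proof (cases "A = {}")
 case False
 define m where "m = Max (a ` A)"
 have m: "m \<in> a ` A" "\<And>i. i \<in> A \<Longrightarrow> a i \<le> m" unfolding m_def using assms(1) False by (auto intro!: Max_in Max_ge)
 have "(\<Sum>i\<in>A. a i) \<le> real (card A) * m" using m sum_bounded_above[of A a m] by simp
 then have "(\<Sum>i\<in>A. a i) powr p \<le> (real (card A) * m) powr p" using assms by (intro powr_mono2 sum_nonneg) auto
 also have "\<dots> = real (card A) powr p * m powr p" using m assms by (auto simp: powr_mult)
 also have "m powr p \<le> (\<Sum>i\<in>A. a i powr p)"
 proof -
  obtain i where "i \<in> A" "m = a i" using m by blast
  then show ?thesis using member_le_sum[of i A "\<lambda>i. a i powr p"] assms(1) by simp
 qed
 finally show ?thesis by (simp add: mult_left_mono)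
qed simp

lemma top_derivs_energy:
 fixes g :: "('d::finite \<Rightarrow> nat) \<Rightarrow> real ^ 'd \<Rightarrow> real"
 assumes [measurable]: "\<And>\<alpha>. g \<alpha> \<in> borel_measurable borel" and E: "energy_le p s g E" "E \<ge> 0" and p: "p \<ge> 1"
 defines "m \<equiv> real (card (multi_indices s :: ('d \<Rightarrow> nat) set))"
 shows "(\<integral>\<^sup>+ w. ennreal (top_derivs s g w powr p) \<partial>lborel) \<le> ennreal (m powr p * (m * E))"
proof -
 have "ennreal (top_derivs s g w powr p) \<le> ennreal (m powr p) * (\<Sum>\<alpha>\<in>multi_indices s. ennreal (\<bar>g \<alpha> w\<bar> powr p))" for w
 proof -
  have "top_derivs s g w \<le> (\<Sum>\<alpha>\<in>multi_indices s. \<bar>g \<alpha> w\<bar>)"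
   unfolding top_derivs_def by (intro sum_mono2 finite_multi_indices) (auto simp: multi_indices_def)
  then have "top_derivs s g w powr p \<le> (\<Sum>\<alpha>\<in>multi_indices s. \<bar>g \<alpha> w\<bar>) powr p" using p top_derivs_nonneg by (intro powr_mono2) auto
  also have "\<dots> \<le> m powr p * (\<Sum>\<alpha>\<in>multi_indices s. \<bar>g \<alpha> w\<bar> powr p)"
   unfolding m_def using p by (intro sum_powr_le finite_multi_indices) auto
  finally show ?thesis by (simp add: ennreal_mult[symmetric] sum_nonneg ennreal_leI)
 qed
 then have "(\<integral>\<^sup>+ w. ennreal (top_derivs s g w powr p) \<partial>lborel) \<le>
   (\<integral>\<^sup>+ w. ennreal (m powr p) * (\<Sum>\<alpha>\<in>multi_indices s. ennreal (\<bar>g \<alpha> w\<bar> powr p)) \<partial>lborel)" by (rule nn_integral_mono)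
 also have "\<dots> = ennreal (m powr p) * (\<Sum>\<alpha>\<in>multi_indices s. (\<integral>\<^sup>+ w. ennreal (\<bar>g \<alpha> w\<bar> powr p) \<partial>lborel))"
  by (simp add: nn_integral_cmult nn_integral_sum del: sum_ennreal)
 also have "\<dots> \<le> ennreal (m powr p) * (\<Sum>\<alpha>\<in>(multi_indices s :: ('d \<Rightarrow> nat) set). ennreal E)"
  using E(1) unfolding energy_le_def by (intro mult_left_mono sum_mono) auto
 also have "\<dots> = ennreal (m powr p * (m * E))" using E(2) by (simp add: ennreal_mult m_def ennreal_of_nat_eq_real_of_nat)
 finally show ?thesis .
qed

text \<open>The unit ball consists of uniformly bounded functions. This gives interpolants in every
  L_q and a trivial error bound for unfavourable samples. The expansion uses the whole cone at
  \<open>x\<close>, with threshold \<Lambda> = 1.\<close>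

theorem embedding_bound:
 fixes \<Omega> :: "(real ^ 'd::finite) set"
 assumes \<Omega>: "open \<Omega>" "bounded \<Omega>" "interior_cone_condition \<Omega>" and s: "s > 0" and E: "E \<ge> 0"
  and p: "p \<ge> 1" "real CARD('d) / p < real s \<or> (p = 1 \<and> s = CARD('d))"
 obtains C where "C > 0" "\<And>f g x. weak_data \<Omega> s f g \<Longrightarrow> (\<And>\<alpha>. g \<alpha> \<in> borel_measurable borel) \<Longrightarrow> energy_le p s g E \<Longrightarrow>
   x \<in> \<Omega> \<Longrightarrow> \<bar>f x\<bar> \<le> C"
proof -
 obtain V \<rho> c where V: "finite V" "c > 0" "8 * c \<le> \<rho>" "\<And>v. v \<in> V \<Longrightarrow> norm v = \<rho>"
  "\<And>x. x \<in> \<Omega> \<Longrightarrow> \<exists>v\<in>V. \<forall>\<tau>\<in>{0..1}. cball (x + \<tau> *\<^sub>R v) (\<tau> * c) \<subseteq> \<Omega>"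
 proof (rule interior_cone_finite_directions[OF \<Omega>(3)], goal_cases)
  case (1 V c \<rho>)
  show ?case by (rule that) (fact 1)+
 qed
 let ?d = "real CARD('d)"
 define m where "m = real (card (multi_indices s :: ('d \<Rightarrow> nat) set))"
 define b where "b = measure lborel (cball (0 :: real ^ 'd) (c / 2))"
 have b: "b > 0" unfolding b_def using V(2) by (intro measure_cball_pos) simp
 define S where "S = m powr p * (m * E)"
 have S: "S \<ge> 0" unfolding S_def m_def using E by simp
 have \<rho>: "\<rho> > 0" using V by linarith
 have fin: "emeasure lborel \<Omega> < \<infinity>" by (rule emeasure_bounded_finite[OF \<Omega>(2)])
 have \<Omega>b[measurable]: "\<Omega> \<in> sets borel" using \<Omega>(1) by simp
 \<comment> \<open>On the bounded set \<open>\<Omega>\<close> one has |g| \<le> 1 + |g|^p, which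
   bounds the integral of |g|.\<close>
 define E1 where "E1 = measure lborel \<Omega> + E"
 have E1: "E1 \<ge> 0" unfolding E1_def using E by simp
 define C where "C = ((?d * \<rho>) ^ s * (embed_const CARD('d) p s * 1 * b + \<rho> / (\<rho> / 4) * 1 powr (1 - p) * S) +
   (\<Sum>k<s. (?d * \<rho>) ^ k * (m * E1))) / b + 1"
 have ec: "embed_const CARD('d) p s \<ge> 0" unfolding embed_const_def using p by auto
 have C: "C > 0" unfolding C_def m_def using \<rho> ec b S E1 by (intro add_nonneg_pos divide_nonneg_pos add_nonneg_nonneg mult_nonneg_nonneg sum_nonneg) auto
 show ?thesis
 proof (rule that[OF C])
  fix f g x
  assume wd: "weak_data \<Omega> s f g" and g[measurable]: "\<And>\<alpha>. g \<alpha> \<in> borel_measurable borel" and en: "energy_le p s g E" and x: "x \<in> \<Omega>"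
  obtain v where v: "v \<in> V" "\<forall>\<tau>\<in>{0..1}. cball (x + \<tau> *\<^sub>R v) (\<tau> * c) \<subseteq> \<Omega>" using V(5)[OF x] by blast
  define T where "T = (\<lambda>w. x + w) ` ice_cone v c"
  have T: "compact T" "convex T" unfolding T_def
   using V(2) by (auto intro!: compact_continuous_image continuous_intros compact_ice_cone convex_translation convex_ice_cone)
  have T\<Omega>: "T \<subseteq> \<Omega>"
  proof
   fix u assume "u \<in> T"
   then obtain w \<tau> where w: "u = x + w" "\<tau> \<in> {0..1}" "dist w (\<tau> *\<^sub>R v) \<le> \<tau> * c" unfolding T_def ice_cone_def by blast
   have "u \<in> cball (x + \<tau> *\<^sub>R v) (\<tau> * c)" using w by (simp add: dist_commute)
   then show "u \<in> \<Omega>" using v(2) w(2) by blast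
  qed
  define B where "B = cball (x + (1 / 2) *\<^sub>R v) (c / 2)"
  have BT: "B \<subseteq> T"
  proof
   fix z assume "z \<in> B"
   then have "dist (z - x) ((1 / 2) *\<^sub>R v) \<le> (1 / 2) * c"
    unfolding B_def by (simp add: dist_norm norm_minus_commute algebra_simps)
   then have "z - x \<in> ice_cone v c" unfolding ice_cone_def by (intro CollectI bexI[of _ "1 / 2"]) auto
   then show "z \<in> T" unfolding T_def by (intro image_eqI[of _ _ "z - x"]) auto
  qed
  have xT: "x \<in> T" unfolding T_def ice_cone_def by (rule image_eqI[of _ _ 0]) (auto intro: bexI[of _ 0])
  have Bb: "emeasure lborel B = ennreal b"
   unfolding B_def b_def using measure_cball_pos(1)[of "c / 2" "x + (1 / 2) *\<^sub>R v"] measure_cball_scale[of 1 "c / 2" "x + (1 / 2) *\<^sub>R v" 0] V(2) by auto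
  have dist: "\<rho> / 4 \<le> dist z x \<and> dist z x \<le> \<rho>" if z: "z \<in> B" for z
  proof -
   have "dist x (x + (1 / 2) *\<^sub>R v) = \<rho> / 2" using V(4)[OF v(1)] by (simp add: dist_norm)
   moreover have "dist (x + (1 / 2) *\<^sub>R v) z \<le> c / 2" using z by (simp add: B_def)
   ultimately show ?thesis using dist_triangle[of x "x + (1 / 2) *\<^sub>R v" z] dist_triangle[of x z "x + (1 / 2) *\<^sub>R v"] V(2,3)
    by (simp add: dist_commute)
  qed
  have Sx: "local_energy s g p x (2 * \<rho>) \<le> ennreal S"
  proof -
   have "local_energy s g p x (2 * \<rho>) \<le> (\<integral>\<^sup>+ w. ennreal (top_derivs s g w powr p) \<partial>lborel)"
    by (intro nn_integral_mono) (auto simp: indicator_def)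
   also have "\<dots> \<le> ennreal S" unfolding S_def m_def by (rule top_derivs_energy[OF g en E p(1)])
   finally show ?thesis .
  qed
  have g1: "(\<integral>\<^sup>+ w. ennreal \<bar>g \<alpha> w\<bar> \<partial>lborel) \<le> ennreal E1" if \<alpha>: "\<alpha> \<in> multi_indices s" for \<alpha>
  proof -
   have z: "g \<alpha> w = 0" if "w \<notin> \<Omega>" for w using wd \<alpha> that by (auto simp: weak_data_def)
   have "(\<integral>\<^sup>+ w. ennreal \<bar>g \<alpha> w\<bar> \<partial>lborel) \<le> (\<integral>\<^sup>+ w. indicator \<Omega> w + ennreal (\<bar>g \<alpha> w\<bar> powr p) \<partial>lborel)"
   proof (rule nn_integral_mono)
    fix w
    show "ennreal \<bar>g \<alpha> w\<bar> \<le> indicator \<Omega> w + ennreal (\<bar>g \<alpha> w\<bar> powr p)"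
    proof (cases "w \<in> \<Omega>")
     case True
     have "\<bar>g \<alpha> w\<bar> \<le> 1 + \<bar>g \<alpha> w\<bar> powr p" using young_threshold[OF p(1), of 1 "\<bar>g \<alpha> w\<bar>"] by simp
     then have "ennreal \<bar>g \<alpha> w\<bar> \<le> ennreal (1 + \<bar>g \<alpha> w\<bar> powr p)" by (rule ennreal_leI)
     then show ?thesis using True by simp
    qed (simp add: z)
   qed
   also have "\<dots> = emeasure lborel \<Omega> + (\<integral>\<^sup>+ w. ennreal (\<bar>g \<alpha> w\<bar> powr p) \<partial>lborel)" by (subst nn_integral_add) auto
   also have "\<dots> \<le> ennreal (measure lborel \<Omega>) + ennreal E"
    using en \<alpha> fin unfolding energy_le_def by (intro add_mono) (auto simp: emeasure_eq_ennreal_measure less_top)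
   finally show ?thesis unfolding E1_def using E by simp
  qed
  have "b * \<bar>f x\<bar> \<le> (?d * \<rho>) ^ s * (embed_const CARD('d) p s * 1 * b + \<rho> / (\<rho> / 4) * 1 powr (1 - p) * S) +
    (\<Sum>k<s. (?d * \<rho>) ^ k * (real (card (multi_indices s :: ('d \<Rightarrow> nat) set)) * E1))"
   by (rule pointwise_embedding[OF wd \<Omega>(1) s g T T\<Omega> _ BT Bb b xT _ dist p _ S Sx E1 g1]) (use \<rho> B_def in auto)
  also have "\<dots> = b * (C - 1)" unfolding C_def m_def using b by simp
  finally have "\<bar>f x\<bar> \<le> C - 1" using b by (simp only: mult_le_cancel_left_pos)
  then show "\<bar>f x\<bar> \<le> C" by simp
 qed
qed

section \<open>Borel representatives of weak derivatives\<close>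

lemma ennreal_powr_le_1:
 assumes "ennreal_powr x a \<le> 1" "a > 0"
 shows "x \<le> 1"
proof (cases "x = \<infinity>")
 case False
 then have x: "x = ennreal (enn2real x)" by (simp add: less_top)
 have "enn2real x powr a \<le> 1" using assms False by (simp add: ennreal_powr_def)
 then have "enn2real x \<le> 1" using assms(2) gr_one_powr[of "enn2real x" a] by (meson not_le)
 then show ?thesis by (subst x) (simp add: ennreal_le_1)
qed (use assms in \<open>simp add: ennreal_powr_def top_unique\<close>)

text \<open>Local integrability gives measurability on compact subsets only; an increasing compact
  exhaustion extends it to \<open>\<Omega>\<close>.\<close>

lemma locally_integrable_measurable:
 fixes W :: "real ^ 'd::finite \<Rightarrow> real"
 assumes "open \<Omega>" "locally_integrable_on W \<Omega>"
 shows "(\<lambda>x. indicator \<Omega> x * W x) \<in> borel_measurable lebesgue"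
proof -
 obtain K where K: "\<And>n. compact (K n)" "\<And>n. K n \<subseteq> \<Omega>" "\<And>n. K n \<subseteq> interior (K (Suc n))" "\<Union>(range K) = \<Omega>"
  using open_Union_compact_subsets[OF assms(1)] by metis
 have mono: "K n \<subseteq> K m" if "n \<le> m" for n m by (rule lift_Suc_mono_le[OF _ that]) (use K(3) interior_subset in blast)
 have meas: "(\<lambda>x. indicator (K n) x * W x) \<in> borel_measurable lebesgue" for n
 proof -
  have "W absolutely_integrable_on K n" using assms(2) K(1,2) unfolding locally_integrable_on_def by blast
  then show ?thesis using borel_measurable_integrable unfolding set_integrable_def by fastforce
 qed
 show ?thesis
 proof (rule borel_measurable_LIMSEQ_metric[OF meas])
  fix x :: "real ^ 'd"
  show "(\<lambda>n. indicator (K n) x * W x) \<longlonglongrightarrow> indicator \<Omega> x * W x"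
  proof (cases "x \<in> \<Omega>")
   case True
   then obtain N where "x \<in> K N" using K(4) by blast
   then have "\<forall>\<^sub>F n in sequentially. indicator (K n) x * W x = indicator \<Omega> x * W x"
    unfolding eventually_sequentially using mono True by (intro exI[of _ N]) (auto simp: indicator_def)
   then show ?thesis by (rule tendsto_eventually)
  next
   case False
   then have "indicator (K n) x * W x = indicator \<Omega> x * W x" for n using K(2) by (auto simp: indicator_def)
   then show ?thesis by (intro tendsto_eventually always_eventually allI)
  qed
 qed
qed

text \<open>Weak derivatives are Lebesgue measurable. Changing one on a null set makes it Borel, as
  the product measures built from \<open>lborel\<close> require, without affecting any
  integral.\<close>

lemma has_weak_deriv_borel_representative:
 fixes f :: "real ^ 'd::finite \<Rightarrow> real"
 assumes \<Omega>: "open \<Omega>" and hw: "has_weak_deriv \<Omega> \<alpha> f W" and f: "continuous_on \<Omega> f"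
 obtains g where "g \<in> borel_measurable borel" "\<And>x. x \<notin> \<Omega> \<Longrightarrow> g x = 0" "AE x in lborel. g x = indicator \<Omega> x * W x"
  "\<And>\<phi>. test_function \<Omega> \<phi> \<Longrightarrow> (LINT x|lborel. indicator \<Omega> x * f x * multi_deriv \<alpha> \<phi> x) =
      (- 1) ^ (\<Sum>i\<in>UNIV. \<alpha> i) * (LINT x|lborel. g x * \<phi> x)"
  "\<And>p. (\<integral>\<^sup>+ x. ennreal (\<bar>g x\<bar> powr p) \<partial>lborel) = (\<integral>\<^sup>+ x. ennreal (\<bar>W x\<bar> powr p) \<partial>lebesgue_on \<Omega>)"
proof -
 have [measurable]: "\<Omega> \<in> sets borel" using \<Omega> by simp
 have Wm: "(\<lambda>x. indicator \<Omega> x * W x) \<in> borel_measurable lebesgue"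
  using hw by (intro locally_integrable_measurable[OF \<Omega>]) (simp add: has_weak_deriv_def)
 then obtain g0 where g0: "g0 \<in> borel_measurable lborel" "AE x in lborel. indicator \<Omega> x * W x = g0 x"
  using completion_ex_borel_measurable_real by blast
 define g where "g x = indicator \<Omega> x * g0 x" for x
 have gm[measurable]: "g \<in> borel_measurable borel" unfolding g_def[abs_def] using g0(1) by measurable
 have ae: "AE x in lborel. g x = indicator \<Omega> x * W x" using g0(2) by eventually_elim (auto simp: g_def indicator_def)
 then have ae': "AE x in lebesgue. g x = indicator \<Omega> x * W x" by (rule AE_completion)
 show ?thesis
 proof (rule that[OF gm _ ae])
  show "g x = 0" if "x \<notin> \<Omega>" for x using that by (simp add: g_def)
  show "(\<integral>\<^sup>+ x. ennreal (\<bar>g x\<bar> powr p) \<partial>lborel) = (\<integral>\<^sup>+ x. ennreal (\<bar>W x\<bar> powr p) \<partial>lebesgue_on \<Omega>)" for p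
  proof -
   have "(\<integral>\<^sup>+ x. ennreal (\<bar>W x\<bar> powr p) \<partial>lebesgue_on \<Omega>) = (\<integral>\<^sup>+ x. ennreal (\<bar>W x\<bar> powr p) * indicator \<Omega> x \<partial>lebesgue)"
    by (subst nn_integral_restrict_space) auto
   also have "\<dots> = (\<integral>\<^sup>+ x. ennreal (\<bar>W x\<bar> powr p) * indicator \<Omega> x \<partial>lborel)" by (rule nn_integral_completion)
   also have "\<dots> = (\<integral>\<^sup>+ x. ennreal (\<bar>g x\<bar> powr p) \<partial>lborel)"
    by (rule nn_integral_cong_AE) (use ae in eventually_elim, auto simp: indicator_def)
   finally show ?thesis by simp
  qed
  fix \<phi> assume \<phi>: "test_function \<Omega> \<phi>"
  have fm: "(\<lambda>x. indicator \<Omega> x * f x) \<in> borel_measurable borel" using borel_measurable_continuous_on_indicator[OF _ f] by simp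
  obtain "is" where "is": "\<And>f. multi_deriv \<alpha> f = foldr partial_deriv is f" using multi_deriv_list by blast
  have mm: "multi_deriv \<alpha> \<phi> \<in> borel_measurable borel" "\<phi> \<in> borel_measurable borel"
   using test_function_iterated(1)[OF \<phi>, of "is"] test_function_iterated(1)[OF \<phi>, of "[]"]
   unfolding "is" by (auto intro!: borel_measurable_continuous_onI differentiable_imp_continuous_on)
  have "(LINT x|lborel. indicator \<Omega> x * f x * multi_deriv \<alpha> \<phi> x) = (LINT x|lebesgue. indicator \<Omega> x * f x * multi_deriv \<alpha> \<phi> x)"
   by (rule integral_completion[symmetric]) (use fm mm in measurable)
  also have "\<dots> = (LINT x|lebesgue_on \<Omega>. f x * multi_deriv \<alpha> \<phi> x)" by (subst integral_lebesgue_on) (auto simp: mult.assoc)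
  also have "\<dots> = (- 1) ^ (\<Sum>i\<in>UNIV. \<alpha> i) * (LINT x|lebesgue_on \<Omega>. W x * \<phi> x)" using hw \<phi> by (auto simp: has_weak_deriv_def)
  also have "(LINT x|lebesgue_on \<Omega>. W x * \<phi> x) = (LINT x|lebesgue. (indicator \<Omega> x * W x) * \<phi> x)"
   by (subst integral_lebesgue_on) (auto simp: mult.assoc)
  also have "\<dots> = (LINT x|lebesgue. g x * \<phi> x)"
  proof (rule integral_cong_AE)
   show "(\<lambda>x. indicator \<Omega> x * W x * \<phi> x) \<in> borel_measurable lebesgue"
    by (rule borel_measurable_times[OF Wm]) (use mm(2) in \<open>simp add: measurable_completion\<close>)
   show "(\<lambda>x. g x * \<phi> x) \<in> borel_measurable lebesgue"
    using gm mm(2) by (intro borel_measurable_times) (auto simp: measurable_completion)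
  qed (use ae' in eventually_elim, simp)
  also have "\<dots> = (LINT x|lborel. g x * \<phi> x)" by (rule integral_completion) (use mm gm in measurable)
  finally show "(LINT x|lborel. indicator \<Omega> x * f x * multi_deriv \<alpha> \<phi> x) = (- 1) ^ (\<Sum>i\<in>UNIV. \<alpha> i) * (LINT x|lborel. g x * \<phi> x)" .
 qed
qed

subsection \<open>Random nodes\<close>

text \<open>The centres of the empty balls in \<open>\<Omega>\<close>. Collecting centres turns
  emptiness into a set with a Lebesgue measure, the expectation of which Fubini's theorem reduces to
  hitting probabilities of fixed balls.\<close>

definition unhit :: "(real ^ 'd::finite) set \<Rightarrow> nat \<Rightarrow> (nat \<Rightarrow> 'w \<Rightarrow> real ^ 'd) \<Rightarrow> real \<Rightarrow> 'w \<Rightarrow> (real ^ 'd) set" where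
 "unhit \<Omega> n X \<rho> \<omega> = {z. cball z \<rho> \<subseteq> \<Omega> \<and> (\<forall>i<n. \<rho> < dist z (X i \<omega>))}"

text \<open>The complement of \<open>\<Omega>\<close> is closed, so the distance to it is attained,
  and the condition says that it exceeds \<open>\<rho>\<close>.\<close>

lemma sets_cball_subset:
 fixes \<Omega> :: "'a::euclidean_space set"
 assumes "open \<Omega>"
 shows "{z. cball z \<rho> \<subseteq> \<Omega>} \<in> sets borel"
proof (cases "\<Omega> = UNIV")
 case False
 have "{z. cball z \<rho> \<subseteq> \<Omega>} = {z. \<rho> < infdist z (- \<Omega>)}"
 proof (intro set_eqI iffI)
  fix z assume "z \<in> {z. cball z \<rho> \<subseteq> \<Omega>}"
  moreover obtain a where "a \<in> - \<Omega>" "infdist z (- \<Omega>) = dist z a" using infdist_attains_inf[of "- \<Omega>" z] assms False by auto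
  ultimately show "z \<in> {z. \<rho> < infdist z (- \<Omega>)}" by (auto simp: not_le[symmetric])
 next
  fix z assume z: "z \<in> {z. \<rho> < infdist z (- \<Omega>)}"
  show "z \<in> {z. cball z \<rho> \<subseteq> \<Omega>}"
  proof (clarsimp)
   fix a assume a: "dist z a \<le> \<rho>"
   show "a \<in> \<Omega>"
   proof (rule ccontr)
    assume "a \<notin> \<Omega>"
    then have "infdist z (- \<Omega>) \<le> dist z a" by (intro infdist_le) auto
    then show False using z a by simp
   qed
  qed
 qed
 moreover have "{z. \<rho> < infdist z (- \<Omega>)} \<in> sets borel" by (intro borel_open open_Collect_less continuous_intros)
 ultimately show ?thesis by simp
qed simp

lemma sets_unhit:
 assumes "open \<Omega>"
 shows "unhit \<Omega> n X \<rho> \<omega> \<in> sets borel"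
proof -
 have "unhit \<Omega> n X \<rho> \<omega> = {z. cball z \<rho> \<subseteq> \<Omega>} \<inter> (\<Inter>i\<in>{..<n}. {z. \<rho> < dist z (X i \<omega>)}) " by (auto simp: unhit_def)
 moreover have "(\<Inter>i\<in>{..<n}. {z. \<rho> < dist z (X i \<omega>)}) \<in> sets borel"
  by (intro borel_open open_INT open_Collect_less continuous_intros finite_lessThan ballI)
 ultimately show ?thesis using sets_cball_subset[OF assms, of \<rho>] by auto
qed

lemma iid_uniformD:
 assumes "iid_uniform M \<Omega> n X"
 shows "prob_space M" "\<And>i. i < n \<Longrightarrow> X i \<in> borel_measurable M"
  "\<And>i \<omega>. i < n \<Longrightarrow> \<omega> \<in> space M \<Longrightarrow> X i \<omega> \<in> \<Omega>"
  "\<And>i. i < n \<Longrightarrow> distr M borel (X i) = uniform_measure lborel \<Omega>"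
proof -
 show pM: "prob_space M" using assms by (simp add: iid_uniform_def)
 then interpret prob_space M .
 show "X i \<in> borel_measurable M" if "i < n" for i using assms that unfolding iid_uniform_def indep_vars_def by auto
 show "X i \<omega> \<in> \<Omega>" if "i < n" "\<omega> \<in> space M" for i \<omega> using assms that unfolding iid_uniform_def by auto
 show "distr M borel (X i) = uniform_measure lborel \<Omega>" if "i < n" for i using assms that unfolding iid_uniform_def by auto
qed

lemma prob_avoid:
 assumes iid: "iid_uniform M \<Omega> n X" and n: "n > 0" and \<Omega>: "open \<Omega>" "bounded \<Omega>" "\<Omega> \<noteq> {}"
  and A: "A \<in> sets borel" "A \<subseteq> \<Omega>"
 shows "measure M {\<omega> \<in> space M. \<forall>i<n. X i \<omega> \<notin> A} = (1 - measure lborel A / measure lborel \<Omega>) ^ n"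
proof -
 note D = iid_uniformD[OF iid]
 interpret prob_space M by (rule D(1))
 have fin: "emeasure lborel \<Omega> < \<infinity>" by (rule emeasure_bounded_finite[OF \<Omega>(2)])
 have pos: "emeasure lborel \<Omega> \<noteq> 0"
  using \<Omega> open_not_negligible by (metis borel_open emeasure_eq_0_AE negligible_iff_null_sets null_setsI null_sets_completionI sets_lborel)
 have \<Omega>b: "\<Omega> \<in> sets borel" using \<Omega>(1) by simp
 have 1: "prob (X i -` (- A) \<inter> space M) = 1 - measure lborel A / measure lborel \<Omega>" if "i < n" for i
 proof -
  have "prob (X i -` A \<inter> space M) = measure (distr M borel (X i)) A" using D(2)[OF that] A by (simp add: measure_distr)
  also have "\<dots> = measure lborel (\<Omega> \<inter> A) / measure lborel \<Omega>"
   unfolding D(4)[OF that] using pos fin \<Omega>b A by (intro measure_uniform_measure) auto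
  also have "\<Omega> \<inter> A = A" using A by auto
  finally have 2: "prob (X i -` A \<inter> space M) = measure lborel A / measure lborel \<Omega>" .
  have "X i -` (- A) \<inter> space M = space M - (X i -` A \<inter> space M)" by auto
  then show ?thesis using 2 D(2)[OF that] A prob_compl[of "X i -` A \<inter> space M"] by (simp add: measurable_sets)
 qed
 have "{\<omega> \<in> space M. \<forall>i<n. X i \<omega> \<notin> A} = (\<Inter>i\<in>{..<n}. X i -` (- A) \<inter> space M)" using n by auto
 also have "prob \<dots> = (\<Prod>i\<in>{..<n}. prob (X i -` (- A) \<inter> space M))"
  by (rule indep_varsD[where M' = "\<lambda>_. borel" and I = "{..<n}"]) (use iid n A in \<open>auto simp: iid_uniform_def\<close>)
 also have "\<dots> = (1 - measure lborel A / measure lborel \<Omega>) ^ n" using 1 by simp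
 finally show ?thesis .
qed

lemma measurable_unhit:
 assumes iid: "iid_uniform M \<Omega> n X" and \<Omega>: "open \<Omega>"
 shows "(\<lambda>(\<omega>, z). indicator (unhit \<Omega> n X \<rho> \<omega>) z :: ennreal) \<in> borel_measurable (M \<Otimes>\<^sub>M lborel)"
proof -
 note D = iid_uniformD[OF iid]
 have [measurable]: "{z. cball z \<rho> \<subseteq> \<Omega>} \<in> sets borel" by (rule sets_cball_subset[OF \<Omega>])
 have "(\<lambda>(\<omega>, z). indicator (unhit \<Omega> n X \<rho> \<omega>) z :: ennreal) =
   (\<lambda>x. indicator {z. cball z \<rho> \<subseteq> \<Omega>} (snd x) * (\<Prod>i\<in>{..<n}. indicator {\<rho><..} (dist (snd x) (X i (fst x)))))"
  by (auto simp: fun_eq_iff unhit_def indicator_def prod_eq_1_iff intro!: prod_zero)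
 also have "\<dots> \<in> borel_measurable (M \<Otimes>\<^sub>M lborel)"
 proof -
  have "(\<lambda>x. indicator {\<rho><..} (dist (snd x) (X i (fst x))) :: ennreal) \<in> borel_measurable (M \<Otimes>\<^sub>M lborel)" if "i \<in> {..<n}" for i
  proof -
   have [measurable]: "X i \<in> borel_measurable M" using D(2) that by simp
   show ?thesis by measurable
  qed
  then have "(\<lambda>x. \<Prod>i\<in>{..<n}. indicator {\<rho><..} (dist (snd x) (X i (fst x))) :: ennreal) \<in> borel_measurable (M \<Otimes>\<^sub>M lborel)"
   by (rule borel_measurable_prod_ennreal)
  then show ?thesis by measurable
 qed
 finally show ?thesis .
qed

text \<open>Each fixed centre is unhit with probability (1 - v)^n \<le> exp(-n v), where v is the
  relative volume of its ball; integrate over the centres.\<close>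

lemma expected_unhit:
 fixes X :: "nat \<Rightarrow> 'w \<Rightarrow> real ^ 'd::finite"
 assumes iid: "iid_uniform M \<Omega> n X" and n: "n > 0" and \<Omega>: "open \<Omega>" "bounded \<Omega>" "\<Omega> \<noteq> {}" and \<rho>: "\<rho> > 0"
 shows "(\<lambda>\<omega>. emeasure lborel (unhit \<Omega> n X \<rho> \<omega>)) \<in> borel_measurable M"
  and "(\<integral>\<^sup>+ \<omega>. emeasure lborel (unhit \<Omega> n X \<rho> \<omega>) \<partial>M) \<le>
   ennreal (measure lborel \<Omega> * exp (- real n * \<rho> ^ CARD('d) * (unit_ball_vol (real CARD('d)) / measure lborel \<Omega>)))"
proof -
 note D = iid_uniformD[OF iid]
 interpret prob_space M by (rule D(1))
 have fin: "emeasure lborel \<Omega> < \<infinity>" by (rule emeasure_bounded_finite[OF \<Omega>(2)])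
 have [measurable]: "\<Omega> \<in> sets borel" using \<Omega>(1) by simp
 note m = measurable_unhit[OF iid \<Omega>(1), of \<rho>]
 have eq: "emeasure lborel (unhit \<Omega> n X \<rho> \<omega>) = (\<integral>\<^sup>+ z. indicator (unhit \<Omega> n X \<rho> \<omega>) z \<partial>lborel)" for \<omega>
  using sets_unhit[OF \<Omega>(1), of n X \<rho> \<omega>] by simp
 show "(\<lambda>\<omega>. emeasure lborel (unhit \<Omega> n X \<rho> \<omega>)) \<in> borel_measurable M"
  unfolding eq using lborel.borel_measurable_nn_integral_fst[OF m] by simp
 interpret ps: pair_sigma_finite M lborel ..
 let ?e = "exp (- real n * \<rho> ^ CARD('d) * (unit_ball_vol (real CARD('d)) / measure lborel \<Omega>))"
 have "(\<integral>\<^sup>+ \<omega>. emeasure lborel (unhit \<Omega> n X \<rho> \<omega>) \<partial>M) = (\<integral>\<^sup>+ z. (\<integral>\<^sup>+ \<omega>. indicator (unhit \<Omega> n X \<rho> \<omega>) z \<partial>M) \<partial>lborel)"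
  unfolding eq using ps.Fubini'[OF m] by simp
 also have "\<dots> \<le> (\<integral>\<^sup>+ z. ennreal ?e * indicator \<Omega> z \<partial>lborel)"
 proof (rule nn_integral_mono)
  fix z :: "real ^ 'd"
  show "(\<integral>\<^sup>+ \<omega>. indicator (unhit \<Omega> n X \<rho> \<omega>) z \<partial>M) \<le> ennreal ?e * indicator \<Omega> z"
  proof (cases "cball z \<rho> \<subseteq> \<Omega>")
   case False
   then show ?thesis by (simp add: unhit_def)
  next
   case True
   then have z: "z \<in> \<Omega>" using \<rho> by auto
   let ?A = "{\<omega> \<in> space M. \<forall>i<n. X i \<omega> \<notin> cball z \<rho>}"
   have A: "?A \<in> sets M"
   proof -
    have "?A = space M \<inter> (\<Inter>i\<in>{..<n}. X i -` (- cball z \<rho>) \<inter> space M)" using n by auto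
    also have "\<dots> \<in> sets M" using n by (intro sets.Int[OF sets.top sets.finite_INT] measurable_sets[OF D(2)]) auto
    finally show ?thesis .
   qed
   have "(\<integral>\<^sup>+ \<omega>. indicator (unhit \<Omega> n X \<rho> \<omega>) z \<partial>M) = (\<integral>\<^sup>+ \<omega>. indicator ?A \<omega> \<partial>M)"
    using True by (intro nn_integral_cong) (auto simp: unhit_def indicator_def not_le)
   also have "\<dots> = ennreal (measure M ?A)" by (simp only: nn_integral_indicator[OF A] emeasure_eq_measure)
   also have "measure M ?A = (1 - measure lborel (cball z \<rho>) / measure lborel \<Omega>) ^ n" by (rule prob_avoid[OF iid n \<Omega> _ True]) simp
   also have "\<dots> \<le> (exp (- (measure lborel (cball z \<rho>) / measure lborel \<Omega>))) ^ n"
   proof (rule power_mono)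
    show "1 - measure lborel (cball z \<rho>) / measure lborel \<Omega> \<le> exp (- (measure lborel (cball z \<rho>) / measure lborel \<Omega>))"
     using exp_ge_add_one_self[of "- (measure lborel (cball z \<rho>) / measure lborel \<Omega>)"] by simp
    have "measure lborel (cball z \<rho>) \<le> measure lborel \<Omega>"
     using True fin by (intro measure_mono_fmeasurable) (auto simp: fmeasurable_def)
    then show "0 \<le> 1 - measure lborel (cball z \<rho>) / measure lborel \<Omega>" by (simp add: divide_le_eq_1 measure_nonneg less_le)
   qed
   also have "\<dots> = ?e" using content_cball[of \<rho> z] \<rho> by (simp add: exp_of_nat_mult[symmetric] measure_completion mult_ac)
   finally show ?thesis using z by (simp add: ennreal_leI)
  qed
 qed
 also have "\<dots> = ennreal ?e * emeasure lborel \<Omega>" by (simp add: nn_integral_cmult_indicator)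
 also have "\<dots> = ennreal (measure lborel \<Omega> * ?e)" using fin by (simp add: emeasure_eq_ennreal_measure ennreal_mult mult.commute)
 finally show "(\<integral>\<^sup>+ \<omega>. emeasure lborel (unhit \<Omega> n X \<rho> \<omega>) \<partial>M) \<le> ennreal (measure lborel \<Omega> * ?e)" .
qed

section \<open>Functions of the Sobolev unit ball\<close>

lemma enn2real_ge_1:
 assumes "1 \<le> p" "p \<noteq> \<infinity>"
 shows "1 \<le> enn2real p" using enn2real_mono[of 1 p] assms by (simp add: less_top)

lemma weak_deriv_of_sobolev_space:
 assumes "f \<in> sobolev_space p s \<Omega>" "\<alpha> \<in> multi_indices s"
 shows "has_weak_deriv \<Omega> \<alpha> f (weak_deriv \<Omega> \<alpha> f)"
proof -
 have "\<exists>g. has_weak_deriv \<Omega> \<alpha> f g" using assms unfolding sobolev_space_def by blast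
 then show ?thesis unfolding weak_deriv_def by (rule someI_ex)
qed

lemma sobolev_norm_le_1D:
 fixes f :: "real ^ 'd::finite \<Rightarrow> real"
 assumes "sobolev_norm p s \<Omega> f \<le> 1" "1 \<le> p" "\<alpha> \<in> multi_indices s"
 shows "Lp_norm p (lebesgue_on \<Omega>) (weak_deriv \<Omega> \<alpha> f) \<le> 1"
proof (cases "p = \<infinity>")
 case True
 then show ?thesis using assms by (auto simp: sobolev_norm_def SUP_le_iff)
next
 case False
 have p: "enn2real p > 0" using enn2real_ge_1[OF assms(2) False] by linarith
 let ?a = "\<lambda>\<alpha>. ennreal_powr (Lp_norm p (lebesgue_on \<Omega>) (weak_deriv \<Omega> \<alpha> f)) (enn2real p)"
 have "ennreal_powr (\<Sum>\<alpha>\<in>multi_indices s. ?a \<alpha>) (1 / enn2real p) \<le> 1"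
  using assms(1) unfolding sobolev_norm_def if_not_P[OF False] .
 then have "(\<Sum>\<alpha>\<in>multi_indices s. ?a \<alpha>) \<le> 1" by (rule ennreal_powr_le_1) (use p in simp)
 moreover have "?a \<alpha> \<le> (\<Sum>\<alpha>\<in>multi_indices s. ?a \<alpha>)" by (rule member_le_sum[OF assms(3) _ finite_multi_indices]) simp
 ultimately have "?a \<alpha> \<le> 1" by (rule order_trans[rotated])
 then show ?thesis using p by (rule ennreal_powr_le_1)
qed

text \<open>\<open>P\<close> equals \<open>p\<close> if that is finite and is otherwise any finite
  exponent. The energy bound covers both cases: 1 for finite p, and the volume of
  \<open>\<Omega>\<close> if the derivatives are bounded by 1. For p = \<infinity> the pointwise
  bound is kept as well.\<close>

lemma sobolev_ball_weak_data:
 fixes f :: "real ^ 'd::finite \<Rightarrow> real"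
 assumes \<Omega>: "open \<Omega>" "bounded \<Omega>" and f: "f \<in> sobolev_ball p s \<Omega>" and p: "1 \<le> p"
  and P: "P \<ge> 1" "p \<noteq> \<infinity> \<Longrightarrow> P = enn2real p"
 obtains g where "weak_data \<Omega> s f g" "\<And>\<alpha>. g \<alpha> \<in> borel_measurable borel" "energy_le P s g (1 + measure lborel \<Omega>)"
  "\<And>\<alpha>. p = \<infinity> \<Longrightarrow> AE x in lborel. \<bar>g \<alpha> x\<bar> \<le> 1"
proof -
 have sp: "f \<in> sobolev_space p s \<Omega>" and sn: "sobolev_norm p s \<Omega> f \<le> 1" using f by (auto simp: sobolev_ball_def)
 have fc: "continuous_on \<Omega> f" using sp by (simp add: sobolev_space_def)
 have fin: "emeasure lborel \<Omega> < \<infinity>" by (rule emeasure_bounded_finite[OF \<Omega>(2)])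
 have [measurable]: "\<Omega> \<in> sets borel" using \<Omega>(1) by simp
 let ?W = "\<lambda>\<alpha>. weak_deriv \<Omega> \<alpha> f"
 define good where "good \<alpha> g \<longleftrightarrow> g \<in> borel_measurable borel \<and> (\<forall>x. x \<notin> \<Omega> \<longrightarrow> g x = 0) \<and> integrable lborel g \<and>
  (\<forall>\<phi>. test_function \<Omega> \<phi> \<longrightarrow> (LINT x|lborel. indicator \<Omega> x * f x * multi_deriv \<alpha> \<phi> x) =
      (- 1) ^ (\<Sum>i\<in>UNIV. \<alpha> i) * (LINT x|lborel. g x * \<phi> x)) \<and>
  (\<integral>\<^sup>+ x. ennreal (\<bar>g x\<bar> powr P) \<partial>lborel) \<le> ennreal (1 + measure lborel \<Omega>) \<and>
  (p = \<infinity> \<longrightarrow> (AE x in lborel. \<bar>g x\<bar> \<le> 1))" for \<alpha> :: "'d \<Rightarrow> nat" and g :: "real ^ 'd \<Rightarrow> real"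
 have ex: "\<exists>g. good \<alpha> g" if \<alpha>: "\<alpha> \<in> multi_indices s" for \<alpha>
 proof -
  have hw: "has_weak_deriv \<Omega> \<alpha> f (?W \<alpha>)" by (rule weak_deriv_of_sobolev_space[OF sp \<alpha>])
  have Ln: "Lp_norm p (lebesgue_on \<Omega>) (?W \<alpha>) \<le> 1" by (rule sobolev_norm_le_1D[OF sn p \<alpha>])
  obtain g where g[measurable]: "g \<in> borel_measurable borel" and g0: "\<And>x. x \<notin> \<Omega> \<Longrightarrow> g x = 0"
   and gW: "AE x in lborel. g x = indicator \<Omega> x * ?W \<alpha> x"
   and gt: "\<And>\<phi>. test_function \<Omega> \<phi> \<Longrightarrow> (LINT x|lborel. indicator \<Omega> x * f x * multi_deriv \<alpha> \<phi> x) =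
      (- 1) ^ (\<Sum>i\<in>UNIV. \<alpha> i) * (LINT x|lborel. g x * \<phi> x)"
   and gP: "\<And>p. (\<integral>\<^sup>+ x. ennreal (\<bar>g x\<bar> powr p) \<partial>lborel) = (\<integral>\<^sup>+ x. ennreal (\<bar>?W \<alpha> x\<bar> powr p) \<partial>lebesgue_on \<Omega>)"
  proof (rule has_weak_deriv_borel_representative[OF \<Omega>(1) hw fc], goal_cases)
   case (1 g)
   show ?case by (rule that) (fact 1)+
  qed
  have ae: "AE x in lborel. \<bar>g x\<bar> \<le> 1" if pinf: "p = \<infinity>"
  proof -
   have le: "esssup (lebesgue_on \<Omega>) (\<lambda>x. ennreal \<bar>?W \<alpha> x\<bar>) \<le> 1" using Ln pinf by (simp add: Lp_norm_def)
   have "AE x in lebesgue_on \<Omega>. ennreal \<bar>?W \<alpha> x\<bar> \<le> esssup (lebesgue_on \<Omega>) (\<lambda>x. ennreal \<bar>?W \<alpha> x\<bar>)" by (rule esssup_AE)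
   then have "AE x in lebesgue_on \<Omega>. ennreal \<bar>?W \<alpha> x\<bar> \<le> 1" by (rule eventually_mono) (rule order_trans[OF _ le])
   then have "AE x in lebesgue. x \<in> \<Omega> \<longrightarrow> ennreal \<bar>?W \<alpha> x\<bar> \<le> 1" by (subst (asm) AE_restrict_space_iff) auto
   moreover have "AE x in lebesgue. g x = indicator \<Omega> x * ?W \<alpha> x" using gW by (rule AE_completion)
   ultimately have "AE x in lebesgue. \<bar>g x\<bar> \<le> 1" by eventually_elim (auto simp: indicator_def ennreal_le_1)
   then show ?thesis by (simp add: AE_completion_iff)
  qed
  have en: "(\<integral>\<^sup>+ x. ennreal (\<bar>g x\<bar> powr P) \<partial>lborel) \<le> ennreal (1 + measure lborel \<Omega>)"
  proof (cases "p = \<infinity>")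
   case True
   have "(\<integral>\<^sup>+ x. ennreal (\<bar>g x\<bar> powr P) \<partial>lborel) \<le> (\<integral>\<^sup>+ x. indicator \<Omega> x \<partial>lborel)"
   proof (rule nn_integral_mono_AE)
    show "AE x in lborel. ennreal (\<bar>g x\<bar> powr P) \<le> indicator \<Omega> x" using ae[OF True]
    proof eventually_elim
     case (elim x)
     then have "\<bar>g x\<bar> powr P \<le> 1" using P(1) by (intro powr_le1) auto
     then show ?case using g0[of x] by (cases "x \<in> \<Omega>") (auto simp: ennreal_le_1)
    qed
   qed
   also have "\<dots> = ennreal (measure lborel \<Omega>)" using fin by (simp add: emeasure_eq_ennreal_measure)
   also have "\<dots> \<le> ennreal (1 + measure lborel \<Omega>)" by (intro ennreal_leI) simp
   finally show ?thesis .
  next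
   case False
   have "ennreal_powr (\<integral>\<^sup>+ x. ennreal (\<bar>?W \<alpha> x\<bar> powr P) \<partial>lebesgue_on \<Omega>) (1 / P) \<le> 1"
    using Ln False P(2)[OF False] by (simp add: Lp_norm_def)
   then have "(\<integral>\<^sup>+ x. ennreal (\<bar>g x\<bar> powr P) \<partial>lborel) \<le> 1" unfolding gP by (rule ennreal_powr_le_1) (use P(1) in simp)
   also have "\<dots> \<le> ennreal (1 + measure lborel \<Omega>)" by simp
   finally show ?thesis .
  qed
  have int: "integrable lborel g"
  proof (rule integrableI_bounded)
   have "(\<integral>\<^sup>+ x. ennreal (norm (g x)) \<partial>lborel) \<le> (\<integral>\<^sup>+ x. indicator \<Omega> x + ennreal (\<bar>g x\<bar> powr P) \<partial>lborel)"
   proof (rule nn_integral_mono)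
    fix x
    have "\<bar>g x\<bar> \<le> 1 + \<bar>g x\<bar> powr P" using young_threshold[OF P(1), of 1 "\<bar>g x\<bar>"] by simp
    then have "ennreal \<bar>g x\<bar> \<le> ennreal (1 + \<bar>g x\<bar> powr P)" by (rule ennreal_leI)
    then show "ennreal (norm (g x)) \<le> indicator \<Omega> x + ennreal (\<bar>g x\<bar> powr P)" using g0[of x] by (cases "x \<in> \<Omega>") auto
   qed
   also have "\<dots> = emeasure lborel \<Omega> + (\<integral>\<^sup>+ x. ennreal (\<bar>g x\<bar> powr P) \<partial>lborel)" by (subst nn_integral_add) auto
   also have "\<dots> < \<infinity>" using fin le_less_trans[OF en] by (simp add: ennreal_add_eq_top less_top)
   finally show "(\<integral>\<^sup>+ x. ennreal (norm (g x)) \<partial>lborel) < \<infinity>" .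
  qed simp
  show ?thesis using g g0 gt en int ae unfolding good_def by blast
 qed
 \<comment> \<open>Outside the relevant orders the family is 0, so that all of its members are Borel
   functions.\<close>
 define G where "G \<alpha> = (if \<alpha> \<in> multi_indices s then SOME g. good \<alpha> g else (\<lambda>_. 0))" for \<alpha> :: "'d \<Rightarrow> nat"
 have G: "good \<alpha> (G \<alpha>)" if "\<alpha> \<in> multi_indices s" for \<alpha> unfolding G_def using that someI_ex[OF ex[OF that]] by simp
 show ?thesis
 proof (rule that[of G])
  show "weak_data \<Omega> s f G" using G fc unfolding weak_data_def good_def by blast
  show "G \<alpha> \<in> borel_measurable borel" for \<alpha> using G[of \<alpha>] by (cases "\<alpha> \<in> multi_indices s") (auto simp: good_def, simp add: G_def)
  show "energy_le P s G (1 + measure lborel \<Omega>)" using G unfolding energy_le_def good_def by blast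
  show "AE x in lborel. \<bar>G \<alpha> x\<bar> \<le> 1" if "p = \<infinity>" for \<alpha>
   using G[of \<alpha>] that by (cases "\<alpha> \<in> multi_indices s") (auto simp: good_def, simp add: G_def)
 qed
qed

lemma test_function_bounded:
 fixes \<phi> :: "real ^ 'd::finite \<Rightarrow> real"
 assumes "test_function \<Omega> \<phi>"
 obtains B where "\<And>x. \<bar>\<phi> x\<bar> \<le> B"
proof -
 let ?S = "closure {x. \<phi> x \<noteq> 0}"
 have c: "continuous_on ?S \<phi>"
  using test_function_iterated(1)[OF assms, of "[]"] by (simp add: differentiable_imp_continuous_on continuous_on_subset[of UNIV])
 have "bounded (\<phi> ` ?S)" using assms c by (intro compact_imp_bounded compact_continuous_image) (auto simp: test_function_def)
 then obtain B where B: "B > 0" "\<And>x. x \<in> ?S \<Longrightarrow> \<bar>\<phi> x\<bar> \<le> B" unfolding bounded_pos by auto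
 have "\<bar>\<phi> x\<bar> \<le> B" for x using B test_function_iterated(2)[OF assms, of x "[]"] by (cases "x \<in> ?S") auto
 then show ?thesis by (rule that)
qed

lemma weak_data_diff:
 fixes f h :: "real ^ 'd::finite \<Rightarrow> real"
 assumes \<Omega>: "open \<Omega>" and f: "weak_data \<Omega> s f g" and h: "weak_data \<Omega> s h k"
 shows "weak_data \<Omega> s (\<lambda>x. f x - h x) (\<lambda>\<alpha> x. g \<alpha> x - k \<alpha> x)" unfolding weak_data_def
proof (intro conjI ballI allI impI)
 have fc: "continuous_on \<Omega> f" "continuous_on \<Omega> h" using f h by (auto simp: weak_data_def)
 show "continuous_on \<Omega> (\<lambda>x. f x - h x)" using fc by (intro continuous_intros)
 fix \<alpha> :: "'d \<Rightarrow> nat" assume \<alpha>: "\<alpha> \<in> multi_indices s"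
 have gk: "integrable lborel (g \<alpha>)" "integrable lborel (k \<alpha>)" using f h \<alpha> by (auto simp: weak_data_def)
 show "integrable lborel (\<lambda>x. g \<alpha> x - k \<alpha> x)" using gk by auto
 show "g \<alpha> x - k \<alpha> x = 0" if "x \<notin> \<Omega>" for x using f h \<alpha> that by (auto simp: weak_data_def)
 fix \<phi> assume \<phi>: "test_function \<Omega> \<phi>"
 let ?S = "closure {x. \<phi> x \<noteq> 0}"
 have S: "compact ?S" "?S \<subseteq> \<Omega>" using \<phi> by (auto simp: test_function_def)
 obtain "is" where "is": "\<And>f. multi_deriv \<alpha> f = foldr partial_deriv is f" using multi_deriv_list by blast
 have mc: "continuous_on UNIV (multi_deriv \<alpha> \<phi>)" "continuous_on UNIV \<phi>"
  using test_function_iterated(1)[OF \<phi>, of "is"] test_function_iterated(1)[OF \<phi>, of "[]"]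
  unfolding "is" by (auto intro: differentiable_imp_continuous_on)
 have mz: "multi_deriv \<alpha> \<phi> x = 0" if "x \<notin> ?S" for x unfolding "is" by (rule test_function_iterated(2)[OF \<phi> that])
 have int: "integrable lborel (\<lambda>x. indicator \<Omega> x * u x * multi_deriv \<alpha> \<phi> x)" if "continuous_on \<Omega> u" for u
 proof -
  have "integrable lborel (\<lambda>x. indicator ?S x *\<^sub>R (u x * multi_deriv \<alpha> \<phi> x))" by (rule borel_integrable_compact[OF S(1)])
     (intro continuous_intros continuous_on_subset[OF that S(2)] continuous_on_subset[OF mc(1)] subset_UNIV)
  also have "(\<lambda>x. indicator ?S x *\<^sub>R (u x * multi_deriv \<alpha> \<phi> x)) = (\<lambda>x. indicator \<Omega> x * u x * multi_deriv \<alpha> \<phi> x)"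
  proof
   fix x
   show "indicator ?S x *\<^sub>R (u x * multi_deriv \<alpha> \<phi> x) = indicator \<Omega> x * u x * multi_deriv \<alpha> \<phi> x"
    using mz[of x] S(2) by (cases "x \<in> ?S") auto
  qed
  finally show ?thesis .
 qed
 obtain B where B: "\<And>x. \<bar>\<phi> x\<bar> \<le> B" using test_function_bounded[OF \<phi>] by blast
 have [measurable]: "\<phi> \<in> borel_measurable borel" using mc(2) by (rule borel_measurable_continuous_onI)
 have int2: "integrable lborel (\<lambda>x. u x * \<phi> x)" if "integrable lborel u" for u
 proof (rule Bochner_Integration.integrable_bound[of _ "\<lambda>x. B * u x"])
  show "integrable lborel (\<lambda>x. B * u x)" using that by simp
  show "(\<lambda>x. u x * \<phi> x) \<in> borel_measurable lborel" using borel_measurable_integrable[OF that] by measurable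
  show "AE x in lborel. norm (u x * \<phi> x) \<le> norm (B * u x)"
  proof (intro AE_I2)
   fix x
   have "\<bar>u x\<bar> * \<bar>\<phi> x\<bar> \<le> \<bar>u x\<bar> * \<bar>B\<bar>" using B[of x] by (intro mult_left_mono) auto
   then show "norm (u x * \<phi> x) \<le> norm (B * u x)" by (simp add: abs_mult mult.commute)
  qed
 qed
 have "(LINT x|lborel. indicator \<Omega> x * (f x - h x) * multi_deriv \<alpha> \<phi> x) =
   (LINT x|lborel. indicator \<Omega> x * f x * multi_deriv \<alpha> \<phi> x - indicator \<Omega> x * h x * multi_deriv \<alpha> \<phi> x)"
  by (simp add: algebra_simps)
 also have "\<dots> = (LINT x|lborel. indicator \<Omega> x * f x * multi_deriv \<alpha> \<phi> x) - (LINT x|lborel. indicator \<Omega> x * h x * multi_deriv \<alpha> \<phi> x)"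
  by (rule Bochner_Integration.integral_diff[OF int[OF fc(1)] int[OF fc(2)]])
 also have "\<dots> = (- 1) ^ (\<Sum>i\<in>UNIV. \<alpha> i) * ((LINT x|lborel. g \<alpha> x * \<phi> x) - (LINT x|lborel. k \<alpha> x * \<phi> x))"
  using f h \<alpha> \<phi> by (simp add: weak_data_def right_diff_distrib)
 also have "(LINT x|lborel. g \<alpha> x * \<phi> x) - (LINT x|lborel. k \<alpha> x * \<phi> x) = (LINT x|lborel. (g \<alpha> x - k \<alpha> x) * \<phi> x)"
  by (subst Bochner_Integration.integral_diff[OF int2[OF gk(1)] int2[OF gk(2)], symmetric]) (simp add: left_diff_distrib)
 finally show "(LINT x|lborel. indicator \<Omega> x * (f x - h x) * multi_deriv \<alpha> \<phi> x) =
   (- 1) ^ (\<Sum>i\<in>UNIV. \<alpha> i) * (LINT x|lborel. (g \<alpha> x - k \<alpha> x) * \<phi> x)" .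
qed

lemma energy_le_diff:
 fixes g k :: "('d::finite \<Rightarrow> nat) \<Rightarrow> real ^ 'd \<Rightarrow> real"
 assumes [measurable]: "\<And>\<alpha>. g \<alpha> \<in> borel_measurable borel" "\<And>\<alpha>. k \<alpha> \<in> borel_measurable borel"
  and g: "energy_le p s g E" and k: "energy_le p s k E" and p: "p \<ge> 1" and E: "E \<ge> 0"
 shows "energy_le p s (\<lambda>\<alpha> x. g \<alpha> x - k \<alpha> x) (2 powr p * (2 * E))" unfolding energy_le_def
proof
 fix \<alpha> :: "'d \<Rightarrow> nat" assume \<alpha>: "\<alpha> \<in> multi_indices s"
 have "(\<integral>\<^sup>+ w. ennreal (\<bar>g \<alpha> w - k \<alpha> w\<bar> powr p) \<partial>lborel) \<le>
   (\<integral>\<^sup>+ w. ennreal (2 powr p) * (ennreal (\<bar>g \<alpha> w\<bar> powr p) + ennreal (\<bar>k \<alpha> w\<bar> powr p)) \<partial>lborel)"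
 proof (rule nn_integral_mono)
  fix w
  have "\<bar>g \<alpha> w - k \<alpha> w\<bar> powr p \<le> (2 * max \<bar>g \<alpha> w\<bar> \<bar>k \<alpha> w\<bar>) powr p" using p by (intro powr_mono2) auto
  also have "\<dots> = 2 powr p * max \<bar>g \<alpha> w\<bar> \<bar>k \<alpha> w\<bar> powr p" by (simp add: powr_mult)
  also have "\<dots> \<le> 2 powr p * (\<bar>g \<alpha> w\<bar> powr p + \<bar>k \<alpha> w\<bar> powr p)" by (intro mult_left_mono) (auto simp: max_def)
  finally show "ennreal (\<bar>g \<alpha> w - k \<alpha> w\<bar> powr p) \<le> ennreal (2 powr p) * (ennreal (\<bar>g \<alpha> w\<bar> powr p) + ennreal (\<bar>k \<alpha> w\<bar> powr p))"
   by (simp add: ennreal_mult[symmetric] ennreal_plus[symmetric] ennreal_leI del: ennreal_plus)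
 qed
 also have "\<dots> = ennreal (2 powr p) * ((\<integral>\<^sup>+ w. ennreal (\<bar>g \<alpha> w\<bar> powr p) \<partial>lborel) + (\<integral>\<^sup>+ w. ennreal (\<bar>k \<alpha> w\<bar> powr p) \<partial>lborel))"
  by (simp add: nn_integral_cmult nn_integral_add)
 also have "\<dots> \<le> ennreal (2 powr p) * (ennreal E + ennreal E)"
  using g k \<alpha> unfolding energy_le_def by (intro mult_left_mono add_mono) auto
 also have "\<dots> = ennreal (2 powr p * (2 * E))" using E by (simp add: ennreal_mult[symmetric] ennreal_plus[symmetric] del: ennreal_plus)
 finally show "(\<integral>\<^sup>+ w. ennreal (\<bar>g \<alpha> w - k \<alpha> w\<bar> powr p) \<partial>lborel) \<le> ennreal (2 powr p * (2 * E))" .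
qed

subsection \<open>The error of interpolants\<close>

text \<open>The bound of \<open>energy_le_diff\<close> for the difference of two functions from the
  unit ball.\<close>

definition ball_energy :: "(real ^ 'd::finite) set \<Rightarrow> real \<Rightarrow> real" where
 "ball_energy \<Omega> P = 2 powr P * (2 * (1 + measure lborel \<Omega>))"

lemma ball_energy_nonneg: "ball_energy \<Omega> P \<ge> 0" by (simp add: ball_energy_def)

text \<open>The properties of f - h for f and h in the unit ball that agree on \<open>N\<close>. The
  pointwise bound for p = \<infinity> is what gives the full rate if q = \<infinity> too; an energy
  bound with a finite exponent would lose a power of \<open>t\<close>.\<close>

definition residual :: "ennreal \<Rightarrow> real \<Rightarrow> nat \<Rightarrow> (real ^ 'd::finite) set \<Rightarrow> (real ^ 'd) set \<Rightarrow> (real ^ 'd \<Rightarrow> real) \<Rightarrow> bool" where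
 "residual p P s \<Omega> N e \<longleftrightarrow> (\<forall>x\<in>N. e x = 0) \<and> (\<exists>g. weak_data \<Omega> s e g \<and> (\<forall>\<alpha>. g \<alpha> \<in> borel_measurable borel) \<and>
   energy_le P s g (ball_energy \<Omega> P) \<and> (p = \<infinity> \<longrightarrow> (\<forall>\<alpha>. AE x in lborel. \<bar>g \<alpha> x\<bar> \<le> 2)))"

lemma residual_diff:
 assumes \<Omega>: "open \<Omega>" "bounded \<Omega>" and f: "f \<in> sobolev_ball p s \<Omega>" "h \<in> sobolev_ball p s \<Omega>" and p: "1 \<le> p"
  and P: "P \<ge> 1" "p \<noteq> \<infinity> \<Longrightarrow> P = enn2real p" and eq: "\<And>x. x \<in> N \<Longrightarrow> f x = h x"
 shows "residual p P s \<Omega> N (\<lambda>x. f x - h x)"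
proof -
 obtain g where g: "weak_data \<Omega> s f g" "\<And>\<alpha>. g \<alpha> \<in> borel_measurable borel" "energy_le P s g (1 + measure lborel \<Omega>)"
  "\<And>\<alpha>. p = \<infinity> \<Longrightarrow> AE x in lborel. \<bar>g \<alpha> x\<bar> \<le> 1"
 proof (rule sobolev_ball_weak_data[OF \<Omega> f(1) p P], goal_cases)
  case (2 g)
  show ?case by (rule that) (fact 2)+
 qed
 obtain k where k: "weak_data \<Omega> s h k" "\<And>\<alpha>. k \<alpha> \<in> borel_measurable borel" "energy_le P s k (1 + measure lborel \<Omega>)"
  "\<And>\<alpha>. p = \<infinity> \<Longrightarrow> AE x in lborel. \<bar>k \<alpha> x\<bar> \<le> 1"
 proof (rule sobolev_ball_weak_data[OF \<Omega> f(2) p P], goal_cases)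
  case (2 k)
  show ?case by (rule that) (fact 2)+
 qed
 have "AE x in lborel. \<bar>g \<alpha> x - k \<alpha> x\<bar> \<le> 2" if "p = \<infinity>" for \<alpha>
  using g(4)[OF that, of \<alpha>] k(4)[OF that, of \<alpha>] by eventually_elim linarith
 moreover have "energy_le P s (\<lambda>\<alpha> x. g \<alpha> x - k \<alpha> x) (ball_energy \<Omega> P)"
  unfolding ball_energy_def by (rule energy_le_diff[OF g(2) k(2) g(3) k(3) P(1)]) simp
 moreover have "\<forall>\<alpha>. (\<lambda>x. g \<alpha> x - k \<alpha> x) \<in> borel_measurable borel" using g(2) k(2) by (auto intro: borel_measurable_diff)
 ultimately show ?thesis unfolding residual_def using weak_data_diff[OF \<Omega>(1) g(1) k(1)] eq
  by (intro conjI exI[of _ "\<lambda>\<alpha> x. g \<alpha> x - k \<alpha> x"]) auto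
qed

lemma Lp_norm_le_of_nn_integral:
 assumes q: "q \<noteq> \<infinity>" "1 \<le> q" and B: "B \<ge> 0" "(\<integral>\<^sup>+ x. ennreal (\<bar>f x\<bar> powr enn2real q) \<partial>M) \<le> ennreal B"
 shows "Lp_norm q M f \<le> ennreal (B powr (1 / enn2real q))"
proof -
 let ?I = "\<integral>\<^sup>+ x. ennreal (\<bar>f x\<bar> powr enn2real q) \<partial>M"
 have q0: "enn2real q > 0" using enn2real_ge_1[OF q(2,1)] by linarith
 have I: "?I \<noteq> \<infinity>" using B(2) by (auto simp: top_unique)
 have "enn2real ?I \<le> B" using B by (simp add: enn2real_leI)
 then have "enn2real ?I powr (1 / enn2real q) \<le> B powr (1 / enn2real q)" using q0 by (intro powr_mono2) auto
 then show ?thesis using q I by (simp add: Lp_norm_def ennreal_powr_def ennreal_leI)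
qed

lemma Lp_norm_le_of_bounded:
 fixes f :: "real ^ 'd::finite \<Rightarrow> real"
 assumes \<Omega>: "open \<Omega>" "bounded \<Omega>" and f: "continuous_on \<Omega> f" and C: "C \<ge> 0" "\<And>x. x \<in> \<Omega> \<Longrightarrow> \<bar>f x\<bar> \<le> C" and q: "1 \<le> q"
 shows "Lp_norm q (lebesgue_on \<Omega>) f \<le> ennreal (C * (1 + measure lborel \<Omega>))"
proof -
 have fm: "f \<in> borel_measurable (lebesgue_on \<Omega>)" using \<Omega> f by (intro continuous_imp_measurable_on_sets_lebesgue) auto
 have fin: "emeasure lborel \<Omega> < \<infinity>" by (rule emeasure_bounded_finite[OF \<Omega>(2)])
 show ?thesis
 proof (cases "q = \<infinity>")
  case True
  have "esssup (lebesgue_on \<Omega>) (\<lambda>x. ennreal \<bar>f x\<bar>) \<le> ennreal C"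
   using fm C by (intro esssup_I) (auto intro!: AE_I2 ennreal_leI simp: space_restrict_space)
  also have "\<dots> \<le> ennreal (C * (1 + measure lborel \<Omega>))" using C by (intro ennreal_leI) (simp add: distrib_left)
  finally show ?thesis using True by (simp add: Lp_norm_def)
 next
  case False
  let ?q = "enn2real q" and ?m = "measure lborel \<Omega>"
  have q1: "?q \<ge> 1" by (rule enn2real_ge_1[OF q False])
  have "(\<integral>\<^sup>+ x. ennreal (\<bar>f x\<bar> powr ?q) \<partial>lebesgue_on \<Omega>) \<le> (\<integral>\<^sup>+ x. ennreal (C powr ?q) \<partial>lebesgue_on \<Omega>)"
   using C q1 by (intro nn_integral_mono ennreal_leI powr_mono2) (auto simp: space_restrict_space)
  also have "\<dots> = ennreal (C powr ?q) * emeasure lborel \<Omega>" using \<Omega> by (simp add: emeasure_restrict_space space_restrict_space)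
  also have "\<dots> = ennreal (C powr ?q * ?m)" using fin by (simp add: emeasure_eq_ennreal_measure ennreal_mult)
  finally have "Lp_norm q (lebesgue_on \<Omega>) f \<le> ennreal ((C powr ?q * ?m) powr (1 / ?q))"
   using False q by (intro Lp_norm_le_of_nn_integral) auto
  also have "(C powr ?q * ?m) powr (1 / ?q) = C * ?m powr (1 / ?q)" using C q1 by (simp add: powr_mult powr_powr)
  also have "\<dots> \<le> C * (1 + ?m)"
  proof (intro mult_left_mono C)
   show "?m powr (1 / ?q) \<le> 1 + ?m" using powr_le_threshold[of "1 / ?q" 1 ?m] q1 by simp
  qed
  finally show ?thesis by (simp add: ennreal_leI)
 qed
qed

text \<open>Data that no function of the unit ball attains are sent to 0, which keeps the mapping
  inside L_q for all data.\<close>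

definition interpolant :: "ennreal \<Rightarrow> nat \<Rightarrow> (real ^ 'd::finite) set \<Rightarrow> (real ^ 'd) set \<Rightarrow> (real ^ 'd \<Rightarrow> real) \<Rightarrow> real ^ 'd \<Rightarrow> real" where
 "interpolant p s \<Omega> N y = (if \<exists>h\<in>sobolev_ball p s \<Omega>. restrict h N = y
   then SOME h. h \<in> sobolev_ball p s \<Omega> \<and> restrict h N = y else (\<lambda>_. 0))"

lemma interpolant:
 assumes "f \<in> sobolev_ball p s \<Omega>"
 shows "interpolant p s \<Omega> N (restrict f N) \<in> sobolev_ball p s \<Omega>"
  "\<And>x. x \<in> N \<Longrightarrow> f x = interpolant p s \<Omega> N (restrict f N) x"
proof -
 have ex: "\<exists>h. h \<in> sobolev_ball p s \<Omega> \<and> restrict h N = restrict f N" using assms by blast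
 have *: "interpolant p s \<Omega> N (restrict f N) \<in> sobolev_ball p s \<Omega> \<and> restrict (interpolant p s \<Omega> N (restrict f N)) N = restrict f N"
  unfolding interpolant_def using someI_ex[OF ex] ex by (auto simp: Bex_def)
 then show "interpolant p s \<Omega> N (restrict f N) \<in> sobolev_ball p s \<Omega>" by simp
 show "f x = interpolant p s \<Omega> N (restrict f N) x" if "x \<in> N" for x using * that by (metis restrict_apply')
qed

text \<open>The error of the algorithm that returns any interpolating function from the unit ball: as all
 residuals vanish on the nodes, it is bounded by the norms of residuals.\<close>

theorem unif_error_points_le:
 fixes \<Omega> :: "(real ^ 'd::finite) set"
 assumes \<Omega>: "open \<Omega>" "bounded \<Omega>" and M: "prob_space M" and pq: "1 \<le> p" "1 \<le> q"
  and P: "P \<ge> 1" "p \<noteq> \<infinity> \<Longrightarrow> P = enn2real p"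
  and bd: "\<And>f g x. weak_data \<Omega> s f g \<Longrightarrow> (\<And>\<alpha>. g \<alpha> \<in> borel_measurable borel) \<Longrightarrow> energy_le P s g (ball_energy \<Omega> P) \<Longrightarrow> x \<in> \<Omega> \<Longrightarrow> \<bar>f x\<bar> \<le> C0"
  and F: "F \<in> borel_measurable M"
   "\<And>\<omega> e. \<omega> \<in> space M \<Longrightarrow> residual p P s \<Omega> (N \<omega>) e \<Longrightarrow> Lp_norm q (lebesgue_on \<Omega>) e \<le> F \<omega>"
 shows "unif_error_points M N p s q \<Omega> \<le> (\<integral>\<^sup>+ \<omega>. F \<omega> \<partial>M)"
proof -
 interpret M: prob_space M by (rule M)
 \<comment> \<open>A point mass: the algorithm uses no additional randomness.\<close>
 define R where "R = (return borel 0 :: real measure)"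
 interpret R: prob_space R unfolding R_def by (rule prob_space_return) simp
 define \<phi> where "\<phi> = (\<lambda>(\<omega>, u :: real). interpolant p s \<Omega> (N \<omega>))"
 have L: "h \<in> Lp_space q (lebesgue_on \<Omega>)" if h: "h \<in> sobolev_ball p s \<Omega>" for h
 proof -
  obtain g where g: "weak_data \<Omega> s h g" "\<And>\<alpha>. g \<alpha> \<in> borel_measurable borel" "energy_le P s g (1 + measure lborel \<Omega>)"
  proof (rule sobolev_ball_weak_data[OF \<Omega> h pq(1) P], goal_cases)
   case (2 g)
   show ?case by (rule that) (fact 2)+
  qed
  have "1 + measure lborel \<Omega> \<le> ball_energy \<Omega> P"
  proof -
   have "1 * (1 + measure lborel \<Omega>) \<le> 2 powr P * (2 * (1 + measure lborel \<Omega>))"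
    using P(1) by (intro mult_mono) (auto simp: ge_one_powr_ge_zero)
   then show ?thesis by (simp add: ball_energy_def)
  qed
  then have "energy_le P s g (ball_energy \<Omega> P)" using g(3) unfolding energy_le_def by (meson ennreal_leI order_trans)
  then have hb: "\<bar>h x\<bar> \<le> max C0 0" if "x \<in> \<Omega>" for x using bd[OF g(1,2) _ that] by (simp add: le_max_iff_disj)
  have hc: "continuous_on \<Omega> h" using h by (simp add: sobolev_ball_def sobolev_space_def)
  have "Lp_norm q (lebesgue_on \<Omega>) h < \<infinity>" using Lp_norm_le_of_bounded[OF \<Omega> hc _ hb pq(2)] by (simp add: le_less_trans)
  moreover have "h \<in> borel_measurable (lebesgue_on \<Omega>)" using \<Omega> hc by (intro continuous_imp_measurable_on_sets_lebesgue) auto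
  ultimately show ?thesis by (simp add: Lp_space_def)
 qed
 have L0: "(\<lambda>_. 0) \<in> Lp_space q (lebesgue_on \<Omega>)"
  using Lp_norm_le_of_bounded[OF \<Omega>, of "\<lambda>_. 0" 0 q] pq(2) by (simp add: Lp_space_def le_less_trans[of _ 0])
 have "interpolant p s \<Omega> K y \<in> Lp_space q (lebesgue_on \<Omega>)" for K y
 proof (cases "\<exists>h\<in>sobolev_ball p s \<Omega>. restrict h K = y")
  case True
  then obtain h where "h \<in> sobolev_ball p s \<Omega>" "restrict h K = y" by blast
  then show ?thesis using interpolant(1)[of h p s \<Omega> K] L by auto
 next
  case False
  then show ?thesis using L0 by (simp add: interpolant_def)
 qed
 then have \<phi>: "\<phi> \<in> random_mappings M R N q \<Omega>" unfolding random_mappings_def \<phi>_def by auto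
 have "unif_error_points M N p s q \<Omega> \<le>
   unif_error (M \<Otimes>\<^sub>M R) (\<lambda>(\<omega>, u) f. \<phi> (\<omega>, u) (restrict f (N \<omega>))) p s q \<Omega>"
  unfolding unif_error_points_def using \<phi> R.prob_space_axioms by (intro INF_lower2[of R] INF_lower2[of \<phi>]) auto
 also have "\<dots> \<le> (\<integral>\<^sup>+ x. F (fst x) \<partial>(M \<Otimes>\<^sub>M R))" unfolding unif_error_def upper_nn_integral_def
 proof (rule INF_lower)
  show "(\<lambda>x. F (fst x)) \<in> {G \<in> borel_measurable (M \<Otimes>\<^sub>M R). \<forall>\<omega>\<in>space (M \<Otimes>\<^sub>M R).
    (SUP f\<in>sobolev_ball p s \<Omega>. Lp_norm q (lebesgue_on \<Omega>)
     (\<lambda>x. f x - (\<lambda>(\<omega>, u) f. \<phi> (\<omega>, u) (restrict f (N \<omega>))) \<omega> f x)) \<le> G \<omega>}"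
  proof (intro CollectI conjI ballI SUP_least)
   show "(\<lambda>x. F (fst x)) \<in> borel_measurable (M \<Otimes>\<^sub>M R)" using F(1) by measurable
   fix \<omega> f assume w: "\<omega> \<in> space (M \<Otimes>\<^sub>M R)" and f: "f \<in> sobolev_ball p s \<Omega>"
   have "residual p P s \<Omega> (N (fst \<omega>)) (\<lambda>x. f x - interpolant p s \<Omega> (N (fst \<omega>)) (restrict f (N (fst \<omega>))) x)"
    by (rule residual_diff[OF \<Omega> f interpolant(1)[OF f] pq(1) P interpolant(2)[OF f]])
   from F(2)[OF _ this] w
   show "Lp_norm q (lebesgue_on \<Omega>) (\<lambda>x. f x - (\<lambda>(\<omega>, u) f. \<phi> (\<omega>, u) (restrict f (N \<omega>))) \<omega> f x) \<le> F (fst \<omega>)"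
    by (simp add: \<phi>_def case_prod_beta space_pair_measure mem_Times_iff)
  qed
 qed
 also have "\<dots> = (\<integral>\<^sup>+ \<omega>. (\<integral>\<^sup>+ u. F \<omega> \<partial>R) \<partial>M)" using F(1) by (subst R.nn_integral_fst[symmetric]) auto
 also have "\<dots> = (\<integral>\<^sup>+ \<omega>. F \<omega> \<partial>M)" by (simp add: R.emeasure_space_1)
 finally show ?thesis .
qed

lemma enn2real_one_divide:
 assumes "1 \<le> p" "p \<noteq> \<infinity>"
 shows "enn2real (1 / p) = 1 / enn2real p"
proof -
 have "p = ennreal (enn2real p)" using assms by (simp add: less_top)
 then have "1 / p = ennreal (1 / enn2real p)" using enn2real_ge_1[OF assms] divide_ennreal[of 1 "enn2real p"] by simp
 then show ?thesis using enn2real_ge_1[OF assms] by simp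
qed

subsection \<open>Upper bounds\<close>

text \<open>Fixes the exponent \<open>P\<close> and the constants of \<open>local_estimate\<close>
  and \<open>embedding_bound\<close>, which are shared by both upper bounds.\<close>

locale upper_setup =
 fixes \<Omega> :: "(real ^ 'd::finite) set" and s :: nat and p :: ennreal and P :: real
  and Y :: "(real ^ 'd) set" and \<eta> R C C0 :: real
 assumes \<Omega>: "open \<Omega>" "bounded \<Omega>" "\<Omega> \<noteq> {}" and P: "P \<ge> 1"
  and params: "finite Y" "\<eta> > 0" "R > 0" "C > 0" "C0 > 0"
  and local_bound: "\<And>f g x t I. weak_data \<Omega> s f g \<Longrightarrow> (\<And>\<alpha>. g \<alpha> \<in> borel_measurable borel) \<Longrightarrow> x \<in> \<Omega> \<Longrightarrow> 0 < t \<Longrightarrow> t \<le> 1 \<Longrightarrow>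
    (\<And>y. y \<in> Y \<Longrightarrow> cball (x + t *\<^sub>R y) (t * \<eta>) \<subseteq> \<Omega> \<Longrightarrow> \<exists>u\<in>cball (x + t *\<^sub>R y) (t * \<eta>). f u = 0) \<Longrightarrow> I \<ge> 0 \<Longrightarrow>
    local_energy s g P x (R * t) \<le> ennreal I \<Longrightarrow>
    \<bar>f x\<bar> powr P \<le> C * t powr (real s * P - real CARD('d)) * I"
  and value_bound: "\<And>f g x. weak_data \<Omega> s f g \<Longrightarrow> (\<And>\<alpha>. g \<alpha> \<in> borel_measurable borel) \<Longrightarrow> energy_le P s g (ball_energy \<Omega> P) \<Longrightarrow>
   x \<in> \<Omega> \<Longrightarrow> \<bar>f x\<bar> \<le> C0"
begin

definition card_mi :: real where "card_mi = real (card (multi_indices s :: ('d \<Rightarrow> nat) set))"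

text \<open>Bounds the integral of \<open>top_derivs\<close> to the power \<open>P\<close> for
  residuals; the summand 1 makes it positive.\<close>

definition total :: real where "total = card_mi powr P * (card_mi * ball_energy \<Omega> P) + 1"

lemma total_pos: "total > 0"
 unfolding total_def card_mi_def using ball_energy_nonneg by (intro add_nonneg_pos mult_nonneg_nonneg) auto

definition vol :: real where "vol = measure lborel \<Omega>"

lemma vol: "emeasure lborel \<Omega> = ennreal vol" "vol > 0"
proof -
 have fin: "emeasure lborel \<Omega> < \<infinity>" by (rule emeasure_bounded_finite[OF \<Omega>(2)])
 then show e: "emeasure lborel \<Omega> = ennreal vol" unfolding vol_def by (simp add: emeasure_eq_ennreal_measure)
 have "emeasure lborel \<Omega> \<noteq> 0"
 proof
  assume "emeasure lborel \<Omega> = 0"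
  then have "negligible \<Omega>" using \<Omega>(1) by (simp add: negligible_iff_null_sets null_sets_completionI null_setsI)
  then show False using open_not_negligible[OF \<Omega>(1,3)] by blast
 qed
 then show "vol > 0" unfolding e by (simp add: ennreal_eq_0_iff not_le)
qed

definition nearby :: "(('d \<Rightarrow> nat) \<Rightarrow> real ^ 'd \<Rightarrow> real) \<Rightarrow> real \<Rightarrow> real ^ 'd \<Rightarrow> ennreal" where
 "nearby g t x = local_energy s g P x (R * t)"

definition ball_R :: real where "ball_R = measure lborel (cball (0 :: real ^ 'd) R)"

lemma ball_R_pos: "ball_R > 0" unfolding ball_R_def using params by (intro measure_cball_pos)

lemma nearby_le_total:
 assumes g: "\<And>\<alpha>. g \<alpha> \<in> borel_measurable borel" and en: "energy_le P s g (ball_energy \<Omega> P)"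
 shows "(\<integral>\<^sup>+ w. ennreal (top_derivs s g w powr P) \<partial>lborel) \<le> ennreal total" "nearby g t x \<le> ennreal total"
proof -
 have "(\<integral>\<^sup>+ w. ennreal (top_derivs s g w powr P) \<partial>lborel) \<le> ennreal (card_mi powr P * (card_mi * ball_energy \<Omega> P))"
  unfolding card_mi_def by (rule top_derivs_energy[OF g en ball_energy_nonneg P])
 also have "\<dots> \<le> ennreal total" unfolding total_def by (intro ennreal_leI) simp
 finally show 1: "(\<integral>\<^sup>+ w. ennreal (top_derivs s g w powr P) \<partial>lborel) \<le> ennreal total" .
 have "nearby g t x \<le> (\<integral>\<^sup>+ w. ennreal (top_derivs s g w powr P) \<partial>lborel)"
  unfolding nearby_def by (intro nn_integral_mono) (auto simp: indicator_def)
 then show "nearby g t x \<le> ennreal total" using 1 by (rule order_trans)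
qed

text \<open>By Fubini's theorem each \<open>w\<close> is counted for those \<open>x\<close> whose
  ball contains it, a set of measure t^d \<open>ball_R\<close>. This plays the role of a covering
  with bounded overlap.\<close>

lemma nearby_integral:
 assumes g[measurable]: "\<And>\<alpha>. g \<alpha> \<in> borel_measurable borel" and en: "energy_le P s g (ball_energy \<Omega> P)" and t: "t > 0"
 shows "nearby g t \<in> borel_measurable borel"
  "(\<integral>\<^sup>+ x. nearby g t x \<partial>lborel) \<le> ennreal (t ^ CARD('d) * (ball_R * total))"
proof -
 have eq: "indicator (cball x (R * t)) w = (indicator {..R * t} (dist x w) :: ennreal)" for x w :: "real ^ 'd"
  by (simp add: indicator_def)
 show "nearby g t \<in> borel_measurable borel" unfolding nearby_def[abs_def] eq by measurable
 have "(\<integral>\<^sup>+ x. nearby g t x \<partial>lborel) = (\<integral>\<^sup>+ w. (\<integral>\<^sup>+ x. ennreal (top_derivs s g w powr P) * indicator {..R * t} (dist x w) \<partial>lborel) \<partial>lborel)"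
  unfolding nearby_def eq by (rule lborel_pair.Fubini') measurable
 also have "\<dots> = (\<integral>\<^sup>+ w. ennreal (top_derivs s g w powr P) * ennreal (t ^ CARD('d) * ball_R) \<partial>lborel)"
 proof (rule nn_integral_cong)
  fix w :: "real ^ 'd"
  have "(\<integral>\<^sup>+ x. indicator {..R * t} (dist x w) \<partial>lborel) = (\<integral>\<^sup>+ x. indicator (cball w (t * R)) x \<partial>lborel)"
   by (intro nn_integral_cong) (simp add: indicator_def dist_commute mult.commute)
  also have "\<dots> = ennreal (t ^ CARD('d) * ball_R)"
   using measure_cball_pos(1)[of "t * R" w] measure_cball_scale[OF t params(3), of w 0] t params by (simp add: ball_R_def)
  finally show "(\<integral>\<^sup>+ x. ennreal (top_derivs s g w powr P) * indicator {..R * t} (dist x w) \<partial>lborel) =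
    ennreal (top_derivs s g w powr P) * ennreal (t ^ CARD('d) * ball_R)" by (subst nn_integral_cmult) auto
 qed
 also have "\<dots> = (\<integral>\<^sup>+ w. ennreal (top_derivs s g w powr P) \<partial>lborel) * ennreal (t ^ CARD('d) * ball_R)"
  by (rule nn_integral_multc) measurable
 also have "\<dots> \<le> ennreal total * ennreal (t ^ CARD('d) * ball_R)" by (intro mult_right_mono nearby_le_total(1)[OF g en]) simp
 also have "\<dots> = ennreal (t ^ CARD('d) * (ball_R * total))"
  using total_pos ball_R_pos t by (simp add: ennreal_mult[symmetric] mult_ac)
 finally show "(\<integral>\<^sup>+ x. nearby g t x \<partial>lborel) \<le> ennreal (t ^ CARD('d) * (ball_R * total))" .
qed

lemma pointwise_good:
 assumes wd: "weak_data \<Omega> s e g" and g: "\<And>\<alpha>. g \<alpha> \<in> borel_measurable borel"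
  and zero: "\<And>u. u \<in> N \<Longrightarrow> e u = 0" and x: "x \<in> \<Omega>" and t: "0 < t" "t \<le> 1"
  and hit: "\<And>y. y \<in> Y \<Longrightarrow> cball (x + t *\<^sub>R y) (t * \<eta>) \<subseteq> \<Omega> \<Longrightarrow> cball (x + t *\<^sub>R y) (t * \<eta>) \<inter> N \<noteq> {}"
  and I: "I \<ge> 0" "nearby g t x \<le> ennreal I"
 shows "\<bar>e x\<bar> powr P \<le> C * t powr (real s * P - real CARD('d)) * I"
proof (rule local_bound[OF wd g x t _ I(1)])
 show "\<exists>u\<in>cball (x + t *\<^sub>R y) (t * \<eta>). e u = 0" if "y \<in> Y" "cball (x + t *\<^sub>R y) (t * \<eta>) \<subseteq> \<Omega>" for y
  using hit[OF that] zero by blast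
qed (use I(2) in \<open>simp add: nearby_def\<close>)

lemma Lp_norm_top_le:
 assumes e: "continuous_on \<Omega> e" and B: "B \<ge> 0" "\<And>x. x \<in> \<Omega> \<Longrightarrow> \<bar>e x\<bar> powr P \<le> B"
 shows "Lp_norm \<infinity> (lebesgue_on \<Omega>) e \<le> ennreal (B powr (1 / P))"
proof -
 have em: "e \<in> borel_measurable (lebesgue_on \<Omega>)" using \<Omega> e by (intro continuous_imp_measurable_on_sets_lebesgue) auto
 have b: "\<bar>e x\<bar> \<le> B powr (1 / P)" if "x \<in> \<Omega>" for x
 proof -
  have "(\<bar>e x\<bar> powr P) powr (1 / P) \<le> B powr (1 / P)" using B(2)[OF that] P by (intro powr_mono2) auto
  then show ?thesis using P by (simp add: powr_powr)
 qed
 have "esssup (lebesgue_on \<Omega>) (\<lambda>x. ennreal \<bar>e x\<bar>) \<le> ennreal (B powr (1 / P))"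
  using em b by (intro esssup_I) (auto intro!: AE_I2 ennreal_leI simp: space_restrict_space)
 then show ?thesis by (simp add: Lp_norm_def)
qed

lemma nn_integral_lebesgue_on:
 fixes h :: "real ^ 'd \<Rightarrow> ennreal"
 shows "(\<integral>\<^sup>+ x. h x \<partial>lebesgue_on \<Omega>) = (\<integral>\<^sup>+ x. h x * indicator \<Omega> x \<partial>lborel)"
proof -
 have "(\<integral>\<^sup>+ x. h x \<partial>lebesgue_on \<Omega>) = (\<integral>\<^sup>+ x. h x * indicator \<Omega> x \<partial>lebesgue)" using \<Omega> by (subst nn_integral_restrict_space) auto
 then show ?thesis by (simp add: nn_integral_completion)
qed

lemma residual_continuous: "residual p P s \<Omega> N e \<Longrightarrow> continuous_on \<Omega> e" by (auto simp: residual_def weak_data_def)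

lemma residual_bounded: "residual p P s \<Omega> N e \<Longrightarrow> x \<in> \<Omega> \<Longrightarrow> \<bar>e x\<bar> \<le> C0" using value_bound unfolding residual_def by blast

text \<open>If q is finite, the P-th power of the error is a power of \<open>t\<close> times a local
  energy I; as I is at most \<open>total\<close> and integrates to order t^d, its power Q/P \<ge> 1
  costs nothing more. If only q is infinite, I \<le> \<open>total\<close> suffices. If p is infinite
  as well, I itself is of order t^d and compensates for the t^(-d) of the local estimate.\<close>

lemma ex_residual_rate:
 assumes pq: "1 \<le> p" "p \<le> q" and Pp: "p \<noteq> \<infinity> \<Longrightarrow> P = enn2real p"
 shows "\<exists>C1>0. \<forall>t N e. 0 < t \<longrightarrow> t \<le> 1 \<longrightarrow> residual p P s \<Omega> N e \<longrightarrow>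
  (\<forall>x\<in>\<Omega>. \<forall>y\<in>Y. cball (x + t *\<^sub>R y) (t * \<eta>) \<subseteq> \<Omega> \<longrightarrow> cball (x + t *\<^sub>R y) (t * \<eta>) \<inter> N \<noteq> {}) \<longrightarrow>
  Lp_norm q (lebesgue_on \<Omega>) e \<le>
   ennreal (C1 * t powr (real s - real CARD('d) * enn2real (1 / p) + real CARD('d) * enn2real (1 / q)))"
proof -
 let ?d = "real CARD('d)"
 let ?good = "\<lambda>t N. \<forall>x\<in>\<Omega>. \<forall>y\<in>Y. cball (x + t *\<^sub>R y) (t * \<eta>) \<subseteq> \<Omega> \<longrightarrow> cball (x + t *\<^sub>R y) (t * \<eta>) \<inter> N \<noteq> {}"
 consider "p = \<infinity>" "q = \<infinity>" | "p \<noteq> \<infinity>" "q = \<infinity>" | "p \<noteq> \<infinity>" "q \<noteq> \<infinity>"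
  using pq(2) by (cases "p = \<infinity>"; cases "q = \<infinity>") (auto simp: top_unique)
 then show ?thesis
 proof cases
  case 1
  define B where "B = C * ((card_mi * 2) powr P * ball_R) + 1"
  have B: "B > 0" unfolding B_def using params ball_R_pos by (intro add_nonneg_pos mult_nonneg_nonneg) auto
  show ?thesis
  proof (intro exI[of _ "B powr (1 / P)"] conjI allI impI)
   show "B powr (1 / P) > 0" using B by simp
   fix t N e assume t: "0 < t" "t \<le> 1" and r: "residual p P s \<Omega> N e" and good: "?good t N"
   obtain g where g: "weak_data \<Omega> s e g" "\<And>\<alpha>. g \<alpha> \<in> borel_measurable borel" "\<And>\<alpha>. AE x in lborel. \<bar>g \<alpha> x\<bar> \<le> 2"
    and z: "\<And>u. u \<in> N \<Longrightarrow> e u = 0" using r 1 unfolding residual_def by blast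
   have ae: "AE w in lborel. top_derivs s g w \<le> card_mi * 2"
   proof -
    have "AE w in lborel. \<forall>\<alpha>\<in>multi_indices s. \<bar>g \<alpha> w\<bar> \<le> 2" using g(3) by (intro AE_finite_allI finite_multi_indices)
    then show ?thesis
    proof eventually_elim
     case (elim w)
     have "top_derivs s g w \<le> (\<Sum>\<alpha>\<in>multi_indices s. \<bar>g \<alpha> w\<bar>)"
      unfolding top_derivs_def by (intro sum_mono2 finite_multi_indices) (auto simp: multi_indices_def)
     also have "\<dots> \<le> (\<Sum>\<alpha>\<in>(multi_indices s :: ('d \<Rightarrow> nat) set). 2)" using elim by (intro sum_mono) auto
     finally show ?case by (simp add: card_mi_def)
    qed
   qed
   have near: "nearby g t x \<le> ennreal ((card_mi * 2) powr P * (t ^ CARD('d) * ball_R))" for x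
   proof -
    have "nearby g t x \<le> (\<integral>\<^sup>+ w. ennreal ((card_mi * 2) powr P) * indicator (cball x (R * t)) w \<partial>lborel)" unfolding nearby_def
    proof (rule nn_integral_mono_AE)
     show "AE w in lborel. ennreal (top_derivs s g w powr P) * indicator (cball x (R * t)) w \<le>
       ennreal ((card_mi * 2) powr P) * indicator (cball x (R * t)) w"
      using ae by eventually_elim (use P top_derivs_nonneg in \<open>auto intro!: mult_right_mono ennreal_leI powr_mono2\<close>)
    qed
    also have "\<dots> = ennreal ((card_mi * 2) powr P) * emeasure lborel (cball x (R * t))" by (rule nn_integral_cmult_indicator) simp
    also have "emeasure lborel (cball x (R * t)) = ennreal (t ^ CARD('d) * ball_R)"
     using measure_cball_pos(1)[of "t * R" x] measure_cball_scale[OF t(1) params(3), of x 0] t params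
     by (simp add: ball_R_def mult.commute[of R])
    finally show ?thesis using ball_R_pos t by (subst ennreal_mult) auto
   qed
   have "\<bar>e x\<bar> powr P \<le> B * t powr (real s * P)" if x: "x \<in> \<Omega>" for x
   proof -
    have "\<bar>e x\<bar> powr P \<le> C * t powr (real s * P - ?d) * ((card_mi * 2) powr P * (t ^ CARD('d) * ball_R))"
     by (rule pointwise_good[OF g(1,2) z x t _ _ near]) (use good x t ball_R_pos in auto)
    also have "t ^ CARD('d) = t powr ?d" using t by (simp add: powr_realpow)
    also have "C * t powr (real s * P - ?d) * ((card_mi * 2) powr P * (t powr ?d * ball_R)) =
      (C * ((card_mi * 2) powr P * ball_R)) * (t powr (real s * P - ?d) * t powr ?d)" by (simp add: mult_ac)
    also have "t powr (real s * P - ?d) * t powr ?d = t powr (real s * P)" by (simp add: powr_add[symmetric])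
    also have "(C * ((card_mi * 2) powr P * ball_R)) * t powr (real s * P) \<le> B * t powr (real s * P)"
     unfolding B_def by (intro mult_right_mono) auto
    finally show ?thesis .
   qed
   then have "Lp_norm \<infinity> (lebesgue_on \<Omega>) e \<le> ennreal ((B * t powr (real s * P)) powr (1 / P))"
    using B by (intro Lp_norm_top_le residual_continuous[OF r]) auto
   also have "(B * t powr (real s * P)) powr (1 / P) = B powr (1 / P) * t powr real s"
    using B P by (simp add: powr_mult powr_powr)
   finally show "Lp_norm q (lebesgue_on \<Omega>) e \<le> ennreal (B powr (1 / P) * t powr (real s - ?d * enn2real (1 / p) + ?d * enn2real (1 / q)))"
    using 1 by simp
  qed
 next
  case 2
  define B where "B = C * total"
  have B: "B > 0" unfolding B_def using params total_pos by simp
  have P': "enn2real (1 / p) = 1 / P" using 2 Pp enn2real_one_divide[OF pq(1)] by simp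
  show ?thesis
  proof (intro exI[of _ "B powr (1 / P)"] conjI allI impI)
   show "B powr (1 / P) > 0" using B by simp
   fix t N e assume t: "0 < t" "t \<le> 1" and r: "residual p P s \<Omega> N e" and good: "?good t N"
   obtain g where g: "weak_data \<Omega> s e g" "\<And>\<alpha>. g \<alpha> \<in> borel_measurable borel" "energy_le P s g (ball_energy \<Omega> P)"
    and z: "\<And>u. u \<in> N \<Longrightarrow> e u = 0" using r unfolding residual_def by blast
   have "\<bar>e x\<bar> powr P \<le> B * t powr (real s * P - ?d)" if x: "x \<in> \<Omega>" for x
   proof -
    have "\<bar>e x\<bar> powr P \<le> C * t powr (real s * P - ?d) * total"
     by (rule pointwise_good[OF g(1,2) z x t _ _ nearby_le_total(2)[OF g(2,3)]]) (use good x total_pos in auto)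
    then show ?thesis by (simp add: B_def mult_ac)
   qed
   then have "Lp_norm \<infinity> (lebesgue_on \<Omega>) e \<le> ennreal ((B * t powr (real s * P - ?d)) powr (1 / P))"
    using B by (intro Lp_norm_top_le residual_continuous[OF r]) auto
   also have "(B * t powr (real s * P - ?d)) powr (1 / P) = B powr (1 / P) * t powr (real s - ?d * (1 / P))"
    using B P by (simp add: powr_mult powr_powr diff_divide_distrib)
   finally show "Lp_norm q (lebesgue_on \<Omega>) e \<le> ennreal (B powr (1 / P) * t powr (real s - ?d * enn2real (1 / p) + ?d * enn2real (1 / q)))"
    using 2 P' by simp
  qed
 next
  case 3
  define Q where "Q = enn2real q"
  have Q: "Q \<ge> 1" unfolding Q_def using pq 3 by (intro enn2real_ge_1) (auto intro: order_trans)
  have PQ: "P \<le> Q" unfolding Q_def using Pp 3 pq(2) by (simp add: enn2real_mono less_top)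
  have P': "enn2real (1 / p) = 1 / P" "enn2real (1 / q) = 1 / Q" 
   using 3 Pp enn2real_one_divide[OF pq(1)] enn2real_one_divide[OF order_trans[OF pq]] unfolding Q_def by simp_all
  define B where "B = C powr (Q / P) * total powr (Q / P - 1) * (ball_R * total)"
  have B: "B > 0" unfolding B_def using params total_pos ball_R_pos by simp
  show ?thesis
  proof (intro exI[of _ "B powr (1 / Q)"] conjI allI impI)
   show "B powr (1 / Q) > 0" using B by simp
   fix t N e assume t: "0 < t" "t \<le> 1" and r: "residual p P s \<Omega> N e" and good: "?good t N"
   obtain g where g: "weak_data \<Omega> s e g" "\<And>\<alpha>. g \<alpha> \<in> borel_measurable borel" "energy_le P s g (ball_energy \<Omega> P)"
    and z: "\<And>u. u \<in> N \<Longrightarrow> e u = 0" using r unfolding residual_def by blast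
   define K where "K = (C * t powr (real s * P - ?d)) powr (Q / P) * total powr (Q / P - 1)"
   have pw: "ennreal (\<bar>e x\<bar> powr Q) * indicator \<Omega> x \<le> ennreal K * nearby g t x" for x
   proof (cases "x \<in> \<Omega>")
    case True
    define I where "I = enn2real (nearby g t x)"
    have le: "nearby g t x \<le> ennreal total" by (rule nearby_le_total(2)[OF g(2,3)])
    then have I: "nearby g t x = ennreal I" "I \<ge> 0" "I \<le> total"
     unfolding I_def using total_pos by (auto simp: enn2real_leI top_unique less_top intro!: ennreal_enn2real[symmetric] le_less_trans[OF le])
    have "\<bar>e x\<bar> powr P \<le> C * t powr (real s * P - ?d) * I"
     by (rule pointwise_good[OF g(1,2) z True t _ I(2)]) (use good True I in auto)
    then have "(\<bar>e x\<bar> powr P) powr (Q / P) \<le> (C * t powr (real s * P - ?d) * I) powr (Q / P)" using P Q by (intro powr_mono2) auto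
    then have "\<bar>e x\<bar> powr Q \<le> (C * t powr (real s * P - ?d)) powr (Q / P) * I powr (Q / P)"
     using P params I by (simp add: powr_powr powr_mult)
    \<comment> \<open>Here p \<le> q enters: the exponent \<open>Q / P - 1\<close> is
      nonnegative.\<close>
    also have "I powr (Q / P) \<le> total powr (Q / P - 1) * I"
    proof (cases "I = 0")
     case False
     then have "I powr (Q / P) = I powr (Q / P - 1) * I" using I powr_add[of I "Q / P - 1" 1] by simp
     also have "\<dots> \<le> total powr (Q / P - 1) * I" using I PQ P by (intro mult_right_mono powr_mono2) (auto simp: le_divide_eq)
     finally show ?thesis .
    qed simp
    finally have "\<bar>e x\<bar> powr Q \<le> K * I" by (simp add: K_def mult_left_mono mult.assoc)
    then show ?thesis using True I by (simp add: ennreal_mult'[symmetric] ennreal_leI K_def)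
   qed simp
   have "(\<integral>\<^sup>+ x. ennreal (\<bar>e x\<bar> powr Q) \<partial>lebesgue_on \<Omega>) \<le> (\<integral>\<^sup>+ x. ennreal K * nearby g t x \<partial>lborel)"
    unfolding nn_integral_lebesgue_on by (intro nn_integral_mono pw)
   also have "\<dots> = ennreal K * (\<integral>\<^sup>+ x. nearby g t x \<partial>lborel)"
    using nearby_integral(1)[OF g(2,3) t(1)] by (intro nn_integral_cmult) simp
   also have "\<dots> \<le> ennreal K * ennreal (t ^ CARD('d) * (ball_R * total))"
    by (intro mult_left_mono nearby_integral(2)[OF g(2,3) t(1)]) simp
   also have "\<dots> = ennreal (K * (t ^ CARD('d) * (ball_R * total)))" by (simp add: ennreal_mult'[symmetric] K_def)
   also have "K * (t ^ CARD('d) * (ball_R * total)) = B * t powr ((real s * P - ?d) * (Q / P) + ?d)"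
    using params t by (simp add: K_def B_def powr_mult powr_powr powr_add powr_realpow mult_ac)
   finally have "Lp_norm q (lebesgue_on \<Omega>) e \<le> ennreal ((B * t powr ((real s * P - ?d) * (Q / P) + ?d)) powr (1 / Q))"
    unfolding Q_def using 3 pq B by (intro Lp_norm_le_of_nn_integral) (auto intro: order_trans)
   also have "(B * t powr ((real s * P - ?d) * (Q / P) + ?d)) powr (1 / Q) =
     B powr (1 / Q) * t powr (((real s * P - ?d) * (Q / P) + ?d) * (1 / Q))" using B by (simp add: powr_mult powr_powr)
   also have "((real s * P - ?d) * (Q / P) + ?d) * (1 / Q) = real s - ?d * enn2real (1 / p) + ?d * enn2real (1 / q)"
    unfolding P' using P Q by (simp add: field_simps)
   finally show "Lp_norm q (lebesgue_on \<Omega>) e \<le> ennreal (B powr (1 / Q) * t powr (real s - ?d * enn2real (1 / p) + ?d * enn2real (1 / q)))" .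
  qed
 qed
qed

lemma error_le:
 assumes M: "prob_space M" and pq: "1 \<le> p" "1 \<le> q" and Pp: "p \<noteq> \<infinity> \<Longrightarrow> P = enn2real p"
  and F: "F \<in> borel_measurable M"
   "\<And>\<omega> e. \<omega> \<in> space M \<Longrightarrow> residual p P s \<Omega> (N \<omega>) e \<Longrightarrow> Lp_norm q (lebesgue_on \<Omega>) e \<le> F \<omega>"
 shows "unif_error_points M N p s q \<Omega> \<le> (\<integral>\<^sup>+ \<omega>. F \<omega> \<partial>M)"
proof (rule unif_error_points_le[where P = P and \<Omega> = \<Omega> and ?C0.0 = C0])
 show "\<bar>f x\<bar> \<le> C0" if "weak_data \<Omega> s f g" "\<And>\<alpha>. g \<alpha> \<in> borel_measurable borel"
  "energy_le P s g (ball_energy \<Omega> P)" "x \<in> \<Omega>" for f g x using that by (rule value_bound)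
qed (fact \<Omega> M pq P Pp F)+

text \<open>One empty ball of radius \<open>t * \<eta>\<close> provides many of half the radius. A
  single failure thus forces \<open>unhit\<close> to have measure of order t^d, and the probability
  of failure is controlled by an expected measure, as in Markov's inequality.\<close>

lemma not_hit_imp_unhit:
 assumes t: "t > 0" and hit: "cball z (t * \<eta>) \<subseteq> \<Omega>" "cball z (t * \<eta>) \<inter> (\<lambda>i. X i \<omega>) ` {..<n} = {}"
 shows "cball z (t * (\<eta> / 2)) \<subseteq> unhit \<Omega> n X (t * (\<eta> / 2)) \<omega>"
proof
 fix u assume u: "u \<in> cball z (t * (\<eta> / 2))"
 have "cball u (t * (\<eta> / 2)) \<subseteq> cball z (t * \<eta>)"
 proof
  fix v assume "v \<in> cball u (t * (\<eta> / 2))"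
  then show "v \<in> cball z (t * \<eta>)" using u dist_triangle[of z v u] by simp
 qed
 moreover have "t * (\<eta> / 2) < dist u (X i \<omega>)" if "i < n" for i
 proof -
  have "X i \<omega> \<notin> cball z (t * \<eta>)" using hit(2) that by auto
  then show ?thesis using u dist_triangle[of z "X i \<omega>" u] by simp
 qed
 ultimately show "u \<in> unhit \<Omega> n X (t * (\<eta> / 2)) \<omega>" using hit(1) unfolding unhit_def by blast
qed

text \<open>The random covering radius is compared with one deterministic scale \<open>t\<close>.
  Either all relevant balls of this scale are hit and \<open>ex_residual_rate\<close> applies, or
  the trivial bound \<open>D0\<close> is at most \<open>c\<close> times the measure of
  \<open>unhit\<close>. The sum of both bounds holds for every sample and is measurable.\<close>

lemma upper_bound_ge:
 assumes pq: "1 \<le> p" "p \<le> q" and Pp: "p \<noteq> \<infinity> \<Longrightarrow> P = enn2real p"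
  and b0: "0 \<le> real s / real CARD('d) - enn2real (1 / p) + enn2real (1 / q)"
 shows "\<exists>K>0. \<forall>n\<ge>2. \<forall>(M :: 'w measure) X. iid_uniform M \<Omega> n X \<longrightarrow>
   unif_error_points M (\<lambda>\<omega>. (\<lambda>i. X i \<omega>) ` {..<n}) p s q \<Omega> \<le>
    ennreal (K * (real n / ln (real n)) powr (- real s / real CARD('d) + enn2real (1 / p) - enn2real (1 / q)))"
proof -
 let ?d = "real CARD('d)"
 define b where "b = real s / ?d - enn2real (1 / p) + enn2real (1 / q)"
 have b: "b \<ge> 0" unfolding b_def using b0 .
 obtain C1 where C1: "C1 > 0" "\<And>t N e. 0 < t \<Longrightarrow> t \<le> 1 \<Longrightarrow> residual p P s \<Omega> N e \<Longrightarrow>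
  (\<forall>x\<in>\<Omega>. \<forall>y\<in>Y. cball (x + t *\<^sub>R y) (t * \<eta>) \<subseteq> \<Omega> \<longrightarrow> cball (x + t *\<^sub>R y) (t * \<eta>) \<inter> N \<noteq> {}) \<Longrightarrow>
  Lp_norm q (lebesgue_on \<Omega>) e \<le> ennreal (C1 * t powr (?d * b))"
 proof -
  have "?d * b = real s - ?d * enn2real (1 / p) + ?d * enn2real (1 / q)" unfolding b_def by (simp add: field_simps)
  then show ?thesis using ex_residual_rate[OF pq Pp] that by auto
 qed
 define D0 where "D0 = C0 * (1 + vol)"
 have D0: "D0 > 0" unfolding D0_def using params vol by simp
 have trivial: "Lp_norm q (lebesgue_on \<Omega>) e \<le> ennreal D0" if "residual p P s \<Omega> N e" for N e unfolding D0_def vol_def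
  by (rule Lp_norm_le_of_bounded[OF \<Omega>(1,2) residual_continuous[OF that]])
    (use residual_bounded[OF that] params pq in \<open>auto intro: order_trans\<close>)
 define v where "v = measure lborel (cball (0 :: real ^ 'd) (\<eta> / 2))"
 have v: "v > 0" unfolding v_def using params by (intro measure_cball_pos) simp
 define k where "k = (\<eta> / 2) ^ CARD('d) * (unit_ball_vol ?d / vol)"
 have k: "k > 0" unfolding k_def using params vol by (simp add: unit_ball_vol_pos)
 \<comment> \<open>With t^d = A ln n / n the expected measure decays like n^(-(1 + b)): b for the
   rate, and one more power to pay for the division by t^d in \<open>c\<close> below.\<close>
 define A where "A = (1 + b) / k"
 have A: "A > 0" "k * A = 1 + b" unfolding A_def using b k by auto
 \<comment> \<open>The summands stem from the regular samples, from the failures, and from those n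
   for which the scale \<open>t\<close> would exceed 1.\<close>
 define K where "K = C1 * A powr b + D0 / v * vol / (A * ln 2) / ln 2 powr b + D0 * A powr b"
 have K0: "C1 * A powr b + D0 / v * vol / (A * ln 2) / ln 2 powr b > 0" using C1 A D0 v vol by (intro add_pos_nonneg) auto
 have K1: "D0 * A powr b > 0" using D0 A by simp
 show ?thesis
 proof (intro exI[of _ K] conjI allI impI)
  show "K > 0" unfolding K_def using K0 K1 by simp
  fix n :: nat and M :: "'w measure" and X assume n: "n \<ge> 2" and iid: "iid_uniform M \<Omega> n X"
  let ?N = "\<lambda>\<omega>. (\<lambda>i. X i \<omega>) ` {..<n}"
  have pM: "prob_space M" by (rule iid_uniformD(1)[OF iid])
  have ln: "ln (real n) \<ge> ln 2" "ln (real n) > 0" using n by auto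
  have rate: "(real n / ln (real n)) powr (- real s / ?d + enn2real (1 / p) - enn2real (1 / q)) = (ln (real n) / real n) powr b"
  proof -
   have "- real s / ?d + enn2real (1 / p) - enn2real (1 / q) = - b" unfolding b_def by simp
   then show ?thesis using ln n by (simp add: powr_minus powr_divide)
  qed
  have nr: "real n > 0" using n by simp
  have "unif_error_points M ?N p s q \<Omega> \<le> ennreal (K * (ln (real n) / real n) powr b)"
  proof (cases "A * ln (real n) \<le> real n")
   case False
   have "unif_error_points M ?N p s q \<Omega> \<le> (\<integral>\<^sup>+ \<omega>. ennreal D0 \<partial>M)"
    by (rule error_le[OF pM pq(1) order_trans[OF pq] Pp]) (use trivial in auto)
   also have "\<dots> = ennreal D0" using pM by (simp add: prob_space.emeasure_space_1)
   also have "\<dots> \<le> ennreal (K * (ln (real n) / real n) powr b)"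
   proof (rule ennreal_leI)
    have "1 \<le> (A * (ln (real n) / real n)) powr b" using False nr b A ln by (intro ge_one_powr_ge_zero) (auto simp: field_simps)
    then have "D0 * 1 \<le> D0 * (A * (ln (real n) / real n)) powr b" using D0 by (intro mult_left_mono) auto
    also have "\<dots> = (D0 * A powr b) * (ln (real n) / real n) powr b" using A ln nr by (subst powr_mult) (auto simp: mult.assoc)
    also have "\<dots> \<le> K * (ln (real n) / real n) powr b" unfolding K_def using K0 by (intro mult_right_mono) auto
    finally show "D0 \<le> K * (ln (real n) / real n) powr b" by simp
   qed
   finally show ?thesis .
  next
   case True
   define x where "x = A * ln (real n) / real n"
   define t where "t = x powr (1 / ?d)"
   have x0: "0 < x" "x \<le> 1" unfolding x_def using True A ln nr by auto
   have t: "0 < t" "t \<le> 1" unfolding t_def using x0 by (auto intro: powr_le1)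
   have "t ^ CARD('d) = x" unfolding t_def using x0 by (subst powr_realpow[symmetric]) (simp_all add: powr_powr)
   then have td: "t ^ CARD('d) = A * ln (real n) / real n" by (simp add: x_def)
   have tb: "t powr (?d * b) = A powr b * (ln (real n) / real n) powr b"
   proof -
    have "t powr (?d * b) = x powr b" unfolding t_def using x0 by (simp add: powr_powr)
    also have "x = A * (ln (real n) / real n)" by (simp add: x_def)
    also have "(A * (ln (real n) / real n)) powr b = A powr b * (ln (real n) / real n) powr b"
     using A ln nr by (subst powr_mult) auto
    finally show ?thesis .
   qed
   let ?U = "\<lambda>\<omega>. emeasure lborel (unhit \<Omega> n X (t * (\<eta> / 2)) \<omega>)"
   have t\<eta>: "t * (\<eta> / 2) > 0" using t params by simp
   have n0: "n > 0" using n by simp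
   note EU = expected_unhit[OF iid n0 \<Omega> t\<eta>]
   note [measurable] = EU(1)
   \<comment> \<open>The denominator is the measure that \<open>unhit\<close> has at least if some
     ball is missed.\<close>
   define c where "c = D0 / (t ^ CARD('d) * v)"
   have c: "c \<ge> 0" unfolding c_def using D0 t v by simp
   have "unif_error_points M ?N p s q \<Omega> \<le> (\<integral>\<^sup>+ \<omega>. ennreal (C1 * t powr (?d * b)) + ennreal c * ?U \<omega> \<partial>M)"
   proof (rule error_le[OF pM pq(1) order_trans[OF pq] Pp])
    show "(\<lambda>\<omega>. ennreal (C1 * t powr (?d * b)) + ennreal c * ?U \<omega>) \<in> borel_measurable M" by measurable
    fix \<omega> e assume r: "residual p P s \<Omega> (?N \<omega>) e"
    show "Lp_norm q (lebesgue_on \<Omega>) e \<le> ennreal (C1 * t powr (?d * b)) + ennreal c * ?U \<omega>"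
    proof (cases "\<forall>x\<in>\<Omega>. \<forall>y\<in>Y. cball (x + t *\<^sub>R y) (t * \<eta>) \<subseteq> \<Omega> \<longrightarrow> cball (x + t *\<^sub>R y) (t * \<eta>) \<inter> ?N \<omega> \<noteq> {}")
     case True
     then show ?thesis using C1(2)[OF t r] by (simp add: add_increasing2)
    next
     case False
     then obtain x y where "cball (x + t *\<^sub>R y) (t * \<eta>) \<subseteq> \<Omega>" "cball (x + t *\<^sub>R y) (t * \<eta>) \<inter> ?N \<omega> = {}" by blast
     then have sub: "cball (x + t *\<^sub>R y) (t * (\<eta> / 2)) \<subseteq> unhit \<Omega> n X (t * (\<eta> / 2)) \<omega>" by (rule not_hit_imp_unhit[OF t(1)])
     have "ennreal (t ^ CARD('d) * v) = emeasure lborel (cball (x + t *\<^sub>R y) (t * (\<eta> / 2)))"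
      using measure_cball_pos(1)[OF t\<eta>, of "x + t *\<^sub>R y"] measure_cball_scale[of t "\<eta> / 2" "x + t *\<^sub>R y" 0] t params
      by (simp add: v_def)
     also have "\<dots> \<le> ?U \<omega>" using sub sets_unhit[OF \<Omega>(1)] by (intro emeasure_mono) auto
     finally have "ennreal c * ennreal (t ^ CARD('d) * v) \<le> ennreal c * ?U \<omega>" by (intro mult_left_mono) auto
     moreover have "ennreal c * ennreal (t ^ CARD('d) * v) = ennreal D0" using c t v by (simp add: ennreal_mult[symmetric] c_def)
     ultimately have "ennreal D0 \<le> ennreal c * ?U \<omega>" by simp
     with trivial[OF r] have "Lp_norm q (lebesgue_on \<Omega>) e \<le> ennreal c * ?U \<omega>" by (rule order_trans)
     then show ?thesis by (simp add: add_increasing)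
    qed
   qed
   also have "\<dots> = (\<integral>\<^sup>+ \<omega>. ennreal (C1 * t powr (?d * b)) \<partial>M) + (\<integral>\<^sup>+ \<omega>. ennreal c * ?U \<omega> \<partial>M)" by (rule nn_integral_add) measurable
   also have "(\<integral>\<^sup>+ \<omega>. ennreal (C1 * t powr (?d * b)) \<partial>M) = ennreal (C1 * t powr (?d * b))"
    using pM by (simp add: prob_space.emeasure_space_1)
   also have "(\<integral>\<^sup>+ \<omega>. ennreal c * ?U \<omega> \<partial>M) = ennreal c * (\<integral>\<^sup>+ \<omega>. ?U \<omega> \<partial>M)" by (rule nn_integral_cmult) measurable
   also have "ennreal (C1 * t powr (?d * b)) + ennreal c * (\<integral>\<^sup>+ \<omega>. ?U \<omega> \<partial>M) \<le>
     ennreal (C1 * t powr (?d * b)) + ennreal c * ennreal (vol * exp (- real n * (t * (\<eta> / 2)) ^ CARD('d) * (unit_ball_vol ?d / vol)))"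
    using EU(2) unfolding vol_def by (intro add_left_mono mult_left_mono) auto
   also have "- real n * (t * (\<eta> / 2)) ^ CARD('d) * (unit_ball_vol ?d / vol) = - (k * (real n * t ^ CARD('d)))"
    unfolding k_def power_mult_distrib by simp
   also have "real n * t ^ CARD('d) = A * ln (real n)" unfolding td using nr by simp
   also have "exp (- (k * (A * ln (real n)))) = real n powr (- (1 + b))"
    using nr A by (simp add: powr_def mult.assoc[symmetric] algebra_simps)
   also have "ennreal (C1 * t powr (?d * b)) + ennreal c * ennreal (vol * real n powr (- (1 + b))) =
     ennreal (C1 * t powr (?d * b) + c * (vol * real n powr (- (1 + b))))"
    using C1(1) c vol by (simp add: ennreal_mult ennreal_plus)
   also have "\<dots> \<le> ennreal (K * (ln (real n) / real n) powr b)"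
   proof (rule ennreal_leI)
    have "c * (vol * real n powr (- (1 + b))) = D0 / v * vol / A * (1 / ln (real n)) * real n powr (- b)"
    proof -
     have "real n powr (- (1 + b)) = real n powr (- b) / real n"
      using nr by (simp add: powr_add[of _ "- 1" "- b", simplified] powr_minus divide_inverse mult.commute)
     then show ?thesis unfolding c_def td using nr A v ln by (simp add: field_simps)
    qed
    also have "\<dots> \<le> D0 / v * vol / A * (1 / ln 2) * ((ln (real n) / ln 2) powr b * real n powr (- b))"
    proof (intro mult_mono)
     show "1 / ln (real n) \<le> 1 / ln 2" using ln by (simp add: frac_le)
     have "1 \<le> (ln (real n) / ln 2) powr b" using ln b by (intro ge_one_powr_ge_zero) (auto simp: le_divide_eq)
     then show "real n powr (- b) \<le> (ln (real n) / ln 2) powr b * real n powr (- b)" by (simp add: mult_le_cancel_right1)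
    qed (use D0 v vol A ln in auto)
    also have "\<dots> = D0 / v * vol / (A * ln 2) / ln 2 powr b * (ln (real n) / real n) powr b"
     using ln nr by (simp add: powr_divide powr_minus field_simps)
    finally have "C1 * t powr (?d * b) + c * (vol * real n powr (- (1 + b))) \<le>
      (C1 * A powr b + D0 / v * vol / (A * ln 2) / ln 2 powr b) * (ln (real n) / real n) powr b"
     unfolding tb by (simp add: distrib_right mult.assoc)
    also have "\<dots> \<le> K * (ln (real n) / real n) powr b" unfolding K_def using K1 by (intro mult_right_mono) auto
    finally show "C1 * t powr (?d * b) + c * (vol * real n powr (- (1 + b))) \<le> K * (ln (real n) / real n) powr b" .
   qed
   finally show ?thesis .
  qed
  then show "unif_error_points M ?N p s q \<Omega> \<le>
    ennreal (K * (real n / ln (real n)) powr (- real s / ?d + enn2real (1 / p) - enn2real (1 / q)))" unfolding rate .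
 qed
qed

end

section \<open>The case q < p: a local dyadic scale\<close>

lemma level_series_bounded:
 fixes k \<sigma> :: real
 assumes k: "k > 0" and \<sigma>: "\<sigma> \<ge> 0" and d: "d > 0"
 obtains B where "B > 0" "\<And>N. (\<Sum>m\<le>N. (2 ^ Suc m) powr \<sigma> * exp (- (k * 2 ^ (m * d)))) \<le> B"
proof -
 \<comment> \<open>The exponential is bounded by (N0 / (k x))^N0 with x = 2^m. As N0 \<ge> \<sigma>
   + 1, this leaves at most a multiple of 1/x, hence a geometric series.\<close>
 define N0 where "N0 = nat \<lceil>\<sigma>\<rceil> + 1"
 have N0: "N0 > 0" "real N0 \<ge> \<sigma> + 1" unfolding N0_def by (simp, linarith)
 define A where "A = 2 powr \<sigma> * (real N0 / k) ^ N0"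
 have A: "A > 0" unfolding A_def using k N0 by simp
 have le: "(2 ^ Suc m) powr \<sigma> * exp (- (k * 2 ^ (m * d))) \<le> A * (1 / 2) ^ m" for m
 proof -
  define x :: real where "x = 2 ^ m"
  have x: "x \<ge> 1" unfolding x_def by simp
  have "exp (- (k * 2 ^ (m * d))) \<le> exp (- (k * x))"
  proof -
   have "m \<le> m * d" using d by simp
   then have "x \<le> 2 ^ (m * d)" unfolding x_def by (intro power_increasing) auto
   then show ?thesis using k by simp
  qed
  also have "\<dots> \<le> (real N0 / (k * x)) ^ N0"
  proof -
   have kx: "k * x > 0" using k x by simp
   have "((k * x) / real N0) ^ N0 \<le> (1 + (k * x) / real N0) ^ N0" using kx N0 by (intro power_mono) auto
   also have "\<dots> \<le> exp (k * x)" using kx N0 by (intro exp_ge_one_plus_x_over_n_power_n) linarith+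
   finally have "inverse (exp (k * x)) \<le> inverse (((k * x) / real N0) ^ N0)" using kx N0 by (intro le_imp_inverse_le) auto
   then show ?thesis by (simp add: exp_minus power_inverse[symmetric])
  qed
  also have "\<dots> = (real N0 / k) ^ N0 * x powr (- real N0)"
   using x by (simp add: power_divide power_mult_distrib powr_minus powr_realpow divide_inverse power_inverse)
  finally have "(2 * x) powr \<sigma> * exp (- (k * 2 ^ (m * d))) \<le> (2 * x) powr \<sigma> * ((real N0 / k) ^ N0 * x powr (- real N0))"
   by (intro mult_left_mono) auto
  also have "\<dots> = A * (x powr \<sigma> * x powr (- real N0))" using x by (simp add: A_def powr_mult)
  also have "x powr \<sigma> * x powr (- real N0) = x powr (\<sigma> - real N0)" by (simp add: powr_add[symmetric])
  also have "A * x powr (\<sigma> - real N0) \<le> A * x powr (- 1)" using A x N0 by (intro mult_left_mono powr_mono) auto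
  also have "x powr (- 1) = (1 / 2) ^ m" unfolding x_def by (simp add: powr_minus power_one_over inverse_eq_divide)
  finally show ?thesis by (simp add: x_def)
 qed
 show ?thesis
 proof (rule that[of "A * 2"])
  show "A * 2 > 0" using A by simp
  fix N
  have "(\<Sum>m\<le>N. (2 ^ Suc m) powr \<sigma> * exp (- (k * 2 ^ (m * d)))) \<le> (\<Sum>m\<le>N. A * (1 / 2) ^ m)" by (intro sum_mono le)
  also have "\<dots> = A * (\<Sum>m\<le>N. (1 / 2) ^ m)" by (simp add: sum_distrib_left)
  also have "(\<Sum>m\<le>N. (1 / 2 :: real) ^ m) = 2 - (1 / 2) ^ N" by (induction N) auto
  also have "A * (2 - (1 / 2) ^ N) \<le> A * 2" using A by (intro mult_left_mono) auto
  finally show "(\<Sum>m\<le>N. (2 ^ Suc m) powr \<sigma> * exp (- (k * 2 ^ (m * d)))) \<le> A * 2" using A by simp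
 qed
qed

context upper_setup
begin

text \<open>The points to which the local estimate at scale \<open>t\<close> might not apply,
  because one of their balls inside \<open>\<Omega>\<close> contains no node.\<close>

definition bad :: "nat \<Rightarrow> (nat \<Rightarrow> 'w \<Rightarrow> real ^ 'd) \<Rightarrow> real \<Rightarrow> 'w \<Rightarrow> (real ^ 'd) set" where
 "bad n X t \<omega> = (\<Union>y\<in>Y. {x. x + t *\<^sub>R y \<in> unhit \<Omega> n X (t * \<eta>) \<omega>})"

lemma bad_measure:
 "bad n X t \<omega> \<in> sets borel"
 "emeasure lborel (bad n X t \<omega>) \<le> of_nat (card Y) * emeasure lborel (unhit \<Omega> n X (t * \<eta>) \<omega>)"
proof -
 let ?U = "unhit \<Omega> n X (t * \<eta>) \<omega>"
 have U: "?U \<in> sets borel" by (rule sets_unhit[OF \<Omega>(1)])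
 have s: "{x. x + t *\<^sub>R y \<in> ?U} \<in> sets borel" for y
 proof -
  have "(\<lambda>x. x + t *\<^sub>R y) -` ?U \<inter> space borel \<in> sets borel" by (rule measurable_sets[OF _ U]) simp
  then show ?thesis by (simp add: vimage_def)
 qed
 show "bad n X t \<omega> \<in> sets borel" unfolding bad_def using params s by (intro sets.finite_UN) auto
 have e: "emeasure lborel {x. x + t *\<^sub>R y \<in> ?U} = emeasure lborel ?U" for y
 proof -
  have "emeasure lborel ?U = emeasure (distr lborel borel ((+) (t *\<^sub>R y))) ?U" by (simp add: lborel_distr_plus)
  also have "\<dots> = emeasure lborel ((+) (t *\<^sub>R y) -` ?U \<inter> space lborel)" using U by (intro emeasure_distr) auto
  also have "(+) (t *\<^sub>R y) -` ?U \<inter> space lborel = {x. x + t *\<^sub>R y \<in> ?U}" by (auto simp: add.commute)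
  finally show ?thesis by simp
 qed
 have "emeasure lborel (bad n X t \<omega>) \<le> (\<Sum>y\<in>Y. emeasure lborel {x. x + t *\<^sub>R y \<in> ?U})"
  unfolding bad_def using params s by (intro emeasure_subadditive_finite) auto
 also have "\<dots> = of_nat (card Y) * emeasure lborel ?U" by (simp add: e)
 finally show "emeasure lborel (bad n X t \<omega>) \<le> of_nat (card Y) * emeasure lborel ?U" .
qed

lemma not_bad_hit:
 assumes "x \<notin> bad n X t \<omega>" "y \<in> Y" "cball (x + t *\<^sub>R y) (t * \<eta>) \<subseteq> \<Omega>"
 shows "cball (x + t *\<^sub>R y) (t * \<eta>) \<inter> (\<lambda>i. X i \<omega>) ` {..<n} \<noteq> {}"
proof -
 have "x + t *\<^sub>R y \<notin> unhit \<Omega> n X (t * \<eta>) \<omega>" using assms unfolding bad_def by blast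
 then obtain i where "i < n" "\<not> t * \<eta> < dist (x + t *\<^sub>R y) (X i \<omega>)" using assms(3) unfolding unhit_def by blast
 then have "X i \<omega> \<in> cball (x + t *\<^sub>R y) (t * \<eta>) \<inter> (\<lambda>i. X i \<omega>) ` {..<n}" by auto
 then show ?thesis by blast
qed

text \<open>The threshold \<open>\<mu>\<close> replaces Hoelder's inequality; it will be the inverse of the expected
 measure of the set on which the estimate is applied.\<close>

lemma level_estimate:
 assumes wd: "weak_data \<Omega> s e g" "\<And>\<alpha>. g \<alpha> \<in> borel_measurable borel" "energy_le P s g (ball_energy \<Omega> P)"
  and zero: "\<And>u. u \<in> (\<lambda>i. X i \<omega>) ` {..<n} \<Longrightarrow> e u = 0"
  and x: "x \<in> \<Omega>" "x \<notin> bad n X t \<omega>" and t: "0 < t" "t \<le> 1" and Q: "0 < Q" "Q \<le> P" and \<mu>: "\<mu> > 0"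
 shows "ennreal (\<bar>e x\<bar> powr Q) \<le> ennreal (C powr (Q / P) * t powr (real s * Q)) *
   (ennreal (\<mu> powr (Q / P)) + ennreal (\<mu> powr (Q / P - 1) / t ^ CARD('d)) * nearby g t x)"
proof -
 let ?d = "real CARD('d)" and ?a = "Q / P"
 define I where "I = enn2real (nearby g t x)"
 have le: "nearby g t x \<le> ennreal total" by (rule nearby_le_total(2)[OF wd(2,3)])
 then have I: "nearby g t x = ennreal I" "I \<ge> 0"
  unfolding I_def by (auto simp: top_unique less_top intro!: ennreal_enn2real[symmetric] le_less_trans[OF le])
 have "\<bar>e x\<bar> powr P \<le> C * t powr (real s * P - ?d) * I"
  by (rule pointwise_good[OF wd(1,2) zero x(1) t _ I(2)]) (use not_bad_hit[OF x(2)] I in auto)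
 then have "(\<bar>e x\<bar> powr P) powr ?a \<le> (C * t powr (real s * P - ?d) * I) powr ?a" using P Q by (intro powr_mono2) auto
 also have "(\<bar>e x\<bar> powr P) powr ?a = \<bar>e x\<bar> powr Q" using P by (simp add: powr_powr)
 also have "C * t powr (real s * P - ?d) * I = C * t powr (real s * P) * (I / t ^ CARD('d))"
  using t by (simp add: powr_diff powr_realpow)
 also have "(C * t powr (real s * P) * (I / t ^ CARD('d))) powr ?a = C powr ?a * t powr (real s * Q) * (I / t ^ CARD('d)) powr ?a"
 proof -
  have "real s * P * ?a = real s * Q" using P by simp
  then show ?thesis using params I t by (simp only: powr_mult powr_powr)
 qed
 also have "\<dots> \<le> C powr ?a * t powr (real s * Q) * (\<mu> powr ?a + \<mu> powr (?a - 1) * (I / t ^ CARD('d)))"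
  using P Q \<mu> I t by (intro mult_left_mono powr_le_threshold) auto
 finally have "ennreal (\<bar>e x\<bar> powr Q) \<le> ennreal (C powr ?a * t powr (real s * Q) * (\<mu> powr ?a + \<mu> powr (?a - 1) / t ^ CARD('d) * I))"
  by (intro ennreal_leI) simp
 also have "\<dots> = ennreal (C powr ?a * t powr (real s * Q)) * (ennreal (\<mu> powr ?a) + ennreal (\<mu> powr (?a - 1) / t ^ CARD('d)) * ennreal I)"
  using I t by (simp add: ennreal_mult[symmetric] ennreal_plus[symmetric] del: ennreal_plus)
 finally show ?thesis by (simp add: I(1))
qed

text \<open>A point that is bad at level m but not at level m + 1 is estimated at the latter. This
  raises the error by a power of 2^m but happens on a set whose expected measure decays like exp(-k
  2^(m d)). The gain of this measure survives with the exponent 1 - Q/P, which is positive exactly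
  because q < p, and the series over the levels converges without a logarithm.\<close>

lemma upper_bound_lt:
 assumes pq: "1 \<le> p" "1 \<le> q" "q \<noteq> \<infinity>" "enn2real q < P" and Pp: "p \<noteq> \<infinity> \<Longrightarrow> P = enn2real p"
 shows "\<exists>K>0. \<forall>n\<ge>2. \<forall>(M :: 'w measure) X. iid_uniform M \<Omega> n X \<longrightarrow>
   unif_error_points M (\<lambda>\<omega>. (\<lambda>i. X i \<omega>) ` {..<n}) p s q \<Omega> \<le>
    ennreal (K * real n powr (- real s / real CARD('d)))"
proof -
 let ?d = "real CARD('d)"
 define Q where "Q = enn2real q"
 have Q: "Q \<ge> 1" "Q < P" unfolding Q_def using pq enn2real_ge_1 by auto
 define a where "a = Q / P"
 have a: "0 < a" "a < 1" unfolding a_def using Q by auto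
 define k where "k = \<eta> ^ CARD('d) * (unit_ball_vol ?d / vol)"
 have k: "k > 0" unfolding k_def using params vol by (simp add: unit_ball_vol_pos)
 define L where "L = C powr a"
 have L: "L > 0" unfolding L_def using params by simp
 define z where "z = ball_R * total"
 have z: "z > 0" unfolding z_def using ball_R_pos total_pos by simp
 define y where "y = real (card Y)"
 have y: "y \<ge> 0" by (simp add: y_def)
 define D0 where "D0 = C0 powr Q"
 have D0: "D0 > 0" unfolding D0_def using params by simp
 obtain B where B: "B > 0" "\<And>N. (\<Sum>m\<le>N. (2 ^ Suc m) powr (real s * Q) * exp (- ((k * (1 - a)) * 2 ^ (m * CARD('d))))) \<le> B"
  using level_series_bounded[of "k * (1 - a)" "real s * Q" "CARD('d)"] k a Q by auto
 define K2 where "K2 = L * (vol + z) + (L * (y * vol + z) + D0 * y * vol) * B"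
 have K2: "K2 \<ge> 0" unfolding K2_def using L vol z y D0 B by simp
 show ?thesis
 proof (intro exI[of _ "1 + K2"] conjI allI impI)
  show "1 + K2 > 0" using K2 by simp
  fix n :: nat and M :: "'w measure" and X assume n: "n \<ge> 2" and iid: "iid_uniform M \<Omega> n X"
  let ?N = "\<lambda>\<omega>. (\<lambda>i. X i \<omega>) ` {..<n}"
  have pM: "prob_space M" by (rule iid_uniformD(1)[OF iid])
  have n0: "n > 0" using n by simp
  \<comment> \<open>The scale at which a ball contains a bounded expected number of nodes, since
    \<tau>^d = 1/n.\<close>
  define \<tau> where "\<tau> = real n powr (- 1 / ?d)"
  have \<tau>: "0 < \<tau>" "\<tau> \<le> 1" unfolding \<tau>_def using n by (auto intro!: powr_le_one_le simp: powr_minus_divide divide_le_eq_1 ge_one_powr_ge_zero)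
  have \<tau>d: "\<tau> ^ CARD('d) = 1 / real n"
  proof -
   have "\<tau> ^ CARD('d) = \<tau> powr ?d" using \<tau> by (simp add: powr_realpow)
   also have "\<dots> = real n powr (- 1)" unfolding \<tau>_def powr_powr by simp
   finally show ?thesis using n by (simp add: powr_minus inverse_eq_divide)
  qed
  \<comment> \<open>The last level at which the scale is at most 1, as \<open>local_estimate\<close>
    demands.\<close>
  obtain Mx where Mx: "2 ^ Mx * \<tau> \<le> 1" "1 < 2 ^ Suc Mx * \<tau>"
  proof -
   define S where "S = {j. (2::real) ^ j * \<tau> \<le> 1}"
   obtain j where j: "1 / \<tau> < 2 ^ j" using real_arch_pow[of 2 "1 / \<tau>"] by auto
   have fin: "finite S"
   proof (rule finite_subset[of _ "{..j}"])
    show "S \<subseteq> {..j}"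
    proof
     fix i assume i: "i \<in> S"
     show "i \<in> {..j}"
     proof (rule ccontr)
      assume "i \<notin> {..j}"
      then have "(2::real) ^ j \<le> 2 ^ i" by (intro power_increasing) auto
      then have "1 / \<tau> < 2 ^ i" using j by linarith
      then show False using i \<tau> unfolding S_def by (simp add: divide_less_eq)
     qed
    qed
   qed simp
   have "0 \<in> S" unfolding S_def using \<tau> by simp
   then have m: "Max S \<in> S" using fin by (intro Max_in) auto
   have "Suc (Max S) \<notin> S" using Max_ge[OF fin, of "Suc (Max S)"] by auto
   then show ?thesis using m that[of "Max S"] unfolding S_def by auto
  qed
  define t where "t m = 2 ^ m * \<tau>" for m :: nat
  have t0: "t m > 0" for m unfolding t_def using \<tau> by simp
  have t1: "t m \<le> 1" if "m \<le> Mx" for m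
  proof -
   have "(2::real) ^ m \<le> 2 ^ Mx" using that by (intro power_increasing) auto
   then have "t m \<le> 2 ^ Mx * \<tau>" unfolding t_def using \<tau> by (intro mult_right_mono) auto
   then show ?thesis using Mx(1) by linarith
  qed
  have tp: "t m powr (real s * Q) = (2 ^ m) powr (real s * Q) * \<tau> powr (real s * Q)" for m
   unfolding t_def using \<tau> by (simp add: powr_mult)
  define ex where "ex m = exp (- (k * 2 ^ (m * CARD('d))))" for m :: nat
  have ex: "ex m > 0" "ex m \<le> 1" for m unfolding ex_def using k by auto
  define ea where "ea m = exp (- ((k * (1 - a)) * 2 ^ (m * CARD('d))))" for m :: nat
  have ea: "ex m powr (1 - a) = ea m" "ea m > 0" for m unfolding ex_def ea_def by (simp_all add: powr_def mult_ac)
  have exea: "ex m \<le> ea m" for m unfolding ex_def ea_def using k a by (simp add: mult_right_mono algebra_simps)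
  define U where "U m \<omega> = emeasure lborel (unhit \<Omega> n X (t m * \<eta>) \<omega>)" for m \<omega>
  have U_meas[measurable]: "U m \<in> borel_measurable M" for m
   unfolding U_def[abs_def] using t0 params by (intro expected_unhit(1)[OF iid n0 \<Omega>]) simp
  have EU: "(\<integral>\<^sup>+ \<omega>. U m \<omega> \<partial>M) \<le> ennreal (vol * ex m)" for m
  proof -
   have "t m ^ CARD('d) * real n = 2 ^ (m * CARD('d))" unfolding t_def power_mult_distrib \<tau>d using n by (simp add: power_mult)
   then have "- real n * (t m * \<eta>) ^ CARD('d) * (unit_ball_vol ?d / vol) = - (k * 2 ^ (m * CARD('d)))"
    unfolding k_def power_mult_distrib by (simp add: mult_ac)
   then show ?thesis using expected_unhit(2)[OF iid n0 \<Omega>, of "t m * \<eta>"] t0[of m] params unfolding U_def ex_def vol_def by simp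
  qed
  \<comment> \<open>Up to a constant \<open>ex m\<close> bounds the expected measure of the m-th bad
    set. With its inverse as threshold both terms of \<open>level_estimate\<close> contribute
    \<open>ex m powr (1 - a)\<close>.\<close>
  define \<mu> where "\<mu> m = 1 / ex m" for m
  have \<mu>: "\<mu> m > 0" "\<mu> m powr a * ex m = ea m" "\<mu> m powr (a - 1) = ea m" for m
  proof -
   show "\<mu> m > 0" unfolding \<mu>_def using ex by simp
   have m1: "\<mu> m = ex m powr (- 1)" unfolding \<mu>_def using ex(1)[of m] by (simp add: powr_minus inverse_eq_divide)
   have "\<mu> m powr a * ex m = ex m powr (- a) * ex m powr 1" unfolding m1 powr_powr using ex(1)[of m] by simp
   also have "\<dots> = ex m powr (1 - a)" by (simp only: powr_add[symmetric]) simp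
   finally show "\<mu> m powr a * ex m = ea m" by (simp add: ea)
   show "\<mu> m powr (a - 1) = ea m" unfolding m1 powr_powr by (simp add: ea(1)[symmetric])
  qed
  define A1 where "A1 m = L * t (Suc m) powr (real s * Q) * \<mu> m powr a * y" for m
  define B1 where "B1 m = L * t (Suc m) powr (real s * Q) * \<mu> m powr (a - 1) * z" for m
  define g0 where "g0 = L * t 0 powr (real s * Q) * (vol + z)"
  have nonneg: "A1 m \<ge> 0" "B1 m \<ge> 0" "g0 \<ge> 0" for m unfolding A1_def B1_def g0_def using L y z vol by auto
  \<comment> \<open>A measurable bound, for each sample, of the integral of the Q-th power of all
    residuals; the last summand covers points bad at every level.\<close>
  define G where "G \<omega> = ennreal g0 + (\<Sum>m<Mx. ennreal (A1 m) * U m \<omega> + ennreal (B1 m)) + ennreal (D0 * y) * U Mx \<omega>" for \<omega>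
  have G_meas[measurable]: "G \<in> borel_measurable M" unfolding G_def[abs_def] by measurable
  have int_e: "(\<integral>\<^sup>+ x. ennreal (\<bar>e x\<bar> powr Q) \<partial>lebesgue_on \<Omega>) \<le> G \<omega>" if r: "residual p P s \<Omega> (?N \<omega>) e" for \<omega> e
  proof -
   obtain g where g: "weak_data \<Omega> s e g" "\<And>\<alpha>. g \<alpha> \<in> borel_measurable borel" "energy_le P s g (ball_energy \<Omega> P)"
    and ez: "\<And>u. u \<in> ?N \<omega> \<Longrightarrow> e u = 0" using r unfolding residual_def by blast
   define W where "W m = bad n X (t m) \<omega>" for m
   have W[measurable]: "W m \<in> sets borel" for m unfolding W_def by (rule bad_measure)
   have WU: "emeasure lborel (W m) \<le> ennreal y * U m \<omega>" for m
    using bad_measure(2)[of n X "t m" \<omega>] unfolding W_def U_def y_def by (simp add: ennreal_of_nat_eq_real_of_nat)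
   have nm[measurable]: "nearby g (t m) \<in> borel_measurable borel" for m by (rule nearby_integral(1)[OF g(2,3) t0])
   have [measurable]: "\<Omega> \<in> sets borel" using \<Omega>(1) by simp
   \<comment> \<open>Only the threshold is restricted to \<open>S\<close>. The energy term may be
     integrated over the whole space, because its integral is controlled by
     \<open>nearby_integral\<close>.\<close>
   define V where "V j \<mu> S x = ennreal (L * t j powr (real s * Q)) * (ennreal (\<mu> powr a) * indicator S x +
     ennreal (\<mu> powr (a - 1) / t j ^ CARD('d)) * nearby g (t j) x)" for j \<mu> S x
   have V_meas: "(\<lambda>x. V j \<mu> S x) \<in> borel_measurable borel" if [measurable]: "S \<in> sets borel" for j \<mu> S
    unfolding V_def by measurable
   note [measurable] = V_meas[OF W] V_meas[of \<Omega>]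
   have lev: "ennreal (\<bar>e x\<bar> powr Q) \<le> V j \<mu> S x" if "x \<in> \<Omega>" "x \<notin> W j" "x \<in> S" "j \<le> Mx" "\<mu> > 0" for x j \<mu> S
   proof -
    have "ennreal (\<bar>e x\<bar> powr Q) \<le> ennreal (C powr (Q / P) * t j powr (real s * Q)) *
      (ennreal (\<mu> powr (Q / P)) + ennreal (\<mu> powr (Q / P - 1) / t j ^ CARD('d)) * nearby g (t j) x)"
     by (rule level_estimate[OF g, where X = X and \<omega> = \<omega> and n = n])
       (use that Q t0 t1[OF that(4)] ez in \<open>auto simp: W_def\<close>)
    then show ?thesis using that(3) unfolding V_def L_def a_def by simp
   qed
   have V_int: "(\<integral>\<^sup>+ x. V j \<mu> S x \<partial>lborel) \<le> ennreal (L * t j powr (real s * Q)) * (ennreal (\<mu> powr a) * emeasure lborel S + ennreal (\<mu> powr (a - 1) * z))"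
    if S: "S \<in> sets borel" for j \<mu> S
   proof -
    have "(\<integral>\<^sup>+ x. V j \<mu> S x \<partial>lborel) = ennreal (L * t j powr (real s * Q)) * (ennreal (\<mu> powr a) * emeasure lborel S +
      ennreal (\<mu> powr (a - 1) / t j ^ CARD('d)) * (\<integral>\<^sup>+ x. nearby g (t j) x \<partial>lborel))"
     unfolding V_def using S by (simp add: nn_integral_cmult nn_integral_add nn_integral_cmult_indicator)
    also have "ennreal (\<mu> powr (a - 1) / t j ^ CARD('d)) * (\<integral>\<^sup>+ x. nearby g (t j) x \<partial>lborel) \<le>
      ennreal (\<mu> powr (a - 1) / t j ^ CARD('d)) * ennreal (t j ^ CARD('d) * z)"
     unfolding z_def by (intro mult_left_mono nearby_integral(2)[OF g(2,3) t0]) simp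
    also have "\<dots> = ennreal (\<mu> powr (a - 1) * z)" using t0[of j] z by (simp add: ennreal_mult[symmetric])
    finally show ?thesis by (simp add: add_left_mono mult_left_mono)
   qed
   have pw: "ennreal (\<bar>e x\<bar> powr Q) * indicator \<Omega> x \<le>
     V 0 1 \<Omega> x + (\<Sum>m<Mx. V (Suc m) (\<mu> m) (W m) x) + ennreal D0 * indicator (W Mx) x" for x
   proof (cases "x \<in> \<Omega>")
    case True
    \<comment> \<open>No inclusion between the sets \<open>W m\<close> is used: a point of
      \<open>W 0\<close> leaves them at some step or stays in all of them up to
      \<open>Mx\<close>.\<close>
    consider "x \<notin> W 0" | m where "m < Mx" "x \<in> W m" "x \<notin> W (Suc m)" | "x \<in> W Mx"
    proof (cases "x \<in> W 0 \<and> (\<forall>m<Mx. x \<in> W m \<longrightarrow> x \<in> W (Suc m))")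
     case True
     have "m \<le> Mx \<Longrightarrow> x \<in> W m" for m by (induction m) (use True in auto)
     then show ?thesis using that by blast
    qed (use that in blast)
    then show ?thesis
    proof cases
     case 1
     then have "ennreal (\<bar>e x\<bar> powr Q) \<le> V 0 1 \<Omega> x" using True by (intro lev) auto
     then show ?thesis using True by (simp add: add_increasing2)
    next
     case (2 m)
     then have "ennreal (\<bar>e x\<bar> powr Q) \<le> V (Suc m) (\<mu> m) (W m) x" using True \<mu> by (intro lev) auto
     also have "\<dots> \<le> (\<Sum>m<Mx. V (Suc m) (\<mu> m) (W m) x)" using 2 by (intro member_le_sum) auto
     finally show ?thesis using True by (simp add: add_increasing add_increasing2)
    next
     case 3
     have "\<bar>e x\<bar> powr Q \<le> D0" unfolding D0_def using residual_bounded[OF r True] Q by (intro powr_mono2) auto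
     then have "ennreal (\<bar>e x\<bar> powr Q) \<le> ennreal D0" by (rule ennreal_leI)
     then show ?thesis using True 3 by (simp add: add_increasing)
    qed
   qed simp
   have "(\<integral>\<^sup>+ x. ennreal (\<bar>e x\<bar> powr Q) \<partial>lebesgue_on \<Omega>) \<le>
     (\<integral>\<^sup>+ x. V 0 1 \<Omega> x + (\<Sum>m<Mx. V (Suc m) (\<mu> m) (W m) x) + ennreal D0 * indicator (W Mx) x \<partial>lborel)"
    unfolding nn_integral_lebesgue_on by (intro nn_integral_mono pw)
   also have "\<dots> = (\<integral>\<^sup>+ x. V 0 1 \<Omega> x \<partial>lborel) + (\<Sum>m<Mx. (\<integral>\<^sup>+ x. V (Suc m) (\<mu> m) (W m) x \<partial>lborel)) + ennreal D0 * emeasure lborel (W Mx)"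
    by (simp add: nn_integral_add nn_integral_sum nn_integral_cmult_indicator)
   also have "\<dots> \<le> G \<omega>" unfolding G_def
   proof (intro add_mono sum_mono)
    have "(\<integral>\<^sup>+ x. V 0 1 \<Omega> x \<partial>lborel) \<le> ennreal (L * t 0 powr (real s * Q)) * (ennreal (1 powr a) * emeasure lborel \<Omega> + ennreal (1 powr (a - 1) * z))"
     by (rule V_int) simp
    also have "\<dots> = ennreal g0"
     unfolding g0_def vol(1) using vol z L by (simp add: ennreal_mult[symmetric] ennreal_plus[symmetric] del: ennreal_plus)
    finally show "(\<integral>\<^sup>+ x. V 0 1 \<Omega> x \<partial>lborel) \<le> ennreal g0" .
    show "(\<integral>\<^sup>+ x. V (Suc m) (\<mu> m) (W m) x \<partial>lborel) \<le> ennreal (A1 m) * U m \<omega> + ennreal (B1 m)" for m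
    proof -
     have "(\<integral>\<^sup>+ x. V (Suc m) (\<mu> m) (W m) x \<partial>lborel) \<le> ennreal (L * t (Suc m) powr (real s * Q)) *
       (ennreal (\<mu> m powr a) * emeasure lborel (W m) + ennreal (\<mu> m powr (a - 1) * z))" by (rule V_int[OF W])
     also have "\<dots> \<le> ennreal (L * t (Suc m) powr (real s * Q)) *
       (ennreal (\<mu> m powr a) * (ennreal y * U m \<omega>) + ennreal (\<mu> m powr (a - 1) * z))"
      by (intro mult_left_mono add_right_mono WU) auto
     also have "\<dots> = ennreal (A1 m) * U m \<omega> + ennreal (B1 m)"
      unfolding A1_def B1_def using L y z by (simp add: distrib_left ennreal_mult mult.assoc)
     finally show ?thesis .
    qed
    have "ennreal D0 * emeasure lborel (W Mx) \<le> ennreal D0 * (ennreal y * U Mx \<omega>)" by (intro mult_left_mono WU) simp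
    then show "ennreal D0 * emeasure lborel (W Mx) \<le> ennreal (D0 * y) * U Mx \<omega>" using D0 y by (simp add: ennreal_mult mult.assoc)
   qed
   finally show ?thesis .
  qed
  \<comment> \<open>The rate aimed at. The Q-th root of \<open>G\<close> is bounded linearly with
    threshold \<rho>^Q, so that only the expectation of \<open>G\<close> is needed.\<close>
  define \<rho> where "\<rho> = \<tau> powr real s"
  have \<rho>: "\<rho> > 0" unfolding \<rho>_def using \<tau> by simp
  have EG: "(\<integral>\<^sup>+ \<omega>. G \<omega> \<partial>M) \<le> ennreal (K2 * \<tau> powr (real s * Q))"
  proof -
   have "(\<integral>\<^sup>+ \<omega>. G \<omega> \<partial>M) = ennreal g0 + (\<Sum>m<Mx. ennreal (A1 m) * (\<integral>\<^sup>+ \<omega>. U m \<omega> \<partial>M) + ennreal (B1 m)) + ennreal (D0 * y) * (\<integral>\<^sup>+ \<omega>. U Mx \<omega> \<partial>M)"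
    unfolding G_def using pM by (simp add: nn_integral_add nn_integral_sum nn_integral_cmult prob_space.emeasure_space_1)
   also have "\<dots> \<le> ennreal g0 + (\<Sum>m<Mx. ennreal (A1 m) * ennreal (vol * ex m) + ennreal (B1 m)) + ennreal (D0 * y) * ennreal (vol * ex Mx)"
    by (intro add_mono sum_mono mult_left_mono EU order_refl) auto
   also have "\<dots> = ennreal (g0 + (\<Sum>m<Mx. A1 m * (vol * ex m) + B1 m) + D0 * y * (vol * ex Mx))"
   proof -
    have "(\<Sum>m<Mx. ennreal (A1 m) * ennreal (vol * ex m) + ennreal (B1 m)) = (\<Sum>m<Mx. ennreal (A1 m * (vol * ex m) + B1 m))"
     using nonneg vol ex by (intro sum.cong) (auto simp: ennreal_mult[symmetric] less_imp_le)
    also have "\<dots> = ennreal (\<Sum>m<Mx. A1 m * (vol * ex m) + B1 m)"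
     using nonneg vol ex by (intro sum_ennreal) (auto simp: less_imp_le)
    finally show ?thesis using nonneg vol ex D0 y
     by (simp add: ennreal_mult[symmetric] ennreal_plus[symmetric] sum_nonneg less_imp_le add_nonneg_nonneg del: ennreal_plus)
   qed
   also have "g0 + (\<Sum>m<Mx. A1 m * (vol * ex m) + B1 m) + D0 * y * (vol * ex Mx) \<le> K2 * \<tau> powr (real s * Q)"
   proof -
    let ?T = "\<tau> powr (real s * Q)" and ?u = "\<lambda>m. (2 ^ Suc m) powr (real s * Q) * ea m"
    have T: "?T > 0" using \<tau> by simp
    have u: "?u m \<ge> 0" for m using ea(2)[of m] by simp
    have s1: "A1 m * (vol * ex m) + B1 m = L * (y * vol + z) * ?T * ?u m" for m
    proof -
     have "A1 m * (vol * ex m) + B1 m = L * t (Suc m) powr (real s * Q) * (y * vol * (\<mu> m powr a * ex m) + z * \<mu> m powr (a - 1))"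
      unfolding A1_def B1_def by (simp add: algebra_simps)
     also have "\<dots> = L * t (Suc m) powr (real s * Q) * ((y * vol + z) * ea m)" unfolding \<mu> by (simp add: algebra_simps)
     finally show ?thesis unfolding tp by (simp add: mult_ac)
    qed
    \<comment> \<open>By maximality of \<open>Mx\<close> the next scale exceeds 1. The constant
      bound is thus at most that constant times a power of this scale, and the last term fits into
      the same series.\<close>
    have s2: "D0 * y * (vol * ex Mx) \<le> D0 * y * vol * ?T * ?u Mx"
    proof -
     have "1 \<le> t (Suc Mx) powr (real s * Q)" using Mx(2) Q unfolding t_def by (intro ge_one_powr_ge_zero) auto
     then have "1 * ex Mx \<le> t (Suc Mx) powr (real s * Q) * ea Mx" using exea ex by (intro mult_mono) (auto simp: less_imp_le)
     then have "ex Mx \<le> ?T * ?u Mx" unfolding tp by (simp add: mult_ac)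
     then have "D0 * y * vol * ex Mx \<le> D0 * y * vol * (?T * ?u Mx)" using D0 y vol by (intro mult_left_mono) auto
     then show ?thesis by (simp add: mult_ac)
    qed
    have su: "(\<Sum>m<Mx. ?u m) \<le> B" "?u Mx \<le> B"
    proof -
     have "(\<Sum>m\<le>Mx. ?u m) \<le> B" using B(2)[of Mx] unfolding ea_def .
     moreover have "(\<Sum>m\<le>Mx. ?u m) = (\<Sum>m<Mx. ?u m) + ?u Mx" by (simp add: lessThan_Suc_atMost[symmetric])
     moreover have "(\<Sum>m<Mx. ?u m) \<ge> 0" by (intro sum_nonneg u)
     ultimately show "(\<Sum>m<Mx. ?u m) \<le> B" "?u Mx \<le> B" using u[of Mx] by linarith+
    qed
    have "(\<Sum>m<Mx. A1 m * (vol * ex m) + B1 m) = L * (y * vol + z) * ?T * (\<Sum>m<Mx. ?u m)"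
     unfolding s1 by (simp add: sum_distrib_left)
    also have "\<dots> \<le> L * (y * vol + z) * ?T * B" using L y vol z T su by (intro mult_left_mono) auto
    finally have 1: "(\<Sum>m<Mx. A1 m * (vol * ex m) + B1 m) \<le> L * (y * vol + z) * ?T * B" .
    have "D0 * y * vol * ?T * ?u Mx \<le> D0 * y * vol * ?T * B" using D0 y vol T su by (intro mult_left_mono) auto
    then have 2: "D0 * y * (vol * ex Mx) \<le> D0 * y * vol * ?T * B" using s2 by linarith
    have 3: "g0 = L * (vol + z) * ?T" unfolding g0_def t_def by simp
    show ?thesis unfolding K2_def using 1 2 3 by (simp add: algebra_simps)
   qed
   finally show ?thesis by (simp add: ennreal_leI)
  qed
  have "unif_error_points M ?N p s q \<Omega> \<le> (\<integral>\<^sup>+ \<omega>. ennreal \<rho> + ennreal (\<rho> powr (1 - Q)) * G \<omega> \<partial>M)"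
  proof (rule error_le[OF pM pq(1,2) Pp])
   show "(\<lambda>\<omega>. ennreal \<rho> + ennreal (\<rho> powr (1 - Q)) * G \<omega>) \<in> borel_measurable M" by measurable
   fix \<omega> e assume r: "residual p P s \<Omega> (?N \<omega>) e"
   show "Lp_norm q (lebesgue_on \<Omega>) e \<le> ennreal \<rho> + ennreal (\<rho> powr (1 - Q)) * G \<omega>"
   proof (cases "G \<omega> = \<infinity>")
    case True
    then show ?thesis using \<rho> by (simp add: ennreal_mult_top)
   next
    case False
    define h where "h = enn2real (G \<omega>)"
    have h: "G \<omega> = ennreal h" "h \<ge> 0" unfolding h_def using False by (auto simp: less_top)
    have "Lp_norm q (lebesgue_on \<Omega>) e \<le> ennreal (h powr (1 / Q))"
     unfolding Q_def by (rule Lp_norm_le_of_nn_integral[OF pq(3,2) h(2)]) (use int_e[OF r] h in \<open>simp add: Q_def\<close>)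
    also have "h powr (1 / Q) \<le> (\<rho> powr Q) powr (1 / Q) + (\<rho> powr Q) powr (1 / Q - 1) * h"
     using Q \<rho> h by (intro powr_le_threshold) auto
    also have "(\<rho> powr Q) powr (1 / Q) = \<rho>" using Q \<rho> by (simp add: powr_powr)
    also have "(\<rho> powr Q) powr (1 / Q - 1) = \<rho> powr (1 - Q)" using Q by (simp add: powr_powr right_diff_distrib)
    finally show ?thesis using h \<rho> by (simp add: ennreal_mult ennreal_leI)
   qed
  qed
  also have "\<dots> = ennreal \<rho> + ennreal (\<rho> powr (1 - Q)) * (\<integral>\<^sup>+ \<omega>. G \<omega> \<partial>M)"
   using pM by (simp add: nn_integral_add nn_integral_cmult prob_space.emeasure_space_1)
  also have "\<dots> \<le> ennreal \<rho> + ennreal (\<rho> powr (1 - Q)) * ennreal (K2 * \<tau> powr (real s * Q))"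
   by (intro add_left_mono mult_left_mono EG) simp
  also have "\<dots> = ennreal ((1 + K2) * \<rho>)"
  proof -
   have "\<rho> powr (1 - Q) * \<tau> powr (real s * Q) = \<rho>"
   proof -
    have "\<rho> powr (1 - Q) * \<tau> powr (real s * Q) = \<tau> powr (real s * (1 - Q)) * \<tau> powr (real s * Q)"
     unfolding \<rho>_def by (simp add: powr_powr)
    also have "\<dots> = \<tau> powr real s" by (simp only: powr_add[symmetric]) (simp add: algebra_simps)
    finally show ?thesis by (simp add: \<rho>_def)
   qed
   then have "\<rho> powr (1 - Q) * (K2 * \<tau> powr (real s * Q)) = K2 * \<rho>" by (simp add: mult.left_commute)
   then show ?thesis using \<rho> K2 by (simp add: ennreal_mult[symmetric] ennreal_plus[symmetric] distrib_right del: ennreal_plus)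
  qed
  also have "\<rho> = real n powr (- real s / ?d)" unfolding \<rho>_def \<tau>_def by (simp add: powr_powr)
  finally show "unif_error_points M ?N p s q \<Omega> \<le> ennreal ((1 + K2) * real n powr (- real s / ?d))" .
 qed
qed

end

subsection \<open>Fooling functions\<close>

lemma locally_integrable_times_test_function:
 fixes W :: "real ^ 'd::finite \<Rightarrow> real"
 assumes \<Omega>: "open \<Omega>" and W: "locally_integrable_on W \<Omega>" and \<phi>: "test_function \<Omega> \<phi>"
 shows "integrable (lebesgue_on \<Omega>) (\<lambda>x. W x * \<phi> x)"
proof -
 let ?S = "closure {x. \<phi> x \<noteq> 0}"
 have S: "compact ?S" "?S \<subseteq> \<Omega>" using \<phi> by (auto simp: test_function_def)
 have WS: "integrable lebesgue (\<lambda>x. indicator ?S x * W x)"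
  using W S unfolding locally_integrable_on_def set_integrable_def by simp
 obtain B where B: "\<And>x. \<bar>\<phi> x\<bar> \<le> B" using test_function_bounded[OF \<phi>] by blast
 have \<phi>m: "\<phi> \<in> borel_measurable lebesgue" using test_function_iterated(1)[OF \<phi>, of "[]"]
  by (auto intro!: measurable_completion borel_measurable_continuous_onI differentiable_imp_continuous_on)
 have "integrable lebesgue (\<lambda>x. (indicator ?S x * W x) * \<phi> x)"
 proof (rule Bochner_Integration.integrable_bound[of _ "\<lambda>x. B * (indicator ?S x * W x)"])
  show "integrable lebesgue (\<lambda>x. B * (indicator ?S x * W x))" using WS by simp
  show "(\<lambda>x. (indicator ?S x * W x) * \<phi> x) \<in> borel_measurable lebesgue"
   by (rule borel_measurable_times[OF borel_measurable_integrable[OF WS] \<phi>m])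
  show "AE x in lebesgue. norm ((indicator ?S x * W x) * \<phi> x) \<le> norm (B * (indicator ?S x * W x))"
  proof (intro AE_I2)
   fix x
   have "\<bar>indicator ?S x * W x\<bar> * \<bar>\<phi> x\<bar> \<le> \<bar>indicator ?S x * W x\<bar> * \<bar>B\<bar>" using B[of x] by (intro mult_left_mono) auto
   then show "norm ((indicator ?S x * W x) * \<phi> x) \<le> norm (B * (indicator ?S x * W x))"
    unfolding real_norm_def abs_mult by (simp add: mult.commute)
  qed
 qed
 also have "(\<lambda>x. (indicator ?S x * W x) * \<phi> x) = (\<lambda>x. indicator \<Omega> x *\<^sub>R (W x * \<phi> x))"
 proof
  fix x
  show "(indicator ?S x * W x) * \<phi> x = indicator \<Omega> x *\<^sub>R (W x * \<phi> x)"
   using test_function_iterated(2)[OF \<phi>, of x "[]"] S(2) by (cases "x \<in> ?S") auto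
 qed
 finally show ?thesis using \<Omega> by (subst integrable_restrict_space) auto
qed

lemma has_weak_deriv_integral:
 assumes "has_weak_deriv \<Omega> \<alpha> f g" "test_function \<Omega> \<phi>"
 shows "(LINT x|lebesgue_on \<Omega>. f x * multi_deriv \<alpha> \<phi> x) = (-1) ^ (\<Sum>i\<in>UNIV. \<alpha> i) * (LINT x|lebesgue_on \<Omega>. g x * \<phi> x)"
 using assms unfolding has_weak_deriv_def by blast

lemma weak_deriv_if:
 assumes "has_weak_deriv \<Omega> \<alpha> f g"
 shows "has_weak_deriv \<Omega> \<alpha> f (weak_deriv \<Omega> \<alpha> f)"
proof -
 have "\<exists>g. has_weak_deriv \<Omega> \<alpha> f g" using assms by blast
 then show ?thesis unfolding weak_deriv_def by (rule someI_ex)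
qed

text \<open>The function chosen by \<open>weak_deriv\<close> is arbitrary. By the fundamental lemma
  it agrees almost everywhere with any explicit weak derivative, so Sobolev norms can be computed
  from the latter.\<close>

lemma weak_deriv_AE_eq:
 fixes f :: "real ^ 'd::finite \<Rightarrow> real"
 assumes \<Omega>: "open \<Omega>" and g: "has_weak_deriv \<Omega> \<alpha> f g"
 shows "AE x in lebesgue_on \<Omega>. weak_deriv \<Omega> \<alpha> f x = g x"
proof -
 let ?W = "weak_deriv \<Omega> \<alpha> f"
 have W: "has_weak_deriv \<Omega> \<alpha> f ?W" using weak_deriv_if[OF g] .
 have li: "locally_integrable_on ?W \<Omega>" "locally_integrable_on g \<Omega>" using W g by (auto simp: has_weak_deriv_def)
 have "AE x in lebesgue. x \<in> \<Omega> \<longrightarrow> ?W x - g x = 0"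
 proof (rule AE_eq_0_of_test_functions[OF \<Omega>])
  show "locally_integrable_on (\<lambda>x. ?W x - g x) \<Omega>" using li unfolding locally_integrable_on_def by (auto intro: set_integral_diff)
  fix \<phi> assume \<phi>: "test_function \<Omega> \<phi>"
  have "(LINT x|lebesgue_on \<Omega>. ?W x * \<phi> x) = (LINT x|lebesgue_on \<Omega>. g x * \<phi> x)"
  proof -
   have "(- 1) ^ (\<Sum>i\<in>UNIV. \<alpha> i) * (LINT x|lebesgue_on \<Omega>. ?W x * \<phi> x) = (- 1) ^ (\<Sum>i\<in>UNIV. \<alpha> i) * (LINT x|lebesgue_on \<Omega>. g x * \<phi> x)"
    by (rule trans[OF has_weak_deriv_integral[OF W \<phi>, symmetric] has_weak_deriv_integral[OF g \<phi>]])
   then show ?thesis by simp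
  qed
  then show "(LINT x|lebesgue_on \<Omega>. (?W x - g x) * \<phi> x) = 0"
   using locally_integrable_times_test_function[OF \<Omega> li(1) \<phi>] locally_integrable_times_test_function[OF \<Omega> li(2) \<phi>]
   by (simp add: left_diff_distrib)
 qed
 then show ?thesis using \<Omega> by (subst AE_restrict_space_iff) (auto elim: eventually_mono)
qed

lemma Lp_norm_cong_AE:
 assumes "f \<in> borel_measurable M" "g \<in> borel_measurable M" "AE x in M. f x = g x"
 shows "Lp_norm p M f = Lp_norm p M g"
proof -
 have "esssup M (\<lambda>x. ennreal \<bar>f x\<bar>) = esssup M (\<lambda>x. ennreal \<bar>g x\<bar>)"
 proof (rule antisym)
  show "esssup M (\<lambda>x. ennreal \<bar>f x\<bar>) \<le> esssup M (\<lambda>x. ennreal \<bar>g x\<bar>)"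
   using assms by (intro esssup_AE_mono) (auto elim: eventually_mono)
  show "esssup M (\<lambda>x. ennreal \<bar>g x\<bar>) \<le> esssup M (\<lambda>x. ennreal \<bar>f x\<bar>)"
   using assms by (intro esssup_AE_mono) (auto elim: eventually_mono)
 qed
 moreover have "(\<integral>\<^sup>+ x. ennreal (\<bar>f x\<bar> powr enn2real p) \<partial>M) = (\<integral>\<^sup>+ x. ennreal (\<bar>g x\<bar> powr enn2real p) \<partial>M)"
  using assms(3) by (intro nn_integral_cong_AE) (auto elim: eventually_mono)
 ultimately show ?thesis by (simp add: Lp_norm_def)
qed

text \<open>A crude but convenient criterion: if m denotes the number of multi-indices, m B \<le> 1
  implies B \<le> 1 and therefore m B^p \<le> m B \<le> 1 for every finite p \<ge> 1.\<close>

lemma sobolev_ballI: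
 fixes f :: "real ^ 'd::finite \<Rightarrow> real"
 assumes \<Omega>: "open \<Omega>" and f: "continuous_on \<Omega> f" and p: "1 \<le> p" and B: "B \<ge> 0"
  and g: "\<And>\<alpha>. \<alpha> \<in> multi_indices s \<Longrightarrow> has_weak_deriv \<Omega> \<alpha> f (g \<alpha>)"
   "\<And>\<alpha>. \<alpha> \<in> multi_indices s \<Longrightarrow> continuous_on UNIV (g \<alpha>)"
   "\<And>\<alpha>. \<alpha> \<in> multi_indices s \<Longrightarrow> Lp_norm p (lebesgue_on \<Omega>) (g \<alpha>) \<le> ennreal B"
  and B1: "real (card (multi_indices s :: ('d \<Rightarrow> nat) set)) * B \<le> 1"
 shows "f \<in> sobolev_ball p s \<Omega>"
proof -
 let ?M = "lebesgue_on \<Omega>" and ?m = "real (card (multi_indices s :: ('d \<Rightarrow> nat) set))"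
 have [simp]: "\<Omega> \<in> sets lebesgue" using \<Omega> by simp
 have gm: "g \<alpha> \<in> borel_measurable ?M" if "\<alpha> \<in> multi_indices s" for \<alpha>
  using continuous_on_subset[OF g(2)[OF that], of \<Omega>] by (intro continuous_imp_measurable_on_sets_lebesgue) auto
 have W: "Lp_norm p ?M (weak_deriv \<Omega> \<alpha> f) \<le> ennreal B" if \<alpha>: "\<alpha> \<in> multi_indices s" for \<alpha>
 proof -
  have "has_weak_deriv \<Omega> \<alpha> f (weak_deriv \<Omega> \<alpha> f)" using weak_deriv_if[OF g(1)[OF \<alpha>]] .
  then have "(\<lambda>x. indicator \<Omega> x * weak_deriv \<Omega> \<alpha> f x) \<in> borel_measurable lebesgue"
   by (intro locally_integrable_measurable[OF \<Omega>]) (simp add: has_weak_deriv_def)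
  then have "weak_deriv \<Omega> \<alpha> f \<in> borel_measurable ?M" by (subst borel_measurable_restrict_space_iff) (auto simp: mult.commute)
  then have "Lp_norm p ?M (weak_deriv \<Omega> \<alpha> f) = Lp_norm p ?M (g \<alpha>)"
   by (rule Lp_norm_cong_AE[OF _ gm[OF \<alpha>] weak_deriv_AE_eq[OF \<Omega> g(1)[OF \<alpha>]]])
  then show ?thesis using g(3)[OF \<alpha>] by simp
 qed
 have zero: "(\<lambda>_. 0) \<in> (multi_indices s :: ('d \<Rightarrow> nat) set)" by (simp add: multi_indices_def)
 have m1: "?m \<ge> 1"
  using zero finite_multi_indices[where 'd = 'd, of s] by (metis One_nat_def Suc_leI card_gt_0_iff empty_iff of_nat_1 of_nat_le_iff)
 then have "1 * B \<le> ?m * B" using B by (intro mult_right_mono) auto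
 then have Ble: "B \<le> 1" using B1 by linarith
 have "sobolev_norm p s \<Omega> f \<le> 1"
 proof (cases "p = \<infinity>")
  case True
  have "ennreal B \<le> 1" using Ble B by (simp add: ennreal_le_1)
  then have "Lp_norm p ?M (weak_deriv \<Omega> \<alpha> f) \<le> 1" if "\<alpha> \<in> multi_indices s" for \<alpha> using W[OF that] by (rule order_trans[rotated])
  then have "(SUP \<alpha>\<in>multi_indices s. Lp_norm p ?M (weak_deriv \<Omega> \<alpha> f)) \<le> 1" by (rule SUP_least)
  then show ?thesis using True by (simp add: sobolev_norm_def)
 next
  case False
  let ?p = "enn2real p"
  have p1: "?p \<ge> 1" by (rule enn2real_ge_1[OF p False])
  have e: "ennreal_powr (Lp_norm p ?M (weak_deriv \<Omega> \<alpha> f)) ?p \<le> ennreal (B powr ?p)" if "\<alpha> \<in> multi_indices s" for \<alpha>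
  proof -
   let ?l = "Lp_norm p ?M (weak_deriv \<Omega> \<alpha> f)"
   have "?l \<noteq> \<infinity>" using W[OF that] by (auto simp: top_unique)
   moreover have "enn2real ?l powr ?p \<le> B powr ?p" using W[OF that] B p1 by (intro powr_mono2 enn2real_leI) auto
   ultimately show ?thesis by (simp add: ennreal_powr_def ennreal_leI)
  qed
  have le: "(\<Sum>\<alpha>\<in>multi_indices s. ennreal_powr (Lp_norm p ?M (weak_deriv \<Omega> \<alpha> f)) ?p) \<le> ennreal (?m * B powr ?p)"
  proof -
   have "(\<Sum>\<alpha>\<in>multi_indices s. ennreal_powr (Lp_norm p ?M (weak_deriv \<Omega> \<alpha> f)) ?p) \<le> (\<Sum>\<alpha>\<in>(multi_indices s :: ('d \<Rightarrow> nat) set). ennreal (B powr ?p))"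
    by (intro sum_mono e)
   also have "\<dots> = ennreal (?m * B powr ?p)" by (simp add: ennreal_mult ennreal_of_nat_eq_real_of_nat)
   finally show ?thesis .
  qed
  let ?S = "\<Sum>\<alpha>\<in>multi_indices s. ennreal_powr (Lp_norm p ?M (weak_deriv \<Omega> \<alpha> f)) ?p"
  have "?S \<noteq> \<infinity>" using le by (auto simp: top_unique)
  moreover have "enn2real ?S powr (1 / ?p) \<le> 1"
  proof -
   have "enn2real ?S \<le> ?m * B powr ?p" using le m1 by (intro enn2real_leI) auto
   also have "\<dots> \<le> 1"
   proof -
    have "B powr ?p \<le> B" using p1 B Ble powr_mono'[of 1 ?p B] by simp
    then have "?m * B powr ?p \<le> ?m * B" by (intro mult_left_mono) auto
    then show ?thesis using B1 by linarith
   qed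
   finally show ?thesis using p1 by (intro powr_le1) auto
  qed
  ultimately show ?thesis using False by (simp add: sobolev_norm_def ennreal_powr_def ennreal_le_1)
 qed
 moreover have "f \<in> sobolev_space p s \<Omega>"
 proof -
  have "\<exists>h\<in>Lp_space p ?M. has_weak_deriv \<Omega> \<alpha> f h" if \<alpha>: "\<alpha> \<in> multi_indices s" for \<alpha>
  proof (rule bexI[of _ "g \<alpha>"])
   show "has_weak_deriv \<Omega> \<alpha> f (g \<alpha>)" by (rule g(1)[OF \<alpha>])
   have "Lp_norm p ?M (g \<alpha>) < \<infinity>" by (rule le_less_trans[OF g(3)[OF \<alpha>]]) simp
   then show "g \<alpha> \<in> Lp_space p ?M" using gm[OF \<alpha>] by (simp add: Lp_space_def)
  qed
  then show ?thesis using f by (simp add: sobolev_space_def)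
 qed
 ultimately show ?thesis by (simp add: sobolev_ball_def)
qed

text \<open>The property of \<open>f\<close> that prevents \<open>f\<close> and \<open>-f\<close>
  from both being closer than \<open>r\<close> to the same function. The factor 2 accounts for the
  two integrals in |f|^q \<le> |f - h|^q + |f + h|^q. Stated by integrals, it needs no triangle
  inequality for the L_q norm.\<close>

definition fools :: "ennreal \<Rightarrow> (real ^ 'd::finite) set \<Rightarrow> (real ^ 'd \<Rightarrow> real) \<Rightarrow> real \<Rightarrow> bool" where
 "fools q \<Omega> f r \<longleftrightarrow> (if q = \<infinity> then \<not> (AE x in lebesgue_on \<Omega>. \<bar>f x\<bar> < r)
   else ennreal (2 * r powr enn2real q) \<le> (\<integral>\<^sup>+ x. ennreal (\<bar>f x\<bar> powr enn2real q) \<partial>lebesgue_on \<Omega>))"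

lemma nn_integral_powr_of_Lp_norm:
 assumes q: "1 \<le> q" "q \<noteq> \<infinity>" and V: "V \<ge> 0" "Lp_norm q M f \<le> ennreal V"
 shows "(\<integral>\<^sup>+ x. ennreal (\<bar>f x\<bar> powr enn2real q) \<partial>M) \<le> ennreal (V powr enn2real q)"
proof -
 let ?Q = "enn2real q" and ?I = "\<integral>\<^sup>+ x. ennreal (\<bar>f x\<bar> powr enn2real q) \<partial>M"
 have Q: "?Q \<ge> 1" by (rule enn2real_ge_1[OF q])
 have I: "?I \<noteq> \<infinity>" using V(2) q by (auto simp: Lp_norm_def ennreal_powr_def top_unique)
 then have "enn2real ?I powr (1 / ?Q) \<le> V" using V q by (simp add: Lp_norm_def ennreal_powr_def)
 then have "(enn2real ?I powr (1 / ?Q)) powr ?Q \<le> V powr ?Q" using Q by (intro powr_mono2) auto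
 then have "enn2real ?I \<le> V powr ?Q" using Q by (simp add: powr_powr)
 then have "ennreal (enn2real ?I) \<le> ennreal (V powr ?Q)" by (rule ennreal_leI)
 moreover have "ennreal (enn2real ?I) = ?I" using I by (intro ennreal_enn2real) (simp add: less_top)
 ultimately show ?thesis by simp
qed

text \<open>An algorithm that only sees zeros treats \<open>f\<close> and \<open>-f\<close> alike.\<close>

lemma fooling_error:
 fixes f h :: "real ^ 'd::finite \<Rightarrow> real"
 assumes q: "1 \<le> q" and r: "r > 0" and f: "fools q \<Omega> f r"
  and meas: "f \<in> borel_measurable (lebesgue_on \<Omega>)" "h \<in> borel_measurable (lebesgue_on \<Omega>)"
  and V: "Lp_norm q (lebesgue_on \<Omega>) (\<lambda>x. f x - h x) \<le> V" "Lp_norm q (lebesgue_on \<Omega>) (\<lambda>x. - f x - h x) \<le> V"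
 shows "ennreal r \<le> V"
proof (rule ccontr)
 let ?M = "lebesgue_on \<Omega>"
 assume "\<not> ennreal r \<le> V"
 then have Vr: "V < ennreal r" by simp
 then have "V \<noteq> \<infinity>" by auto
 define v where "v = enn2real V"
 have v: "V = ennreal v" "v \<ge> 0" "v < r" 
  using Vr r \<open>V \<noteq> \<infinity>\<close> unfolding v_def by (auto simp: less_top enn2real_less_iff intro!: ennreal_enn2real[symmetric])
 show False
 proof (cases "q = \<infinity>")
  case True
  have "AE x in ?M. ennreal \<bar>f x - h x\<bar> \<le> esssup ?M (\<lambda>x. ennreal \<bar>f x - h x\<bar>)" by (rule esssup_AE)
  moreover have "AE x in ?M. ennreal \<bar>- f x - h x\<bar> \<le> esssup ?M (\<lambda>x. ennreal \<bar>- f x - h x\<bar>)" by (rule esssup_AE)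
  ultimately have "AE x in ?M. \<bar>f x\<bar> < r"
  proof eventually_elim
   case (elim x)
   have "ennreal \<bar>f x - h x\<bar> \<le> ennreal v" "ennreal \<bar>- f x - h x\<bar> \<le> ennreal v"
    using elim V True unfolding v(1)[symmetric] by (auto simp: Lp_norm_def intro: order_trans)
   then have "\<bar>f x - h x\<bar> \<le> v" "\<bar>- f x - h x\<bar> \<le> v" using v(2) by auto
   then show ?case using v(3) by linarith
  qed
  then show False using f True by (simp add: fools_def)
 next
  case False
  let ?Q = "enn2real q"
  have Q: "?Q \<ge> 1" by (rule enn2real_ge_1[OF q False])
  have "ennreal (2 * r powr ?Q) \<le> (\<integral>\<^sup>+ x. ennreal (\<bar>f x\<bar> powr ?Q) \<partial>?M)" using f False by (simp add: fools_def)
  also have "\<dots> \<le> (\<integral>\<^sup>+ x. ennreal (\<bar>f x - h x\<bar> powr ?Q) + ennreal (\<bar>- f x - h x\<bar> powr ?Q) \<partial>?M)"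
  proof (rule nn_integral_mono)
   fix x
   \<comment> \<open>At each point one of the two deviations is at least
     \<open>\<bar>f x\<bar>\<close>, since their difference is \<open>2 * f x\<close> up to
     sign.\<close>
   have "\<bar>f x\<bar> \<le> \<bar>f x - h x\<bar> \<or> \<bar>f x\<bar> \<le> \<bar>- f x - h x\<bar>" by linarith
   then have "\<bar>f x\<bar> powr ?Q \<le> \<bar>f x - h x\<bar> powr ?Q \<or> \<bar>f x\<bar> powr ?Q \<le> \<bar>- f x - h x\<bar> powr ?Q" using Q by (auto intro: powr_mono2)
   moreover have "\<bar>f x - h x\<bar> powr ?Q \<ge> 0" "\<bar>- f x - h x\<bar> powr ?Q \<ge> 0" by auto
   ultimately have "\<bar>f x\<bar> powr ?Q \<le> \<bar>f x - h x\<bar> powr ?Q + \<bar>- f x - h x\<bar> powr ?Q" by linarith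
   then show "ennreal (\<bar>f x\<bar> powr ?Q) \<le> ennreal (\<bar>f x - h x\<bar> powr ?Q) + ennreal (\<bar>- f x - h x\<bar> powr ?Q)"
    by (simp add: ennreal_plus[symmetric] ennreal_leI del: ennreal_plus)
  qed
  also have "\<dots> = (\<integral>\<^sup>+ x. ennreal (\<bar>f x - h x\<bar> powr ?Q) \<partial>?M) + (\<integral>\<^sup>+ x. ennreal (\<bar>- f x - h x\<bar> powr ?Q) \<partial>?M)"
  proof -
   note [measurable] = meas
   show ?thesis by (rule nn_integral_add) measurable
  qed
  also have "\<dots> \<le> ennreal (v powr ?Q) + ennreal (v powr ?Q)"
   using V v by (intro add_mono nn_integral_powr_of_Lp_norm[OF q False]) auto
  also have "\<dots> = ennreal (2 * v powr ?Q)" by (simp add: ennreal_plus[symmetric] del: ennreal_plus)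
  finally have "r powr ?Q \<le> v powr ?Q" by simp
  moreover have "v powr ?Q < r powr ?Q" using v Q by (intro powr_less_mono2) auto
  ultimately show False by simp
 qed
qed

abbreviation fooled :: "ennreal \<Rightarrow> nat \<Rightarrow> ennreal \<Rightarrow> (real ^ 'd::finite) set \<Rightarrow> (real ^ 'd) set \<Rightarrow> real \<Rightarrow> bool" where
 "fooled p s q \<Omega> N r \<equiv> (\<exists>f. f \<in> sobolev_ball p s \<Omega> \<and> (\<lambda>x. - f x) \<in> sobolev_ball p s \<Omega> \<and>
  (\<forall>x\<in>N. f x = 0) \<and> fools q \<Omega> f r)"

text \<open>The fooling function may depend on \<omega> in any way: it is used for each \<omega>
  separately, to see that every measurable majorant in the upper integral is at least
  \<open>r\<close> on \<open>A\<close> times the space of additional randomness.\<close>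

theorem unif_error_points_ge:
 fixes \<Omega> :: "(real ^ 'd::finite) set"
 assumes \<Omega>: "open \<Omega>" and M: "prob_space M" and q: "1 \<le> q" and r: "r > 0" and A: "A \<in> sets M"
  and f: "\<And>\<omega>. \<omega> \<in> A \<Longrightarrow> fooled p s q \<Omega> (N \<omega>) r"
 shows "ennreal (r * measure M A) \<le> unif_error_points M N p s q \<Omega>" unfolding unif_error_points_def
proof (intro INF_greatest)
 fix R \<phi> assume R: "R \<in> {R :: real measure. prob_space R}" and \<phi>: "\<phi> \<in> random_mappings M R N q \<Omega>"
 interpret M: prob_space M by (rule M)
 interpret R: prob_space R using R by simp
 interpret pair_sigma_finite M R ..
 let ?S = "\<lambda>\<omega>. SUP f\<in>sobolev_ball p s \<Omega>. Lp_norm q (lebesgue_on \<Omega>)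
   (\<lambda>x. f x - (\<lambda>(\<omega>, u) f. \<phi> (\<omega>, u) (restrict f (N \<omega>))) \<omega> f x)"
 show "ennreal (r * measure M A) \<le> unif_error (M \<Otimes>\<^sub>M R) (\<lambda>(\<omega>, u) f. \<phi> (\<omega>, u) (restrict f (N \<omega>))) p s q \<Omega>"
  unfolding unif_error_def upper_nn_integral_def
 proof (rule INF_greatest)
  fix G assume G: "G \<in> {G \<in> borel_measurable (M \<Otimes>\<^sub>M R). \<forall>\<omega>\<in>space (M \<Otimes>\<^sub>M R). ?S \<omega> \<le> G \<omega>}"
  have low: "ennreal r \<le> G (\<omega>, u)" if \<omega>: "\<omega> \<in> A" and u: "u \<in> space R" for \<omega> u
  proof -
   have \<omega>M: "\<omega> \<in> space M" using \<omega> A sets.sets_into_space by blast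
   obtain f where f1: "f \<in> sobolev_ball p s \<Omega>" "(\<lambda>x. - f x) \<in> sobolev_ball p s \<Omega>" "\<forall>x\<in>N \<omega>. f x = 0" "fools q \<Omega> f r"
    using f[OF \<omega>] by blast
   define h where "h = \<phi> (\<omega>, u) (restrict (\<lambda>_. 0) (N \<omega>))"
   have rf: "restrict f (N \<omega>) = restrict (\<lambda>_. 0) (N \<omega>)" "restrict (\<lambda>x. - f x) (N \<omega>) = restrict (\<lambda>_. 0) (N \<omega>)"
    using f1(3) by (auto simp: restrict_def fun_eq_iff)
   have "restrict (\<lambda>_. 0) (N \<omega>) \<in> N \<omega> \<rightarrow>\<^sub>E (UNIV :: real set)" by auto
   then have "h \<in> Lp_space q (lebesgue_on \<Omega>)" using \<phi> \<omega>M u unfolding random_mappings_def h_def by (auto simp: space_pair_measure)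
   then have hm: "h \<in> borel_measurable (lebesgue_on \<Omega>)" by (simp add: Lp_space_def)
   have fm: "f \<in> borel_measurable (lebesgue_on \<Omega>)"
    using f1(1) \<Omega> by (intro continuous_imp_measurable_on_sets_lebesgue) (auto simp: sobolev_ball_def sobolev_space_def)
   have "ennreal r \<le> ?S (\<omega>, u)"
   proof (rule fooling_error[OF q r f1(4) fm hm])
    show "Lp_norm q (lebesgue_on \<Omega>) (\<lambda>x. f x - h x) \<le> ?S (\<omega>, u)" by (rule SUP_upper2[OF f1(1)]) (simp add: h_def rf)
    show "Lp_norm q (lebesgue_on \<Omega>) (\<lambda>x. - f x - h x) \<le> ?S (\<omega>, u)" by (rule SUP_upper2[OF f1(2)]) (simp add: h_def rf)
   qed
   also have "\<dots> \<le> G (\<omega>, u)" using G \<omega>M u by (auto simp: space_pair_measure)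
   finally show ?thesis .
  qed
  have "ennreal (r * measure M A) = (\<integral>\<^sup>+ x. ennreal r * indicator (A \<times> space R) x \<partial>(M \<Otimes>\<^sub>M R))"
  proof -
   have "emeasure (M \<Otimes>\<^sub>M R) (A \<times> space R) = emeasure M A * emeasure R (space R)"
    using A by (intro R.emeasure_pair_measure_Times) auto
   then have "emeasure (M \<Otimes>\<^sub>M R) (A \<times> space R) = ennreal (measure M A)" by (simp add: R.emeasure_space_1 M.emeasure_eq_measure)
   then show ?thesis using A r by (subst nn_integral_cmult_indicator) (auto simp: ennreal_mult)
  qed
  also have "\<dots> \<le> (\<integral>\<^sup>+ x. G x \<partial>(M \<Otimes>\<^sub>M R))" using low by (intro nn_integral_mono) (auto simp: indicator_def split: prod.splits)
  finally show "ennreal (r * measure M A) \<le> (\<integral>\<^sup>+ x. G x \<partial>(M \<Otimes>\<^sub>M R))" .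
 qed
qed

lemma locally_integrable_continuous:
 fixes f :: "real ^ 'd::finite \<Rightarrow> real"
 assumes "continuous_on UNIV f"
 shows "locally_integrable_on f \<Omega>" unfolding locally_integrable_on_def
proof (intro allI impI)
 fix K assume K: "compact K \<and> K \<subseteq> \<Omega>"
 have "integrable lborel (\<lambda>x. indicator K x *\<^sub>R f x)"
  using K continuous_on_subset[OF assms] by (intro borel_integrable_compact) auto
 then have "integrable lebesgue (\<lambda>x. indicator K x *\<^sub>R f x)" by (simp add: integrable_completion borel_measurable_integrable)
 then show "f absolutely_integrable_on K" by (simp add: set_integrable_def)
qed

lemma integral_lebesgue_on_compact_support:
 fixes f :: "real ^ 'd::finite \<Rightarrow> real"
 assumes \<Omega>: "open \<Omega>" and f: "continuous_on UNIV f" and K: "K \<subseteq> \<Omega>" "\<And>x. x \<notin> K \<Longrightarrow> f x = 0"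
 shows "(LINT x|lebesgue_on \<Omega>. f x) = (LINT x|lborel. f x)"
proof -
 have "(LINT x|lebesgue_on \<Omega>. f x) = (LINT x|lebesgue. indicator \<Omega> x * f x)" using \<Omega> by (intro integral_lebesgue_on) auto
 also have "(\<lambda>x. indicator \<Omega> x * f x) = f" using K by (force simp: indicator_def)
 also have "(LINT x|lebesgue. f x) = (LINT x|lborel. f x)"
  using f by (intro integral_completion) (auto intro: borel_measurable_continuous_onI)
 finally show ?thesis .
qed

lemma has_weak_deriv_sum_prodf:
 fixes b :: "'j \<Rightarrow> 'd::finite \<Rightarrow> nat \<Rightarrow> real \<Rightarrow> real"
 assumes \<Omega>: "open \<Omega>" and S: "finite S" and b: "\<And>j. \<forall>i. dseq (b j i)"
 shows "has_weak_deriv \<Omega> \<alpha> (\<lambda>x. a * (\<Sum>j\<in>S. prodf (b j) (\<lambda>_. 0) x)) (\<lambda>x. a * (\<Sum>j\<in>S. prodf (b j) \<alpha> x))"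
proof -
 have c: "continuous_on UNIV (prodf (b j) m)" for j m by (rule prodf_continuous[OF b])
 have cs: "continuous_on UNIV (\<lambda>x. a * (\<Sum>j\<in>S. prodf (b j) m x))" for m by (intro continuous_intros c)
 have main: "(LINT x|lebesgue_on \<Omega>. a * (\<Sum>j\<in>S. prodf (b j) (\<lambda>_. 0) x) * multi_deriv \<alpha> \<phi> x) =
   (-1) ^ (\<Sum>i\<in>UNIV. \<alpha> i) * (LINT x|lebesgue_on \<Omega>. a * (\<Sum>j\<in>S. prodf (b j) \<alpha> x) * \<phi> x)"
  if \<phi>: "test_function \<Omega> \<phi>" for \<phi>
 proof -
  obtain "is" where l: "\<And>i. count_list is i = \<alpha> i" "\<And>f :: real ^ 'd \<Rightarrow> real. multi_deriv \<alpha> f = foldr partial_deriv is f"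
   using multi_deriv_list by blast
  have len: "length is = (\<Sum>i\<in>UNIV. \<alpha> i)" using sum_count_set[of "is" UNIV] l(1) by simp
  let ?K = "closure {x. \<phi> x \<noteq> 0}" and ?\<psi> = "foldr partial_deriv is \<phi>"
  have K: "compact ?K" "?K \<subseteq> \<Omega>" using \<phi> by (auto simp: test_function_def)
  have \<psi>c: "continuous_on UNIV ?\<psi>" using test_function_iterated(1)[OF \<phi>] by (rule differentiable_imp_continuous_on)
  have \<psi>0: "?\<psi> x = 0" if "x \<notin> ?K" for x by (rule test_function_iterated(2)[OF \<phi> that])
  have \<phi>c: "continuous_on UNIV \<phi>" using test_function_iterated(1)[OF \<phi>, of "[]"] by (auto intro: differentiable_imp_continuous_on)
  have \<phi>0: "\<phi> x = 0" if "x \<notin> ?K" for x using test_function_iterated(2)[OF \<phi> that, of "[]"] by simp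
  have swap: "(LINT x|lebesgue_on \<Omega>. a * (\<Sum>j\<in>S. prodf (b j) m x) * g x) = a * (\<Sum>j\<in>S. LINT x|lborel. prodf (b j) m x * g x)"
   if g: "continuous_on UNIV g" "\<And>x. x \<notin> ?K \<Longrightarrow> g x = 0" for m g
  proof -
   have i: "integrable lborel (\<lambda>x. prodf (b j) m x * g x)" for j
    by (rule integrable_continuous_compact_support[OF _ K(1)]) (auto intro!: continuous_intros c g)
   have "(LINT x|lebesgue_on \<Omega>. a * (\<Sum>j\<in>S. prodf (b j) m x) * g x) = (LINT x|lborel. a * (\<Sum>j\<in>S. prodf (b j) m x) * g x)"
    by (rule integral_lebesgue_on_compact_support[OF \<Omega> _ K(2)]) (auto intro!: continuous_intros c g)
   also have "\<dots> = (LINT x|lborel. a * (\<Sum>j\<in>S. prodf (b j) m x * g x))" by (simp add: sum_distrib_right mult.assoc)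
   also have "\<dots> = a * (\<Sum>j\<in>S. LINT x|lborel. prodf (b j) m x * g x)" using i by (simp add: Bochner_Integration.integral_sum)
   finally show ?thesis .
  qed
  have "(LINT x|lebesgue_on \<Omega>. a * (\<Sum>j\<in>S. prodf (b j) (\<lambda>_. 0) x) * ?\<psi> x) = a * (\<Sum>j\<in>S. LINT x|lborel. prodf (b j) (\<lambda>_. 0) x * ?\<psi> x)"
   by (rule swap[OF \<psi>c \<psi>0])
  also have "\<dots> = a * (\<Sum>j\<in>S. (-1) ^ length is * (LINT x|lborel. prodf (b j) \<alpha> x * \<phi> x))"
   using integration_by_parts_prodf[OF b \<phi>, of _ "\<lambda>_. 0" "is"] by (simp add: l(1))
  also have "\<dots> = (-1) ^ length is * (a * (\<Sum>j\<in>S. LINT x|lborel. prodf (b j) \<alpha> x * \<phi> x))" by (simp add: sum_distrib_left mult_ac)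
  also have "a * (\<Sum>j\<in>S. LINT x|lborel. prodf (b j) \<alpha> x * \<phi> x) = (LINT x|lebesgue_on \<Omega>. a * (\<Sum>j\<in>S. prodf (b j) \<alpha> x) * \<phi> x)"
   by (rule swap[OF \<phi>c \<phi>0, symmetric])
  finally show ?thesis unfolding l(2) len .
 qed
 show ?thesis unfolding has_weak_deriv_def using locally_integrable_continuous[OF cs] main by blast
qed

section \<open>Bumps on small cubes\<close>

definition scaled_bump :: "real \<Rightarrow> real ^ 'd::finite \<Rightarrow> 'd \<Rightarrow> nat \<Rightarrow> real \<Rightarrow> real" where
 "scaled_bump h c i = (\<lambda>m t. (1 / h) ^ m * bump 1 (-1) 1 m ((1 / h) * t + - (c $ i / h)))"

lemma dseq_scaled_bump: "\<forall>i. dseq (scaled_bump h c i)" unfolding scaled_bump_def by (intro allI dseq_affine dseq_bump)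

lemma prodf_scaled_bump:
 "prodf (scaled_bump h c) \<alpha> x = (1 / h) ^ (\<Sum>i\<in>UNIV. \<alpha> i) * prodf std_bump \<alpha> ((1 / h) *\<^sub>R (x - c))"
 unfolding prodf_def scaled_bump_def prod.distrib power_sum by (simp add: diff_divide_distrib)

definition cube :: "real ^ 'd::finite \<Rightarrow> real \<Rightarrow> (real ^ 'd) set" where
 "cube c h = box (\<chi> i. c $ i - h) (\<chi> i. c $ i + h)"

lemma mem_cube: "x \<in> cube c h \<longleftrightarrow> (\<forall>i. \<bar>x $ i - c $ i\<bar> < h)"
proof -
 have "(c $ i - h < x $ i \<and> x $ i < c $ i + h) \<longleftrightarrow> \<bar>x $ i - c $ i\<bar> < h" for i by linarith
 then show ?thesis unfolding cube_def mem_box_cart by simp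
qed

lemma sets_cube [simp, measurable]: "cube c h \<in> sets borel" by (simp add: cube_def)

lemma emeasure_cube:
 fixes c :: "real ^ 'd::finite"
 assumes "h > 0"
 shows "emeasure lborel (cube c h) = ennreal ((2 * h) ^ CARD('d))"
proof -
 have e: "((\<chi> i. c $ i + h) - (\<chi> i. c $ i - h)) \<bullet> b = 2 * h" if "b \<in> Basis" for b :: "real ^ 'd"
  using that by (auto simp: Basis_vec_def inner_axis)
 have "emeasure lborel (cube c h) = ennreal (\<Prod>b\<in>(Basis :: (real ^ 'd) set). ((\<chi> i. c $ i + h) - (\<chi> i. c $ i - h)) \<bullet> b)"
  unfolding cube_def
 proof (rule emeasure_lborel_box)
  fix b :: "real ^ 'd" assume "b \<in> Basis"
  then show "(\<chi> i. c $ i - h) \<bullet> b \<le> (\<chi> i. c $ i + h) \<bullet> b" using e[of b] assms by (simp add: inner_diff_left)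
 qed
 also have "(\<Prod>b\<in>(Basis :: (real ^ 'd) set). ((\<chi> i. c $ i + h) - (\<chi> i. c $ i - h)) \<bullet> b) = (\<Prod>b\<in>(Basis :: (real ^ 'd) set). 2 * h)"
  by (intro prod.cong refl e)
 also have "\<dots> = (2 * h) ^ CARD('d)" by simp
 finally show ?thesis .
qed

lemma prodf_scaled_bump_eq_0:
 assumes "h > 0" "x \<notin> cube c h"
 shows "prodf (scaled_bump h c) \<alpha> x = 0"
proof (rule ccontr)
 assume "prodf (scaled_bump h c) \<alpha> x \<noteq> 0"
 then have "prodf std_bump \<alpha> ((1 / h) *\<^sub>R (x - c)) \<noteq> 0" unfolding prodf_scaled_bump by auto
 then have "\<bar>((1 / h) *\<^sub>R (x - c)) $ i\<bar> < 1" for i by (rule prodf_std_bump_eq_0)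
 then have "\<bar>x $ i - c $ i\<bar> < h" for i using assms(1) by (simp add: abs_mult abs_divide field_simps)
 then show False using assms(2) by (simp add: mem_cube)
qed

lemma prodf_std_bump_ge:
 fixes x :: "real ^ 'd::finite"
 assumes "\<And>i. \<bar>x $ i\<bar> < 1 / 2"
 shows "exp (- 4) ^ CARD('d) \<le> prodf std_bump (\<lambda>_. 0) x"
proof -
 have "exp (- 4) \<le> bump 1 (-1) 1 0 (x $ i)" for i
 proof -
  \<comment> \<open>Both one-sided factors have argument 1 + x_i or 1 - x_i, which exceeds 1/2 on
    the half cube.\<close>
  have e: "exp (- 2) \<le> flat_seq 0 y" if "y > 1 / 2" for y :: real using that by (simp add: flat_seq_0 field_simps)
  have "exp (- 4) = exp (- 2) * exp (- 2 :: real)" by (simp add: exp_add[symmetric])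
  also have "\<dots> \<le> flat_seq 0 (1 * (x $ i - (-1))) * flat_seq 0 (1 * (1 - x $ i))"
  proof -
   have "- (1 / 2) < x $ i" "x $ i < 1 / 2" using assms[of i] by linarith+
   then show ?thesis by (intro mult_mono e) (auto simp: flat_seq_0)
  qed
  finally show ?thesis by (simp add: bump_0)
 qed
 then have "(\<Prod>i\<in>(UNIV :: 'd set). exp (- 4)) \<le> prodf std_bump (\<lambda>_. 0) x" unfolding prodf_def by (intro prod_mono) auto
 then show ?thesis by simp
qed

lemma Lp_norm_le_indicator:
 fixes f :: "real ^ 'd::finite \<Rightarrow> real"
 assumes \<Omega>: "open \<Omega>" and p: "1 \<le> p" and f: "continuous_on UNIV f" and B: "B \<ge> 0" "\<And>x. \<bar>f x\<bar> \<le> B * indicator D x"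
  and D: "D \<in> sets borel" "emeasure lborel D \<le> ennreal V" "V > 0"
 shows "Lp_norm p (lebesgue_on \<Omega>) f \<le> ennreal (B * V powr enn2real (1 / p))"
proof (cases "p = \<infinity>")
 case True
 have "f \<in> borel_measurable (lebesgue_on \<Omega>)"
  using \<Omega> continuous_on_subset[OF f, of \<Omega>] by (intro continuous_imp_measurable_on_sets_lebesgue) auto
 moreover have "\<bar>f x\<bar> \<le> B" for x using B(2)[of x] B(1) by (cases "x \<in> D") auto
 ultimately have "esssup (lebesgue_on \<Omega>) (\<lambda>x. ennreal \<bar>f x\<bar>) \<le> ennreal B" by (intro esssup_I) (auto intro!: AE_I2 ennreal_leI)
 then show ?thesis using True D(3) by (simp add: Lp_norm_def)
next
 case False
 let ?p = "enn2real p"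
 have p1: "?p \<ge> 1" by (rule enn2real_ge_1[OF p False])
 have "(\<integral>\<^sup>+ x. ennreal (\<bar>f x\<bar> powr ?p) \<partial>lebesgue_on \<Omega>) \<le> (\<integral>\<^sup>+ x. ennreal (B powr ?p) * indicator D x \<partial>lebesgue_on \<Omega>)"
 proof (rule nn_integral_mono)
  fix x
  show "ennreal (\<bar>f x\<bar> powr ?p) \<le> ennreal (B powr ?p) * indicator D x"
  proof (cases "x \<in> D")
   case True
   then have "\<bar>f x\<bar> \<le> B" using B(2)[of x] by simp
   then have "\<bar>f x\<bar> powr ?p \<le> B powr ?p" using p1 by (intro powr_mono2) auto
   then show ?thesis using True by (simp add: ennreal_leI)
  next
   case False
   then have "f x = 0" using B(2)[of x] by simp
   then show ?thesis by simp
  qed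
 qed
 also have "\<dots> = (\<integral>\<^sup>+ x. ennreal (B powr ?p) * indicator D x * indicator \<Omega> x \<partial>lebesgue)"
  using \<Omega> by (subst nn_integral_restrict_space) auto
 also have "\<dots> \<le> (\<integral>\<^sup>+ x. ennreal (B powr ?p) * indicator D x \<partial>lebesgue)" by (intro nn_integral_mono) (auto simp: indicator_def)
 also have "\<dots> = ennreal (B powr ?p) * emeasure lborel D" using D(1) by (subst nn_integral_cmult_indicator) auto
 also have "\<dots> \<le> ennreal (B powr ?p) * ennreal V" by (intro mult_left_mono D(2)) simp
 also have "\<dots> = ennreal (B powr ?p * V)" by (simp add: ennreal_mult')
 finally have "Lp_norm p (lebesgue_on \<Omega>) f \<le> ennreal ((B powr ?p * V) powr (1 / ?p))"
  using False p D(3) by (intro Lp_norm_le_of_nn_integral) auto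
 also have "(B powr ?p * V) powr (1 / ?p) = B * V powr enn2real (1 / p)"
  using p1 B(1) D(3) unfolding enn2real_one_divide[OF p False] by (simp add: powr_mult powr_powr)
 finally show ?thesis .
qed

text \<open>Halving \<open>b\<close> absorbs the factor 2 in \<open>fools\<close>, because 2 (1/2)^q
  \<le> 1, and for q = \<infinity> it makes the inequality strict.\<close>

lemma fools_indicator:
 fixes f :: "real ^ 'd::finite \<Rightarrow> real"
 assumes \<Omega>: "open \<Omega>" and q: "1 \<le> q" and b: "b > 0" "\<And>x. x \<in> D \<Longrightarrow> b \<le> \<bar>f x\<bar>"
  and D: "D \<in> sets borel" "D \<subseteq> \<Omega>" "emeasure lborel D = ennreal V" "V > 0"
 shows "fools q \<Omega> f (b / 2 * V powr enn2real (1 / q))"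
proof (cases "q = \<infinity>")
 case True
 have "\<not> (AE x in lebesgue_on \<Omega>. \<bar>f x\<bar> < b / 2)"
 proof
  assume "AE x in lebesgue_on \<Omega>. \<bar>f x\<bar> < b / 2"
  then have "AE x in lebesgue. x \<in> \<Omega> \<longrightarrow> \<bar>f x\<bar> < b / 2" using \<Omega> by (subst (asm) AE_restrict_space_iff) auto
  then have "AE x in lebesgue. x \<notin> D"
  proof eventually_elim
   case (elim x)
   then show ?case using b(1) b(2)[of x] D(2) by force
  qed
  then have "emeasure lebesgue D = 0" using D(1) by (subst (asm) AE_iff_measurable[where N = D]) auto
  then show False using D by simp
 qed
 then show ?thesis using True D(4) by (simp add: fools_def)
next
 case False
 let ?Q = "enn2real q"
 have Q: "?Q \<ge> 1" by (rule enn2real_ge_1[OF q False])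
 have "2 * (1 / 2 :: real) powr ?Q \<le> 1" using powr_mono'[of 1 ?Q "1 / 2"] Q by simp
 then have "(2 * (1 / 2) powr ?Q) * (b powr ?Q * V) \<le> 1 * (b powr ?Q * V)" using D(4) by (intro mult_right_mono) auto
 moreover have "(b / 2 * V powr enn2real (1 / q)) powr ?Q = (1 / 2) powr ?Q * (b powr ?Q * V)"
 proof -
  have "b / 2 * V powr enn2real (1 / q) = 1 / 2 * (b * V powr (1 / ?Q))" unfolding enn2real_one_divide[OF q False] by simp
  also have "\<dots> powr ?Q = (1 / 2) powr ?Q * (b powr ?Q * (V powr (1 / ?Q)) powr ?Q)" using b(1) by (simp only: powr_mult)
  also have "(V powr (1 / ?Q)) powr ?Q = V" using Q D(4) by (simp add: powr_powr)
  finally show ?thesis .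
 qed
 ultimately have "ennreal (2 * (b / 2 * V powr enn2real (1 / q)) powr ?Q) \<le> ennreal (b powr ?Q * V)" by (intro ennreal_leI) simp
 also have "\<dots> = (\<integral>\<^sup>+ x. ennreal (b powr ?Q) * indicator D x \<partial>lebesgue)"
  using D by (subst nn_integral_cmult_indicator) (auto simp: ennreal_mult')
 also have "\<dots> \<le> (\<integral>\<^sup>+ x. ennreal (\<bar>f x\<bar> powr ?Q) * indicator \<Omega> x \<partial>lebesgue)"
 proof (rule nn_integral_mono)
  fix x
  show "ennreal (b powr ?Q) * indicator D x \<le> ennreal (\<bar>f x\<bar> powr ?Q) * indicator \<Omega> x"
  proof (cases "x \<in> D")
   case True
   then have "b powr ?Q \<le> \<bar>f x\<bar> powr ?Q" using b Q by (intro powr_mono2) auto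
   then show ?thesis using True D(2) by (auto simp: indicator_def ennreal_leI)
  qed simp
 qed
 also have "\<dots> = (\<integral>\<^sup>+ x. ennreal (\<bar>f x\<bar> powr ?Q) \<partial>lebesgue_on \<Omega>)" using \<Omega> by (subst nn_integral_restrict_space) auto
 finally show ?thesis using False by (simp add: fools_def)
qed

lemma fools_mono:
 assumes "fools q \<Omega> f r" "0 \<le> r'" "r' \<le> r" 
 shows "fools q \<Omega> f r'"
proof (cases "q = \<infinity>")
 case True
 have "\<not> (AE x in lebesgue_on \<Omega>. \<bar>f x\<bar> < r')"
 proof
  assume "AE x in lebesgue_on \<Omega>. \<bar>f x\<bar> < r'"
  then have "AE x in lebesgue_on \<Omega>. \<bar>f x\<bar> < r" by eventually_elim (use assms(3) in linarith)
  then show False using assms(1) True by (simp add: fools_def)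
 qed
 then show ?thesis using True by (simp add: fools_def)
next
 case False
 have "ennreal (2 * r' powr enn2real q) \<le> ennreal (2 * r powr enn2real q)"
  using assms by (intro ennreal_leI mult_left_mono powr_mono2) auto
 also have "\<dots> \<le> (\<integral>\<^sup>+ x. ennreal (\<bar>f x\<bar> powr enn2real q) \<partial>lebesgue_on \<Omega>)" using assms(1) False by (simp add: fools_def)
 finally show ?thesis using False by (simp add: fools_def)
qed

text \<open>A sum of scaled bumps on disjoint empty cubes, normalised to lie in the unit ball.\<close>

lemma cube_fooling:
 fixes \<Omega> :: "(real ^ 'd::finite) set"
 assumes \<Omega>: "open \<Omega>" and p: "1 \<le> p" and q: "1 \<le> q"
 obtains c0 where "c0 > 0"
  "\<And>S (c :: 'j \<Rightarrow> real ^ 'd) h N. finite S \<Longrightarrow> S \<noteq> {} \<Longrightarrow> 0 < h \<Longrightarrow> h \<le> 1 \<Longrightarrow>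
   (\<And>j. j \<in> S \<Longrightarrow> cube (c j) h \<subseteq> \<Omega>) \<Longrightarrow> disjoint_family_on (\<lambda>j. cube (c j) h) S \<Longrightarrow>
   (\<And>j. j \<in> S \<Longrightarrow> cube (c j) h \<inter> N = {}) \<Longrightarrow>
   fooled p s q \<Omega> N (c0 * h ^ s * (real (card S) * h ^ CARD('d)) powr (enn2real (1 / q) - enn2real (1 / p)))"
proof -
 let ?MI = "multi_indices s :: ('d \<Rightarrow> nat) set"
 let ?m = "real (card ?MI)" and ?ep = "enn2real (1 / p)" and ?eq = "enn2real (1 / q)"
 have fin: "finite ?MI" by (rule finite_multi_indices)
 have "(\<lambda>_. 0) \<in> ?MI" by (simp add: multi_indices_def)
 then have m: "?m > 0" using fin by (auto simp: card_gt_0_iff)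
 have "\<exists>B>0. \<forall>x. \<bar>prodf std_bump \<alpha> x\<bar> \<le> B" for \<alpha> :: "'d \<Rightarrow> nat" using prodf_std_bump_bounded by metis
 then obtain B where B: "\<And>\<alpha> :: 'd \<Rightarrow> nat. B \<alpha> > 0" "\<And>\<alpha> x. \<bar>prodf std_bump \<alpha> x\<bar> \<le> B \<alpha>" by metis
 define H where "H = 1 + (\<Sum>\<alpha>\<in>?MI. B \<alpha>)"
 have H0: "H > 0" unfolding H_def using B(1) by (intro add_pos_nonneg sum_nonneg) (auto intro: less_imp_le)
 have H: "\<bar>prodf std_bump \<alpha> x\<bar> \<le> H" if "\<alpha> \<in> ?MI" for \<alpha> x
 proof -
  have "B \<alpha> \<le> (\<Sum>\<alpha>\<in>?MI. B \<alpha>)" using fin that B(1) by (intro member_le_sum) (auto intro: less_imp_le)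
  then show ?thesis using B(2)[of \<alpha> x] unfolding H_def by linarith
 qed
 \<comment> \<open>\<open>H\<close> bounds all derivatives of the bump, \<open>?m\<close> counts the
   multi-indices, and the last factor compares the volume (2h)^d of a cube with h^d.\<close>
 define K where "K = H * ?m * (2 ^ CARD('d)) powr ?ep"
 have K: "K > 0" unfolding K_def using H0 m by simp
 define \<eta> :: real where "\<eta> = exp (- 4) ^ CARD('d)"
 have \<eta>: "\<eta> > 0" by (simp add: \<eta>_def)
 show thesis
 proof (rule that[of "\<eta> / K / 2"])
  show "\<eta> / K / 2 > 0" using \<eta> K by simp
  fix S :: "'j set" and c :: "'j \<Rightarrow> real ^ 'd" and h :: real and N :: "(real ^ 'd) set"
  assume S: "finite S" "S \<noteq> {}" and h: "0 < h" "h \<le> 1" and sub: "\<And>j. j \<in> S \<Longrightarrow> cube (c j) h \<subseteq> \<Omega>"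
   and disj: "disjoint_family_on (\<lambda>j. cube (c j) h) S" and N: "\<And>j. j \<in> S \<Longrightarrow> cube (c j) h \<inter> N = {}"
  define V where "V = real (card S) * h ^ CARD('d)"
  have V: "V > 0" unfolding V_def using S h by (simp add: card_gt_0_iff)
  \<comment> \<open>The largest admissible amplitude up to constants: derivatives of order at most
    \<open>s\<close> are of size h^(-s), as h \<le> 1, on a support of volume comparable to
    \<open>V\<close>.\<close>
  define A where "A = h ^ s / (K * V powr ?ep)"
  have A: "A > 0" unfolding A_def using h K V by simp
  define D where "D = (\<Union>j\<in>S. cube (c j) h)"
  \<comment> \<open>The concentric half cubes, on which the bumps are at least \<eta>. Their total
    volume is exactly \<open>V\<close>.\<close>
  define D' where "D' = (\<Union>j\<in>S. cube (c j) (h / 2))"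
  define F where "F = (\<lambda>\<alpha> x. \<Sum>j\<in>S. prodf (scaled_bump h (c j)) \<alpha> x)"
  have out: "F \<alpha> x = 0" if "x \<notin> D" for \<alpha> x
   using that h(1) unfolding F_def D_def by (intro sum.neutral ballI prodf_scaled_bump_eq_0) auto
  have single: "F \<alpha> x = prodf (scaled_bump h (c j)) \<alpha> x" if "j \<in> S" "x \<in> cube (c j) h" for \<alpha> x j
  proof -
   have "prodf (scaled_bump h (c i)) \<alpha> x = 0" if i: "i \<in> S - {j}" for i
   proof (rule prodf_scaled_bump_eq_0[OF h(1)])
    have "cube (c i) h \<inter> cube (c j) h = {}" using disj i \<open>j \<in> S\<close> by (auto simp: disjoint_family_on_def)
    then show "x \<notin> cube (c i) h" using \<open>x \<in> cube (c j) h\<close> by blast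
   qed
   then have "(\<Sum>i\<in>S - {j}. prodf (scaled_bump h (c i)) \<alpha> x) = 0" by (intro sum.neutral) blast
   then show ?thesis unfolding F_def using S(1) that(1) by (simp add: sum.remove)
  qed
  have bound: "\<bar>a * F \<alpha> x\<bar> \<le> (A * (1 / h) ^ s * H) * indicator D x" if \<alpha>: "\<alpha> \<in> ?MI" and a: "\<bar>a\<bar> = A" for \<alpha> x a
  proof (cases "x \<in> D")
   case True
   then obtain j where j: "j \<in> S" "x \<in> cube (c j) h" by (auto simp: D_def)
   have "\<bar>F \<alpha> x\<bar> = (1 / h) ^ (\<Sum>i\<in>UNIV. \<alpha> i) * \<bar>prodf std_bump \<alpha> ((1 / h) *\<^sub>R (x - c j))\<bar>"
    unfolding single[OF j] prodf_scaled_bump using h by (simp add: abs_mult)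
   also have "\<dots> \<le> (1 / h) ^ s * H" using \<alpha> h H0 by (intro mult_mono H power_increasing) (auto simp: multi_indices_def)
   finally have "A * \<bar>F \<alpha> x\<bar> \<le> A * ((1 / h) ^ s * H)" using A by (intro mult_left_mono) auto
   then show ?thesis using True a by (simp add: abs_mult mult.assoc)
  next
   case False
   then show ?thesis by (simp add: out)
  qed
  have Dm: "D \<in> sets borel" "D' \<in> sets borel" unfolding D_def D'_def using S(1) by auto
  have DV: "emeasure lborel D \<le> ennreal (2 ^ CARD('d) * V)"
  proof -
   have "emeasure lborel D \<le> (\<Sum>j\<in>S. emeasure lborel (cube (c j) h))"
    unfolding D_def using S(1) by (intro emeasure_subadditive_finite) auto
   also have "\<dots> = ennreal (2 ^ CARD('d) * V)" unfolding emeasure_cube[OF h(1)] V_def using h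
    by (simp add: ennreal_of_nat_eq_real_of_nat ennreal_mult[symmetric] power_mult_distrib mult_ac)
   finally show ?thesis .
  qed
  have inball: "(\<lambda>x. a * F (\<lambda>_. 0) x) \<in> sobolev_ball p s \<Omega>" if a: "\<bar>a\<bar> = A" for a
  proof (rule sobolev_ballI[where g = "\<lambda>\<alpha> x. a * F \<alpha> x" and B = "1 / ?m"])
   have c: "continuous_on X (\<lambda>x. a * F \<alpha> x)" for X \<alpha>
    unfolding F_def by (intro continuous_intros continuous_on_subset[OF prodf_continuous[OF dseq_scaled_bump]]) auto
   show "continuous_on \<Omega> (\<lambda>x. a * F (\<lambda>_. 0) x)" "\<And>\<alpha>. continuous_on UNIV (\<lambda>x. a * F \<alpha> x)" by (rule c)+
   show "has_weak_deriv \<Omega> \<alpha> (\<lambda>x. a * F (\<lambda>_. 0) x) (\<lambda>x. a * F \<alpha> x)" for \<alpha>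
    unfolding F_def by (rule has_weak_deriv_sum_prodf[OF \<Omega> S(1) dseq_scaled_bump])
   fix \<alpha> assume \<alpha>: "\<alpha> \<in> ?MI"
   have "Lp_norm p (lebesgue_on \<Omega>) (\<lambda>x. a * F \<alpha> x) \<le> ennreal (A * (1 / h) ^ s * H * (2 ^ CARD('d) * V) powr ?ep)"
    using A h H0 V by (intro Lp_norm_le_indicator[OF \<Omega> p c _ bound[OF \<alpha> a] Dm(1) DV]) auto
   also have "A * (1 / h) ^ s * H * (2 ^ CARD('d) * V) powr ?ep = 1 / ?m"
   proof -
    have "(2 ^ CARD('d) * V) powr ?ep = (2 ^ CARD('d)) powr ?ep * V powr ?ep" using V by (simp add: powr_mult)
    then have "A * (1 / h) ^ s * H * (2 ^ CARD('d) * V) powr ?ep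
      = h ^ s * (1 / h) ^ s * (H * (2 ^ CARD('d)) powr ?ep / K) * (V powr ?ep / V powr ?ep)" by (simp add: A_def)
    also have "h ^ s * (1 / h) ^ s = 1" using h by (simp add: power_mult_distrib[symmetric])
    also have "V powr ?ep / V powr ?ep = 1" using V by simp
    also have "H * (2 ^ CARD('d)) powr ?ep / K = 1 / ?m" unfolding K_def using H0 m by (simp add: field_simps)
    finally show ?thesis by simp
   qed
   finally show "Lp_norm p (lebesgue_on \<Omega>) (\<lambda>x. a * F \<alpha> x) \<le> ennreal (1 / ?m)" .
  qed (use \<Omega> p m in auto)
  have D'sub: "D' \<subseteq> \<Omega>" and D'V: "emeasure lborel D' = ennreal V"
  proof -
   have half: "cube (c j) (h / 2) \<subseteq> cube (c j) h" for j
   proof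
    fix x assume "x \<in> cube (c j) (h / 2)"
    then have *: "\<bar>x $ i - c j $ i\<bar> < h / 2" for i by (simp add: mem_cube)
    have "\<bar>x $ i - c j $ i\<bar> < h" for i using h(1) *[of i] by linarith
    then show "x \<in> cube (c j) h" by (simp add: mem_cube)
   qed
   then show "D' \<subseteq> \<Omega>" unfolding D'_def using sub by blast
   have "disjoint_family_on (\<lambda>j. cube (c j) (h / 2)) S" using disj half unfolding disjoint_family_on_def by blast
   then have "emeasure lborel D' = (\<Sum>j\<in>S. emeasure lborel (cube (c j) (h / 2)))"
    unfolding D'_def using S(1) by (intro sum_emeasure[symmetric]) auto
   also have "\<dots> = ennreal V" unfolding V_def using h
    by (simp add: emeasure_cube ennreal_of_nat_eq_real_of_nat ennreal_mult[symmetric])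
   finally show "emeasure lborel D' = ennreal V" .
  qed
  have low: "A * \<eta> \<le> \<bar>A * F (\<lambda>_. 0) x\<bar>" if x: "x \<in> D'" for x
  proof -
   obtain j where j: "j \<in> S" "x \<in> cube (c j) (h / 2)" using x by (auto simp: D'_def)
   have j2: "\<bar>x $ i - c j $ i\<bar> < h / 2" for i using j(2) by (simp add: mem_cube)
   have "\<bar>x $ i - c j $ i\<bar> < h" for i using h(1) j2[of i] by linarith
   then have "x \<in> cube (c j) h" by (simp add: mem_cube)
   then have "F (\<lambda>_. 0) x = prodf std_bump (\<lambda>_. 0) ((1 / h) *\<^sub>R (x - c j))" using single[OF j(1)] by (simp add: prodf_scaled_bump)
   moreover have "\<eta> \<le> prodf std_bump (\<lambda>_. 0) ((1 / h) *\<^sub>R (x - c j))"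
    unfolding \<eta>_def using j2 h(1) by (intro prodf_std_bump_ge) (simp add: abs_divide field_simps)
   ultimately have "A * \<eta> \<le> A * F (\<lambda>_. 0) x" using A by simp
   then show ?thesis by linarith
  qed
  have "fools q \<Omega> (\<lambda>x. A * F (\<lambda>_. 0) x) (A * \<eta> / 2 * V powr ?eq)"
   by (rule fools_indicator[OF \<Omega> q _ low Dm(2) D'sub D'V V]) (use A \<eta> in auto)
  also have "A * \<eta> / 2 * V powr ?eq = \<eta> / K / 2 * h ^ s * V powr (?eq - ?ep)" by (simp add: A_def powr_diff mult_ac)
  finally have f: "fools q \<Omega> (\<lambda>x. A * F (\<lambda>_. 0) x) (\<eta> / K / 2 * h ^ s * V powr (?eq - ?ep))" .
  show "fooled p s q \<Omega> N (\<eta> / K / 2 * h ^ s * (real (card S) * h ^ CARD('d)) powr (?eq - ?ep))"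
  proof (intro exI[of _ "\<lambda>x. A * F (\<lambda>_. 0) x"] conjI ballI)
   show "(\<lambda>x. A * F (\<lambda>_. 0) x) \<in> sobolev_ball p s \<Omega>" using A by (intro inball) simp
   have "(\<lambda>x. - A * F (\<lambda>_. 0) x) \<in> sobolev_ball p s \<Omega>" using A by (intro inball) simp
   then show "(\<lambda>x. - (A * F (\<lambda>_. 0) x)) \<in> sobolev_ball p s \<Omega>" by simp
   show "A * F (\<lambda>_. 0) x = 0" if "x \<in> N" for x
   proof -
    have "x \<notin> D" using that N unfolding D_def by blast
    then show ?thesis by (simp add: out)
   qed
  qed (use f in \<open>simp add: V_def\<close>)
 qed
qed

subsection \<open>Lower bounds\<close>

text \<open>Let N count the events that occur and let e be its expectation. Since (1 - N/e)^2 \<ge>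
  0, the indicator of the union dominates 2N/e - N^2/e^2. The pair bound gives a second moment of at
  most e + e^2, hence a probability of at least 1 - 1/e.\<close>

lemma second_moment_bound:
 assumes M: "prob_space M" and J: "finite J" and E: "\<And>j. j \<in> J \<Longrightarrow> E j \<in> sets M"
  and \<pi>: "\<And>j. j \<in> J \<Longrightarrow> measure M (E j) = \<pi>"
   "\<And>j j'. j \<in> J \<Longrightarrow> j' \<in> J \<Longrightarrow> j \<noteq> j' \<Longrightarrow> measure M (E j \<inter> E j') \<le> \<pi>\<^sup>2"
  and large: "real (card J) * \<pi> \<ge> 2"
 shows "measure M (\<Union>j\<in>J. E j) \<ge> 1 / 2"
proof -
 interpret prob_space M by (rule M)
 define e where "e = real (card J) * \<pi>"
 define U where "U = (\<Union>j\<in>J. E j)"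
 let ?N = "\<lambda>\<omega>. \<Sum>j\<in>J. indicator (E j) \<omega> :: real"
 have U: "U \<in> sets M" unfolding U_def using J E by auto
 have iE: "integrable M (indicator (E j) :: _ \<Rightarrow> real)" if "j \<in> J" for j using E[OF that] by (simp add: emeasure_eq_measure)
 have iE2: "integrable M (indicator (E j \<inter> E j') :: _ \<Rightarrow> real)" if "j \<in> J" "j' \<in> J" for j j'
  using E that by (simp add: emeasure_eq_measure)
 have NN: "(?N \<omega>)\<^sup>2 = (\<Sum>j\<in>J. \<Sum>j'\<in>J. indicator (E j \<inter> E j') \<omega>)" for \<omega>
  by (simp add: power2_eq_square sum_product indicator_inter_arith)
 have EN: "expectation ?N = e"
 proof -
  have "expectation ?N = (\<Sum>j\<in>J. expectation (indicator (E j)))" by (intro Bochner_Integration.integral_sum iE)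
  also have "\<dots> = (\<Sum>j\<in>J. \<pi>)"
  proof (intro sum.cong refl)
   fix j assume j: "j \<in> J"
   then have "E j \<inter> space M = E j" by (intro Int_absorb2 sets.sets_into_space E)
   then show "expectation (indicator (E j)) = \<pi>" by (simp only: Bochner_Integration.integral_indicator \<pi>(1)[OF j])
  qed
  finally show ?thesis by (simp add: e_def)
 qed
 have iNN: "integrable M (\<lambda>\<omega>. (?N \<omega>)\<^sup>2)" unfolding NN by (intro Bochner_Integration.integrable_sum iE2)
 have ENN: "expectation (\<lambda>\<omega>. (?N \<omega>)\<^sup>2) \<le> e + e\<^sup>2"
 proof -
  have "expectation (\<lambda>\<omega>. (?N \<omega>)\<^sup>2) = (\<Sum>j\<in>J. \<Sum>j'\<in>J. prob (E j \<inter> E j'))"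
  proof -
   have "expectation (\<lambda>\<omega>. (?N \<omega>)\<^sup>2) = (\<Sum>j\<in>J. expectation (\<lambda>\<omega>. \<Sum>j'\<in>J. indicator (E j \<inter> E j') \<omega>))"
    unfolding NN by (intro Bochner_Integration.integral_sum Bochner_Integration.integrable_sum iE2)
   also have "\<dots> = (\<Sum>j\<in>J. \<Sum>j'\<in>J. expectation (indicator (E j \<inter> E j')))"
    by (intro sum.cong refl Bochner_Integration.integral_sum iE2)
   also have "\<dots> = (\<Sum>j\<in>J. \<Sum>j'\<in>J. prob (E j \<inter> E j'))"
   proof (intro sum.cong refl)
    fix j j' assume "j \<in> J" "j' \<in> J"
    then have "E j \<subseteq> space M" by (intro sets.sets_into_space E)
    then have "E j \<inter> E j' \<inter> space M = E j \<inter> E j'" by blast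
    then show "expectation (indicator (E j \<inter> E j')) = prob (E j \<inter> E j')" by (simp only: Bochner_Integration.integral_indicator)
   qed
   finally show ?thesis .
  qed
  also have "\<dots> \<le> (\<Sum>j\<in>J. \<pi> + real (card J) * \<pi>\<^sup>2)"
  proof (rule sum_mono)
   fix j assume j: "j \<in> J"
   have "(\<Sum>j'\<in>J. prob (E j \<inter> E j')) = prob (E j) + (\<Sum>j'\<in>J - {j}. prob (E j \<inter> E j'))" using J j by (subst sum.remove[of J j]) auto
   also have "\<dots> \<le> \<pi> + (\<Sum>j'\<in>J - {j}. \<pi>\<^sup>2)" using \<pi> j by (intro add_mono sum_mono) auto
   also have "(\<Sum>j'\<in>J - {j}. \<pi>\<^sup>2) \<le> (\<Sum>j'\<in>J. \<pi>\<^sup>2)" using J by (intro sum_mono2) auto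
   finally show "(\<Sum>j'\<in>J. prob (E j \<inter> E j')) \<le> \<pi> + real (card J) * \<pi>\<^sup>2" by simp
  qed
  also have "\<dots> = e + e\<^sup>2" by (simp add: e_def power2_eq_square algebra_simps)
  finally show ?thesis .
 qed
 have e2: "e \<ge> 2" using large by (simp add: e_def)
 have "expectation (\<lambda>\<omega>. 2 / e * ?N \<omega> - 1 / e\<^sup>2 * (?N \<omega>)\<^sup>2) \<le> expectation (indicator U)"
 proof (rule integral_mono)
  show "integrable M (\<lambda>\<omega>. 2 / e * ?N \<omega> - 1 / e\<^sup>2 * (?N \<omega>)\<^sup>2)"
   by (intro Bochner_Integration.integrable_diff integrable_mult_right Bochner_Integration.integrable_sum iE iNN)
  show "integrable M (indicator U :: _ \<Rightarrow> real)" using U by (simp add: emeasure_eq_measure)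
  fix \<omega>
  show "2 / e * ?N \<omega> - 1 / e\<^sup>2 * (?N \<omega>)\<^sup>2 \<le> indicator U \<omega>"
  proof (cases "\<omega> \<in> U")
   case True
   have "0 \<le> (1 - ?N \<omega> / e)\<^sup>2" by simp
   then show ?thesis using True by (simp add: power2_diff power_divide)
  next
   case False
   then have "?N \<omega> = 0" by (auto simp: U_def)
   then show ?thesis by simp
  qed
 qed
 also have "expectation (indicator U) = prob U"
  by (simp only: Bochner_Integration.integral_indicator Int_absorb2[OF sets.sets_into_space[OF U]])
 finally have "expectation (\<lambda>\<omega>. 2 / e * ?N \<omega> - 1 / e\<^sup>2 * (?N \<omega>)\<^sup>2) \<le> prob U" .
 moreover have "expectation (\<lambda>\<omega>. 2 / e * ?N \<omega> - 1 / e\<^sup>2 * (?N \<omega>)\<^sup>2) = 2 / e * e - 1 / e\<^sup>2 * expectation (\<lambda>\<omega>. (?N \<omega>)\<^sup>2)"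
 proof -
  have "integrable M ?N" by (intro Bochner_Integration.integrable_sum iE)
  then have "expectation (\<lambda>\<omega>. 2 / e * ?N \<omega> - 1 / e\<^sup>2 * (?N \<omega>)\<^sup>2) = expectation (\<lambda>\<omega>. 2 / e * ?N \<omega>) - expectation (\<lambda>\<omega>. 1 / e\<^sup>2 * (?N \<omega>)\<^sup>2)"
   using iNN by (intro Bochner_Integration.integral_diff integrable_mult_right)
  then show ?thesis by (simp only: integral_mult_right_zero EN)
 qed
 moreover have "1 / e\<^sup>2 * expectation (\<lambda>\<omega>. (?N \<omega>)\<^sup>2) \<le> 1 / e\<^sup>2 * (e + e\<^sup>2)" by (intro mult_left_mono ENN) simp
 moreover have "1 / e\<^sup>2 * (e + e\<^sup>2) = 1 / e + 1" using e2 by (simp add: power2_eq_square field_simps)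
 moreover have "2 / e * e = 2" using e2 by simp
 moreover have "1 / e \<le> 1 / 2" using e2 by (intro divide_left_mono) auto
 ultimately show ?thesis unfolding U_def by linarith
qed

section \<open>A grid of cells inside the domain\<close>

lemma open_contains_corner_cube:
 fixes \<Omega> :: "(real ^ 'd::finite) set"
 assumes "open \<Omega>" "\<Omega> \<noteq> {}"
 obtains x0 l where "0 < l" "l \<le> 1" "\<And>x. (\<And>i. x0 $ i < x $ i \<and> x $ i < x0 $ i + l) \<Longrightarrow> x \<in> \<Omega>"
proof -
 obtain x0 e where e: "e > 0" "ball x0 e \<subseteq> \<Omega>" using assms open_contains_ball by blast
 define l where "l = min 1 (e / real CARD('d))"
 show thesis
 proof (rule that[of l x0])
  show "0 < l" "l \<le> 1" using e by (auto simp: l_def)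
  fix x assume x: "\<And>i. x0 $ i < x $ i \<and> x $ i < x0 $ i + l"
  have "norm (x - x0) \<le> (\<Sum>i\<in>UNIV. \<bar>(x - x0) $ i\<bar>)" by (rule norm_le_l1_cart)
  also have "\<dots> < (\<Sum>i\<in>(UNIV :: 'd set). e / real CARD('d))"
  proof (rule sum_strict_mono)
   fix i
   have "\<bar>(x - x0) $ i\<bar> < l" using x[of i] by simp
   also have "l \<le> e / real CARD('d)" by (simp add: l_def)
   finally show "\<bar>(x - x0) $ i\<bar> < e / real CARD('d)" .
  qed auto
  also have "\<dots> = e" by simp
  finally show "x \<in> \<Omega>" using e(2) by (auto simp: dist_norm norm_minus_commute)
 qed
qed

definition cells :: "nat \<Rightarrow> ('d::finite \<Rightarrow> nat) set" where
 "cells k = UNIV \<rightarrow>\<^sub>E {..<k}"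

definition cell_center :: "real ^ 'd::finite \<Rightarrow> real \<Rightarrow> ('d \<Rightarrow> nat) \<Rightarrow> real ^ 'd" where
 "cell_center x0 h j = (\<chi> i. x0 $ i + 2 * h * real (j i) + h)"

lemma finite_cells: "finite (cells k :: ('d::finite \<Rightarrow> nat) set)" unfolding cells_def by (intro finite_PiE) auto

lemma card_cells: "card (cells k :: ('d::finite \<Rightarrow> nat) set) = k ^ CARD('d)" unfolding cells_def by (subst card_PiE) auto

lemma cell_subset:
 assumes \<Omega>: "\<And>x. (\<And>i. x0 $ i < x $ i \<and> x $ i < x0 $ i + l) \<Longrightarrow> x \<in> \<Omega>" and h: "h > 0" "2 * h * real k \<le> l" and j: "j \<in> cells k"
 shows "cube (cell_center x0 h j) h \<subseteq> \<Omega>"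
proof
 fix x assume x: "x \<in> cube (cell_center x0 h j) h"
 show "x \<in> \<Omega>"
 proof (rule \<Omega>)
  fix i
  have xi: "\<bar>x $ i - (x0 $ i + 2 * h * real (j i) + h)\<bar> < h" using x by (simp add: mem_cube cell_center_def)
  have "j i < k" using j by (auto simp: cells_def PiE_iff)
  then have "real (j i) + 1 \<le> real k" by linarith
  then have "2 * h * (real (j i) + 1) \<le> 2 * h * real k" using h(1) by (intro mult_left_mono) auto
  moreover have "0 \<le> 2 * h * real (j i)" using h(1) by simp
  moreover have "2 * h * (real (j i) + 1) = 2 * h * real (j i) + 2 * h" by (simp add: distrib_left)
  ultimately show "x0 $ i < x $ i \<and> x $ i < x0 $ i + l" using xi h(2) unfolding abs_less_iff by linarith
 qed
qed

lemma disjoint_cells: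
 fixes x0 :: "real ^ 'd::finite"
 assumes h: "h > 0"
 shows "disjoint_family (\<lambda>j. cube (cell_center x0 h j) h)" unfolding disjoint_family_on_def
proof (intro ballI impI)
 fix j j' :: "'d \<Rightarrow> nat" assume "j \<noteq> j'"
 then obtain i where i: "j i \<noteq> j' i" by auto
 have sep: "x0 $ i + 2 * h * real a + h + h \<le> x0 $ i + 2 * h * real b + h - h" if "a < b" for a b
 proof -
  have "2 * h * (real a + 1) \<le> 2 * h * real b" using that h by (intro mult_left_mono) auto
  then show ?thesis by (simp add: distrib_left)
 qed
 show "cube (cell_center x0 h j) h \<inter> cube (cell_center x0 h j') h = {}"
 proof (rule ccontr)
  assume "cube (cell_center x0 h j) h \<inter> cube (cell_center x0 h j') h \<noteq> {}"
  then obtain x where "x \<in> cube (cell_center x0 h j) h" "x \<in> cube (cell_center x0 h j') h" by blast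
  then have "\<bar>x $ i - (x0 $ i + 2 * h * real (j i) + h)\<bar> < h" "\<bar>x $ i - (x0 $ i + 2 * h * real (j' i) + h)\<bar> < h"
   by (auto simp: mem_cube cell_center_def)
  then show False using i sep[of "j i" "j' i"] sep[of "j' i" "j i"] by (cases "j i < j' i") (linarith | auto)+
 qed
qed

lemma ceiling_root:
 assumes y: "y \<ge> 1" and d: "d > 0"
 defines "k \<equiv> nat \<lceil>y powr (1 / real d)\<rceil>"
 shows "k \<ge> 1" "real k ^ d \<ge> y" "real k \<le> 2 * y powr (1 / real d)"
proof -
 let ?r = "y powr (1 / real d)"
 have r: "?r \<ge> 1" using y d by (intro ge_one_powr_ge_zero) auto
 have k: "real k = real_of_int \<lceil>?r\<rceil>" unfolding k_def using r by simp
 have kr: "real k \<ge> ?r" unfolding k by (rule le_of_int_ceiling)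
 then show "k \<ge> 1" using r by linarith
 have "y = ?r powr real d" using y d by (simp add: powr_powr)
 also have "\<dots> = ?r ^ d" using y by (intro powr_realpow) simp
 also have "\<dots> \<le> real k ^ d" using kr y by (intro power_mono) auto
 finally show "real k ^ d \<ge> y" .
 have "real k < ?r + 1" unfolding k using of_int_ceiling_le_add_one[of ?r] by (smt (verit) ceiling_correct)
 then show "real k \<le> 2 * ?r" using r by linarith
qed

lemma four_powr_inverse_le: "(0::nat) < d \<Longrightarrow> 4 powr (1 / real d) \<le> (4::real)" using powr_mono[of "1 / real d" 1 "4::real"] by simp

lemma lower_bound_lt:
 fixes \<Omega> :: "(real ^ 'd::finite) set"
 assumes \<Omega>: "open \<Omega>" "\<Omega> \<noteq> {}" and p: "1 \<le> p" and q: "1 \<le> q"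
 shows "\<exists>K>0. \<forall>n\<ge>2. \<forall>(M :: 'w measure) X. iid_uniform M \<Omega> n X \<longrightarrow>
  ennreal (K * real n powr (- real s / real CARD('d))) \<le> unif_error_points M (\<lambda>\<omega>. (\<lambda>i. X i \<omega>) ` {..<n}) p s q \<Omega>"
proof -
 let ?d = "CARD('d)" and ?e = "enn2real (1 / q) - enn2real (1 / p)"
 have d: "?d > 0" by simp
 obtain c0 where c0: "c0 > 0" and fool: "\<And>S (c :: ('d \<Rightarrow> nat) \<Rightarrow> real ^ 'd) h N. finite S \<Longrightarrow> S \<noteq> {} \<Longrightarrow> 0 < h \<Longrightarrow> h \<le> 1 \<Longrightarrow>
   (\<And>j. j \<in> S \<Longrightarrow> cube (c j) h \<subseteq> \<Omega>) \<Longrightarrow> disjoint_family_on (\<lambda>j. cube (c j) h) S \<Longrightarrow>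
   (\<And>j. j \<in> S \<Longrightarrow> cube (c j) h \<inter> N = {}) \<Longrightarrow>
   fooled p s q \<Omega> N (c0 * h ^ s * (real (card S) * h ^ ?d) powr ?e)"
 proof (rule cube_fooling[OF \<Omega>(1) p q, where s = s and 'j = "'d \<Rightarrow> nat"], goal_cases)
  case (1 c0)
  show ?case by (rule that) (fact 1)+
 qed
 obtain x0 l where l: "0 < l" "l \<le> 1" "\<And>x. (\<And>i. x0 $ i < x $ i \<and> x $ i < x0 $ i + l) \<Longrightarrow> x \<in> \<Omega>"
  using open_contains_corner_cube[OF \<Omega>] by metis
 \<comment> \<open>Half of the cells have total volume of at least this size, independently of n;
   volume means number of cells times h^d here.\<close>
 define v0 where "v0 = (l / 2) ^ ?d / 2"
 have v0: "v0 > 0" "v0 \<le> 1"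
 proof -
  have "(l / 2) ^ ?d \<le> 1" using l by (intro power_le_one) auto
  then show "v0 > 0" "v0 \<le> 1" using l unfolding v0_def by auto
 qed
 \<comment> \<open>The total volume of the empty cells lies in [v0, 1]; the absolute value of the
   exponent gives a lower bound for its power whatever the sign.\<close>
 define K where "K = c0 * (l / 16) ^ s * v0 powr \<bar>?e\<bar>"
 have K: "K > 0" using c0 l v0 by (simp add: K_def)
 show ?thesis
 proof (intro exI[of _ K] conjI allI impI K)
  fix n :: nat and M :: "'w measure" and X
  assume n: "n \<ge> 2" and iid: "iid_uniform M \<Omega> n X"
  define y where "y = 2 * real n"
  have y: "y \<ge> 1" using n by (simp add: y_def)
  define k where "k = nat \<lceil>y powr (1 / real ?d)\<rceil>"
  note k = ceiling_root[OF y d, folded k_def]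
  define h where "h = l / (2 * real k)"
  have h: "h > 0" "2 * h * real k \<le> l" "h \<le> 1"
  proof -
   show "h > 0" "2 * h * real k \<le> l" using l k(1) by (auto simp: h_def)
   have "l \<le> 2 * real k" using l k(1) by linarith
   then show "h \<le> 1" using k(1) by (simp add: h_def)
  qed
  let ?c = "cell_center x0 h"
  let ?r = "K * real n powr (- real s / real ?d)"
  interpret prob_space M using iid_uniformD(1)[OF iid] .
  have "ennreal (?r * measure M (space M)) \<le> unif_error_points M (\<lambda>\<omega>. (\<lambda>i. X i \<omega>) ` {..<n}) p s q \<Omega>"
  proof (rule unif_error_points_ge[OF \<Omega>(1) prob_space_axioms q _ sets.top])
   show "?r > 0" using K n by simp
   fix \<omega>
   define N where "N = (\<lambda>i. X i \<omega>) ` {..<n}"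
   define S where "S = {j \<in> cells k. cube (?c j) h \<inter> N = {}}"
   have Sf: "finite S" unfolding S_def by (rule finite_subset[OF _ finite_cells[of k]]) auto
   have cS: "real k ^ ?d \<le> real (card S) + real n"
   proof -
    have "\<exists>x. x \<in> cube (?c j) h \<inter> N" if "j \<in> cells k - S" for j using that by (auto simp: S_def)
    \<comment> \<open>Pigeonhole: choosing a node in each occupied cell is injective, as the cells
      are disjoint, so at most n cells are occupied.\<close>
    then obtain \<xi> where \<xi>: "\<And>j. j \<in> cells k - S \<Longrightarrow> \<xi> j \<in> cube (?c j) h \<inter> N" by metis
    have "inj_on \<xi> (cells k - S)"
    proof (rule inj_onI)
     fix j j' assume j: "j \<in> cells k - S" "j' \<in> cells k - S" and eq: "\<xi> j = \<xi> j'"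
     have "\<xi> j \<in> cube (?c j) h" "\<xi> j \<in> cube (?c j') h" using \<xi>[OF j(1)] \<xi>[OF j(2)] eq by auto
     then show "j = j'" using disjoint_cells[OF h(1), of x0] unfolding disjoint_family_on_def by blast
    qed
    moreover have "\<xi> ` (cells k - S) \<subseteq> N" using \<xi> by auto
    ultimately have "card (cells k - S) \<le> card N" by (rule card_inj_on_le) (simp add: N_def)
    also have "\<dots> \<le> n" unfolding N_def using card_image_le[of "{..<n}" "\<lambda>i. X i \<omega>"] by simp
    finally have "card (cells k - S) \<le> n" .
    moreover have "card (cells k - S) = card (cells k :: ('d \<Rightarrow> nat) set) - card S"
     using Sf by (intro card_Diff_subset) (auto simp: S_def)
    ultimately have "k ^ ?d \<le> card S + n" by (simp add: card_cells)
    then show ?thesis using of_nat_mono by fastforce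
   qed
   have half: "real k ^ ?d / 2 \<le> real (card S)" using cS k(2) unfolding y_def by linarith
   have "S \<noteq> {}"
   proof
    assume "S = {}"
    then show False using half k(2) y by simp
   qed
   define V where "V = real (card S) * h ^ ?d"
   have hk: "real k ^ ?d * h ^ ?d = (l / 2) ^ ?d" using k(1) by (simp add: h_def power_mult_distrib[symmetric])
   have V: "v0 \<le> V" "V \<le> 1"
   proof -
    have "(real k ^ ?d / 2) * h ^ ?d \<le> V" unfolding V_def using half h by (intro mult_right_mono) auto
    then show "v0 \<le> V" using hk by (simp add: v0_def)
    have "card S \<le> card (cells k :: ('d \<Rightarrow> nat) set)" using finite_cells by (intro card_mono) (auto simp: S_def)
    then have "real (card S) \<le> real k ^ ?d" unfolding card_cells using of_nat_mono by fastforce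
    then have "V \<le> real k ^ ?d * h ^ ?d" unfolding V_def using h by (intro mult_right_mono) auto
    also have "\<dots> \<le> 1" unfolding hk using l by (intro power_le_one) auto
    finally show "V \<le> 1" .
   qed
   have Ve: "v0 powr \<bar>?e\<bar> \<le> V powr ?e"
   proof (cases "?e \<ge> 0")
    case True
    then show ?thesis using V v0 by (auto intro: powr_mono2)
   next
    case False
    have "v0 powr \<bar>?e\<bar> \<le> 1" using v0 by (intro powr_le1) auto
    also have "1 \<le> V powr ?e"
    proof -
     have "1 powr ?e \<le> V powr ?e" using False V v0 by (intro powr_mono2') auto
     then show ?thesis by simp
    qed
    finally show ?thesis .
   qed
   have hs: "(l / 16) ^ s * real n powr (- real s / real ?d) \<le> h ^ s"
   proof -
    have nd: "real n powr (1 / real ?d) > 0" using n by simp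
    have "real k \<le> 2 * (2 powr (1 / real ?d) * real n powr (1 / real ?d))" using k(3) by (simp add: y_def powr_mult)
    also have "\<dots> \<le> 2 * (4 * real n powr (1 / real ?d))"
    proof -
     have "2 powr (1 / real ?d) \<le> (4 :: real) powr (1 / real ?d)" by (intro powr_mono2) auto
     also have "\<dots> \<le> 4" by (rule four_powr_inverse_le[OF d])
     finally show ?thesis by (intro mult_left_mono mult_right_mono) auto
    qed
    finally have "l / (16 * real n powr (1 / real ?d)) \<le> h" unfolding h_def using l k(1) nd by (intro divide_left_mono) auto
    then have "(l / (16 * real n powr (1 / real ?d))) ^ s \<le> h ^ s" using l by (intro power_mono) auto
    moreover have "(l / (16 * real n powr (1 / real ?d))) ^ s = (l / 16) ^ s * real n powr (- real s / real ?d)"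
    proof -
     have "(real n powr (1 / real ?d)) ^ s = real n powr (real s / real ?d)"
      using n by (simp add: powr_realpow[symmetric] powr_powr)
     moreover have "(l / (16 * y)) ^ s = (l / 16) ^ s * (1 / y ^ s)" for y :: real by (simp add: power_divide power_mult_distrib)
     moreover have "real n powr (- real s / real ?d) = 1 / real n powr (real s / real ?d)"
      unfolding minus_divide_left[symmetric] by (rule powr_minus_divide)
     ultimately show ?thesis by (simp only:)
    qed
    ultimately show ?thesis by simp
   qed
   have "fooled p s q \<Omega> N (c0 * h ^ s * (real (card S) * h ^ ?d) powr ?e)"
   proof (rule fool[OF Sf \<open>S \<noteq> {}\<close> h(1,3)])
    show "cube (?c j) h \<subseteq> \<Omega>" if "j \<in> S" for j by (rule cell_subset[OF l(3) h(1,2)]) (use that in \<open>auto simp: S_def\<close>)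
    show "disjoint_family_on (\<lambda>j. cube (?c j) h) S" by (rule disjoint_family_on_mono[OF subset_UNIV disjoint_cells[OF h(1)]])
    show "cube (?c j) h \<inter> N = {}" if "j \<in> S" for j using that by (simp add: S_def)
   qed
   then obtain f where f: "f \<in> sobolev_ball p s \<Omega>" "(\<lambda>x. - f x) \<in> sobolev_ball p s \<Omega>" "\<forall>x\<in>N. f x = 0"
    "fools q \<Omega> f (c0 * h ^ s * V powr ?e)" unfolding V_def by blast
   have "fools q \<Omega> f ?r"
   proof (rule fools_mono[OF f(4)])
    show "0 \<le> ?r" using K by simp
    have "?r = c0 * ((l / 16) ^ s * real n powr (- real s / real ?d)) * v0 powr \<bar>?e\<bar>" by (simp add: K_def)
    also have "\<dots> \<le> c0 * h ^ s * V powr ?e" using c0 h hs Ve l(1) by (intro mult_mono) auto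
    finally show "?r \<le> c0 * h ^ s * V powr ?e" .
   qed
   then show "fooled p s q \<Omega> ((\<lambda>i. X i \<omega>) ` {..<n}) ?r" using f(1-3) unfolding N_def by blast
  qed
  then show "ennreal ?r \<le> unif_error_points M (\<lambda>\<omega>. (\<lambda>i. X i \<omega>) ` {..<n}) p s q \<Omega>" by (simp add: prob_space)
 qed
qed

text \<open>For v \<le> 1/4 one has ln(1 - v) \<ge> -2v. A cell of relative volume v is thus empty
  with probability at least n^(-1/2), which makes the expected number of empty cells at least 2 when
  there are 4 n / ln n cells.\<close>

lemma empty_cell_power_ge:
 assumes n: "n \<ge> 2" and v: "0 \<le> v" "v \<le> ln (real n) / (4 * real n)"
 shows "v \<le> 1 / 4" "real n powr (- 1 / 2) \<le> (1 - v) ^ n"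
proof -
 have "ln (real n) \<le> real n" using n ln_le_minus_one[of "real n"] by simp
 then have "ln (real n) / (4 * real n) \<le> 1 / 4" using n by (simp add: field_simps)
 then show v4: "v \<le> 1 / 4" using v by linarith
 have "- v - 2 * v\<^sup>2 \<le> ln (1 - v)" using v v4 by (intro ln_one_minus_pos_lower_bound) auto
 moreover have "v\<^sup>2 \<le> v * (1 / 4)" unfolding power2_eq_square using v v4 by (intro mult_left_mono)
 ultimately have l: "- 2 * v \<le> ln (1 - v)" using v by linarith
 have "2 * real n * v \<le> 2 * real n * (ln (real n) / (4 * real n))" using v by (intro mult_left_mono) auto
 also have "\<dots> = ln (real n) / 2" using n by simp
 finally have "- 1 / 2 * ln (real n) \<le> real n * (- 2 * v)" by simp
 also have "\<dots> \<le> real n * ln (1 - v)" using l by (intro mult_left_mono) auto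
 finally have "exp (- 1 / 2 * ln (real n)) \<le> exp (real n * ln (1 - v))" by simp
 moreover have "exp (- 1 / 2 * ln (real n)) = real n powr (- 1 / 2)" using n by (simp add: powr_def)
 moreover have "exp (real n * ln (1 - v)) = (1 - v) ^ n" using v4 by (simp add: exp_of_nat_mult)
 ultimately show "real n powr (- 1 / 2) \<le> (1 - v) ^ n" by simp
qed

lemma lower_bound_ge:
 fixes \<Omega> :: "(real ^ 'd::finite) set"
 assumes \<Omega>: "open \<Omega>" "bounded \<Omega>" "\<Omega> \<noteq> {}" and p: "1 \<le> p" and q: "1 \<le> q"
  and s: "0 \<le> real s / real CARD('d) - enn2real (1 / p) + enn2real (1 / q)"
 shows "\<exists>K>0. \<forall>n\<ge>2. \<forall>(M :: 'w measure) X. iid_uniform M \<Omega> n X \<longrightarrow>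
  ennreal (K * (real n / ln (real n)) powr (- real s / real CARD('d) + enn2real (1 / p) - enn2real (1 / q)))
   \<le> unif_error_points M (\<lambda>\<omega>. (\<lambda>i. X i \<omega>) ` {..<n}) p s q \<Omega>"
proof -
 let ?d = "CARD('d)" and ?e = "enn2real (1 / q) - enn2real (1 / p)"
 let ?b = "- real s / real CARD('d) + enn2real (1 / p) - enn2real (1 / q)"
 have d: "?d > 0" by simp
 obtain c0 where c0: "c0 > 0" and fool: "\<And>S (c :: ('d \<Rightarrow> nat) \<Rightarrow> real ^ 'd) h N. finite S \<Longrightarrow> S \<noteq> {} \<Longrightarrow> 0 < h \<Longrightarrow> h \<le> 1 \<Longrightarrow>
   (\<And>j. j \<in> S \<Longrightarrow> cube (c j) h \<subseteq> \<Omega>) \<Longrightarrow> disjoint_family_on (\<lambda>j. cube (c j) h) S \<Longrightarrow>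
   (\<And>j. j \<in> S \<Longrightarrow> cube (c j) h \<inter> N = {}) \<Longrightarrow>
   fooled p s q \<Omega> N (c0 * h ^ s * (real (card S) * h ^ ?d) powr ?e)"
 proof (rule cube_fooling[OF \<Omega>(1) p q, where s = s and 'j = "'d \<Rightarrow> nat"], goal_cases)
  case (1 c0)
  show ?case by (rule that) (fact 1)+
 qed
 obtain x0 l where l: "0 < l" "l \<le> 1" "\<And>x. (\<And>i. x0 $ i < x $ i \<and> x $ i < x0 $ i + l) \<Longrightarrow> x \<in> \<Omega>"
  using open_contains_corner_cube[OF \<Omega>(1,3)] by metis
 \<comment> \<open>The exponent of \<open>h\<close> in the error produced by a single cell. It is
   nonnegative by the hypothesis on \<open>s\<close>, so lower bounds for \<open>h\<close> carry
   over.\<close>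
 define \<beta> where "\<beta> = - (real ?d * ?b)"
 have \<beta>: "\<beta> \<ge> 0" and \<beta>2: "\<beta> = real s + real ?d * ?e"
 proof -
  have "?b \<le> 0" using s by linarith
  then show "\<beta> \<ge> 0" unfolding \<beta>_def by (simp add: mult_nonneg_nonpos)
  show "\<beta> = real s + real ?d * ?e" by (simp add: \<beta>_def algebra_simps)
 qed
 define K where "K = c0 * (l / 16) powr \<beta> / 2"
 have K: "K > 0" using c0 l by (simp add: K_def)
 show ?thesis
 proof (intro exI[of _ K] conjI allI impI K)
  fix n :: nat and M :: "'w measure" and X
  assume n: "n \<ge> 2" and iid: "iid_uniform M \<Omega> n X"
  define z where "z = real n / ln (real n)"
  have ln0: "ln (real n) > 0" using n by simp
  have z1: "z \<ge> 1" unfolding z_def using n ln0 ln_le_minus_one[of "real n"] by simp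
  have y: "4 * z \<ge> 1" using z1 by simp
  define k where "k = nat \<lceil>(4 * z) powr (1 / real ?d)\<rceil>"
  note k = ceiling_root[OF y d, folded k_def]
  define h where "h = l / (2 * real k)"
  have h: "h > 0" "2 * h * real k \<le> l" "h \<le> 1"
  proof -
   show "h > 0" "2 * h * real k \<le> l" using l k(1) by (auto simp: h_def)
   have "l \<le> 2 * real k" using l k(1) by linarith
   then show "h \<le> 1" using k(1) by (simp add: h_def)
  qed
  let ?c = "cell_center x0 h" and ?J = "cells k :: ('d \<Rightarrow> nat) set"
  let ?r = "c0 * h ^ s * (real 1 * h ^ ?d) powr ?e"
  have sub: "cube (?c j) h \<subseteq> \<Omega>" if "j \<in> ?J" for j by (rule cell_subset[OF l(3) h(1,2) that])
  interpret prob_space M using iid_uniformD(1)[OF iid] .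
  define E where "E j = {\<omega> \<in> space M. \<forall>i<n. X i \<omega> \<notin> cube (?c j) h}" for j
  have E: "E j \<in> sets M" for j
  proof -
   have "E j = space M \<inter> (\<Inter>i\<in>{..<n}. X i -` (- cube (?c j) h) \<inter> space M)" using n by (auto simp: E_def)
   also have "\<dots> \<in> sets M" using n by (intro sets.Int[OF sets.top sets.finite_INT] measurable_sets[OF iid_uniformD(2)[OF iid]]) (auto simp: lessThan_empty_iff)
   finally show ?thesis .
  qed
  define v where "v = (2 * h) ^ ?d / measure lborel \<Omega>"
  have mc: "measure lborel (cube (?c j) h) = (2 * h) ^ ?d" for j
   using emeasure_cube[OF h(1), of "?c j"] h by (simp add: measure_def)
  have fin: "emeasure lborel \<Omega> < \<infinity>" by (rule emeasure_bounded_finite[OF \<Omega>(2)])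
  have card: "real (card ?J) = real k ^ ?d" by (simp add: card_cells)
  have ld: "l ^ ?d \<le> measure lborel \<Omega>" 
  proof -
   have "cube (cell_center x0 (l / 2) (\<lambda>_. 0)) (l / 2) \<subseteq> \<Omega>"
   proof (rule cell_subset[where ?x0.0 = x0 and l = l and k = 1])
    show "x \<in> \<Omega>" if "\<And>i. x0 $ i < x $ i \<and> x $ i < x0 $ i + l" for x by (rule l(3)[OF that])
   qed (use l in \<open>auto simp: cells_def\<close>)
   then have "measure lborel (cube (cell_center x0 (l / 2) (\<lambda>_. 0)) (l / 2)) \<le> measure lborel \<Omega>"
    using fin \<Omega>(1) by (intro measure_mono_fmeasurable) (auto simp: fmeasurable_def)
   then show ?thesis using emeasure_cube[of "l / 2" "cell_center x0 (l / 2) (\<lambda>_. 0)"] l by (simp add: measure_def)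
  qed
  have ld0: "0 < l ^ ?d" using l by simp
  have \<Omega>0: "measure lborel \<Omega> > 0" using ld ld0 by linarith
  have v: "0 \<le> v" "v \<le> ln (real n) / (4 * real n)"
  proof -
   show "0 \<le> v" unfolding v_def using h by simp
   have "2 * h = l / real k" by (simp add: h_def)
   then have "v = l ^ ?d / measure lborel \<Omega> * (1 / real k ^ ?d)" unfolding v_def by (simp add: power_divide)
   also have "\<dots> \<le> 1 * (1 / real k ^ ?d)" using ld \<Omega>0 by (intro mult_right_mono) auto
   also have "\<dots> \<le> 1 / (4 * z)" using k(2) z1 by (simp add: frac_le)
   also have "\<dots> = ln (real n) / (4 * real n)" by (simp add: z_def)
   finally show "v \<le> ln (real n) / (4 * real n)" .
  qed
  note pw = empty_cell_power_ge[OF n v]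
  have "measure M (\<Union>j\<in>?J. E j) \<ge> 1 / 2"
  proof (rule second_moment_bound[OF prob_space_axioms finite_cells E])
   show "measure M (E j) = (1 - v) ^ n" if "j \<in> ?J" for j
    unfolding E_def v_def using prob_avoid[OF iid _ \<Omega> sets_cube sub[OF that]] n by (simp add: mc)
   show "measure M (E j \<inter> E j') \<le> ((1 - v) ^ n)\<^sup>2" if j: "j \<in> ?J" "j' \<in> ?J" "j \<noteq> j'" for j j'
   proof -
    have "E j \<inter> E j' = {\<omega> \<in> space M. \<forall>i<n. X i \<omega> \<notin> cube (?c j) h \<union> cube (?c j') h}" by (auto simp: E_def)
    then have "measure M (E j \<inter> E j') = (1 - measure lborel (cube (?c j) h \<union> cube (?c j') h) / measure lborel \<Omega>) ^ n"
     using prob_avoid[OF iid _ \<Omega>, of "cube (?c j) h \<union> cube (?c j') h"] sub j n by simp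
    also have "measure lborel (cube (?c j) h \<union> cube (?c j') h) = (2 * h) ^ ?d + (2 * h) ^ ?d"
    proof -
     have "cube (?c j) h \<inter> cube (?c j') h = {}"
      using disjoint_cells[OF h(1), of x0] j(3) unfolding disjoint_family_on_def by blast
     then have "measure lborel (cube (?c j) h \<union> cube (?c j') h) = measure lborel (cube (?c j) h) + measure lborel (cube (?c j') h)"
      by (intro measure_Union) (auto simp: emeasure_cube[OF h(1)])
     then show ?thesis by (simp only: mc)
    qed
    also have "(1 - ((2 * h) ^ ?d + (2 * h) ^ ?d) / measure lborel \<Omega>) = 1 - 2 * v" by (simp add: v_def add_divide_distrib)
    \<comment> \<open>Emptiness of two disjoint cells is negatively correlated: 1 - 2v \<le> (1 -
      v)^2.\<close>
    also have "(1 - 2 * v) ^ n \<le> ((1 - v)\<^sup>2) ^ n" using pw(1) by (intro power_mono) (auto simp: power2_diff)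
    also have "\<dots> = ((1 - v) ^ n)\<^sup>2" by (simp add: power_mult[symmetric] mult.commute)
    finally show ?thesis .
   qed
   \<comment> \<open>From ln x \<le> x at x = n^(1/2).\<close>
   have "2 \<le> 4 * (real n powr (1 / 2)) / ln (real n)"
   proof -
    have "ln (real n powr (1 / 2)) \<le> real n powr (1 / 2)" using n ln_le_minus_one[of "real n powr (1 / 2)"] by simp
    then have "ln (real n) \<le> 2 * real n powr (1 / 2)" using n by (simp add: ln_powr)
    then show ?thesis using ln0 by (simp add: field_simps)
   qed
   also have "\<dots> = 4 * z * real n powr (- 1 / 2)"
   proof -
    have "real n * real n powr (- 1 / 2) = real n powr (1 + - 1 / 2)" unfolding powr_add using n by simp
    then show ?thesis by (simp add: z_def)
   qed
   also have "\<dots> \<le> real (card ?J) * (1 - v) ^ n" unfolding card using k(2) pw z1 by (intro mult_mono) auto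
   finally show "2 \<le> real (card ?J) * (1 - v) ^ n" .
  qed
  have r0: "?r > 0" using c0 h by simp
  have hb: "(l / 16) powr \<beta> * z powr ?b \<le> h ^ s * (real 1 * h ^ ?d) powr ?e"
  proof -
   have zd: "z powr (1 / real ?d) > 0" using z1 by simp
   have "real k \<le> 2 * (4 powr (1 / real ?d) * z powr (1 / real ?d))" using k(3) by (simp add: powr_mult)
   also have "\<dots> \<le> 2 * (4 * z powr (1 / real ?d))" using four_powr_inverse_le[OF d] by (intro mult_left_mono mult_right_mono) auto
   finally have "l / (16 * z powr (1 / real ?d)) \<le> h" unfolding h_def using l k(1) zd by (intro divide_left_mono) auto
   then have "(l / (16 * z powr (1 / real ?d))) powr \<beta> \<le> h powr \<beta>" using l zd \<beta> by (intro powr_mono2) auto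
   also have "h powr \<beta> = h ^ s * (real 1 * h ^ ?d) powr ?e"
    
   proof -
    have "h powr \<beta> = h powr real s * h powr (real ?d * ?e)" unfolding \<beta>2 by (rule powr_add)
    also have "h powr real s = h ^ s" using h(1) by (rule powr_realpow)
    also have "h powr (real ?d * ?e) = (h powr real ?d) powr ?e" by (rule powr_powr[symmetric])
    also have "h powr real ?d = h ^ ?d" using h(1) by (rule powr_realpow)
    finally show ?thesis by simp
   qed
   also have "(l / (16 * z powr (1 / real ?d))) powr \<beta> = (l / 16) powr \<beta> * z powr ?b"
   proof -
    have "l / (16 * y) = l / 16 * (1 / y)" for y :: real by simp
    then have "l / (16 * z powr (1 / real ?d)) = l / 16 * z powr (- (1 / real ?d))" by (simp only: powr_minus_divide)
    then have "(l / (16 * z powr (1 / real ?d))) powr \<beta> = (l / 16) powr \<beta> * (z powr (- (1 / real ?d))) powr \<beta>"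
     by (simp only: powr_mult)
    also have "(z powr (- (1 / real ?d))) powr \<beta> = z powr ?b"
    proof -
     have "- (1 / real ?d) * \<beta> = ?b" unfolding \<beta>_def by simp
     then show ?thesis by (simp only: powr_powr)
    qed
    finally show ?thesis .
   qed
   finally show ?thesis .
  qed
  have "ennreal (K * z powr ?b) \<le> ennreal (?r * measure M (\<Union>j\<in>?J. E j))"
  proof (rule ennreal_leI)
   have "K * z powr ?b = c0 * ((l / 16) powr \<beta> * z powr ?b) * (1 / 2)" by (simp add: K_def)
   also have "\<dots> \<le> c0 * (h ^ s * (real 1 * h ^ ?d) powr ?e) * (1 / 2)" using hb c0 by (intro mult_right_mono mult_left_mono) auto
   also have "\<dots> = ?r * (1 / 2)" by simp
   also have "\<dots> \<le> ?r * measure M (\<Union>j\<in>?J. E j)" using \<open>measure M (\<Union>j\<in>?J. E j) \<ge> 1 / 2\<close> r0 by (intro mult_left_mono) auto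
   finally show "K * z powr ?b \<le> ?r * measure M (\<Union>j\<in>?J. E j)" .
  qed
  also have "\<dots> \<le> unif_error_points M (\<lambda>\<omega>. (\<lambda>i. X i \<omega>) ` {..<n}) p s q \<Omega>"
  proof (rule unif_error_points_ge[OF \<Omega>(1) prob_space_axioms q r0])
   show "(\<Union>j\<in>?J. E j) \<in> sets M" using E finite_cells[of k] by (intro sets.finite_UN) auto
   fix \<omega> assume "\<omega> \<in> (\<Union>j\<in>?J. E j)"
   then obtain j where j: "j \<in> ?J" "\<omega> \<in> E j" by blast
   \<comment> \<open>One empty cell suffices here: for q \<ge> p a concentrated bump fools
     best.\<close>
   have "fooled p s q \<Omega> ((\<lambda>i. X i \<omega>) ` {..<n}) (c0 * h ^ s * (real (card {j}) * h ^ ?d) powr ?e)"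
    by (rule fool[of "{j}" h ?c]) (use h sub j in \<open>auto simp: E_def disjoint_family_on_def\<close>)
   then show "fooled p s q \<Omega> ((\<lambda>i. X i \<omega>) ` {..<n}) ?r" by simp
  qed
  finally show "ennreal (K * (real n / ln (real n)) powr ?b) \<le> unif_error_points M (\<lambda>\<omega>. (\<lambda>i. X i \<omega>) ` {..<n}) p s q \<Omega>"
   unfolding z_def .
 qed
qed

subsection \<open>Matching rates\<close>

theorem theorem2:
 fixes \<Omega> :: "(real ^ 'd::finite) set" and p q :: ennreal and s :: nat
 assumes "\<Omega> \<noteq> {}" and "open \<Omega>" and "bounded \<Omega>" and "interior_cone_condition \<Omega>"
  and "1 \<le> p" and "1 \<le> q"
  and "of_nat CARD('d) / p < of_nat s \<or> (p = 1 \<and> s = CARD('d))"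
 shows "\<exists>c>0. \<exists>C>0. \<forall>n\<ge>2. \<forall>(M :: 'w measure) X. iid_uniform M \<Omega> n X \<longrightarrow>
      ennreal (c * rate CARD('d) p s q n)
       \<le> unif_error_points M (\<lambda>\<omega>. (\<lambda>i. X i \<omega>) ` {..<n}) p s q \<Omega> \<and>
      unif_error_points M (\<lambda>\<omega>. (\<lambda>i. X i \<omega>) ` {..<n}) p s q \<Omega>
       \<le> ennreal (C * rate CARD('d) p s q n)"
proof -
 note \<Omega> = assms(2,3,1)
 let ?d = "real CARD('d)"
 have s: "s > 0" using assms(7) by (cases s) auto
 \<comment> \<open>For p = \<infinity> a finite exponent is chosen. Exceeding the dimension, it
   satisfies d/P < 1 \<le> s; exceeding a finite q, it fits \<open>upper_bound_lt\<close>.\<close>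
 define P where "P = (if p \<noteq> \<infinity> then enn2real p else if q = \<infinity> then ?d + 1 else enn2real q + ?d + 1)"
 have Pp: "P = enn2real p" if "p \<noteq> \<infinity>" using that by (simp add: P_def)
 have P1: "P \<ge> 1" using enn2real_ge_1[OF assms(5)] by (simp add: P_def)
 have Ps: "?d / P < real s \<or> (P = 1 \<and> s = CARD('d))"
 proof (cases "p = \<infinity>")
  case True
  then have "?d < P" by (simp add: P_def add_nonneg_pos)
  then have "?d / P < 1" using P1 by simp
  then show ?thesis using s by linarith
 next
  case False
  then have p: "p = ennreal P" using Pp by (simp add: less_top)
  have "?d / P < real s" if "of_nat CARD('d) / p < of_nat s"
  proof -
   have "of_nat CARD('d) / p = ennreal (?d / P)" unfolding p ennreal_of_nat_eq_real_of_nat using P1 by (intro divide_ennreal) auto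
   then show ?thesis using that P1 by (simp add: ennreal_of_nat_eq_real_of_nat ennreal_less_iff)
  qed
  moreover have "P = 1" if "p = 1" using that Pp by simp
  ultimately show ?thesis using assms(7) by blast
 qed
 \<comment> \<open>The rate does not grow with the scale parameter ln n / n tending to 0; this
   follows from 1/p \<le> s/d, which also holds in the borderline case.\<close>
 have b0: "0 \<le> real s / ?d - enn2real (1 / p) + enn2real (1 / q)"
 proof (cases "p = \<infinity>")
  case False
  have "?d / P \<le> real s" using Ps by auto
  then have "1 / P \<le> real s / ?d" using P1 by (simp add: field_simps)
  then have "enn2real (1 / p) \<le> real s / ?d" using enn2real_one_divide[OF assms(5) False] Pp[OF False] by simp
  moreover have "enn2real (1 / q) \<ge> 0" by simp
  ultimately show ?thesis by linarith
 qed simp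
 obtain Y \<eta> R C where params: "finite Y" "\<eta> > 0" "R > 0" "C > 0"
  and lb: "\<And>f g x t I. weak_data \<Omega> s f g \<Longrightarrow> (\<And>\<alpha>. g \<alpha> \<in> borel_measurable borel) \<Longrightarrow> x \<in> \<Omega> \<Longrightarrow> 0 < t \<Longrightarrow> t \<le> 1 \<Longrightarrow>
    (\<And>y. y \<in> Y \<Longrightarrow> cball (x + t *\<^sub>R y) (t * \<eta>) \<subseteq> \<Omega> \<Longrightarrow> \<exists>u\<in>cball (x + t *\<^sub>R y) (t * \<eta>). f u = 0) \<Longrightarrow> I \<ge> 0 \<Longrightarrow>
    local_energy s g P x (R * t) \<le> ennreal I \<Longrightarrow>
    \<bar>f x\<bar> powr P \<le> C * t powr (real s * P - ?d) * I"
 proof (rule local_estimate[OF assms(2,4) s P1 Ps], goal_cases)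
  case (1 Y \<eta> R C)
  show ?case by (rule that) (fact 1)+
 qed
 obtain C0 where C0: "C0 > 0" and vb: "\<And>f g x. weak_data \<Omega> s f g \<Longrightarrow> (\<And>\<alpha>. g \<alpha> \<in> borel_measurable borel) \<Longrightarrow>
   energy_le P s g (ball_energy \<Omega> P) \<Longrightarrow> x \<in> \<Omega> \<Longrightarrow> \<bar>f x\<bar> \<le> C0"
 proof (rule embedding_bound[OF assms(2,3,4) s ball_energy_nonneg[of \<Omega> P] P1 Ps], goal_cases)
  case (1 C0)
  show ?case by (rule that) (fact 1)+
 qed
 interpret upper_setup \<Omega> s p P Y \<eta> R C C0 by (rule upper_setup.intro) (fact \<Omega> P1 params C0 lb vb)+
 let ?e = "\<lambda>M X n. unif_error_points (M :: 'w measure) (\<lambda>\<omega>. (\<lambda>i. X i \<omega>) ` {..<n}) p s q \<Omega>"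
 have "\<exists>c>0. \<forall>n\<ge>2. \<forall>M X. iid_uniform M \<Omega> n X \<longrightarrow> ennreal (c * rate CARD('d) p s q n) \<le> ?e M X n"
 proof (cases "p \<le> q")
  case True
  show ?thesis using lower_bound_ge[OF \<Omega> assms(5,6) b0] by (simp only: rate_def True if_True)
 next
  case False
  show ?thesis using lower_bound_lt[OF assms(2,1,5,6)] by (simp only: rate_def False if_False)
 qed
 moreover have "\<exists>C>0. \<forall>n\<ge>2. \<forall>M X. iid_uniform M \<Omega> n X \<longrightarrow> ?e M X n \<le> ennreal (C * rate CARD('d) p s q n)"
 proof (cases "p \<le> q")
  case True
  show ?thesis unfolding rate_def if_P[OF True] by (rule upper_bound_ge[OF assms(5) True _ b0]) (rule Pp)
 next
  case False
  have q: "q \<noteq> \<infinity>" using False by (auto simp: not_le)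
  have "enn2real q < P"
  proof (cases "p = \<infinity>")
   case True
   then show ?thesis using q by (simp add: P_def add_nonneg_pos)
  next
   case p: False
   have "ennreal (enn2real q) < ennreal (enn2real p)" using False p q by (simp add: less_top not_le)
   then show ?thesis using Pp[OF p] by (simp add: ennreal_less_iff)
  qed
  then show ?thesis unfolding rate_def if_not_P[OF False] by (rule upper_bound_lt[OF assms(5,6) q]) (rule Pp)
 qed
 ultimately show ?thesis by blast
qed

end
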